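(* Let $n\geq 1$. (i) The assignment $t_i\mapsto \tau_i$ ($i=1,\dots,n$), $s_i\mapsto\sigma_i$ ($i=1,\dots,n-1$) defines an algebra morphism $$\Phi\colon \Bbbk\mathcal{FB}_{d,n}\to \operatorname{End}_A(V^{\otimes n}).$$ (ii) There is an isomorphism of algebras $$\Phi(\Bbbk\mathcal{FB}_{d,n})\simeq \bigoplus_{\nu\vDash_d n}\operatorname{Mat}_{\binom{n}{\nu}}\Bigl(\phi_1(\Bbbk\mathcal{B}_{\nu_1})\otimes\cdots\otimes\phi_d(\Bbbk\mathcal{B}_{\nu_d})\Bigr),$$ where the sum is over all $d$-compositions $\nu=(\nu_1,\dots,\nu_d)$ of $n$ and $\binom{n}{\nu}=\frac{n!}{\nu_1!\cdots\nu_d!}$.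
   Context: Let $d\geq 1$ be an integer and $\Bbbk$ a field in which $d$ is invertible and which contains a primitive $d$-th root of unity $\zeta$. A $d$-composition $\nu\vDash_d n$ is a $d$-tuple of non-negative integers with sum $n$. Groups. $\mathcal{B}_n$ is the braid group with generators $s_1,\dots,s_{n-1}$ and relations $s_is_j=s_js_i$ if $|i-j|>1$, $s_is_js_i=s_js_is_j$ if $|i-j|=1$ (trivial group for $n=0,1$). The framed braid group $\mathcal{FB}_{d,n}$ has generators $s_1,\dots,s_{n-1},t_1,\dots,t_n$, the braid relations on the $s_i$, and $t_i^d=1$, $t_it_j=t_jt_i$, $s_it_j=t_{s_i(j)}s_i$, where $s_i$ acts on indices $\{1,\dots,n\}$ as the transposition $(i,i+1)$. $\Bbbk\mathcal{B}_n$, $\Bbbk\mathcal{FB}_{d,n}$ are the group algebras. Modules. For $1\le b\le d$, $A_b$ is a unital $\Bbbk$-bialgebra with counit $\epsilon_b$, and $V_b$ is an $A_b$-module. $A=A_1\boxtimes\cdots\boxtimes A_d$ is the tensor product algebra (componentwise multiplication, and componentwise comultiplication, used to form tensor products of $A$-modules). Each $V_b$ is an $A$-module via $(a_1\otimes\cdots\otimes a_d)\cdot v=\bigl(\prod_{c\ne b}\epsilon_c(a_c)\bigr)a_b\cdot v$, and $V=V_1\oplus\cdots\oplus V_d$. Standing assumption. For each $b$ there is an element $\check R^{(b)}\in\operatorname{End}(V_b\otimes V_b)$ such that for all $n\ge 2$ there is an algebra morphism $\phi_b\colon\Bbbk\mathcal{B}_n\to\operatorname{End}_{A_b}(V_b^{\otimes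 n})$, $s_i\mapsto\check R^{(b)}_i$, where $\check R^{(b)}_i$ acts as $\check R^{(b)}$ on tensor factors $i,i+1$ and as the identity on the others (for $n=0,1$, $\phi_b$ is the trivial map on $\Bbbk\mathcal{B}_n=\Bbbk$, and $V_b^{\otimes 0}$ is the trivial module $\Bbbk$). Operators. $\tau\colon V\to V$ is $\tau(v)=\zeta^{b-1}v$ for $v\in V_b$. $\sigma\colon V\otimes V\to V\otimes V$ is $\sigma(v\otimes w)=w\otimes v$ if $v\in V_b,w\in V_c$ with $b\neq c$, and $\sigma(v\otimes w)=\check R^{(b)}(v\otimes w)$ if $v,w\in V_b$. On $V^{\otimes n}$, $\tau_i$ acts as $\tau$ on factor $i$ and $\sigma_i$ acts as $\sigma$ on factors $i,i+1$ (identity elsewhere). *)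

theory Defs
  imports "HOL-Algebra.Module" "HOL-Algebra.AbelCoset" "HOL-Combinatorics.Transposition"
begin

section \<open>Linear maps and unital algebras over a field\<close>

text \<open>
  The algebra locale of HOL-Algebra is restricted to commutative algebras, hence the
  following variant.  Vector spaces over \<open>K\<close> are modules over \<open>K\<close>; the ring
  multiplication and unit of the record of a vector space carry no information.
  Linear maps are taken extensional, so that they are determined by their values on the carrier.
\<close>

locale unital_algebra = module K A + ring A for K (structure) and A (structure) +
  assumes smult_mult_left: "\<lbrakk>c \<in> carrier K; x \<in> carrier A; y \<in> carrier A\<rbrakk> \<Longrightarrow>
      (c \<odot>\<^bsub>A\<^esub> x) \<otimes>\<^bsub>A\<^esub> y = c \<odot>\<^bsub>A\<^esub> (x \<otimes>\<^bsub>A\<^esub> y)"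
    and smult_mult_right: "\<lbrakk>c \<in> carrier K; x \<in> carrier A; y \<in> carrier A\<rbrakk> \<Longrightarrow>
      x \<otimes>\<^bsub>A\<^esub> (c \<odot>\<^bsub>A\<^esub> y) = c \<odot>\<^bsub>A\<^esub> (x \<otimes>\<^bsub>A\<^esub> y)"

definition linear_maps :: "'k ring \<Rightarrow> ('k, 'a) module \<Rightarrow> ('k, 'b) module \<Rightarrow> ('a \<Rightarrow> 'b) set"
  where "linear_maps K M N =
    {f \<in> carrier M \<rightarrow>\<^sub>E carrier N.
       (\<forall>x\<in>carrier M. \<forall>y\<in>carrier M. f (x \<oplus>\<^bsub>M\<^esub> y) = f x \<oplus>\<^bsub>N\<^esub> f y) \<and>
       (\<forall>c\<in>carrier K. \<forall>x\<in>carrier M. f (c \<odot>\<^bsub>M\<^esub> x) = c \<odot>\<^bsub>N\<^esub> f x)}"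

definition alg_hom :: "'k ring \<Rightarrow> ('k, 'a) module \<Rightarrow> ('k, 'b) module \<Rightarrow> ('a \<Rightarrow> 'b) set"
  where "alg_hom K A B =
    {h \<in> ring_hom A B. \<forall>c\<in>carrier K. \<forall>x\<in>carrier A. h (c \<odot>\<^bsub>A\<^esub> x) = c \<odot>\<^bsub>B\<^esub> h x}"

definition alg_isomorphic :: "'k ring \<Rightarrow> ('k, 'a) module \<Rightarrow> ('k, 'b) module \<Rightarrow> bool"
  where "alg_isomorphic K A B \<longleftrightarrow> (\<exists>h\<in>alg_hom K A B. bij_betw h (carrier A) (carrier B))"

definition image_alg :: "('a \<Rightarrow> 'b) \<Rightarrow> ('k, 'a) module \<Rightarrow> ('k, 'b) module \<Rightarrow> ('k, 'b) module"
  where "image_alg h A B = B\<lparr>carrier := h ` carrier A\<rparr>"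

definition ground_alg :: "'k ring \<Rightarrow> ('k, 'k) module"
  where "ground_alg K =
    \<lparr>carrier = carrier K, monoid.mult = monoid.mult K, monoid.one = \<one>\<^bsub>K\<^esub>,
     ring.zero = \<zero>\<^bsub>K\<^esub>, ring.add = ring.add K, smult = monoid.mult K\<rparr>"

definition end_alg :: "'k ring \<Rightarrow> ('k, 'v) module \<Rightarrow> ('k, 'v \<Rightarrow> 'v) module"
  where "end_alg K M =
    \<lparr>carrier = linear_maps K M M,
     monoid.mult = (\<lambda>f g. compose (carrier M) f g),
     monoid.one = (\<lambda>x\<in>carrier M. x),
     ring.zero = (\<lambda>x\<in>carrier M. \<zero>\<^bsub>M\<^esub>),
     ring.add = (\<lambda>f g. \<lambda>x\<in>carrier M. f x \<oplus>\<^bsub>M\<^esub> g x),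
     smult = (\<lambda>c f. \<lambda>x\<in>carrier M. c \<odot>\<^bsub>M\<^esub> f x)\<rparr>"

text \<open>
  A (left) module \<open>M\<close> over a \<open>K\<close>-algebra \<open>A\<close> is given by its structure map
  \<open>\<rho> \<in> alg_hom K A (end_alg K M)\<close>; the following is the algebra of \<open>A\<close>-linear
  endomorphisms of \<open>M\<close>.
\<close>

definition end_over :: "'k ring \<Rightarrow> ('k, 'a) module \<Rightarrow> ('k, 'v) module \<Rightarrow> ('a \<Rightarrow> 'v \<Rightarrow> 'v)
    \<Rightarrow> ('k, 'v \<Rightarrow> 'v) module"
  where "end_over K A M \<rho> = (end_alg K M)
    \<lparr>carrier := {f \<in> linear_maps K M M. \<forall>a\<in>carrier A. \<forall>x\<in>carrier M. f (\<rho> a x) = \<rho> a (f x)}\<rparr>"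

section \<open>Finite direct sums and matrix algebras\<close>

text \<open>Only used for finite \<open>I\<close>, where the direct sum is the product.\<close>

definition dsum :: "'i set \<Rightarrow> ('i \<Rightarrow> ('k, 'a) module) \<Rightarrow> ('k, 'i \<Rightarrow> 'a) module"
  where "dsum I M =
    \<lparr>carrier = (\<Pi>\<^sub>E i\<in>I. carrier (M i)),
     monoid.mult = (\<lambda>x y. \<lambda>i\<in>I. x i \<otimes>\<^bsub>M i\<^esub> y i),
     monoid.one = (\<lambda>i\<in>I. \<one>\<^bsub>M i\<^esub>),
     ring.zero = (\<lambda>i\<in>I. \<zero>\<^bsub>M i\<^esub>),
     ring.add = (\<lambda>x y. \<lambda>i\<in>I. x i \<oplus>\<^bsub>M i\<^esub> y i),
     smult = (\<lambda>c x. \<lambda>i\<in>I. c \<odot>\<^bsub>M i\<^esub> x i)\<rparr>"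

definition dsum_in :: "'i set \<Rightarrow> ('i \<Rightarrow> ('k, 'a) module) \<Rightarrow> 'i \<Rightarrow> 'a \<Rightarrow> 'i \<Rightarrow> 'a"
  where "dsum_in I M b v = (\<lambda>i\<in>I. if i = b then v else \<zero>\<^bsub>M i\<^esub>)"

definition mat_alg :: "nat \<Rightarrow> ('k, 'a) module \<Rightarrow> ('k, nat \<times> nat \<Rightarrow> 'a) module"
  where "mat_alg m B =
    (let I = {..<m} \<times> {..<m} in
      \<lparr>carrier = I \<rightarrow>\<^sub>E carrier B,
       monoid.mult = (\<lambda>X Y. restrict (\<lambda>(i, j). \<Oplus>\<^bsub>B\<^esub>l\<in>{..<m}. X (i, l) \<otimes>\<^bsub>B\<^esub> Y (l, j)) I),
       monoid.one = restrict (\<lambda>(i, j). if i = j then \<one>\<^bsub>B\<^esub> else \<zero>\<^bsub>B\<^esub>) I,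
       ring.zero = (\<lambda>p\<in>I. \<zero>\<^bsub>B\<^esub>),
       ring.add = (\<lambda>X Y. \<lambda>p\<in>I. X p \<oplus>\<^bsub>B\<^esub> Y p),
       smult = (\<lambda>c X. \<lambda>p\<in>I. c \<odot>\<^bsub>B\<^esub> X p)\<rparr>)"

section \<open>Free vector spaces and group algebras\<close>

definition free_mod :: "'k ring \<Rightarrow> 'x set \<Rightarrow> ('k, 'x \<Rightarrow> 'k) module"
  where "free_mod K X =
    \<lparr>carrier = {f. (\<forall>x. f x \<in> carrier K) \<and> finite {x. f x \<noteq> \<zero>\<^bsub>K\<^esub>} \<and> {x. f x \<noteq> \<zero>\<^bsub>K\<^esub>} \<subseteq> X},
     monoid.mult = undefined,
     monoid.one = undefined,
     ring.zero = (\<lambda>x. \<zero>\<^bsub>K\<^esub>),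
     ring.add = (\<lambda>f g x. f x \<oplus>\<^bsub>K\<^esub> g x),
     smult = (\<lambda>c f x. c \<otimes>\<^bsub>K\<^esub> f x)\<rparr>"

definition basis_vec :: "'k ring \<Rightarrow> 'x \<Rightarrow> 'x \<Rightarrow> 'k"
  where "basis_vec K x = (\<lambda>y. if y = x then \<one>\<^bsub>K\<^esub> else \<zero>\<^bsub>K\<^esub>)"

definition group_alg :: "'k ring \<Rightarrow> 'g monoid \<Rightarrow> ('k, 'g \<Rightarrow> 'k) module"
  where "group_alg K G = (free_mod K (carrier G))
    \<lparr>monoid.mult := (\<lambda>f g x. if x \<in> carrier G
        then \<Oplus>\<^bsub>K\<^esub>y\<in>{y. f y \<noteq> \<zero>\<^bsub>K\<^esub>}. f y \<otimes>\<^bsub>K\<^esub> g (inv\<^bsub>G\<^esub> y \<otimes>\<^bsub>G\<^esub> x) else \<zero>\<^bsub>K\<^esub>),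
     monoid.one := basis_vec K \<one>\<^bsub>G\<^esub>\<rparr>"

section \<open>Tensor products of finite families of vector spaces\<close>

text \<open>
  The tensor product of the \<open>M i\<close>, \<open>i \<in> I\<close>, is the free vector space on the product of
  the carriers modulo the multilinearity relations; \<open>pure K I M x\<close> is the class of the
  family \<open>x\<close>.  For \<open>I = {}\<close> this is the free vector space on the empty family.
\<close>

definition tensor_rels :: "'k ring \<Rightarrow> 'i set \<Rightarrow> ('i \<Rightarrow> ('k, 'v) module) \<Rightarrow> (('i \<Rightarrow> 'v) \<Rightarrow> 'k) set"
  where "tensor_rels K I M =
    (let X = (\<Pi>\<^sub>E i\<in>I. carrier (M i)); F = free_mod K X; \<delta> = basis_vec K in
      {\<delta> (x(i := u \<oplus>\<^bsub>M i\<^esub> v)) \<ominus>\<^bsub>F\<^esub> (\<delta> (x(i := u)) \<oplus>\<^bsub>F\<^esub> \<delta> (x(i := v))) | x i u v.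
         x \<in> X \<and> i \<in> I \<and> u \<in> carrier (M i) \<and> v \<in> carrier (M i)} \<union>
      {\<delta> (x(i := c \<odot>\<^bsub>M i\<^esub> u)) \<ominus>\<^bsub>F\<^esub> c \<odot>\<^bsub>F\<^esub> \<delta> (x(i := u)) | x i c u.
         x \<in> X \<and> i \<in> I \<and> c \<in> carrier K \<and> u \<in> carrier (M i)})"

definition tensor_null :: "'k ring \<Rightarrow> 'i set \<Rightarrow> ('i \<Rightarrow> ('k, 'v) module) \<Rightarrow> (('i \<Rightarrow> 'v) \<Rightarrow> 'k) set"
  where "tensor_null K I M =
    \<Inter>{N. submodule N K (free_mod K (\<Pi>\<^sub>E i\<in>I. carrier (M i))) \<and> tensor_rels K I M \<subseteq> N}"

definition tensor :: "'k ring \<Rightarrow> 'i set \<Rightarrow> ('i \<Rightarrow> ('k, 'v) module)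
    \<Rightarrow> ('k, (('i \<Rightarrow> 'v) \<Rightarrow> 'k) set) module"
  where "tensor K I M =
    (let F = free_mod K (\<Pi>\<^sub>E i\<in>I. carrier (M i)); N = tensor_null K I M in
      \<lparr>carrier = a_rcosets\<^bsub>F\<^esub> N,
       monoid.mult = undefined,
       monoid.one = undefined,
       ring.zero = N,
       ring.add = (\<lambda>X Y. X <+>\<^bsub>F\<^esub> Y),
       smult = (\<lambda>c X. N <+>\<^bsub>F\<^esub> (\<lambda>x. c \<odot>\<^bsub>F\<^esub> x) ` X)\<rparr>)"

definition pure :: "'k ring \<Rightarrow> 'i set \<Rightarrow> ('i \<Rightarrow> ('k, 'v) module) \<Rightarrow> ('i \<Rightarrow> 'v)
    \<Rightarrow> (('i \<Rightarrow> 'v) \<Rightarrow> 'k) set"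
  where "pure K I M x =
    tensor_null K I M +>\<^bsub>free_mod K (\<Pi>\<^sub>E i\<in>I. carrier (M i))\<^esub> basis_vec K (restrict x I)"

text \<open>The linear map on the tensor product induced by a multilinear map \<open>f\<close> with values in \<open>P\<close>.\<close>

definition tensor_lift :: "'k ring \<Rightarrow> 'i set \<Rightarrow> ('i \<Rightarrow> ('k, 'v) module) \<Rightarrow> ('k, 'p) module
    \<Rightarrow> (('i \<Rightarrow> 'v) \<Rightarrow> 'p) \<Rightarrow> (('i \<Rightarrow> 'v) \<Rightarrow> 'k) set \<Rightarrow> 'p"
  where "tensor_lift K I M P f =
    (THE g. g \<in> linear_maps K (tensor K I M) P \<and>
            (\<forall>x\<in>(\<Pi>\<^sub>E i\<in>I. carrier (M i)). g (pure K I M x) = f x))"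

definition tensor_alg :: "'k ring \<Rightarrow> 'i set \<Rightarrow> ('i \<Rightarrow> ('k, 'a) module)
    \<Rightarrow> ('k, (('i \<Rightarrow> 'a) \<Rightarrow> 'k) set) module"
  where "tensor_alg K I A = (tensor K I A)
    \<lparr>monoid.mult := (\<lambda>X Y. tensor_lift K I A (tensor K I A) (\<lambda>x.
        tensor_lift K I A (tensor K I A) (\<lambda>y. pure K I A (\<lambda>i. x i \<otimes>\<^bsub>A i\<^esub> y i)) Y) X),
     monoid.one := pure K I A (\<lambda>i. \<one>\<^bsub>A i\<^esub>)\<rparr>"

subsection \<open>Tensor powers\<close>

text \<open>The tensor factors of \<open>tpow K M n\<close> are numbered \<open>1, \<dots>, n\<close>.\<close>

abbreviation tpow :: "'k ring \<Rightarrow> ('k, 'v) module \<Rightarrow> nat \<Rightarrow> ('k, ((nat \<Rightarrow> 'v) \<Rightarrow> 'k) set) module"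
  where "tpow K M n \<equiv> tensor K {1..n} (\<lambda>_. M)"

abbreviation tpure :: "'k ring \<Rightarrow> ('k, 'v) module \<Rightarrow> nat \<Rightarrow> (nat \<Rightarrow> 'v) \<Rightarrow> ((nat \<Rightarrow> 'v) \<Rightarrow> 'k) set"
  where "tpure K M n x \<equiv> pure K {1..n} (\<lambda>_. M) x"

abbreviation tpow_lift :: "'k ring \<Rightarrow> ('k, 'v) module \<Rightarrow> nat \<Rightarrow> ('k, 'p) module
    \<Rightarrow> ((nat \<Rightarrow> 'v) \<Rightarrow> 'p) \<Rightarrow> ((nat \<Rightarrow> 'v) \<Rightarrow> 'k) set \<Rightarrow> 'p"
  where "tpow_lift K M n \<equiv> tensor_lift K {1..n} (\<lambda>_. M)"

definition pure1 :: "'k ring \<Rightarrow> ('k, 'v) module \<Rightarrow> 'v \<Rightarrow> ((nat \<Rightarrow> 'v) \<Rightarrow> 'k) set"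
  where "pure1 K M v = tpure K M 1 (\<lambda>_. v)"

definition pure2 :: "'k ring \<Rightarrow> ('k, 'v) module \<Rightarrow> 'v \<Rightarrow> 'v \<Rightarrow> ((nat \<Rightarrow> 'v) \<Rightarrow> 'k) set"
  where "pure2 K M v w = tpure K M 2 (\<lambda>i. if i = 1 then v else w)"

text \<open>The concatenation product of the \<open>m\<close>-th and the \<open>n\<close>-th tensor power.\<close>

definition tconcat :: "'k ring \<Rightarrow> ('k, 'v) module \<Rightarrow> nat \<Rightarrow> nat
    \<Rightarrow> ((nat \<Rightarrow> 'v) \<Rightarrow> 'k) set \<Rightarrow> ((nat \<Rightarrow> 'v) \<Rightarrow> 'k) set \<Rightarrow> ((nat \<Rightarrow> 'v) \<Rightarrow> 'k) set"
  where "tconcat K M m n X Y =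
    tpow_lift K M m (tpow K M (m + n)) (\<lambda>x.
      tpow_lift K M n (tpow K M (m + n)) (\<lambda>y.
        tpure K M (m + n) (\<lambda>i. if i \<le> m then x i else y (i - m))) Y) X"

text \<open>\<open>f 1 \<otimes> \<dots> \<otimes> f n\<close> for linear maps \<open>f i\<close> from \<open>M\<close> to \<open>N\<close>.\<close>

definition tensor_map :: "'k ring \<Rightarrow> ('k, 'v) module \<Rightarrow> ('k, 'w) module \<Rightarrow> nat \<Rightarrow> (nat \<Rightarrow> 'v \<Rightarrow> 'w)
    \<Rightarrow> ((nat \<Rightarrow> 'v) \<Rightarrow> 'k) set \<Rightarrow> ((nat \<Rightarrow> 'w) \<Rightarrow> 'k) set"
  where "tensor_map K M N n f = tpow_lift K M n (tpow K N n) (\<lambda>v. tpure K N n (\<lambda>i. f i (v i)))"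

text \<open>Endomorphisms acting on the factor \<open>i\<close>, and on the factors \<open>i, i + 1\<close>, of a tensor power.\<close>

definition on_factor :: "'k ring \<Rightarrow> ('k, 'v) module \<Rightarrow> nat \<Rightarrow> nat \<Rightarrow> ('v \<Rightarrow> 'v)
    \<Rightarrow> ((nat \<Rightarrow> 'v) \<Rightarrow> 'k) set \<Rightarrow> ((nat \<Rightarrow> 'v) \<Rightarrow> 'k) set"
  where "on_factor K M n i f = tensor_map K M M n (\<lambda>j v. if j = i then f v else v)"

definition on_factors :: "'k ring \<Rightarrow> ('k, 'v) module \<Rightarrow> nat \<Rightarrow> nat
    \<Rightarrow> (((nat \<Rightarrow> 'v) \<Rightarrow> 'k) set \<Rightarrow> ((nat \<Rightarrow> 'v) \<Rightarrow> 'k) set)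
    \<Rightarrow> ((nat \<Rightarrow> 'v) \<Rightarrow> 'k) set \<Rightarrow> ((nat \<Rightarrow> 'v) \<Rightarrow> 'k) set"
  where "on_factors K M n i g = tpow_lift K M n (tpow K M n) (\<lambda>v.
    tpow_lift K M 2 (tpow K M n) (\<lambda>x. tpure K M n (v(i := x 1, i + 1 := x 2)))
      (g (pure2 K M (v i) (v (i + 1)))))"

section \<open>Bialgebras\<close>

locale bialgebra = unital_algebra K A
  for K :: "'k ring" (structure) and A :: "('k, 'a) module" (structure) +
  fixes \<Delta> :: "'a \<Rightarrow> ((nat \<Rightarrow> 'a) \<Rightarrow> 'k) set" and \<epsilon> :: "'a \<Rightarrow> 'k"
  assumes comult_hom: "\<Delta> \<in> alg_hom K A (tensor_alg K {1..2} (\<lambda>_. A))"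
    and counit_hom: "\<epsilon> \<in> alg_hom K A (ground_alg K)"
    and coassoc: "a \<in> carrier A \<Longrightarrow>
      tpow_lift K A 2 (tpow K A 3) (\<lambda>x. tconcat K A 2 1 (\<Delta> (x 1)) (pure1 K A (x 2))) (\<Delta> a) =
      tpow_lift K A 2 (tpow K A 3) (\<lambda>x. tconcat K A 1 2 (pure1 K A (x 1)) (\<Delta> (x 2))) (\<Delta> a)"
    and counit_left: "a \<in> carrier A \<Longrightarrow> tpow_lift K A 2 A (\<lambda>x. \<epsilon> (x 1) \<odot>\<^bsub>A\<^esub> x 2) (\<Delta> a) = a"
    and counit_right: "a \<in> carrier A \<Longrightarrow> tpow_lift K A 2 A (\<lambda>x. \<epsilon> (x 2) \<odot>\<^bsub>A\<^esub> x 1) (\<Delta> a) = a"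

text \<open>The iterated comultiplication \<open>A \<rightarrow> A\<^sup>\<otimes>\<^sup>n\<close>; it is the counit for \<open>n = 0\<close>.\<close>

primrec iter_comult :: "'k ring \<Rightarrow> ('k, 'a) module \<Rightarrow> ('a \<Rightarrow> ((nat \<Rightarrow> 'a) \<Rightarrow> 'k) set) \<Rightarrow> ('a \<Rightarrow> 'k)
    \<Rightarrow> nat \<Rightarrow> 'a \<Rightarrow> ((nat \<Rightarrow> 'a) \<Rightarrow> 'k) set"
  where
    "iter_comult K A \<Delta> \<epsilon> 0 a = \<epsilon> a \<odot>\<^bsub>tpow K A 0\<^esub> tpure K A 0 (\<lambda>_. undefined)"
  | "iter_comult K A \<Delta> \<epsilon> (Suc n) a =
      tpow_lift K A 2 (tpow K A (n + 1))
        (\<lambda>x. tconcat K A n 1 (iter_comult K A \<Delta> \<epsilon> n (x 1)) (pure1 K A (x 2))) (\<Delta> a)"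

text \<open>The structure map of the \<open>n\<close>-th tensor power of the \<open>A\<close>-module \<open>M\<close> with structure map \<open>\<rho>\<close>.\<close>

definition tpow_rep :: "'k ring \<Rightarrow> ('k, 'a) module \<Rightarrow> ('a \<Rightarrow> ((nat \<Rightarrow> 'a) \<Rightarrow> 'k) set) \<Rightarrow> ('a \<Rightarrow> 'k)
    \<Rightarrow> ('k, 'v) module \<Rightarrow> ('a \<Rightarrow> 'v \<Rightarrow> 'v) \<Rightarrow> nat
    \<Rightarrow> 'a \<Rightarrow> ((nat \<Rightarrow> 'v) \<Rightarrow> 'k) set \<Rightarrow> ((nat \<Rightarrow> 'v) \<Rightarrow> 'k) set"
  where "tpow_rep K A \<Delta> \<epsilon> M \<rho> n a =
    tpow_lift K A n (end_alg K (tpow K M n)) (\<lambda>x. tensor_map K M M n (\<lambda>i. \<rho> (x i)))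
      (iter_comult K A \<Delta> \<epsilon> n a)"

abbreviation end_tpow :: "'k ring \<Rightarrow> ('k, 'a) module \<Rightarrow> ('a \<Rightarrow> ((nat \<Rightarrow> 'a) \<Rightarrow> 'k) set) \<Rightarrow> ('a \<Rightarrow> 'k)
    \<Rightarrow> ('k, 'v) module \<Rightarrow> ('a \<Rightarrow> 'v \<Rightarrow> 'v) \<Rightarrow> nat
    \<Rightarrow> ('k, ((nat \<Rightarrow> 'v) \<Rightarrow> 'k) set \<Rightarrow> ((nat \<Rightarrow> 'v) \<Rightarrow> 'k) set) module"
  where "end_tpow K A \<Delta> \<epsilon> M \<rho> n \<equiv> end_over K A (tpow K M n) (tpow_rep K A \<Delta> \<epsilon> M \<rho> n)"

subsection \<open>The tensor product of the bialgebras \<open>A 1, \<dots>, A d\<close>\<close>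

abbreviation box_alg :: "'k ring \<Rightarrow> nat \<Rightarrow> (nat \<Rightarrow> ('k, 'a) module)
    \<Rightarrow> ('k, ((nat \<Rightarrow> 'a) \<Rightarrow> 'k) set) module"
  where "box_alg K d A \<equiv> tensor_alg K {1..d} A"

text \<open>
  The linear map \<open>(A 1 \<otimes> A 1) \<otimes> \<dots> \<otimes> (A d \<otimes> A d) \<rightarrow>
  (A 1 \<otimes> \<dots> \<otimes> A d) \<otimes> (A 1 \<otimes> \<dots> \<otimes> A d)\<close> reordering the factors.
\<close>

definition box_shuffle :: "'k ring \<Rightarrow> nat \<Rightarrow> (nat \<Rightarrow> ('k, 'a) module)
    \<Rightarrow> ((nat \<Rightarrow> ((nat \<Rightarrow> 'a) \<Rightarrow> 'k) set) \<Rightarrow> 'k) set \<Rightarrow> ((nat \<Rightarrow> ((nat \<Rightarrow> 'a) \<Rightarrow> 'k) set) \<Rightarrow> 'k) set"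
  where "box_shuffle K d A =
    (THE g. g \<in> linear_maps K (tensor K {1..d} (\<lambda>b. tpow K (A b) 2)) (tpow K (box_alg K d A) 2) \<and>
      (\<forall>x\<in>(\<Pi>\<^sub>E b\<in>{1..d}. carrier (A b)). \<forall>y\<in>(\<Pi>\<^sub>E b\<in>{1..d}. carrier (A b)).
        g (pure K {1..d} (\<lambda>b. tpow K (A b) 2) (\<lambda>b. pure2 K (A b) (x b) (y b))) =
        pure2 K (box_alg K d A) (pure K {1..d} A x) (pure K {1..d} A y)))"

definition box_comult :: "'k ring \<Rightarrow> nat \<Rightarrow> (nat \<Rightarrow> ('k, 'a) module)
    \<Rightarrow> (nat \<Rightarrow> 'a \<Rightarrow> ((nat \<Rightarrow> 'a) \<Rightarrow> 'k) set)
    \<Rightarrow> ((nat \<Rightarrow> 'a) \<Rightarrow> 'k) set \<Rightarrow> ((nat \<Rightarrow> ((nat \<Rightarrow> 'a) \<Rightarrow> 'k) set) \<Rightarrow> 'k) set"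
  where "box_comult K d A \<Delta> =
    tensor_lift K {1..d} A (tpow K (box_alg K d A) 2)
      (\<lambda>a. box_shuffle K d A (pure K {1..d} (\<lambda>b. tpow K (A b) 2) (\<lambda>b. \<Delta> b (a b))))"

definition box_counit :: "'k ring \<Rightarrow> nat \<Rightarrow> (nat \<Rightarrow> ('k, 'a) module) \<Rightarrow> (nat \<Rightarrow> 'a \<Rightarrow> 'k)
    \<Rightarrow> ((nat \<Rightarrow> 'a) \<Rightarrow> 'k) set \<Rightarrow> 'k"
  where "box_counit K d A \<epsilon> =
    tensor_lift K {1..d} A (ground_alg K) (\<lambda>a. \<Otimes>\<^bsub>K\<^esub>b\<in>{1..d}. \<epsilon> b (a b))"

text \<open>The structure map of \<open>V b\<close> as a module over \<open>A 1 \<otimes> \<dots> \<otimes> A d\<close>.\<close>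

definition inflate_rep :: "'k ring \<Rightarrow> nat \<Rightarrow> (nat \<Rightarrow> ('k, 'a) module) \<Rightarrow> (nat \<Rightarrow> 'a \<Rightarrow> 'k)
    \<Rightarrow> (nat \<Rightarrow> ('k, 'v) module) \<Rightarrow> (nat \<Rightarrow> 'a \<Rightarrow> 'v \<Rightarrow> 'v) \<Rightarrow> nat
    \<Rightarrow> ((nat \<Rightarrow> 'a) \<Rightarrow> 'k) set \<Rightarrow> 'v \<Rightarrow> 'v"
  where "inflate_rep K d A \<epsilon> V \<rho> b =
    tensor_lift K {1..d} A (end_alg K (V b))
      (\<lambda>a. \<lambda>v\<in>carrier (V b). (\<Otimes>\<^bsub>K\<^esub>c\<in>{1..d} - {b}. \<epsilon> c (a c)) \<odot>\<^bsub>V b\<^esub> \<rho> b (a b) v)"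

abbreviation box_mod :: "nat \<Rightarrow> (nat \<Rightarrow> ('k, 'v) module) \<Rightarrow> ('k, nat \<Rightarrow> 'v) module"
  where "box_mod d V \<equiv> dsum {1..d} V"

definition box_rep :: "'k ring \<Rightarrow> nat \<Rightarrow> (nat \<Rightarrow> ('k, 'a) module) \<Rightarrow> (nat \<Rightarrow> 'a \<Rightarrow> 'k)
    \<Rightarrow> (nat \<Rightarrow> ('k, 'v) module) \<Rightarrow> (nat \<Rightarrow> 'a \<Rightarrow> 'v \<Rightarrow> 'v)
    \<Rightarrow> ((nat \<Rightarrow> 'a) \<Rightarrow> 'k) set \<Rightarrow> (nat \<Rightarrow> 'v) \<Rightarrow> nat \<Rightarrow> 'v"
  where "box_rep K d A \<epsilon> V \<rho> a =
    (\<lambda>v\<in>carrier (box_mod d V). \<lambda>b\<in>{1..d}. inflate_rep K d A \<epsilon> V \<rho> b a (v b))"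

section \<open>The braid group and the framed braid group\<close>

text \<open>
  The group presented by generators \<open>S\<close> and relations \<open>R\<close> consists of the words in the
  letters \<open>(x, True)\<close>, standing for \<open>x\<close>, and \<open>(x, False)\<close>, standing for the inverse
  of \<open>x\<close>, modulo the congruence generated by free cancellation and by the pairs in \<open>R\<close>.
\<close>

type_synonym 'g word = "('g \<times> bool) list"

inductive_set word_eq :: "'g set \<Rightarrow> ('g word \<times> 'g word) set \<Rightarrow> ('g word \<times> 'g word) set"
  for S :: "'g set" and R :: "('g word \<times> 'g word) set"
  where
    refl: "w \<in> lists (S \<times> UNIV) \<Longrightarrow> (w, w) \<in> word_eq S R"
  | sym: "(v, w) \<in> word_eq S R \<Longrightarrow> (w, v) \<in> word_eq S R"
  | trans: "(u, v) \<in> word_eq S R \<Longrightarrow> (v, w) \<in> word_eq S R \<Longrightarrow> (u, w) \<in> word_eq S R"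
  | cancel: "u \<in> lists (S \<times> UNIV) \<Longrightarrow> v \<in> lists (S \<times> UNIV) \<Longrightarrow> x \<in> S \<Longrightarrow>
      (u @ [(x, e), (x, \<not> e)] @ v, u @ v) \<in> word_eq S R"
  | relation: "u \<in> lists (S \<times> UNIV) \<Longrightarrow> v \<in> lists (S \<times> UNIV) \<Longrightarrow> (l, r) \<in> R \<Longrightarrow>
      l \<in> lists (S \<times> UNIV) \<Longrightarrow> r \<in> lists (S \<times> UNIV) \<Longrightarrow>
      (u @ l @ v, u @ r @ v) \<in> word_eq S R"

definition presented_group :: "'g set \<Rightarrow> ('g word \<times> 'g word) set \<Rightarrow> 'g word set monoid"
  where "presented_group S R =
    \<lparr>carrier = lists (S \<times> UNIV) // word_eq S R,
     monoid.mult = (\<lambda>X Y. \<Union>u\<in>X. \<Union>v\<in>Y. word_eq S R `` {u @ v}),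
     monoid.one = word_eq S R `` {[]}\<rparr>"

definition pgen :: "'g set \<Rightarrow> ('g word \<times> 'g word) set \<Rightarrow> 'g \<Rightarrow> 'g word set"
  where "pgen S R x = word_eq S R `` {[(x, True)]}"

text \<open>\<open>Sg i\<close> and \<open>Tg i\<close> are the generators \<open>s\<^sub>i\<close> and \<open>t\<^sub>i\<close>.\<close>

datatype fb_gen = Sg nat | Tg nat

abbreviation (input) pos :: "'g \<Rightarrow> 'g \<times> bool"
  where "pos x \<equiv> (x, True)"

definition braid_gens :: "nat \<Rightarrow> fb_gen set"
  where "braid_gens n = Sg ` {i. 1 \<le> i \<and> i < n}"

definition braid_rels :: "nat \<Rightarrow> (fb_gen word \<times> fb_gen word) set"
  where "braid_rels n =
    {([pos (Sg i), pos (Sg j)], [pos (Sg j), pos (Sg i)]) | i j.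
       1 \<le> i \<and> i < n \<and> 1 \<le> j \<and> j < n \<and> \<bar>int i - int j\<bar> > 1} \<union>
    {([pos (Sg i), pos (Sg j), pos (Sg i)], [pos (Sg j), pos (Sg i), pos (Sg j)]) | i j.
       1 \<le> i \<and> i < n \<and> 1 \<le> j \<and> j < n \<and> \<bar>int i - int j\<bar> = 1}"

definition framed_gens :: "nat \<Rightarrow> fb_gen set"
  where "framed_gens n = braid_gens n \<union> Tg ` {1..n}"

definition framed_rels :: "nat \<Rightarrow> nat \<Rightarrow> (fb_gen word \<times> fb_gen word) set"
  where "framed_rels d n = braid_rels n \<union>
    {(replicate d (pos (Tg i)), []) | i. i \<in> {1..n}} \<union>
    {([pos (Tg i), pos (Tg j)], [pos (Tg j), pos (Tg i)]) | i j. i \<in> {1..n} \<and> j \<in> {1..n}} \<union>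
    {([pos (Sg i), pos (Tg j)], [pos (Tg (Transposition.transpose i (i + 1) j)), pos (Sg i)]) | i j.
       1 \<le> i \<and> i < n \<and> j \<in> {1..n}}"

definition braid_group :: "nat \<Rightarrow> fb_gen word set monoid"
  where "braid_group n = presented_group (braid_gens n) (braid_rels n)"

definition framed_braid_group :: "nat \<Rightarrow> nat \<Rightarrow> fb_gen word set monoid"
  where "framed_braid_group d n = presented_group (framed_gens n) (framed_rels d n)"

definition braid_elt :: "'k ring \<Rightarrow> nat \<Rightarrow> fb_gen \<Rightarrow> fb_gen word set \<Rightarrow> 'k"
  where "braid_elt K n x = basis_vec K (pgen (braid_gens n) (braid_rels n) x)"

definition framed_braid_elt :: "'k ring \<Rightarrow> nat \<Rightarrow> nat \<Rightarrow> fb_gen \<Rightarrow> fb_gen word set \<Rightarrow> 'k"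
  where "framed_braid_elt K d n x = basis_vec K (pgen (framed_gens n) (framed_rels d n) x)"

section \<open>The operators and the index set\<close>

definition tau_op :: "'k ring \<Rightarrow> nat \<Rightarrow> 'k \<Rightarrow> (nat \<Rightarrow> ('k, 'v) module) \<Rightarrow> (nat \<Rightarrow> 'v) \<Rightarrow> nat \<Rightarrow> 'v"
  where "tau_op K d \<zeta> V =
    (\<lambda>v\<in>carrier (box_mod d V). \<lambda>b\<in>{1..d}. (\<zeta> [^]\<^bsub>K\<^esub> (b - 1)) \<odot>\<^bsub>V b\<^esub> v b)"

definition sigma_op :: "'k ring \<Rightarrow> nat \<Rightarrow> (nat \<Rightarrow> ('k, 'v) module)
    \<Rightarrow> (nat \<Rightarrow> ((nat \<Rightarrow> 'v) \<Rightarrow> 'k) set \<Rightarrow> ((nat \<Rightarrow> 'v) \<Rightarrow> 'k) set)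
    \<Rightarrow> ((nat \<Rightarrow> (nat \<Rightarrow> 'v)) \<Rightarrow> 'k) set \<Rightarrow> ((nat \<Rightarrow> (nat \<Rightarrow> 'v)) \<Rightarrow> 'k) set"
  where "sigma_op K d V R =
    (let W = box_mod d V; \<iota> = dsum_in {1..d} V in
      THE s. s \<in> linear_maps K (tpow K W 2) (tpow K W 2) \<and>
        (\<forall>b\<in>{1..d}. \<forall>c\<in>{1..d}. \<forall>v\<in>carrier (V b). \<forall>w\<in>carrier (V c).
          s (pure2 K W (\<iota> b v) (\<iota> c w)) =
          (if b \<noteq> c then pure2 K W (\<iota> c w) (\<iota> b v)
           else tensor_map K (V b) W 2 (\<lambda>_. \<iota> b) (R b (pure2 K (V b) v w)))))"

definition compositions :: "nat \<Rightarrow> nat \<Rightarrow> (nat \<Rightarrow> nat) set"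
  where "compositions d n = {\<nu> \<in> {1..d} \<rightarrow>\<^sub>E UNIV. (\<Sum>b\<in>{1..d}. \<nu> b) = n}"

definition multinomial :: "nat \<Rightarrow> nat \<Rightarrow> (nat \<Rightarrow> nat) \<Rightarrow> nat"
  where "multinomial d n \<nu> = fact n div (\<Prod>b\<in>{1..d}. fact (\<nu> b))"

end

theory Submission
 imports "HOL-Combinatorics.Multiset_Permutations" Defs
begin

text \<open>
A word \<open>w\<close> of length \<open>n\<close> in the letters \<open>1, ..., d\<close> picks out a summand of the \<open>n\<close>-th tensor power
of \<open>V\<close>; sorting the factors identifies it with the tensor product over \<open>b\<close> of the powers of \<open>V b\<close> to
the number \<open>\<nu> b\<close> of letters \<open>b\<close> in \<open>w\<close>. In these coordinates \<open>\<tau>\<^sub>i\<close> is diagonal and \<open>\<sigma>\<^sub>i\<close> is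
monomial: it swaps two distinct neighbouring letters and acts by one braid generator of a single block
when the two letters agree. So the relations, and the commutation with \<open>A\<close>, are checked on
coefficients. The projections to the summands are Lagrange interpolation polynomials in the \<open>\<tau>\<^sub>i\<close>, and
words of equal content are connected by swaps of distinct neighbours. Hence the image contains all
matrix units over the tensor product of the algebras \<open>\<phi>\<^sub>b(B)\<close>, and it is spanned by monomial
operators, so it is the sum of matrix algebras. Over a field the tensor product of these algebras acts
faithfully, by separating tensors with linear functionals.
\<close>

text \<open>The obstacle is that the matrix entries in (ii) are abstract tensors over the algebras
  \<open>\<phi> b (B)\<close>, whereas the image of \<Phi> consists of operators. An entry can be
  read back as an abstract tensor because the map to operators is injective. The spaces may be
  infinite-dimensional, so no bases are chosen: a tensor is fixed by a tensor product of finite rank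
  maps built from matrix coefficients f \<mapsto> l(f u), and if the tensor acts as zero, every rank
  one term of that product kills it. Equivariance rests on the counit law. On V c the algebras A b
  with b \<noteq> c act by scalars, so on the component of a word the iterated coproduct contracts
  to the (\<nu> b)-fold coproduct of each A b. The action therefore depends on the content of the
  word alone. Primitivity of \<zeta> makes the eigenvalues of \<tau> on distinct letters distinct;
  their differences are what the interpolation divides by. Since \<open>tensor_lift\<close>,
  \<open>box_shuffle\<close> and \<open>sigma_op\<close> are definite descriptions, existence and
  uniqueness of the maps described precede any use of them.\<close>

type_synonym ('i, 'v, 'k) tens = "(('i => 'v) => 'k) set"

section \<open>Linear maps\<close>

text \<open>Linearity without the extensionality demanded by \<open>linear_maps\<close>, so that
  plain compositions and lambda terms qualify; restriction to the carrier converts back.\<close>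

definition lin :: "'k ring => ('k, 'a) module => ('k, 'b) module => ('a => 'b) => bool"
 where "lin K M N f \<longleftrightarrow> (ALL x:carrier M. f x \<in> carrier N) \<and> (ALL x:carrier M. ALL y:carrier M. f (x \<oplus>\<^bsub>M\<^esub> y) = f x \<oplus>\<^bsub>N\<^esub> f y) \<and>
  (ALL c:carrier K. ALL x:carrier M. f (c \<odot>\<^bsub>M\<^esub> x) = c \<odot>\<^bsub>N\<^esub> f x)"

lemma linI:
 assumes "!!x. x \<in> carrier M ==> f x \<in> carrier N"
  and "!!x y. x \<in> carrier M ==> y \<in> carrier M ==> f (x \<oplus>\<^bsub>M\<^esub> y) = f x \<oplus>\<^bsub>N\<^esub> f y"
  and "!!c x. c \<in> carrier K ==> x \<in> carrier M ==> f (c \<odot>\<^bsub>M\<^esub> x) = c \<odot>\<^bsub>N\<^esub> f x"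
 shows "lin K M N f"
 using assms by (auto simp: lin_def)

lemma lin_closed: "lin K M N f ==> x \<in> carrier M ==> f x \<in> carrier N"
 and lin_add: "lin K M N f ==> x \<in> carrier M ==> y \<in> carrier M ==> f (x \<oplus>\<^bsub>M\<^esub> y) = f x \<oplus>\<^bsub>N\<^esub> f y"
 and lin_smult: "lin K M N f ==> c \<in> carrier K ==> x \<in> carrier M ==> f (c \<odot>\<^bsub>M\<^esub> x) = c \<odot>\<^bsub>N\<^esub> f x"
 by (auto simp: lin_def)

lemma linear_maps_iff: "f \<in> linear_maps K M N \<longleftrightarrow> lin K M N f \<and> f \<in> extensional (carrier M)"
 by (auto simp: linear_maps_def lin_def PiE_def)

lemma linear_maps_lin: "f \<in> linear_maps K M N ==> lin K M N f" by (simp add: linear_maps_iff)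

lemma lin_cong:
 assumes "module K M" and "!!x. x \<in> carrier M ==> f x = g x"
 shows "lin K M N f \<longleftrightarrow> lin K M N g"
proof -
 interpret M: module K M by fact
 show ?thesis using assms(2) by (simp add: lin_def)
qed

lemma lin_restrict [simp]:
 assumes "module K M" shows "lin K M N (restrict f (carrier M)) \<longleftrightarrow> lin K M N f"
 by (rule lin_cong[OF assms]) simp

lemma restrict_linear_maps:
 "module K M ==> lin K M N f ==> restrict f (carrier M) \<in> linear_maps K M N"
 by (simp add: linear_maps_iff)

lemma lin_comp: "lin K M N f ==> lin K N P g ==> lin K M P (%x. g (f x))" by (simp add: lin_def)

lemma lin_id: "lin K M M (%x. x)" by (simp add: lin_def)

lemma lin_zero:
 assumes "module K M" "module K N" "lin K M N f" shows "f \<zero>\<^bsub>M\<^esub> = \<zero>\<^bsub>N\<^esub>"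
proof -
 interpret M: module K M by fact
 interpret N: module K N by fact
 have "f (\<zero>\<^bsub>K\<^esub> \<odot>\<^bsub>M\<^esub> \<zero>\<^bsub>M\<^esub>) = \<zero>\<^bsub>K\<^esub> \<odot>\<^bsub>N\<^esub> f \<zero>\<^bsub>M\<^esub>" using assms(3) by (intro lin_smult) auto
 then show ?thesis using lin_closed[OF assms(3)] by simp
qed

lemma lin_zero_map:
 assumes "module K N" shows "lin K M N (%x. \<zero>\<^bsub>N\<^esub>)"
proof -
 interpret N: module K N by fact
 show ?thesis by (simp add: lin_def)
qed

lemma lin_add_map:
 assumes "module K N" "lin K M N f" "lin K M N g" shows "lin K M N (%x. f x \<oplus>\<^bsub>N\<^esub> g x)"
proof -
 interpret N: module K N by fact
 show ?thesis using assms(2,3) by (simp add: lin_def N.smult_r_distr N.a_ac)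
qed

lemma lin_smult_map:
 assumes "module K N" "lin K M N f" "c \<in> carrier K" shows "lin K M N (%x. c \<odot>\<^bsub>N\<^esub> f x)"
proof -
 interpret N: module K N by fact
 show ?thesis using assms(2,3) by (simp add: lin_def N.smult_r_distr N.smult_assoc1[symmetric] N.R.m_comm)
qed

lemma lin_finsum:
 assumes "module K M" "module K N" "lin K M N f" "finite A" "g \<in> A \<rightarrow> carrier M"
 shows "f (\<Oplus>\<^bsub>M\<^esub>i\<in>A. g i) = (\<Oplus>\<^bsub>N\<^esub>i\<in>A. f (g i))"
proof -
 interpret M: module K M by fact
 interpret N: module K N by fact
 show ?thesis using assms(4,5) by (induction A rule: finite_induct)
   (use assms(3) in \<open>auto simp: lin_zero[OF assms(1-3)] lin_add[OF assms(3)] Pi_iff lin_closed[OF assms(3)]\<close>)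
qed

lemma lin_finsum_map:
 assumes "module K N" "finite A" "!!i. i \<in> A ==> lin K M N (f i)"
 shows "lin K M N (%x. \<Oplus>\<^bsub>N\<^esub>i\<in>A. f i x)"
proof -
 interpret N: module K N by fact
 show ?thesis using assms(2,3)
 proof (induction A rule: finite_induct)
  case empty then show ?case using lin_zero_map[OF assms(1)] by simp
 next
  case (insert a A)
  have "lin K M N (%x. f a x \<oplus>\<^bsub>N\<^esub> (\<Oplus>\<^bsub>N\<^esub>i\<in>A. f i x))" using insert by (intro lin_add_map assms(1)) auto
  moreover have "(\<Oplus>\<^bsub>N\<^esub>i\<in>insert a A. f i x) = f a x \<oplus>\<^bsub>N\<^esub> (\<Oplus>\<^bsub>N\<^esub>i\<in>A. f i x)" if "x \<in> carrier M" for x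
   using insert that by (subst N.finsum_insert) (auto simp: Pi_iff lin_def)
  moreover have "lin K M N (%x. \<Oplus>\<^bsub>N\<^esub>i\<in>A. f i x)" using insert by auto
  ultimately show ?case using insert
   by (auto simp: lin_def Pi_iff N.finsum_closed N.finsum_addf N.smult_r_distr N.finsum_smult_ldistr)
 qed
qed

section \<open>Subspaces and spanning sets\<close>

definition subsp :: "'k ring => ('k, 'a) module => 'a set => bool"
 where "subsp K M N \<longleftrightarrow> N <= carrier M \<and> \<zero>\<^bsub>M\<^esub> \<in> N \<and> (ALL x:N. ALL y:N. x \<oplus>\<^bsub>M\<^esub> y \<in> N) \<and> (ALL c:carrier K. ALL x:N. c \<odot>\<^bsub>M\<^esub> x \<in> N)"

text \<open>Closure under negatives is scaling by minus one, so the predicate \<open>subsp\<close>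
  can do without the subgroup structure.\<close>

lemma submodule_iff_subsp:
 assumes "module K M" shows "submodule N K M \<longleftrightarrow> subsp K M N"
proof -
 interpret M: module K M by fact
 have "\<ominus>\<^bsub>M\<^esub> a \<in> N" if "subsp K M N" "a \<in> N" for a
 proof -
  have "(\<ominus>\<^bsub>K\<^esub> \<one>\<^bsub>K\<^esub>) \<odot>\<^bsub>M\<^esub> a \<in> N" using that by (auto simp: subsp_def)
  then show ?thesis using that by (subst (asm) M.smult_l_minus) (auto simp: subsp_def)
 qed
 then have "submodule N K M" if "subsp K M N" using that by (intro M.submoduleI) (auto simp: subsp_def)
 moreover have "subsp K M N" if "submodule N K M"
  using M.submoduleE[OF that] subgroup.one_closed[OF submodule.axioms(1)[OF that]]
  by (auto simp: subsp_def)
 ultimately show ?thesis by blast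
qed

text \<open>Spanning is expressed through subspaces containing the generators instead of linear
  combinations. This yields an induction rule at once, and no finite sums have to be
  handled.\<close>

definition spans :: "'k ring => ('k, 'a) module => 'a set => bool"
 where "spans K M G \<longleftrightarrow> G <= carrier M \<and> (\<forall>N. subsp K M N --> G <= N --> carrier M <= N)"

lemma spans_induct [consumes 3, case_names zero gen add smult]:
 assumes "module K M" "spans K M G" "x \<in> carrier M"
  and "P \<zero>\<^bsub>M\<^esub>" and "!!x. x \<in> G ==> P x"
  and "!!x y. x \<in> carrier M ==> y \<in> carrier M ==> P x ==> P y ==> P (x \<oplus>\<^bsub>M\<^esub> y)"
  and "!!c x. c \<in> carrier K ==> x \<in> carrier M ==> P x ==> P (c \<odot>\<^bsub>M\<^esub> x)"
 shows "P x"
proof -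
 interpret M: module K M by fact
 have "subsp K M {x \<in> carrier M. P x}" using assms by (auto simp: subsp_def)
 moreover have "G <= {x \<in> carrier M. P x}" using assms(2,5) by (auto simp: spans_def)
 ultimately show ?thesis using assms(2,3) unfolding spans_def by blast
qed

lemma subsp_eq:
 assumes "module K M" "module K N" "lin K M N f" "lin K M N g"
 shows "subsp K M {x \<in> carrier M. f x = g x}"
proof -
 interpret M: module K M by fact
 interpret N: module K N by fact
 show ?thesis using assms(3,4) lin_zero[OF assms(1,2,3)] lin_zero[OF assms(1,2,4)] by (auto simp: subsp_def lin_def)
qed

lemma lin_eq_on_spans:
 assumes "module K M" "module K N" "spans K M G" "lin K M N f" "lin K M N g"
  and "!!x. x \<in> G ==> f x = g x" and "x \<in> carrier M"
 shows "f x = g x"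
proof -
 have "G <= {x \<in> carrier M. f x = g x}" using assms(3,6) by (auto simp: spans_def)
 then show ?thesis using assms(3,7) subsp_eq[OF assms(1,2,4,5)] unfolding spans_def by blast
qed

lemma spans_image_closed:
 assumes "module K M" "module K N" "spans K M G" "lin K M N f" "subsp K N S"
  and "!!x. x \<in> G ==> f x \<in> S" and "x \<in> carrier M"
 shows "f x \<in> S"
 using assms(1,3,7)
 by (induction rule: spans_induct) (use assms lin_zero[OF assms(1,2,4)] in \<open>auto simp: subsp_def lin_def\<close>)

section \<open>Endomorphism algebras\<close>

lemma end_alg_simps [simp]:
 "carrier (end_alg K M) = linear_maps K M M"
 "f \<otimes>\<^bsub>end_alg K M\<^esub> g = compose (carrier M) f g"
 "\<one>\<^bsub>end_alg K M\<^esub> = (\<lambda>x\<in>carrier M. x)"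
 "\<zero>\<^bsub>end_alg K M\<^esub> = (\<lambda>x\<in>carrier M. \<zero>\<^bsub>M\<^esub>)"
 "f \<oplus>\<^bsub>end_alg K M\<^esub> g = (\<lambda>x\<in>carrier M. f x \<oplus>\<^bsub>M\<^esub> g x)"
 "c \<odot>\<^bsub>end_alg K M\<^esub> f = (\<lambda>x\<in>carrier M. c \<odot>\<^bsub>M\<^esub> f x)"
 by (simp_all add: end_alg_def)

lemma linear_maps_ext:
 assumes "f \<in> linear_maps K M N" "g \<in> linear_maps K M N" "!!x. x \<in> carrier M ==> f x = g x"
 shows "f = g"
 using assms by (auto simp: linear_maps_iff intro: extensionalityI)

lemma compose_linear_maps:
 "module K M ==> f \<in> linear_maps K N P ==> g \<in> linear_maps K M N ==> compose (carrier M) f g \<in> linear_maps K M P"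
 by (simp add: linear_maps_iff compose_def lin_comp[of K M N g P f])

lemma unital_algebra_end:
 assumes "module K M" shows "unital_algebra K (end_alg K M)"
proof -
 interpret M: module K M by fact
 let ?E = "end_alg K M"
 have cl: "f x \<in> carrier M" if "f \<in> linear_maps K M M" "x \<in> carrier M" for f x using that by (auto simp: linear_maps_def)
 have ex: "f = g" if "f \<in> linear_maps K M M" "g \<in> linear_maps K M M"
  "!!x. x \<in> carrier M ==> f x = g x" for f g
  using that by (rule linear_maps_ext)
 have lm: "(\<lambda>x\<in>carrier M. f x \<oplus>\<^bsub>M\<^esub> g x) \<in> linear_maps K M M"
  "(\<lambda>x\<in>carrier M. c \<odot>\<^bsub>M\<^esub> f x) \<in> linear_maps K M M"
  "compose (carrier M) f g \<in> linear_maps K M M"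
  if "f \<in> linear_maps K M M" "g \<in> linear_maps K M M" "c \<in> carrier K" for f g c
  using that assms by (simp_all add: linear_maps_iff lin_add_map lin_smult_map compose_def lin_comp[of K M M _ M])
 have lm0: "(\<lambda>x\<in>carrier M. \<zero>\<^bsub>M\<^esub>) \<in> linear_maps K M M" "(\<lambda>x\<in>carrier M. x) \<in> linear_maps K M M"
  using assms by (auto intro!: restrict_linear_maps lin_zero_map lin_id)
 have one: "\<one>\<^bsub>K\<^esub> \<in> carrier K" "\<ominus>\<^bsub>K\<^esub> \<one>\<^bsub>K\<^esub> \<in> carrier K" by auto
 have ag: "abelian_group ?E"
 proof (rule abelian_groupI)
  fix f assume f: "f \<in> carrier ?E"
  then have f': "f \<in> linear_maps K M M" by simp
  \<comment> \<open>The multiple by minus one serves as the additive inverse; its linearity is an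
    instance of \<open>lm\<close>.\<close>
  let ?g = "(\<ominus>\<^bsub>K\<^esub> \<one>\<^bsub>K\<^esub>) \<odot>\<^bsub>?E\<^esub> f"
  have "(\<ominus>\<^bsub>K\<^esub> \<one>\<^bsub>K\<^esub>) \<odot>\<^bsub>M\<^esub> x \<oplus>\<^bsub>M\<^esub> x = \<zero>\<^bsub>M\<^esub>" if "x \<in> carrier M" for x using that by (simp add: M.smult_l_minus M.l_neg)
  then show "EX g:carrier ?E. g \<oplus>\<^bsub>?E\<^esub> f = \<zero>\<^bsub>?E\<^esub>" using lm(2)[OF f' f' one(2)] cl[OF f']
   by (intro bexI[of _ ?g]) (auto simp: fun_eq_iff restrict_def)
 qed (use cl one in \<open>auto simp del: restrict_apply simp: restrict_apply' lm lm0 M.a_ac intro!: ex lm restrict_ext\<close>)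
 show ?thesis
 proof (intro unital_algebra.intro unital_algebra_axioms.intro)
  show "module K ?E" by (rule moduleI[OF M.R.is_cring ag])
    (use cl in \<open>auto simp del: restrict_apply simp: restrict_apply' lm M.smult_l_distr M.smult_r_distr M.smult_assoc1 intro!: ex lm\<close>)
  show "ring ?E"
  proof (rule ringI[OF ag])
   show "monoid ?E"
    by (rule monoidI) (use cl one in \<open>auto simp del: restrict_apply simp: restrict_apply' lm lm0 compose_eq intro!: ex lm\<close>)
  qed (use cl one in \<open>auto simp del: restrict_apply simp: restrict_apply' lm compose_eq lin_add[OF linear_maps_lin] intro!: ex lm\<close>)
 qed (use cl in \<open>auto simp del: restrict_apply simp: restrict_apply' lm compose_eq lin_smult[OF linear_maps_lin] intro!: ex lm\<close>)
qed

text \<open>Images of group algebras are subsets of endomorphism algebras. Here such a subset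
  becomes an algebra of its own, which can then be a factor of \<open>tensor_alg\<close>.\<close>

lemma unital_algebra_carrier_update:
 assumes "unital_algebra K A" "subsp K A H" "\<one>\<^bsub>A\<^esub> \<in> H"
  and "!!x y. x \<in> H ==> y \<in> H ==> x \<otimes>\<^bsub>A\<^esub> y \<in> H"
 shows "unital_algebra K (A\<lparr>carrier := H\<rparr>)"
proof -
 interpret A: unital_algebra K A by fact
 have HA: "!!x. x \<in> H ==> x \<in> carrier A" using assms(2) by (auto simp: subsp_def)
 have mod: "module K (A\<lparr>carrier := H\<rparr>)"
  using assms(2) A.module_axioms submodule.submodule_is_module[of H K A] submodule_iff_subsp by blast
 interpret H: module K "A\<lparr>carrier := H\<rparr>" by fact
 show ?thesis
 proof (intro unital_algebra.intro unital_algebra_axioms.intro mod)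
  show "ring (A\<lparr>carrier := H\<rparr>)"
  proof (rule ringI)
   show "abelian_group (A\<lparr>carrier := H\<rparr>)" by (rule H.abelian_group_axioms)
   show "monoid (A\<lparr>carrier := H\<rparr>)" by (rule monoidI) (use assms(3,4) HA in \<open>auto simp: A.m_assoc\<close>)
  qed (use HA in \<open>auto simp: A.l_distr A.r_distr\<close>)
 qed (use HA in \<open>auto simp: A.smult_mult_left A.smult_mult_right\<close>)
qed

section \<open>Free vector spaces\<close>

lemma free_mod_simps [simp]:
 "f \<in> carrier (free_mod K X) \<longleftrightarrow> (\<forall>x. f x \<in> carrier K) \<and> finite {x. f x ~= \<zero>\<^bsub>K\<^esub>} \<and> {x. f x ~= \<zero>\<^bsub>K\<^esub>} <= X"
 "\<zero>\<^bsub>free_mod K X\<^esub> = (%x. \<zero>\<^bsub>K\<^esub>)"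
 "f \<oplus>\<^bsub>free_mod K X\<^esub> g = (%x. f x \<oplus>\<^bsub>K\<^esub> g x)"
 "c \<odot>\<^bsub>free_mod K X\<^esub> f = (%x. c \<otimes>\<^bsub>K\<^esub> f x)"
 by (simp_all add: free_mod_def)

lemma free_mod_module:
 assumes "cring K" shows "module K (free_mod K X)"
proof -
 interpret K: cring K by fact
 let ?F = "free_mod K X"
 have fin_add: "finite {x. f x \<oplus>\<^bsub>K\<^esub> g x ~= \<zero>\<^bsub>K\<^esub>} \<and> {x. f x \<oplus>\<^bsub>K\<^esub> g x ~= \<zero>\<^bsub>K\<^esub>} <= X" if "f \<in> carrier ?F" "g \<in> carrier ?F" for f g
 proof -
  have "{x. f x \<oplus>\<^bsub>K\<^esub> g x ~= \<zero>\<^bsub>K\<^esub>} <= {x. f x ~= \<zero>\<^bsub>K\<^esub>} \<union> {x. g x ~= \<zero>\<^bsub>K\<^esub>}" by auto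
  then show ?thesis using that by (auto intro: finite_subset)
 qed
 have fin_smult: "finite {x. c \<otimes>\<^bsub>K\<^esub> f x ~= \<zero>\<^bsub>K\<^esub>} \<and> {x. c \<otimes>\<^bsub>K\<^esub> f x ~= \<zero>\<^bsub>K\<^esub>} <= X" if "c \<in> carrier K" "f \<in> carrier ?F" for f c
 proof -
  have "{x. c \<otimes>\<^bsub>K\<^esub> f x ~= \<zero>\<^bsub>K\<^esub>} <= {x. f x ~= \<zero>\<^bsub>K\<^esub>}" using that by auto
  then show ?thesis using that by (auto intro: finite_subset)
 qed
 have ag: "abelian_group ?F"
 proof (rule abelian_groupI)
  fix f assume f: "f \<in> carrier ?F"
  have "\<ominus>\<^bsub>K\<^esub> f x = \<zero>\<^bsub>K\<^esub> \<longleftrightarrow> f x = \<zero>\<^bsub>K\<^esub>" for x using f by (metis K.minus_minus K.minus_zero free_mod_simps(1))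
  then show "EX g:carrier ?F. g \<oplus>\<^bsub>?F\<^esub> f = \<zero>\<^bsub>?F\<^esub>" using f by (intro bexI[of _ "%x. \<ominus>\<^bsub>K\<^esub> f x"]) (auto simp: K.l_neg)
 next
  fix f g assume "f \<in> carrier ?F" "g \<in> carrier ?F"
  then show "f \<oplus>\<^bsub>?F\<^esub> g \<in> carrier ?F" using fin_add[of f g] by auto
 qed (auto simp: K.a_ac)
 show ?thesis
 proof (rule moduleI[OF assms ag])
  fix c f assume "c \<in> carrier K" "f \<in> carrier ?F"
  then show "c \<odot>\<^bsub>?F\<^esub> f \<in> carrier ?F" using fin_smult[of c f] by auto
 qed (auto simp: K.l_distr K.r_distr K.m_assoc)
qed

lemma basis_vec_closed [simp]:
 assumes "cring K" "x \<in> X" shows "basis_vec K x \<in> carrier (free_mod K X)"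
proof -
 interpret K: cring K by fact
 have "{y. basis_vec K x y ~= \<zero>\<^bsub>K\<^esub>} <= {x}" by (auto simp: basis_vec_def)
 then show ?thesis using assms(2) by (auto simp: basis_vec_def intro: finite_subset)
qed

lemma spans_basis_vec:
 assumes "cring K" shows "spans K (free_mod K X) (basis_vec K ` X)"
 unfolding spans_def
proof (intro conjI allI impI)
 let ?F = "free_mod K X"
 interpret K: cring K by fact
 interpret F: module K ?F using assms by (rule free_mod_module)
 show "basis_vec K ` X <= carrier ?F" by (intro image_subsetI basis_vec_closed[OF assms])
 fix N assume N: "subsp K ?F N" and X: "basis_vec K ` X <= N"
 have "h \<in> N" if "finite A" "A <= X" "h \<in> carrier ?F" "{x. h x ~= \<zero>\<^bsub>K\<^esub>} <= A" for A h using that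
 proof (induction A arbitrary: h rule: finite_induct)
  case empty
  then have "h = \<zero>\<^bsub>?F\<^esub>" by auto
  then show ?case using N by (auto simp: subsp_def)
 next
  case (insert a A)
  \<comment> \<open>Erasing the coefficient at \<open>a\<close> leaves a vector supported in
    \<open>A\<close>, and the erased part is a multiple of one basis vector.\<close>
  let ?h = "h(a := \<zero>\<^bsub>K\<^esub>)"
  have "{x. ?h x ~= \<zero>\<^bsub>K\<^esub>} <= {x. h x ~= \<zero>\<^bsub>K\<^esub>}" by auto
  then have "?h \<in> carrier ?F" using insert.prems by (auto intro: finite_subset)
  then have "?h \<in> N" using insert by (intro insert.IH) auto
  moreover have "h a \<odot>\<^bsub>?F\<^esub> basis_vec K a \<in> N" using insert.prems X N by (auto simp: subsp_def)
  ultimately have "?h \<oplus>\<^bsub>?F\<^esub> h a \<odot>\<^bsub>?F\<^esub> basis_vec K a \<in> N" using N unfolding subsp_def by blast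
  also have "?h \<oplus>\<^bsub>?F\<^esub> h a \<odot>\<^bsub>?F\<^esub> basis_vec K a = h" using insert.prems by (auto simp: basis_vec_def)
  finally show ?case .
 qed
 then show "carrier ?F <= N" by auto
qed

definition free_lift :: "'k ring => ('k, 'p) module => ('x => 'p) => ('x => 'k) => 'p"
 where "free_lift K P f h = (\<Oplus>\<^bsub>P\<^esub>x\<in>{x. h x ~= \<zero>\<^bsub>K\<^esub>}. h x \<odot>\<^bsub>P\<^esub> f x)"

context
 fixes K :: "'k ring" and P :: "('k, 'p) module" (structure) and X :: "'x set" and f :: "'x => 'p"
 assumes P: "module K P" and f: "!!x. x \<in> X ==> f x \<in> carrier P"
begin

interpretation P: module K P by (fact P)

text \<open>The supports of two vectors and of their sum differ. Summing over a common finite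
  superset turns additivity into a termwise identity.\<close>

lemma free_lift_eq:
 assumes "h \<in> carrier (free_mod K X)" "finite A" "{x. h x ~= \<zero>\<^bsub>K\<^esub>} <= A" "A <= X"
 shows "free_lift K P f h = (\<Oplus>x\<in>A. h x \<odot> f x)"
 unfolding free_lift_def using assms f
 by (intro P.add.finprod_mono_neutral_cong_left) auto

lemma free_lift_lin: "lin K (free_mod K X) P (free_lift K P f)"
proof (rule linI)
 let ?S = "%h. {x. h x ~= \<zero>\<^bsub>K\<^esub>}"
 interpret F: module K "free_mod K X" by (rule free_mod_module[OF P.is_cring])
 fix h assume h: "h \<in> carrier (free_mod K X)"
 show "free_lift K P f h \<in> carrier P" unfolding free_lift_def using h f by (intro P.finsum_closed) auto
 { fix h' assume h': "h' \<in> carrier (free_mod K X)"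
  have hh: "h \<oplus>\<^bsub>free_mod K X\<^esub> h' \<in> carrier (free_mod K X)" using h h' by (rule F.a_closed)
  let ?A = "?S h \<union> ?S h'"
  have A: "finite ?A" "?A <= X" using h h' by auto
  have "free_lift K P f (h \<oplus>\<^bsub>free_mod K X\<^esub> h') = (\<Oplus>x\<in>?A. (h \<oplus>\<^bsub>free_mod K X\<^esub> h') x \<odot> f x)"
   by (rule free_lift_eq[OF hh]) (use A in auto)
  also have "... = (\<Oplus>x\<in>?A. h x \<odot> f x \<oplus> h' x \<odot> f x)" using h h' f A by (intro P.add.finprod_cong') (auto simp: P.smult_l_distr)
  also have "... = (\<Oplus>x\<in>?A. h x \<odot> f x) \<oplus> (\<Oplus>x\<in>?A. h' x \<odot> f x)" using h h' f A by (intro P.finsum_addf) auto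
  finally show "free_lift K P f (h \<oplus>\<^bsub>free_mod K X\<^esub> h') = free_lift K P f h \<oplus> free_lift K P f h'"
   using free_lift_eq[OF h A(1) _ A(2)] free_lift_eq[OF h' A(1) _ A(2)] by simp }
 fix c assume c: "c \<in> carrier K"
 have hh: "c \<odot>\<^bsub>free_mod K X\<^esub> h \<in> carrier (free_mod K X)" using c h by (rule F.smult_closed)
 have "free_lift K P f (c \<odot>\<^bsub>free_mod K X\<^esub> h) = (\<Oplus>x\<in>?S h. (c \<odot>\<^bsub>free_mod K X\<^esub> h) x \<odot> f x)"
  by (rule free_lift_eq[OF hh]) (use h c in auto)
 also have "... = (\<Oplus>x\<in>?S h. c \<odot> (h x \<odot> f x))" using c h f by (intro P.add.finprod_cong') (auto simp: P.smult_assoc1)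
 also have "... = c \<odot> free_lift K P f h" unfolding free_lift_def using c h f by (intro P.finsum_smult_ldistr[symmetric]) auto
 finally show "free_lift K P f (c \<odot>\<^bsub>free_mod K X\<^esub> h) = c \<odot> free_lift K P f h" .
qed

lemma free_lift_basis_vec:
 assumes "x \<in> X" shows "free_lift K P f (basis_vec K x) = f x"
proof -
 have "free_lift K P f (basis_vec K x) = (\<Oplus>y\<in>{x}. basis_vec K x y \<odot> f y)"
  using assms by (intro free_lift_eq basis_vec_closed[OF P.is_cring]) (auto simp: basis_vec_def)
 then show ?thesis using f[OF assms] by (simp add: basis_vec_def)
qed

end

section \<open>Tensor products\<close>

text \<open>A slot is varied by function update because the relations in \<open>tensor_rels\<close>
  have this form.\<close>

definition multilin :: "'k ring => 'i set => ('i => ('k, 'v) module) => ('k, 'p) module => (('i => 'v) => 'p) => bool"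
 where "multilin K I M P f \<longleftrightarrow> (ALL x:(\<Pi>\<^sub>E i\<in>I. carrier (M i)). f x \<in> carrier P \<and> (ALL i:I. lin K (M i) P (%u. f (x(i := u)))))"

lemma multilinI:
 assumes "!!x. x \<in> (\<Pi>\<^sub>E i\<in>I. carrier (M i)) ==> f x \<in> carrier P"
  and "!!x i. x \<in> (\<Pi>\<^sub>E i\<in>I. carrier (M i)) ==> i \<in> I ==> lin K (M i) P (%u. f (x(i := u)))"
 shows "multilin K I M P f"
 using assms by (auto simp: multilin_def)

lemma multilin_closed:
 "multilin K I M P f ==> x \<in> (\<Pi>\<^sub>E i\<in>I. carrier (M i)) ==> f x \<in> carrier P"
 by (auto simp: multilin_def)

lemma multilin_lin:
 "multilin K I M P f ==> x \<in> (\<Pi>\<^sub>E i\<in>I. carrier (M i)) ==> i \<in> I ==> lin K (M i) P (%u. f (x(i := u)))"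
 by (auto simp: multilin_def)

lemma fun_upd_PiE:
 "x \<in> (\<Pi>\<^sub>E i\<in>I. S i) ==> i \<in> I ==> u \<in> S i ==> x(i := u) \<in> (\<Pi>\<^sub>E i\<in>I. S i)"
 by (auto simp: PiE_iff extensional_def)

locale tensor_prod =
 fixes K :: "'k ring" and I :: "'i set" and M :: "'i => ('k, 'v) module"
 assumes K: "cring K" and M: "!!i. i \<in> I ==> module K (M i)"
begin

abbreviation (input) "X \<equiv> \<Pi>\<^sub>E i\<in>I. carrier (M i)"
abbreviation (input) "F \<equiv> free_mod K X"
abbreviation (input) "N \<equiv> tensor_null K I M"
abbreviation (input) "T \<equiv> tensor K I M"

interpretation K: cring K by (fact K)
interpretation F: module K F by (rule free_mod_module[OF K])

lemma M_closed:
 "i \<in> I ==> u \<in> carrier (M i) ==> v \<in> carrier (M i) ==> u \<oplus>\<^bsub>M i\<^esub> v \<in> carrier (M i)"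
 "i \<in> I ==> c \<in> carrier K ==> u \<in> carrier (M i) ==> c \<odot>\<^bsub>M i\<^esub> u \<in> carrier (M i)"
proof -
 assume i: "i \<in> I"
 interpret Mi: module K "M i" using M[OF i] .
 show "u \<in> carrier (M i) ==> v \<in> carrier (M i) ==> u \<oplus>\<^bsub>M i\<^esub> v \<in> carrier (M i)"
  "c \<in> carrier K ==> u \<in> carrier (M i) ==> c \<odot>\<^bsub>M i\<^esub> u \<in> carrier (M i)" by auto
qed

text \<open>Replaces the set comprehensions by bounded quantifiers. It is read in both directions:
  the relations lie in the null space, which makes \<open>pure\<close> multilinear, and they lie in
  the kernel of the linear extension of a multilinear map.\<close>

lemma tensor_rels_subset_iff:
 assumes "S <= carrier F"
 shows "tensor_rels K I M <= S \<longleftrightarrow> (ALL x:X. ALL i:I. ALL u:carrier (M i). (ALL v:carrier (M i). basis_vec K (x(i := u \<oplus>\<^bsub>M i\<^esub> v)) \<ominus>\<^bsub>F\<^esub>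
   (basis_vec K (x(i := u)) \<oplus>\<^bsub>F\<^esub> basis_vec K (x(i := v))) \<in> S) \<and>
  (ALL c:carrier K. basis_vec K (x(i := c \<odot>\<^bsub>M i\<^esub> u)) \<ominus>\<^bsub>F\<^esub> c \<odot>\<^bsub>F\<^esub> basis_vec K (x(i := u)) \<in> S))"
proof -
 have 1: "{f x i u v | x i u v. x \<in> X \<and> i \<in> I \<and> u \<in> carrier (M i) \<and> v \<in> carrier (M i)} <= S \<longleftrightarrow>
   (ALL x:X. ALL i:I. ALL u:carrier (M i). ALL v:carrier (M i). f x i u v \<in> S)" for f
  by blast
 have 2: "{f x i c u | x i c u. x \<in> X \<and> i \<in> I \<and> c \<in> carrier K \<and> u \<in> carrier (M i)} <= S \<longleftrightarrow>
   (ALL x:X. ALL i:I. ALL u:carrier (M i). ALL c:carrier K. f x i c u \<in> S)" for f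
  by blast
 show ?thesis unfolding tensor_rels_def Let_def Un_subset_iff 1 2 ball_conj_distrib ..
qed

lemma basis_vec_F: "x \<in> X ==> basis_vec K x \<in> carrier F" by (rule basis_vec_closed[OF K])

lemma tensor_rels_F: "tensor_rels K I M <= carrier F" by (subst tensor_rels_subset_iff)
  (auto simp del: free_mod_simps intro!: F.minus_closed F.a_closed F.smult_closed basis_vec_F
   intro: fun_upd_PiE M_closed)

text \<open>An intersection of subspaces; the family is nonempty since the whole free space contains
  the relations.\<close>

lemma null_subsp: "subsp K F N"
proof -
 have "subsp K F S" if "submodule S K F" for S using that submodule_iff_subsp[OF F.module_axioms] by blast
 moreover have "subsp K F (carrier F)" using F.carrier_is_submodule submodule_iff_subsp[OF F.module_axioms] by blast
 ultimately show ?thesis unfolding tensor_null_def using tensor_rels_F F.carrier_is_submodule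
  by (auto simp del: free_mod_simps simp: subsp_def)
qed

lemma null_submodule: "submodule N K F" using null_subsp submodule_iff_subsp[OF F.module_axioms] by blast

lemma null_F: "x \<in> N ==> x \<in> carrier F" using null_subsp unfolding subsp_def by blast

lemma rels_null: "tensor_rels K I M <= N" by (auto simp: tensor_null_def)

lemma null_least: "subsp K F S ==> tensor_rels K I M <= S ==> N <= S"
 using submodule_iff_subsp[OF F.module_axioms] by (auto simp: tensor_null_def)

sublocale N: abelian_subgroup N F using null_submodule by (intro abelian_subgroupI3 F.abelian_group_axioms)
  (simp add: additive_subgroup_def submodule_def)

definition cls :: "(('i => 'v) => 'k) => ('i, 'v, 'k) tens"
 where "cls f = N +>\<^bsub>F\<^esub> f"

lemma tensor_carrier: "carrier T = cls ` carrier F" by (auto simp: tensor_def Let_def cls_def A_RCOSETS_def')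

lemma tensor_zero: "\<zero>\<^bsub>T\<^esub> = cls \<zero>\<^bsub>F\<^esub>"
 using F.a_coset_add_zero[of N] null_F by (auto simp del: free_mod_simps simp: tensor_def Let_def cls_def subset_iff)

lemma tensor_add: "f \<in> carrier F ==> g \<in> carrier F ==> cls f \<oplus>\<^bsub>T\<^esub> cls g = cls (f \<oplus>\<^bsub>F\<^esub> g)"
 using N.a_rcos_sum[of f g] by (simp del: free_mod_simps add: tensor_def Let_def cls_def)

lemma cls_eq_iff:
 assumes "f \<in> carrier F" "g \<in> carrier F" shows "cls f = cls g \<longleftrightarrow> f \<ominus>\<^bsub>F\<^esub> g \<in> N"
proof
 assume "cls f = cls g"
 then have "f \<in> N +>\<^bsub>F\<^esub> g" using N.a_rcos_self[of f] assms by (simp del: free_mod_simps add: cls_def)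
 then show "f \<ominus>\<^bsub>F\<^esub> g \<in> N" using assms null_F by (auto simp del: free_mod_simps simp: a_r_coset_def' F.minus_eq F.a_assoc F.r_neg)
next
 assume "f \<ominus>\<^bsub>F\<^esub> g \<in> N"
 moreover have "f = (f \<ominus>\<^bsub>F\<^esub> g) \<oplus>\<^bsub>F\<^esub> g" using assms by (simp del: free_mod_simps add: F.minus_eq F.a_assoc F.l_neg)
 ultimately have "f \<in> N +>\<^bsub>F\<^esub> g" unfolding a_r_coset_def' by blast
 then show "cls f = cls g" using F.a_repr_independence[of f N g] assms N.a_subgroup by (simp del: free_mod_simps add: cls_def)
qed

text \<open>Scaling a coset elementwise by zero collapses it to a point. Adding \<open>N\<close>
  afterwards restores a full coset, so the formula holds for every scalar.\<close>

lemma tensor_smult: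
 assumes "c \<in> carrier K" "f \<in> carrier F" shows "c \<odot>\<^bsub>T\<^esub> cls f = cls (c \<odot>\<^bsub>F\<^esub> f)"
proof -
 have cF: "c \<odot>\<^bsub>F\<^esub> f \<in> carrier F" using assms by (rule F.smult_closed)
 have sm: "c \<odot>\<^bsub>F\<^esub> h \<in> N" if "h \<in> N" for h using that assms(1) null_subsp unfolding subsp_def by blast
 have "c \<odot>\<^bsub>T\<^esub> cls f = N <+>\<^bsub>F\<^esub> (%x. c \<odot>\<^bsub>F\<^esub> x) ` (N +>\<^bsub>F\<^esub> f)" by (simp del: free_mod_simps add: tensor_def Let_def cls_def)
 also have "... = {h \<oplus>\<^bsub>F\<^esub> c \<odot>\<^bsub>F\<^esub> (h' \<oplus>\<^bsub>F\<^esub> f) | h h'. h \<in> N \<and> h' \<in> N}" unfolding set_add_def' a_r_coset_def' by blast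
 also have "... = {h \<oplus>\<^bsub>F\<^esub> c \<odot>\<^bsub>F\<^esub> f | h. h \<in> N}"
 proof (intro equalityI subsetI)
  fix z assume "z \<in> {h \<oplus>\<^bsub>F\<^esub> c \<odot>\<^bsub>F\<^esub> (h' \<oplus>\<^bsub>F\<^esub> f) | h h'. h \<in> N \<and> h' \<in> N}"
  then obtain h h' where h: "h \<in> N" "h' \<in> N" and z: "z = h \<oplus>\<^bsub>F\<^esub> c \<odot>\<^bsub>F\<^esub> (h' \<oplus>\<^bsub>F\<^esub> f)" by blast
  have "z = (h \<oplus>\<^bsub>F\<^esub> c \<odot>\<^bsub>F\<^esub> h') \<oplus>\<^bsub>F\<^esub> c \<odot>\<^bsub>F\<^esub> f" unfolding z using h null_F assms F.a_assoc F.smult_r_distr F.smult_closed by metis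
  moreover have "h \<oplus>\<^bsub>F\<^esub> c \<odot>\<^bsub>F\<^esub> h' \<in> N" using h sm null_subsp unfolding subsp_def by blast
  ultimately show "z \<in> {h \<oplus>\<^bsub>F\<^esub> c \<odot>\<^bsub>F\<^esub> f | h. h \<in> N}" by blast
 next
  fix z assume "z \<in> {h \<oplus>\<^bsub>F\<^esub> c \<odot>\<^bsub>F\<^esub> f | h. h \<in> N}"
  then obtain h where h: "h \<in> N" "z = h \<oplus>\<^bsub>F\<^esub> c \<odot>\<^bsub>F\<^esub> f" by blast
  then have "z = h \<oplus>\<^bsub>F\<^esub> c \<odot>\<^bsub>F\<^esub> (\<zero>\<^bsub>F\<^esub> \<oplus>\<^bsub>F\<^esub> f)" using F.l_zero[OF assms(2)] by (simp only:)
  moreover note h(1)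
  moreover have "\<zero>\<^bsub>F\<^esub> \<in> N" using null_subsp unfolding subsp_def by blast
  ultimately show "z \<in> {h \<oplus>\<^bsub>F\<^esub> c \<odot>\<^bsub>F\<^esub> (h' \<oplus>\<^bsub>F\<^esub> f) | h h'. h \<in> N \<and> h' \<in> N}" by blast
 qed
 also have "... = cls (c \<odot>\<^bsub>F\<^esub> f)" unfolding cls_def a_r_coset_def' by blast
 finally show ?thesis .
qed

lemma tensor_module: "module K T"
proof -
 have ag: "abelian_group T"
 proof (rule abelian_groupI)
  fix x assume "x \<in> carrier T"
  then obtain f where "f \<in> carrier F" "x = cls f" by (auto simp: tensor_carrier)
  then show "EX y:carrier T. y \<oplus>\<^bsub>T\<^esub> x = \<zero>\<^bsub>T\<^esub>" by (intro bexI[of _ "cls (\<ominus>\<^bsub>F\<^esub> f)"])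
    (simp_all del: free_mod_simps add: tensor_carrier tensor_add tensor_zero F.l_neg)
 qed (auto simp del: free_mod_simps simp: tensor_carrier tensor_add tensor_zero F.a_ac)
 show ?thesis by (rule moduleI[OF K ag])
   (auto simp del: free_mod_simps simp: tensor_carrier tensor_add tensor_smult
    F.smult_l_distr F.smult_r_distr F.smult_assoc1)
qed

sublocale T: module K T by (rule tensor_module)

lemma cls_lin: "lin K F T cls" by (rule linI) (auto simp del: free_mod_simps simp: tensor_carrier tensor_add tensor_smult)

lemma pure_eq: "pure K I M x = cls (basis_vec K (restrict x I))" by (simp add: pure_def cls_def)

lemma pure_cong: "(!!i. i \<in> I ==> x i = y i) ==> pure K I M x = pure K I M y"
 unfolding pure_eq using restrict_ext[of I x y] by simp

lemma pure_restrict: "pure K I M (restrict x I) = pure K I M x" by (simp add: pure_eq)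

lemma pure_closed:
 assumes "!!i. i \<in> I ==> x i \<in> carrier (M i)" shows "pure K I M x \<in> carrier T"
 unfolding pure_eq tensor_carrier using assms by (intro imageI basis_vec_F) auto

lemma pure_closed_PiE: "x \<in> X ==> pure K I M x \<in> carrier T" by (rule pure_closed) (rule PiE_mem)

lemma pure_lin:
 assumes "!!j. j \<in> I ==> j ~= i ==> x j \<in> carrier (M j)" and i: "i \<in> I"
 shows "lin K (M i) T (%u. pure K I M (x(i := u)))"
proof -
 interpret Mi: module K "M i" using M i .
 \<comment> \<open>The entry of \<open>x\<close> at \<open>i\<close> is unconstrained, so it is
   replaced by zero to obtain a point of the product.\<close>
 let ?x = "restrict (x(i := \<zero>\<^bsub>M i\<^esub>)) I"
 have x: "?x \<in> X" using assms by auto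
 have p: "pure K I M (x(i := u)) = cls (basis_vec K (?x(i := u)))" for u
  unfolding pure_eq using i by (intro arg_cong[of _ _ "%z. cls (basis_vec K z)"]) (auto simp: restrict_def)
 have b: "basis_vec K (?x(i := u)) \<in> carrier F" if "u \<in> carrier (M i)" for u using basis_vec_F[OF fun_upd_PiE[OF x i that]] .
 note r = tensor_rels_subset_iff[of N, THEN iffD1, OF subsetI[OF null_F] rels_null,
   THEN bspec, OF _ x, THEN bspec, OF _ i, THEN bspec]
 note rel = r[THEN conjunct1, THEN bspec] r[THEN conjunct2, THEN bspec]
 show ?thesis
 proof (rule linI; unfold p)
  show "cls (basis_vec K (?x(i := u))) \<in> carrier T" if "u \<in> carrier (M i)" for u
   using b[OF that] by (simp del: free_mod_simps add: tensor_carrier)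
  show "cls (basis_vec K (?x(i := u \<oplus>\<^bsub>M i\<^esub> v))) = cls (basis_vec K (?x(i := u))) \<oplus>\<^bsub>T\<^esub> cls (basis_vec K (?x(i := v)))"
   if "u \<in> carrier (M i)" "v \<in> carrier (M i)" for u v
   using that rel(1) b by (simp del: free_mod_simps add: tensor_add cls_eq_iff)
  show "cls (basis_vec K (?x(i := c \<odot>\<^bsub>M i\<^esub> u))) = c \<odot>\<^bsub>T\<^esub> cls (basis_vec K (?x(i := u)))"
   if "c \<in> carrier K" "u \<in> carrier (M i)" for u c
   using that rel(2) b by (simp del: free_mod_simps add: tensor_smult cls_eq_iff)
 qed
qed

lemma spans_pure: "spans K T (pure K I M ` X)" unfolding spans_def
proof (intro conjI allI impI)
 show "pure K I M ` X <= carrier T" using pure_closed by (auto simp: PiE_iff)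
 fix S assume S: "subsp K T S" and sub: "pure K I M ` X <= S"
 have "cls h \<in> S" if "h \<in> carrier F" for h
 proof (rule spans_image_closed[OF F.module_axioms T.module_axioms spans_basis_vec[OF K] cls_lin S _ that])
  fix h assume "h \<in> basis_vec K ` X"
  then obtain x where x: "x \<in> X" "h = basis_vec K x" by blast
  moreover have "restrict x I = x" using x by (intro PiE_restrict)
  ultimately have "cls h = pure K I M x" by (simp add: pure_eq)
  then show "cls h \<in> S" using sub x by auto
 qed
 then show "carrier T <= S" by (auto simp del: free_mod_simps simp: tensor_carrier)
qed

lemma tensor_lin_eq:
 assumes "module K P" "lin K T P f" "lin K T P g"
  and "!!x. x \<in> X ==> f (pure K I M x) = g (pure K I M x)" and "z \<in> carrier T"
 shows "f z = g z"
 by (rule lin_eq_on_spans[OF T.module_axioms assms(1) spans_pure assms(2,3) _ assms(5)])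
  (elim imageE, simp only: assms(4))

text \<open>The linear extension of \<open>f\<close> to the free space kills the relations by
  multilinearity, hence kills \<open>N\<close> by minimality and descends to cosets.\<close>

lemma tensor_lift_ex:
 assumes P: "module K P" and f: "multilin K I M P f"
 shows "\<exists>g. lin K T P g \<and> (ALL x:X. g (pure K I M x) = f x)"
proof -
 interpret P: module K P by fact
 have fc: "f x \<in> carrier P" if "x \<in> X" for x using multilin_closed[OF f that] .
 define L where "L = free_lift K P f"
 have L: "lin K F P L" and Lb: "!!x. x \<in> X ==> L (basis_vec K x) = f x"
  unfolding L_def by (rule free_lift_lin[OF P fc], assumption, rule free_lift_basis_vec[OF P fc])
 have Lm: "L (g \<ominus>\<^bsub>F\<^esub> h) = L g \<ominus>\<^bsub>P\<^esub> L h" if "g \<in> carrier F" "h \<in> carrier F" for g h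
 proof -
  have "g \<ominus>\<^bsub>F\<^esub> h = g \<oplus>\<^bsub>F\<^esub> (\<ominus>\<^bsub>K\<^esub> \<one>\<^bsub>K\<^esub>) \<odot>\<^bsub>F\<^esub> h" using that F.smult_l_minus[of "\<one>\<^bsub>K\<^esub>" h] F.smult_one[OF that(2)] K.one_closed
   by (simp del: free_mod_simps add: F.minus_eq)
  moreover have "L (g \<oplus>\<^bsub>F\<^esub> (\<ominus>\<^bsub>K\<^esub> \<one>\<^bsub>K\<^esub>) \<odot>\<^bsub>F\<^esub> h) = L g \<oplus>\<^bsub>P\<^esub> (\<ominus>\<^bsub>K\<^esub> \<one>\<^bsub>K\<^esub>) \<odot>\<^bsub>P\<^esub> L h"
   using lin_add[OF L that(1) F.smult_closed[OF _ that(2)]] lin_smult[OF L _ that(2)] K.one_closed K.a_inv_closed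
   by metis
  ultimately show ?thesis
   using lin_closed[OF L that(2)] P.smult_l_minus[of "\<one>\<^bsub>K\<^esub>" "L h"] K.one_closed by (simp del: free_mod_simps add: P.minus_eq)
 qed
 \<comment> \<open>The kernel of \<open>L\<close> is a subspace, so it is enough that it contains
   the relations.\<close>
 have "N <= {h \<in> carrier F. L h = \<zero>\<^bsub>P\<^esub>}"
 proof (rule null_least)
  show "subsp K F {h \<in> carrier F. L h = \<zero>\<^bsub>P\<^esub>}" using subsp_eq[OF F.module_axioms P L lin_zero_map[OF P]] .
  show "tensor_rels K I M <= {h \<in> carrier F. L h = \<zero>\<^bsub>P\<^esub>}"
  proof (subst tensor_rels_subset_iff, blast, intro ballI conjI)
   fix x i u assume x: "x \<in> X" "i \<in> I" "u \<in> carrier (M i)"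
   note l = multilin_lin[OF f x(1,2)]
   have xu: "basis_vec K (x(i := v)) \<in> carrier F" "L (basis_vec K (x(i := v))) = f (x(i := v))" if "v \<in> carrier (M i)" for v
    using Lb basis_vec_F fun_upd_PiE[OF x(1,2) that] by auto
   { fix v assume v: "v \<in> carrier (M i)"
    have "L (basis_vec K (x(i := u)) \<oplus>\<^bsub>F\<^esub> basis_vec K (x(i := v))) = f (x(i := u)) \<oplus>\<^bsub>P\<^esub> f (x(i := v))"
     using lin_add[OF L] xu v x(3) by metis
    then show "basis_vec K (x(i := u \<oplus>\<^bsub>M i\<^esub> v)) \<ominus>\<^bsub>F\<^esub> (basis_vec K (x(i := u)) \<oplus>\<^bsub>F\<^esub> basis_vec K (x(i := v)))
      \<in> {h \<in> carrier F. L h = \<zero>\<^bsub>P\<^esub>}"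
     using xu v x M_closed(1)[OF x(2)] lin_add[OF l x(3) v] lin_closed[OF l]
     by (simp del: free_mod_simps add: Lm P.r_neg P.minus_eq) }
   { fix c assume c: "c \<in> carrier K"
    have "L (c \<odot>\<^bsub>F\<^esub> basis_vec K (x(i := u))) = c \<odot>\<^bsub>P\<^esub> f (x(i := u))" using lin_smult[OF L c] xu x(3) by metis
    then show "basis_vec K (x(i := c \<odot>\<^bsub>M i\<^esub> u)) \<ominus>\<^bsub>F\<^esub> c \<odot>\<^bsub>F\<^esub> basis_vec K (x(i := u)) \<in> {h \<in> carrier F. L h = \<zero>\<^bsub>P\<^esub>}"
     using xu c x M_closed(2)[OF x(2)] lin_smult[OF l c x(3)] lin_closed[OF l]
     by (simp del: free_mod_simps add: Lm P.r_neg P.minus_eq) }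
  qed
 qed
 then have wd: "L g = L h" if "g \<in> carrier F" "h \<in> carrier F" "cls g = cls h" for g h
 proof -
  have "L g \<ominus>\<^bsub>P\<^esub> L h = \<zero>\<^bsub>P\<^esub>" using \<open>N <= _\<close> that cls_eq_iff[OF that(1,2)] Lm[OF that(1,2)] by auto
  then show ?thesis using lin_closed[OF L that(1)] lin_closed[OF L that(2)] by (simp add: P.minus_eq P.add.inv_solve_right')
 qed
 \<comment> \<open>Evaluation at a chosen representative; by \<open>wd\<close> the choice does not
   matter.\<close>
 define G where "G z = L (SOME h. h \<in> carrier F \<and> cls h = z)" for z
 have Gc: "G (cls h) = L h" if "h \<in> carrier F" for h
 proof -
  have "(SOME h'. h' \<in> carrier F \<and> cls h' = cls h) \<in> carrier F \<and> cls (SOME h'. h' \<in> carrier F \<and> cls h' = cls h) = cls h"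
   by (rule someI[of _ h]) (use that in auto)
  then show ?thesis unfolding G_def using wd that by blast
 qed
 have "lin K T P G" by (rule linI)
   (auto simp del: free_mod_simps simp: tensor_carrier Gc tensor_add tensor_smult
    lin_add[OF L] lin_smult[OF L] lin_closed[OF L])
 moreover have "G (pure K I M x) = f x" if "x \<in> X" for x
  using Gc[OF basis_vec_F[OF that]] Lb[OF that] PiE_restrict[OF that] by (simp add: pure_eq)
 ultimately show ?thesis by blast
qed

text \<open>Discharges the definite description. Pure tensors span, which settles uniqueness on the
  carrier, and extensionality settles it elsewhere.\<close>

lemma tensor_lift_props:
 assumes P: "module K P" and f: "multilin K I M P f"
 shows tensor_lift_linear_maps: "tensor_lift K I M P f \<in> linear_maps K T P"
  and tensor_lift_pure': "x \<in> X ==> tensor_lift K I M P f (pure K I M x) = f x"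
proof -
 obtain g where g: "lin K T P g" "ALL x:X. g (pure K I M x) = f x" using tensor_lift_ex[OF assms] by blast
 let ?Q = "%g. g \<in> linear_maps K T P \<and> (ALL x:X. g (pure K I M x) = f x)"
 have "\<exists>!g. ?Q g"
 proof (rule ex1I[of _ "restrict g (carrier T)"])
  show "?Q (restrict g (carrier T))" using g restrict_linear_maps[OF T.module_axioms g(1)] by (simp add: pure_closed_PiE)
  fix g' assume g': "?Q g'"
  have "g' z = g z" if "z \<in> carrier T" for z by (rule tensor_lin_eq[OF P linear_maps_lin g(1) _ that]) (use g g' in auto)
  then show "g' = restrict g (carrier T)"
   using g' restrict_linear_maps[OF T.module_axioms g(1)] by (intro linear_maps_ext[of _ K T P]) auto
 qed
 then have "?Q (tensor_lift K I M P f)" unfolding tensor_lift_def by (rule theI')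
 then show "tensor_lift K I M P f \<in> linear_maps K T P"
  "x \<in> X ==> tensor_lift K I M P f (pure K I M x) = f x" by auto
qed

lemma tensor_lift_lin:
 "module K P ==> multilin K I M P f ==> lin K T P (tensor_lift K I M P f)"
 using tensor_lift_linear_maps by (rule linear_maps_lin)

lemma tensor_lift_pure:
 assumes "module K P" "multilin K I M P f" "!!i. i \<in> I ==> x i \<in> carrier (M i)"
 shows "tensor_lift K I M P f (pure K I M x) = f (restrict x I)"
 using tensor_lift_pure'[OF assms(1,2), of "restrict x I"] assms(3) by (auto simp: pure_restrict)

text \<open>Slots are freed one at a time: \<open>J\<close> holds the slots where an arbitrary
  vector is allowed, the others still carry generators.\<close>

lemma spans_pure_gen:
 assumes "finite I" and "!!i. i \<in> I ==> spans K (M i) (G i)"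
 shows "spans K T (pure K I M ` (\<Pi>\<^sub>E i\<in>I. G i))"
 unfolding spans_def
proof (intro conjI allI impI)
 have GM: "!!i. i \<in> I ==> G i <= carrier (M i)" using assms(2) by (auto simp: spans_def)
 show "pure K I M ` (\<Pi>\<^sub>E i\<in>I. G i) <= carrier T" using GM by (intro image_subsetI pure_closed) (blast dest: PiE_mem)
 fix S assume S: "subsp K T S" and sub: "pure K I M ` (\<Pi>\<^sub>E i\<in>I. G i) <= S"
 have "pure K I M x \<in> S" if "finite J" "J <= I" "x \<in> X" "!!i. i \<in> I - J ==> x i \<in> G i" for J x using that
 proof (induction J arbitrary: x rule: finite_induct)
  case empty
  then have "x \<in> (\<Pi>\<^sub>E i\<in>I. G i)" by (auto simp: PiE_iff)
  then show ?case using sub by auto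
 next
  case (insert i J)
  have i: "i \<in> I" using insert by auto
  have xM: "!!j. j \<in> I ==> x j \<in> carrier (M j)" using insert.prems(2) by (rule PiE_mem)
  have "pure K I M (x(i := x i)) \<in> S"
  proof (rule spans_image_closed[OF M[OF i] T.module_axioms assms(2)[OF i] pure_lin[OF _ i] S])
   fix g assume g: "g \<in> G i"
   show "pure K I M (x(i := g)) \<in> S"
   proof (rule insert.IH)
    show "x(i := g) \<in> X" by (rule fun_upd_PiE) (use insert.prems g i GM[OF i] in auto)
    show "(x(i := g)) j \<in> G j" if "j \<in> I - J" for j using insert.prems(3)[of j] that g by auto
   qed (use insert.prems in auto)
  qed (use xM i in auto)
  then show ?case by simp
 qed
 from this[OF assms(1) order_refl] have "pure K I M ` X <= S" by (intro image_subsetI) simp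
 then show "carrier T <= S" using spans_pure S unfolding spans_def by blast
qed

end

context tensor_prod
begin

text \<open>Serves every nested lift: the inner lift has to be linear in the variables of the outer
  one, which are parameters for it. The claim is closed under linear combinations of
  \<open>z\<close> and is the hypothesis on \<open>H\<close> when \<open>z\<close> is pure.\<close>

lemma lift_param_lin:
 assumes Q: "module K Q" and P: "module K P"
  and H: "!!q. q \<in> carrier Q ==> multilin K I M P (H q)"
  and l: "!!x. x \<in> X ==> lin K Q P (%q. H q x)" and z: "z \<in> carrier T"
 shows "lin K Q P (%q. tensor_lift K I M P (H q) z)"
proof -
 have L: "lin K T P (tensor_lift K I M P (H q))" if "q \<in> carrier Q" for q using that by (intro tensor_lift_lin P H)
 show ?thesis using T.module_axioms spans_pure z
 proof (induction rule: spans_induct)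
  case zero
  show ?case using lin_zero_map[OF P, of Q] lin_zero[OF T.module_axioms P L] by (subst lin_cong[OF Q, of _ "%q. \<zero>\<^bsub>P\<^esub>"]) auto
 next
  case (gen z)
  then obtain x where x: "x \<in> X" "z = pure K I M x" by blast
  show ?case using l[OF x(1)] tensor_lift_pure'[OF P H x(1)] x(2) by (subst lin_cong[OF Q, of _ "%q. H q x"]) auto
 next
  case (add y z)
  then show ?case by (subst lin_cong[OF Q, of _ "%q. tensor_lift K I M P (H q) y \<oplus>\<^bsub>P\<^esub> tensor_lift K I M P (H q) z"])
    (auto intro!: lin_add_map P simp: lin_add[OF L])
 next
  case (smult c z)
  then show ?case by (subst lin_cong[OF Q, of _ "%q. c \<odot>\<^bsub>P\<^esub> tensor_lift K I M P (H q) z"])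
    (auto intro!: lin_smult_map P simp: lin_smult[OF L])
 qed
qed

end

section \<open>Tensor products of linear maps\<close>

definition tmap :: "'k ring => 'i set => ('i => ('k, 'v) module) => ('i => ('k, 'w) module)
  => ('i => 'v => 'w) => ('i, 'v, 'k) tens => ('i, 'w, 'k) tens"
 where "tmap K I M N f = tensor_lift K I M (tensor K I N) (%x. pure K I N (%i. f i (x i)))"

lemma tensor_map_tmap: "tensor_map K M N n f = tmap K {1..n} (%_. M) (%_. N) f" by (simp add: tensor_map_def tmap_def)

locale two_tensor_prods = M: tensor_prod K I M + N: tensor_prod K I N
 for K :: "'k ring" and I :: "'i set" and M :: "'i => ('k, 'v) module" and N :: "'i => ('k, 'w) module"
begin

lemma tmap_multilin:
 assumes f: "!!i. i \<in> I ==> lin K (M i) (N i) (f i)"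
 shows "multilin K I M (tensor K I N) (%x. pure K I N (%i. f i (x i)))"
proof (rule multilinI)
 fix x assume x: "x \<in> (\<Pi>\<^sub>E i\<in>I. carrier (M i))"
 have xM: "!!i. i \<in> I ==> f i (x i) \<in> carrier (N i)" using lin_closed[OF f] PiE_mem[OF x] by auto
 then show "pure K I N (%i. f i (x i)) \<in> carrier (tensor K I N)" by (rule N.pure_closed)
 fix i assume i: "i \<in> I"
 have "lin K (M i) (tensor K I N) (%u. pure K I N ((%i. f i (x i))(i := f i u)))"
  by (rule lin_comp[OF f[OF i] N.pure_lin]) (use xM i in auto)
 moreover have "(%j. f j ((x(i := u)) j)) = (%i. f i (x i))(i := f i u)" for u by auto
 ultimately show "lin K (M i) (tensor K I N) (%u. pure K I N (%j. f j ((x(i := u)) j)))" by simp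
qed

lemma tmap_linear_maps:
 "(!!i. i \<in> I ==> lin K (M i) (N i) (f i)) ==> tmap K I M N f \<in> linear_maps K (tensor K I M) (tensor K I N)"
 unfolding tmap_def by (rule M.tensor_lift_linear_maps[OF N.tensor_module tmap_multilin])

lemma tmap_lin:
 "(!!i. i \<in> I ==> lin K (M i) (N i) (f i)) ==> lin K (tensor K I M) (tensor K I N) (tmap K I M N f)"
 by (rule linear_maps_lin) (rule tmap_linear_maps)

lemma tmap_pure:
 assumes "!!i. i \<in> I ==> lin K (M i) (N i) (f i)" "!!i. i \<in> I ==> x i \<in> carrier (M i)"
 shows "tmap K I M N f (pure K I M x) = pure K I N (%i. f i (x i))"
 unfolding tmap_def
 by (subst M.tensor_lift_pure[OF N.tensor_module tmap_multilin]) (use assms in \<open>auto intro!: N.pure_cong\<close>)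

lemma tmap_cong:
 assumes "!!i. i \<in> I ==> lin K (M i) (N i) (f i)" "!!i. i \<in> I ==> lin K (M i) (N i) (g i)"
  and "!!i x. i \<in> I ==> x \<in> carrier (M i) ==> f i x = g i x"
 shows "tmap K I M N f = tmap K I M N g"
proof (rule linear_maps_ext[OF tmap_linear_maps[OF assms(1)] tmap_linear_maps[OF assms(2)]])
 fix z assume "z \<in> carrier (tensor K I M)"
 then show "tmap K I M N f z = tmap K I M N g z"
 proof (rule M.tensor_lin_eq[OF N.tensor_module tmap_lin[OF assms(1)] tmap_lin[OF assms(2)], rotated -1])
  fix x assume x: "x \<in> (\<Pi>\<^sub>E i\<in>I. carrier (M i))"
  then have "tmap K I M N f (pure K I M x) = pure K I N (%i. f i (x i))" by (intro tmap_pure assms(1)) auto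
  also have "... = pure K I N (%i. g i (x i))" using assms(3) PiE_mem[OF x] by (intro N.pure_cong) auto
  also have "... = tmap K I M N g (pure K I M x)" using x by (intro tmap_pure[symmetric] assms(2)) auto
  finally show "tmap K I M N f (pure K I M x) = tmap K I M N g (pure K I M x)" .
 qed
qed

text \<open>A tensor product of maps is linear in each of its maps. The parameter \<open>q\<close>
  is kept general because it may be an operator, an algebra element acting by multiplication, or one
  acting through a representation.\<close>

lemma tmap_slot_lin:
 assumes Q: "module K Q" and i: "i \<in> I"
  and f: "!!j. j \<in> I ==> j ~= i ==> lin K (M j) (N j) (f j)"
  and h: "!!q. q \<in> carrier Q ==> lin K (M i) (N i) (h q)"
  and hl: "!!x. x \<in> carrier (M i) ==> lin K Q (N i) (%q. h q x)"
  and z: "z \<in> carrier (tensor K I M)"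
 shows "lin K Q (tensor K I N) (%q. tmap K I M N (f(i := h q)) z)"
 unfolding tmap_def
proof (rule M.lift_param_lin[OF Q N.tensor_module tmap_multilin _ z])
 fix q j assume "q \<in> carrier Q" "j \<in> I"
 then show "lin K (M j) (N j) ((f(i := h q)) j)" using f h by auto
next
 fix x assume x: "x \<in> (\<Pi>\<^sub>E i\<in>I. carrier (M i))"
 have "lin K Q (tensor K I N) (%q. pure K I N ((%j. f j (x j))(i := h q (x i))))"
  by (rule lin_comp[OF hl N.pure_lin]) (use x i lin_closed[OF f] PiE_mem[OF x] in auto)
 moreover have "(%j. (f(i := h q)) j (x j)) = (%j. f j (x j))(i := h q (x i))" for q by auto
 ultimately show "lin K Q (tensor K I N) (%q. pure K I N (%j. (f(i := h q)) j (x j)))" by simp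
qed

end

lemma tmap_comp:
 assumes "two_tensor_prods K I M N" "two_tensor_prods K I N P"
  and f: "!!i. i \<in> I ==> lin K (M i) (N i) (f i)" and g: "!!i. i \<in> I ==> lin K (N i) (P i) (g i)"
  and z: "z \<in> carrier (tensor K I M)"
 shows "tmap K I N P g (tmap K I M N f z) = tmap K I M P (%i x. g i (f i x)) z"
proof -
 interpret MN: two_tensor_prods K I M N by fact
 interpret NP: two_tensor_prods K I N P by fact
 interpret MP: two_tensor_prods K I M P ..
 have gf: "!!i. i \<in> I ==> lin K (M i) (P i) (%x. g i (f i x))" using lin_comp f g by blast
 show ?thesis
 proof (rule MN.M.tensor_lin_eq[OF NP.N.tensor_module lin_comp[OF MN.tmap_lin[OF f] NP.tmap_lin[OF g]]
    MP.tmap_lin[OF gf] _ z])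
  fix x assume x: "x \<in> (\<Pi>\<^sub>E i\<in>I. carrier (M i))"
  have xM: "!!i. i \<in> I ==> x i \<in> carrier (M i)" using x by auto
  show "tmap K I N P g (tmap K I M N f (pure K I M x)) = tmap K I M P (%i x. g i (f i x)) (pure K I M x)"
   using xM lin_closed[OF f] by (simp add: MN.tmap_pure f NP.tmap_pure g MP.tmap_pure gf)
 qed auto
qed

lemma tmap_id:
 assumes "tensor_prod K I M" and f: "!!i x. i \<in> I ==> x \<in> carrier (M i) ==> f i x = x"
  and z: "z \<in> carrier (tensor K I M)"
 shows "tmap K I M M f z = z"
proof -
 interpret M: tensor_prod K I M by fact
 interpret MM: two_tensor_prods K I M M ..
 have fl: "lin K (M i) (M i) (f i)" if "i \<in> I" for i using lin_cong[OF M.M[OF that], of "f i" "%x. x"] f[OF that] lin_id by auto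
 show ?thesis
 proof (rule M.tensor_lin_eq[OF M.tensor_module MM.tmap_lin[OF fl] lin_id _ z])
  fix x assume x: "x \<in> (\<Pi>\<^sub>E i\<in>I. carrier (M i))"
  have xM: "!!i. i \<in> I ==> x i \<in> carrier (M i)" using x by auto
  show "tmap K I M M f (pure K I M x) = pure K I M x" using xM by (simp add: MM.tmap_pure fl f cong: M.pure_cong)
 qed auto
qed

section \<open>Iterated tensor products\<close>

text \<open>A tensor product of tensor powers, the \<open>b\<close>-th power having its factors
  indexed by \<open>J b\<close>. Both the components of the tensor powers of \<open>V\<close> and
  the source of \<open>box_shuffle\<close> have this shape.\<close>

locale nested_tensor =
 fixes K :: "'k ring" and I :: "'i set" and J :: "'i => 'j set" and V :: "'i => ('k, 'v) module"
 assumes K: "cring K" and fin: "finite I" and V: "!!b. b \<in> I ==> module K (V b)"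
begin

abbreviation (input) "fams b \<equiv> \<Pi>\<^sub>E j\<in>J b. carrier (V b)"
abbreviation (input) "VV \<equiv> \<Pi>\<^sub>E b\<in>I. fams b"
abbreviation (input) "TT \<equiv> %b. tensor K (J b) (%_. V b)"
abbreviation (input) "ppure v \<equiv> pure K I TT (%b. pure K (J b) (%_. V b) (v b))"

definition multilin2 :: "('k, 'p) module => (('i => 'j => 'v) => 'p) => bool"
 where "multilin2 P f \<longleftrightarrow> (ALL v:VV. f v \<in> carrier P \<and> (ALL b:I. ALL j:J b. lin K (V b) P (%u. f (v(b := (v b)(j := u))))))"

lemma inner: "b \<in> I ==> tensor_prod K (J b) (%_. V b)" by (simp add: tensor_prod_def K V)

sublocale outer: tensor_prod K I TT using tensor_prod.tensor_module[OF inner] by (simp add: tensor_prod_def K)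

text \<open>The universal property is reached by lifting one outer index after another. In the
  invariant, \<open>g\<close> takes tensors \<open>Y\<close> at the treated indices
  \<open>I'\<close> and families \<open>v\<close> at the remaining ones. It is multilinear in
  \<open>Y\<close> and in each remaining family, and it ignores \<open>v\<close> at the treated
  indices.\<close>

lemma nested_partial_lift:
 assumes P: "module K P" and f: "multilin2 P f" and I': "finite I'" "I' <= I"
 shows "\<exists>g. (ALL v:VV. multilin K I' TT P (%Y. g Y v)) \<and>
  (ALL v:VV. ALL Y:(\<Pi>\<^sub>E b\<in>I'. carrier (TT b)). ALL b:I - I'. multilin K (J b) (%_. V b) P (%y. g Y (v(b := y)))) \<and>
  (ALL v:VV. g (\<lambda>b\<in>I'. pure K (J b) (%_. V b) (v b)) v = f v) \<and> (\<forall>Y v v'. (\<forall>b. b \<notin> I' --> v b = v' b) --> g Y v = g Y v')"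
 (is "\<exists>g. ?P I' g")
 using I'
proof (induction I' rule: finite_induct)
 case empty
 have m1: "multilin K (J b) (%_. V b) P (%y. f (v(b := y)))" if v: "v \<in> VV" and b: "b \<in> I" for v b
 proof (rule multilinI)
  fix y assume y: "y \<in> fams b"
  have vy: "v(b := y) \<in> VV" using fun_upd_PiE[OF v b] y by blast
  then show "f (v(b := y)) \<in> carrier P" using f unfolding multilin2_def by blast
  fix j assume "j \<in> J b"
  then have "lin K (V b) P (%u. f ((v(b := y))(b := ((v(b := y)) b)(j := u))))" using f vy b unfolding multilin2_def by blast
  then show "lin K (V b) P (%u. f (v(b := y(j := u))))" by simp
 qed
 have m2: "multilin K {} TT P (%Y. f v)" if "v \<in> VV" for v using f that by (simp add: multilin_def multilin2_def)
 have m3: "f v = f v'" if "\<forall>b. b \<notin> {} --> v b = v' b" for v v' using that by (intro arg_cong[of _ _ f] ext) auto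
 show ?case
 proof (intro exI[of _ "%Y v. f v"] conjI ballI allI impI)
  show "multilin K {} TT P (%Y. f v)" if "v \<in> VV" for v using that by (rule m2)
  show "multilin K (J b) (%_. V b) P (%y. f (v(b := y)))" if "v \<in> VV" "b \<in> I - {}" for v b using that by (intro m1) simp_all
  show "f v = f v" for v ..
  show "f v = f v'" if "\<forall>b. b \<notin> {} --> v b = v' b" for v v' using that by (rule m3)
 qed
next
 case (insert b0 I')
 then have "\<exists>g. ?P I' g" by (intro insert.IH) simp
 then obtain g where g: "?P I' g" by (elim exE)
 note g1 = g[THEN conjunct1, rule_format] and g2 = g[THEN conjunct2, THEN conjunct1, rule_format]
  and g3 = g[THEN conjunct2, THEN conjunct2, THEN conjunct1, rule_format]
  and g4 = g[THEN conjunct2, THEN conjunct2, THEN conjunct2, rule_format]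
 have b0: "b0 \<in> I" "b0 \<notin> I'" "I' <= I" using insert by auto
 interpret B: tensor_prod K "J b0" "%_. V b0" by (rule inner[OF b0(1)])
 \<comment> \<open>The family at \<open>b0\<close> is lifted to a tensor; all other variables become
   parameters of this lift.\<close>
 define h where "h Y v = tensor_lift K (J b0) (%_. V b0) P (%y. g (restrict Y I') (v(b0 := y))) (Y b0)" for Y v
 have rY: "restrict Y I' \<in> (\<Pi>\<^sub>E b\<in>I'. carrier (TT b))" "Y b0 \<in> carrier (TT b0)"
  if "Y \<in> (\<Pi>\<^sub>E b\<in>insert b0 I'. carrier (TT b))" for Y
  using that by (auto simp: PiE_iff)
 have gm: "multilin K (J b0) (%_. V b0) P (%y. g (restrict Y I') (v(b0 := y)))"
  if "v \<in> VV" "Y \<in> (\<Pi>\<^sub>E b\<in>insert b0 I'. carrier (TT b))" for v Y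
  using g2[OF that(1) rY(1)[OF that(2)], of b0] b0 by blast
 have h_closed: "h Y v \<in> carrier P" if "v \<in> VV" "Y \<in> (\<Pi>\<^sub>E b\<in>insert b0 I'. carrier (TT b))" for v Y
  unfolding h_def by (rule lin_closed[OF B.tensor_lift_lin[OF P gm[OF that]] rY(2)[OF that(2)]])
 show ?case
 proof (intro exI[of _ h] conjI ballI allI impI)
  fix v assume v: "v \<in> VV"
  show "multilin K (insert b0 I') TT P (%Y. h Y v)"
  proof (rule multilinI)
   fix Y i assume Y: "Y \<in> (\<Pi>\<^sub>E b\<in>insert b0 I'. carrier (TT b))" and i: "i \<in> insert b0 I'"
   show "lin K (TT i) P (%u. h (Y(i := u)) v)"
   proof (cases "i = b0")
    case True
    have "restrict (Y(b0 := u)) I' = restrict Y I'" for u using b0 by (intro ext) auto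
    then show ?thesis unfolding h_def True by (simp add: B.tensor_lift_lin[OF P gm[OF v Y]])
   next
    case False
    then have iI': "i \<in> I'" using i by blast
    have r: "restrict (Y(i := u)) I' = (restrict Y I')(i := u)" for u using iI' by (intro ext) auto
    \<comment> \<open>For a slot treated earlier, \<open>u\<close> is a parameter of the lift at
      \<open>b0\<close>, so linearity passes through it.\<close>
    have "lin K (TT i) P (%u. tensor_lift K (J b0) (%_. V b0) P (%y. g ((restrict Y I')(i := u)) (v(b0 := y))) (Y b0))"
    proof (rule B.lift_param_lin[OF _ P _ _ rY(2)[OF Y]])
     show "module K (TT i)" using outer.M i b0 by auto
     show "multilin K (J b0) (%_. V b0) P (%y. g ((restrict Y I')(i := u)) (v(b0 := y)))" if "u \<in> carrier (TT i)" for u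
      using g2[OF v fun_upd_PiE[OF rY(1)[OF Y] iI' that], of b0] b0 by blast
     show "lin K (TT i) P (%u. g ((restrict Y I')(i := u)) (v(b0 := y)))" if "y \<in> fams b0" for y
      using multilin_lin[OF g1 rY(1)[OF Y] iI'] fun_upd_PiE[OF v b0(1) that] .
    qed
    then show ?thesis unfolding h_def r using False by simp
   qed
  qed (rule h_closed[OF v])
  { fix Y b assume Y: "Y \<in> (\<Pi>\<^sub>E b\<in>insert b0 I'. carrier (TT b))" and b: "b \<in> I - insert b0 I'"
   show "multilin K (J b) (%_. V b) P (%y. h Y (v(b := y)))"
   proof (rule multilinI)
    fix y assume y: "y \<in> fams b"
    have vy: "v(b := y) \<in> VV" using b by (intro fun_upd_PiE[OF v _ y]) auto
    then show "h Y (v(b := y)) \<in> carrier P" by (rule h_closed[OF _ Y])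
    fix j assume j: "j \<in> J b"
    have tw: "v(b := y(j := u), b0 := y0) = v(b0 := y0, b := y(j := u))" for u y0 using b by (intro fun_upd_twist) auto
    show "lin K (V b) P (%u. h Y (v(b := y(j := u))))" unfolding h_def
    proof (rule B.lift_param_lin[OF _ P gm[OF _ Y] _ rY(2)[OF Y]])
     show "module K (V b)" using V b by auto
     show "v(b := y(j := u)) \<in> VV" if "u \<in> carrier (V b)" for u
      using b fun_upd_PiE[OF y j that] by (intro fun_upd_PiE[OF v]) auto
     show "lin K (V b) P (%u. g (restrict Y I') (v(b := y(j := u), b0 := y0)))" if "y0 \<in> fams b0" for y0 unfolding tw using b
      by (intro multilin_lin[OF g2[OF fun_upd_PiE[OF v b0(1) that] rY(1)[OF Y]] y j]) auto
    qed
   qed }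
  have vb: "v b0 \<in> fams b0" by (rule PiE_mem[OF v b0(1)])
  have vp: "pure K (J b) (%_. V b) (v b) \<in> carrier (TT b)" if "b \<in> I" for b
   by (rule tensor_prod.pure_closed_PiE[OF inner[OF that]]) (rule PiE_mem[OF v that])
  have Y: "(\<lambda>b\<in>insert b0 I'. pure K (J b) (%_. V b) (v b)) \<in> (\<Pi>\<^sub>E b\<in>insert b0 I'. carrier (TT b))" using vp b0 by auto
  have r: "restrict (\<lambda>b\<in>insert b0 I'. pure K (J b) (%_. V b) (v b)) I' = (\<lambda>b\<in>I'. pure K (J b) (%_. V b) (v b))"
   by (intro ext) auto
  have "h (\<lambda>b\<in>insert b0 I'. pure K (J b) (%_. V b) (v b)) v = tensor_lift K (J b0) (%_. V b0) P
    (%y. g (\<lambda>b\<in>I'. pure K (J b) (%_. V b) (v b)) (v(b0 := y))) (pure K (J b0) (%_. V b0) (v b0))"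
   unfolding h_def r by simp
  also have "... = g (\<lambda>b\<in>I'. pure K (J b) (%_. V b) (v b)) (v(b0 := v b0))"
   using gm[OF v Y] unfolding r by (rule B.tensor_lift_pure'[OF P _ vb])
  finally show "h (\<lambda>b\<in>insert b0 I'. pure K (J b) (%_. V b) (v b)) v = f v" using g3[OF v] by simp
 next
  fix Y v v' assume vv: "\<forall>b. b \<notin> insert b0 I' --> v b = (v' b :: 'j => 'v)"
  have "g (restrict Y I') (v(b0 := y)) = g (restrict Y I') (v'(b0 := y))" for y by (rule g4) (use vv in auto)
  then show "h Y v = h Y v'" unfolding h_def by simp
 qed
qed

lemma nested_lift:
 assumes P: "module K P" and f: "multilin2 P f"
 shows "\<exists>G. lin K (tensor K I TT) P G \<and> (ALL v:VV. G (ppure v) = f v)"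
proof -
 note ex = nested_partial_lift[OF P f fin order_refl]
 from ex obtain g where g: "(ALL v:VV. multilin K I TT P (%Y. g Y v)) \<and>
  (ALL v:VV. ALL Y:(\<Pi>\<^sub>E b\<in>I. carrier (TT b)). ALL b:I - I. multilin K (J b) (%_. V b) P (%y. g Y (v(b := y)))) \<and>
  (ALL v:VV. g (\<lambda>b\<in>I. pure K (J b) (%_. V b) (v b)) v = f v) \<and>
  (\<forall>Y v v'. (\<forall>b. b \<notin> I --> v b = v' b) --> g Y v = g Y v')" by (elim exE)
 note g1 = g[THEN conjunct1, rule_format]
  and g3 = g[THEN conjunct2, THEN conjunct2, THEN conjunct1, rule_format]
  and g4 = g[THEN conjunct2, THEN conjunct2, THEN conjunct2, rule_format]
 \<comment> \<open>With all indices treated, \<open>g Y\<close> no longer depends on the family. Any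
   member of \<open>VV\<close> may be substituted; the zero family is one.\<close>
 define v0 where "v0 = (\<lambda>b\<in>I. \<lambda>j\<in>J b. \<zero>\<^bsub>V b\<^esub>)"
 have v0: "v0 \<in> VV" unfolding v0_def using V abelian_monoid.zero_closed[OF abelian_group.axioms(1)[OF module.axioms(2)]]
  by (auto intro!: restrict_PiE_iff[THEN iffD2])
 show ?thesis
 proof (intro exI conjI ballI)
  show "lin K (tensor K I TT) P (tensor_lift K I TT P (%Y. g Y v0))" by (rule outer.tensor_lift_lin[OF P g1[OF v0]])
  fix v assume v: "v \<in> VV"
  have vp: "pure K (J b) (%_. V b) (v b) \<in> carrier (TT b)" if "b \<in> I" for b
   by (rule tensor_prod.pure_closed_PiE[OF inner[OF that]]) (rule PiE_mem[OF v that])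
  have "tensor_lift K I TT P (%Y. g Y v0) (ppure v) = g (\<lambda>b\<in>I. pure K (J b) (%_. V b) (v b)) v0"
   by (rule outer.tensor_lift_pure[OF P g1[OF v0]]) (rule vp)
  also have "... = g (\<lambda>b\<in>I. pure K (J b) (%_. V b) (v b)) v" using v v0 by (intro g4) (auto simp: PiE_iff extensional_def)
  finally show "tensor_lift K I TT P (%Y. g Y v0) (ppure v) = f v" using g3[OF v] by simp
 qed
qed

lemma spans_ppure: "spans K (tensor K I TT) (ppure ` VV)"
proof -
 have "spans K (TT b) (pure K (J b) (%_. V b) ` fams b)" if "b \<in> I" for b by (rule tensor_prod.spans_pure[OF inner[OF that]])
 then have "spans K (tensor K I TT) (pure K I TT ` (\<Pi>\<^sub>E b\<in>I. pure K (J b) (%_. V b) ` fams b))"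
  by (rule outer.spans_pure_gen[OF fin])
 moreover have "pure K I TT ` (\<Pi>\<^sub>E b\<in>I. pure K (J b) (%_. V b) ` fams b) = ppure ` VV"
 proof (intro equalityI image_subsetI)
  fix Y assume Y: "Y \<in> (\<Pi>\<^sub>E b\<in>I. pure K (J b) (%_. V b) ` fams b)"
  then have "ALL b:I. \<exists>v. v \<in> fams b \<and> Y b = pure K (J b) (%_. V b) v" by (blast dest: PiE_mem)
  then obtain v where v: "!!b. b \<in> I ==> v b \<in> fams b \<and> Y b = pure K (J b) (%_. V b) (v b)" by metis
  have "restrict v I \<in> VV" using v by simp
  moreover have "pure K I TT Y = ppure (restrict v I)" by (rule outer.pure_cong) (use v in auto)
  ultimately show "pure K I TT Y \<in> ppure ` VV" by blast
 next
  fix v assume v: "v \<in> VV"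
  let ?Y = "\<lambda>b\<in>I. pure K (J b) (%_. V b) (v b)"
  have "?Y \<in> (\<Pi>\<^sub>E b\<in>I. pure K (J b) (%_. V b) ` fams b)" using PiE_mem[OF v] by (simp add: image_eqI)
  moreover have "ppure v = pure K I TT ?Y" by (rule outer.pure_cong) auto
  ultimately show "ppure v \<in> pure K I TT ` (\<Pi>\<^sub>E b\<in>I. pure K (J b) (%_. V b) ` fams b)" by blast
 qed
 ultimately show ?thesis by simp
qed

lemma nested_lin_eq:
 assumes "module K P" "lin K (tensor K I TT) P f" "lin K (tensor K I TT) P g"
  and "!!v. v \<in> VV ==> f (ppure v) = g (ppure v)" and "z \<in> carrier (tensor K I TT)"
 shows "f z = g z"
 by (rule lin_eq_on_spans[OF outer.tensor_module assms(1) spans_ppure assms(2,3) _ assms(5)])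
  (elim imageE, simp only: assms(4))

end

section \<open>Linear functionals\<close>

lemma ground_alg_simps [simp]:
 "carrier (ground_alg K) = carrier K"
 "x \<otimes>\<^bsub>ground_alg K\<^esub> y = x \<otimes>\<^bsub>K\<^esub> y"
 "\<one>\<^bsub>ground_alg K\<^esub> = \<one>\<^bsub>K\<^esub>"
 "\<zero>\<^bsub>ground_alg K\<^esub> = \<zero>\<^bsub>K\<^esub>"
 "x \<oplus>\<^bsub>ground_alg K\<^esub> y = x \<oplus>\<^bsub>K\<^esub> y"
 "c \<odot>\<^bsub>ground_alg K\<^esub> x = c \<otimes>\<^bsub>K\<^esub> x"
 by (simp_all add: ground_alg_def)

lemma ground_alg_module: assumes "cring K" shows "module K (ground_alg K)"
proof -
 interpret K: cring K by fact
 have "abelian_group (ground_alg K)" by (rule abelian_groupI) (auto simp: K.a_ac intro: bexI[of _ "\<ominus>\<^bsub>K\<^esub> _"] K.l_neg)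
 then show ?thesis by (rule moduleI[OF assms]) (auto simp: K.l_distr K.r_distr K.m_assoc)
qed

text \<open>Zorn's lemma gives a subspace \<open>N\<close> maximal among those avoiding
  \<open>u\<close>. Every vector is then uniquely \<open>n + c u\<close> with \<open>n\<close> in
  \<open>N\<close>, and the functional reads off \<open>c\<close>; this works in any
  dimension.\<close>

lemma functional_nonzero:
 fixes K :: "'k ring" and M :: "('k, 'a) module" (structure)
 assumes K: "field K" and M: "module K M" and u: "u \<in> carrier M" "u ~= \<zero>"
 shows "\<exists>l. lin K M (ground_alg K) l \<and> l u ~= \<zero>\<^bsub>K\<^esub>"
proof -
 interpret K: field K by fact
 interpret M: module K M by fact
 let ?A = "{N. subsp K M N \<and> u \<notin> N}"
 have "{\<zero>} \<in> ?A" using u by (auto simp: subsp_def)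
 then have A_ne: "?A ~= {}" by (rule ex_in_conv[THEN iffD1, OF exI])
 have A_ch: "\<Union>\<C> \<in> ?A" if ne: "\<C> ~= {}" and ch: "subset.chain ?A \<C>" for \<C>
 proof -
  have C: "!!N. N \<in> \<C> ==> subsp K M N \<and> u \<notin> N" and
   tot: "!!N N'. N \<in> \<C> ==> N' \<in> \<C> ==> N <= N' \<or> N' <= N"
   using ch by (auto simp: subset.chain_def)
  have "subsp K M (\<Union>\<C>)" unfolding subsp_def
  proof (intro conjI ballI)
   show "\<Union>\<C> <= carrier M" using C unfolding subsp_def by blast
   show "\<zero> \<in> \<Union>\<C>" using C ne by (auto simp: subsp_def)
   show "c \<odot> x \<in> \<Union>\<C>" if "c \<in> carrier K" "x \<in> \<Union>\<C>" for c x using C that unfolding subsp_def by blast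
   fix x y assume "x \<in> \<Union>\<C>" "y \<in> \<Union>\<C>"
   then obtain N where "N \<in> \<C>" "x \<in> N" "y \<in> N" using tot by blast
   then show "x \<oplus> y \<in> \<Union>\<C>" using C unfolding subsp_def by blast
  qed
  then show ?thesis using C by auto
 qed
 have "EX N:?A. ALL X:?A. N <= X --> X = N" by (rule subset_Zorn_nonempty[OF A_ne]) (rule A_ch)
 then obtain N where
  N: "N \<in> ?A" and max': "ALL X:?A. N <= X --> X = N" by (elim bexE)
 note max = max'[rule_format]
 have Ns: "subsp K M N" and uN: "u \<notin> N" using N by auto
 have NM: "!!x. x \<in> N ==> x \<in> carrier M" and Na: "!!x y. x \<in> N ==> y \<in> N ==> x \<oplus> y \<in> N"
  and Nsm: "!!c x. c \<in> carrier K ==> x \<in> N ==> c \<odot> x \<in> N" and N0: "\<zero> \<in> N"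
  using Ns by (auto simp: subsp_def)
 have Nm: "\<ominus> x \<in> N" if "x \<in> N" for x using Nsm[of "\<ominus>\<^bsub>K\<^esub> \<one>\<^bsub>K\<^esub>" x] that NM by (simp add: M.smult_l_minus)
 have ex: "EX c:carrier K. EX n:N. x = n \<oplus> c \<odot> u" if x: "x \<in> carrier M" for x
 proof (cases "x \<in> N")
  case True
  then show ?thesis using u x by (intro bexI[of _ "\<zero>\<^bsub>K\<^esub>"] bexI[of _ x]) auto
 next
  case False
  \<comment> \<open>The span of \<open>N\<close> and \<open>x\<close> is strictly larger than
    \<open>N\<close>, so by maximality it contains \<open>u\<close>. The coefficient of
    \<open>x\<close> in \<open>u\<close> is nonzero as \<open>u\<close> is not in \<open>N\<close>,
    hence \<open>x\<close> can be solved for.\<close>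
  let ?N = "{n \<oplus> a \<odot> x | n a. n \<in> N \<and> a \<in> carrier K}"
  have sub: "subsp K M ?N" unfolding subsp_def
  proof (intro conjI ballI)
   show "?N <= carrier M" using NM x by auto
   show "\<zero> \<in> ?N" using N0 x by (auto intro!: exI[of _ "\<zero>"] exI[of _ "\<zero>\<^bsub>K\<^esub>"])
   fix y assume "y \<in> ?N"
   then obtain n a where y: "n \<in> N" "a \<in> carrier K" "y = n \<oplus> a \<odot> x" by blast
   { fix c assume c: "c \<in> carrier K"
    have "c \<odot> y = c \<odot> n \<oplus> (c \<otimes>\<^bsub>K\<^esub> a) \<odot> x" using y c NM x by (simp add: M.smult_r_distr M.smult_assoc1)
    then show "c \<odot> y \<in> ?N" using Nsm[OF c y(1)] c y(2) by blast }
   { fix z assume "z \<in> ?N"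
    then obtain n' a' where z: "n' \<in> N" "a' \<in> carrier K" "z = n' \<oplus> a' \<odot> x" by blast
    have "y \<oplus> z = (n \<oplus> n') \<oplus> (a \<oplus>\<^bsub>K\<^esub> a') \<odot> x" using y z NM x by (simp add: M.smult_l_distr M.a_ac)
    then show "y \<oplus> z \<in> ?N" using Na[OF y(1) z(1)] y(2) z(2) by blast }
  qed
  have NN: "N <= ?N"
  proof
   fix n assume n: "n \<in> N"
   then have "n = n \<oplus> \<zero>\<^bsub>K\<^esub> \<odot> x" using x NM by simp
   then show "n \<in> ?N" using n K.zero_closed by blast
  qed
  have "x = \<zero> \<oplus> \<one>\<^bsub>K\<^esub> \<odot> x" using x by simp
  then have "x \<in> ?N" using N0 K.one_closed by blast
  then have "u \<in> ?N" using max[of ?N] NN sub False by blast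
  then obtain n a where na: "n \<in> N" "a \<in> carrier K" "u = n \<oplus> a \<odot> x" by blast
  have "a ~= \<zero>\<^bsub>K\<^esub>" using na uN x NM by auto
  then have a: "inv\<^bsub>K\<^esub> a \<in> carrier K" "inv\<^bsub>K\<^esub> a \<otimes>\<^bsub>K\<^esub> a = \<one>\<^bsub>K\<^esub>" using na K.field_Units by auto
  have "inv\<^bsub>K\<^esub> a \<odot> u = inv\<^bsub>K\<^esub> a \<odot> n \<oplus> x" using na a x NM by (simp add: M.smult_r_distr flip: M.smult_assoc1)
  then have "x = \<ominus> (inv\<^bsub>K\<^esub> a \<odot> n) \<oplus> inv\<^bsub>K\<^esub> a \<odot> u" using na a x NM by (simp add: M.r_neg1)
  then show ?thesis using Nm[OF Nsm[OF a(1) na(1)]] a(1) by blast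
 qed
 \<comment> \<open>Two different coefficients would put a nonzero multiple of \<open>u\<close>, and
   so \<open>u\<close> itself, into \<open>N\<close>.\<close>
 have uniq: "c = c'" if c: "c \<in> carrier K" "c' \<in> carrier K" "n \<in> N" "n' \<in> N"
   and eq: "n \<oplus> c \<odot> u = n' \<oplus> c' \<odot> u" for c c' n n'
 proof (rule ccontr)
  assume "c ~= c'"
  then have ne: "c \<ominus>\<^bsub>K\<^esub> c' ~= \<zero>\<^bsub>K\<^esub>" using c by (auto simp: K.minus_eq K.add.inv_solve_right')
  let ?d = "c \<ominus>\<^bsub>K\<^esub> c'"
  have d: "?d \<in> carrier K" using c by simp
  have di: "inv\<^bsub>K\<^esub> ?d \<in> carrier K" "inv\<^bsub>K\<^esub> ?d \<otimes>\<^bsub>K\<^esub> ?d = \<one>\<^bsub>K\<^esub>" using ne d K.field_Units by auto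
  have "?d \<odot> u = c \<odot> u \<oplus> \<ominus> (c' \<odot> u)" using c u by (simp add: K.minus_eq M.smult_l_distr M.smult_l_minus)
  also have "c \<odot> u = \<ominus> n \<oplus> (n' \<oplus> c' \<odot> u)" using c u NM by (simp add: M.r_neg1 flip: eq)
  also have "\<ominus> n \<oplus> (n' \<oplus> c' \<odot> u) \<oplus> \<ominus> (c' \<odot> u) = \<ominus> n \<oplus> n'" using c u NM by (simp add: M.a_assoc M.r_neg)
  finally have "?d \<odot> u \<in> N" using Na[OF Nm[OF c(3)] c(4)] by simp
  then have "inv\<^bsub>K\<^esub> ?d \<odot> (?d \<odot> u) \<in> N" by (rule Nsm[OF di(1)])
  moreover have "inv\<^bsub>K\<^esub> ?d \<odot> (?d \<odot> u) = (inv\<^bsub>K\<^esub> ?d \<otimes>\<^bsub>K\<^esub> ?d) \<odot> u" using M.smult_assoc1[OF di(1) d u(1)] by simp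
  ultimately show False using uN u di(2) by simp
 qed
 define l where "l x = (THE c. c \<in> carrier K \<and> (EX n:N. x = n \<oplus> c \<odot> u))" for x
 have l: "l (n \<oplus> c \<odot> u) = c" if "n \<in> N" "c \<in> carrier K" for n c unfolding l_def
 proof (rule the_equality)
  show "c \<in> carrier K \<and> (EX n':N. n \<oplus> c \<odot> u = n' \<oplus> c \<odot> u)" using that by blast
  show "c' = c" if "c' \<in> carrier K \<and> (EX n':N. n \<oplus> c \<odot> u = n' \<oplus> c' \<odot> u)" for c'
  proof -
   from that obtain n' where "c' \<in> carrier K" "n' \<in> N" "n \<oplus> c \<odot> u = n' \<oplus> c' \<odot> u" by blast
   then show ?thesis using uniq[of c' c n' n] \<open>n \<in> N\<close> \<open>c \<in> carrier K\<close> by simp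
  qed
 qed
 have "lin K M (ground_alg K) l"
 proof (rule linI)
  fix x assume "x \<in> carrier M"
  then obtain c n where x: "c \<in> carrier K" "n \<in> N" "x = n \<oplus> c \<odot> u" using ex by blast
  show "l x \<in> carrier (ground_alg K)" using x l by simp
  { fix y assume "y \<in> carrier M"
   then obtain c' n' where y: "c' \<in> carrier K" "n' \<in> N" "y = n' \<oplus> c' \<odot> u" using ex by blast
   have "x \<oplus> y = (n \<oplus> n') \<oplus> (c \<oplus>\<^bsub>K\<^esub> c') \<odot> u" using x y NM u by (simp add: M.smult_l_distr M.a_ac)
   then show "l (x \<oplus> y) = l x \<oplus>\<^bsub>ground_alg K\<^esub> l y" using l x y Na by simp }
  fix a assume a: "a \<in> carrier K"
  have "a \<odot> x = a \<odot> n \<oplus> (a \<otimes>\<^bsub>K\<^esub> c) \<odot> u" using x NM u a by (simp add: M.smult_r_distr M.smult_assoc1)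
  then show "l (a \<odot> x) = a \<odot>\<^bsub>ground_alg K\<^esub> l x" using l x Nsm a by simp
 qed
 moreover have "l u = \<one>\<^bsub>K\<^esub>" using l[OF N0, of "\<one>\<^bsub>K\<^esub>"] u by simp
 ultimately show ?thesis using K.one_not_zero by metis
qed

section \<open>Separating the points of a tensor product\<close>

text \<open>Finite sums of rank one maps x \<mapsto> l(x) e with \<open>l\<close> taken from a
  prescribed set \<open>L\<close>. The set matters: for spaces of operators the functionals used
  below are matrix coefficients. The rule \<open>cong\<close> makes the predicate depend on values
  on the carrier only.\<close>

inductive fin_rank :: "'k ring => ('k, 'v) module => ('v => 'k) set => ('v => 'v) => bool"
 for K :: "'k ring" and M :: "('k, 'v) module" and L :: "('v => 'k) set"
 where
  zero: "fin_rank K M L (%x. \<zero>\<^bsub>M\<^esub>)"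
 | add: "fin_rank K M L P ==> l \<in> L ==> e \<in> carrier M ==> fin_rank K M L (%x. P x \<oplus>\<^bsub>M\<^esub> l x \<odot>\<^bsub>M\<^esub> e)"
 | cong: "fin_rank K M L P ==> (!!x. x \<in> carrier M ==> P x = Q x) ==> fin_rank K M L Q"

lemma lin_rank_one:
 assumes "module K N" "lin K M (ground_alg K) l" "e \<in> carrier N"
 shows "lin K M N (%x. l x \<odot>\<^bsub>N\<^esub> e)"
proof -
 interpret N: module K N by fact
 show ?thesis using assms(2,3) by (auto simp: lin_def N.smult_l_distr N.smult_assoc1)
qed

context
 fixes K :: "'k ring" and M :: "('k, 'v) module" and L :: "('v => 'k) set"
 assumes M: "module K M" and L: "!!l. l \<in> L ==> lin K M (ground_alg K) l"
begin

interpretation M: module K M by (fact M)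

lemma fin_rank_lin: "fin_rank K M L P ==> lin K M M P"
proof (induction rule: fin_rank.induct)
 case (cong P Q)
 then show ?case using lin_cong[OF M, of P Q] by blast
qed (auto intro!: lin_zero_map lin_add_map lin_rank_one L M)

lemma fin_rank_comp:
 assumes g: "lin K M M g" shows "fin_rank K M L P ==> fin_rank K M L (%x. g (P x))"
proof (induction rule: fin_rank.induct)
 case zero
 then show ?case using lin_zero[OF M M g] fin_rank.zero by simp
next
 case (add P l e)
 show ?case
 proof (rule fin_rank.cong[OF fin_rank.add[OF add.IH add.hyps(2) lin_closed[OF g add.hyps(3)]]])
  fix x assume x: "x \<in> carrier M"
  have "l x \<in> carrier K" using lin_closed[OF L[OF add.hyps(2)] x] by simp
  then show "g (P x) \<oplus>\<^bsub>M\<^esub> l x \<odot>\<^bsub>M\<^esub> g e = g (P x \<oplus>\<^bsub>M\<^esub> l x \<odot>\<^bsub>M\<^esub> e)"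
   using lin_closed[OF fin_rank_lin[OF add.hyps(1)] x] add.hyps(3) by (simp add: lin_add[OF g] lin_smult[OF g])
 qed
qed (simp add: fin_rank.cong)

lemma fin_rank_add: 
 assumes P: "fin_rank K M L P" shows "fin_rank K M L Q ==> fin_rank K M L (%x. P x \<oplus>\<^bsub>M\<^esub> Q x)"
proof (induction rule: fin_rank.induct)
 case zero
 show ?case by (rule fin_rank.cong[OF P]) (simp add: lin_closed[OF fin_rank_lin[OF P]])
next
 case (add Q l e)
 show ?case
 proof (rule fin_rank.cong[OF fin_rank.add[OF add.IH add.hyps(2,3)]])
  fix x assume x: "x \<in> carrier M"
  have "l x \<in> carrier K" using lin_closed[OF L[OF add.hyps(2)] x] by simp
  then show "P x \<oplus>\<^bsub>M\<^esub> Q x \<oplus>\<^bsub>M\<^esub> l x \<odot>\<^bsub>M\<^esub> e = P x \<oplus>\<^bsub>M\<^esub> (Q x \<oplus>\<^bsub>M\<^esub> l x \<odot>\<^bsub>M\<^esub> e)"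
   using lin_closed[OF fin_rank_lin[OF add.hyps(1)] x] lin_closed[OF fin_rank_lin[OF P] x] add.hyps(3)
   by (simp add: M.a_assoc)
 qed
qed (auto intro: fin_rank.cong)

text \<open>A substitute for the projection onto a finite-dimensional subspace. The vectors are
  added one by one, and a rank one correction repairs the map at the new vector without disturbing
  the old ones.\<close>

lemma fin_rank_fix:
 assumes K: "field K" and sep: "!!x. x \<in> carrier M ==> x ~= \<zero>\<^bsub>M\<^esub> ==> EX l:L. l x ~= \<zero>\<^bsub>K\<^esub>"
  and S: "finite S" "S <= carrier M"
 shows "\<exists>P. fin_rank K M L P \<and> (ALL s:S. P s = s)"
 using S
proof (induction S rule: finite_induct)
 case empty
 show ?case by (auto intro: fin_rank.zero)
next
 case (insert s S)
 interpret K: field K by fact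
 obtain P where P: "fin_rank K M L P" "ALL s:S. P s = s" using insert by auto
 note Pl = fin_rank_lin[OF P(1)]
 have s: "s \<in> carrier M" "P s \<in> carrier M" using insert lin_closed[OF Pl] by auto
 show ?case
 proof (cases "P s = s")
  case True
  then show ?thesis using P by auto
 next
  case False
  define u where "u = s \<ominus>\<^bsub>M\<^esub> P s"
  have u: "u \<in> carrier M" "u ~= \<zero>\<^bsub>M\<^esub>" using s False by (auto simp: u_def M.minus_eq M.add.inv_solve_right')
  then obtain l where l: "l \<in> L" "l u ~= \<zero>\<^bsub>K\<^esub>" using sep by blast
  note ll = L[OF l(1)]
  have lu: "l u \<in> carrier K" using lin_closed[OF ll u(1)] by simp
  have iu: "inv\<^bsub>K\<^esub> (l u) \<in> carrier K" "inv\<^bsub>K\<^esub> (l u) \<otimes>\<^bsub>K\<^esub> l u = \<one>\<^bsub>K\<^esub>" using K.field_Units l(2) lu by auto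
  define e where "e = inv\<^bsub>K\<^esub> (l u) \<odot>\<^bsub>M\<^esub> u"
  have e: "e \<in> carrier M" "l u \<odot>\<^bsub>M\<^esub> e = u" using u iu lu by (auto simp: e_def M.R.m_comm simp flip: M.smult_assoc1)
  define g where "g x = (\<ominus>\<^bsub>K\<^esub> \<one>\<^bsub>K\<^esub>) \<odot>\<^bsub>M\<^esub> (l x \<odot>\<^bsub>M\<^esub> e)" for x
  have g: "lin K M M g" unfolding g_def by (intro lin_smult_map M lin_rank_one ll e) auto
  \<comment> \<open>Since \<open>g y\<close> is minus \<open>l y\<close> times \<open>e\<close>,
    this is P x + l(x - P x) e. The correction vanishes wherever \<open>P\<close> already fixes
    \<open>x\<close>; at \<open>s\<close> it equals l(u) e = u, which is exactly what is
    missing.\<close>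
  define Q where "Q x = (P x \<oplus>\<^bsub>M\<^esub> l x \<odot>\<^bsub>M\<^esub> e) \<oplus>\<^bsub>M\<^esub> g (P x)" for x
  have Q: "fin_rank K M L Q" unfolding Q_def by (rule fin_rank_add[OF fin_rank.add[OF P(1) l(1) e(1)] fin_rank_comp[OF g P(1)]])
  have gx: "g x = \<ominus>\<^bsub>M\<^esub> (l x \<odot>\<^bsub>M\<^esub> e)" if "x \<in> carrier M" for x
   using lin_closed[OF ll that] e by (simp add: g_def M.smult_l_minus)
  have "Q t = t" if t: "t \<in> S" for t
  proof -
   have "t \<in> carrier M" "P t = t" using insert.prems t P(2) by auto
   then show ?thesis using lin_closed[OF ll, of t] e by (simp add: Q_def gx M.a_assoc M.r_neg)
  qed
  moreover have "Q s = s"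
  proof -
   have su: "s = P s \<oplus>\<^bsub>M\<^esub> u" using s by (simp add: u_def M.minus_eq M.a_lcomm M.r_neg)
   have "l s = l (P s) \<oplus>\<^bsub>K\<^esub> l u" using lin_add[OF ll s(2) u(1)] su by simp
   then have "l s \<odot>\<^bsub>M\<^esub> e = l (P s) \<odot>\<^bsub>M\<^esub> e \<oplus>\<^bsub>M\<^esub> u" using lin_closed[OF ll s(2)] lu e by (simp add: M.smult_l_distr)
   then have "Q s = P s \<oplus>\<^bsub>M\<^esub> u" using lin_closed[OF ll s(2)] e s u by (simp add: Q_def gx M.a_ac M.r_neg)
   then show ?thesis using su by simp
  qed
  ultimately show ?thesis using Q by auto
 qed
qed

end

context tensor_prod
begin

interpretation TT: two_tensor_prods K I M M ..

lemma tmap_slot_end_lin: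
 assumes i: "i \<in> I" and f: "!!j. j \<in> I ==> j ~= i ==> lin K (M j) (M j) (f j)" and z: "z \<in> carrier T"
 shows "lin K (end_alg K (M i)) T (%q. tmap K I M M (f(i := q)) z)"
proof (rule TT.tmap_slot_lin[OF _ i f _ _ z])
 interpret Mi: module K "M i" using M[OF i] .
 show "module K (end_alg K (M i))" using unital_algebra_end[OF M[OF i]] by (rule unital_algebra.axioms)
 show "lin K (M i) (M i) q" if "q \<in> carrier (end_alg K (M i))" for q using that by (simp add: linear_maps_lin)
 show "lin K (end_alg K (M i)) (M i) (%q. q x)" if "x \<in> carrier (M i)" for x using that by (auto simp: lin_def linear_maps_def)
qed

text \<open>Finite rank maps need not be extensional, so they enter the endomorphism algebra only
  after restriction.\<close>

lemma tmap_restrict_slot: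
 assumes i: "i \<in> I" and f: "!!j. j \<in> I ==> j ~= i ==> lin K (M j) (M j) (f j)" and q: "lin K (M i) (M i) q"
 shows "tmap K I M M (f(i := q)) = tmap K I M M (f(i := restrict q (carrier (M i))))"
 using assms M by (intro TT.tmap_cong) auto

text \<open>Multilinear expansion of the finite rank maps into rank one terms. \<open>J\<close>
  holds the slots still to be expanded; when it is empty, all maps have rank one and
  \<open>kill\<close> applies.\<close>

lemma tmap_fin_rank_zero:
 assumes fin: "finite I" and L: "!!i l. i \<in> I ==> l \<in> L i ==> lin K (M i) (ground_alg K) l"
  and z: "z \<in> carrier T"
  and kill: "!!l e. (!!i. i \<in> I ==> l i \<in> L i \<and> e i \<in> carrier (M i)) ==> tmap K I M M (%i x. l i x \<odot>\<^bsub>M i\<^esub> e i) z = \<zero>\<^bsub>T\<^esub>"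
  and P: "!!i. i \<in> I ==> fin_rank K (M i) (L i) (P i)"
 shows "tmap K I M M P z = \<zero>\<^bsub>T\<^esub>"
proof -
 let ?r1 = "%i p. EX l:L i. EX e:carrier (M i). p = (%x. l x \<odot>\<^bsub>M i\<^esub> e)"
 have frl: "lin K (M i) (M i) p" if "i \<in> I" "fin_rank K (M i) (L i) p" for i p
  by (rule fin_rank_lin[OF M[OF that(1)] L[OF that(1)] that(2)])
 have r1l: "lin K (M i) (M i) p" if "i \<in> I" "?r1 i p" for i p using that L M by (auto intro!: lin_rank_one)
 have "tmap K I M M P z = \<zero>\<^bsub>T\<^esub>"
  if "finite J" "J <= I" "!!i. i \<in> J ==> fin_rank K (M i) (L i) (P i)" "!!i. i \<in> I - J ==> ?r1 i (P i)"
  for J P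
  using that
 proof (induction J arbitrary: P rule: finite_induct)
  case empty
  then have "ALL i:I. \<exists>l e. l \<in> L i \<and> e \<in> carrier (M i) \<and> P i = (%x. l x \<odot>\<^bsub>M i\<^esub> e)" unfolding Bex_def by simp
  then obtain l e where le: "!!i. i \<in> I ==> l i \<in> L i \<and> e i \<in> carrier (M i) \<and> P i = (%x. l i x \<odot>\<^bsub>M i\<^esub> e i)" by metis
  have "tmap K I M M P = tmap K I M M (%i x. l i x \<odot>\<^bsub>M i\<^esub> e i)"
  proof (rule TT.tmap_cong)
   show "lin K (M i) (M i) (P i)" if "i \<in> I" for i using r1l[OF that, of "P i"] le[OF that] by blast
   then show "lin K (M i) (M i) (%x. l i x \<odot>\<^bsub>M i\<^esub> e i)" if "i \<in> I" for i using le[OF that] that by metis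
  qed (use le in simp)
  then show ?case using kill[of l e] le by simp
 next
  case (insert i J)
  have i: "i \<in> I" using insert by auto
  have Pj: "lin K (M j) (M j) (P j)" if "j \<in> I" "j ~= i" for j
   using that insert.prems(2)[of j] insert.prems(3)[of j] frl[OF that(1)] r1l[OF that(1)]
   by (cases "j \<in> J") auto
  have sl: "lin K (end_alg K (M i)) T (%q. tmap K I M M (P(i := q)) z)" by (rule tmap_slot_end_lin[OF i _ z]) (rule Pj)
  interpret E: unital_algebra K "end_alg K (M i)" by (rule unital_algebra_end[OF M[OF i]])
  have rs: "tmap K I M M (P(i := q)) = tmap K I M M (P(i := restrict q (carrier (M i))))" if "lin K (M i) (M i) q" for q
   by (rule tmap_restrict_slot[OF i _ that]) (rule Pj)
  note ml = restrict_linear_maps[OF M[OF i]]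
  \<comment> \<open>Inner induction over the finite rank map in slot \<open>i\<close>; each rank one
    summand leaves only \<open>J\<close> to expand.\<close>
  have "tmap K I M M (P(i := p)) z = \<zero>\<^bsub>T\<^esub>" if "fin_rank K (M i) (L i) p" for p using that
  proof (induction rule: fin_rank.induct)
   case zero
   show ?case using lin_zero[OF E.module_axioms tensor_module sl] by (subst rs) (auto intro: lin_zero_map M i)
  next
   case (add p l e)
   have pl: "lin K (M i) (M i) p" using frl[OF i add.hyps(1)] .
   have el: "lin K (M i) (M i) (%x. l x \<odot>\<^bsub>M i\<^esub> e)" using r1l[OF i] add.hyps by blast
   have "tmap K I M M (P(i := %x. l x \<odot>\<^bsub>M i\<^esub> e)) z = \<zero>\<^bsub>T\<^esub>"
   proof (rule insert.IH)
    show "fin_rank K (M j) (L j) ((P(i := %x. l x \<odot>\<^bsub>M i\<^esub> e)) j)" if "j \<in> J" for j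
     using insert.prems(2)[of j] insert.hyps(2) that by auto
    show "?r1 j ((P(i := %x. l x \<odot>\<^bsub>M i\<^esub> e)) j)" if "j \<in> I - J" for j
    proof (cases "j = i")
     case True
     then show ?thesis using add.hyps(2,3) by auto
    next
     case False
     then show ?thesis using insert.prems(3)[of j] that by auto
    qed
   qed (use insert.prems in auto)
   moreover have "tmap K I M M (P(i := %x. p x \<oplus>\<^bsub>M i\<^esub> l x \<odot>\<^bsub>M i\<^esub> e)) z =
     tmap K I M M (P(i := p)) z \<oplus>\<^bsub>T\<^esub> tmap K I M M (P(i := %x. l x \<odot>\<^bsub>M i\<^esub> e)) z"
   proof -
    have "restrict (%x. p x \<oplus>\<^bsub>M i\<^esub> l x \<odot>\<^bsub>M i\<^esub> e) (carrier (M i)) =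
      restrict p (carrier (M i)) \<oplus>\<^bsub>end_alg K (M i)\<^esub> restrict (%x. l x \<odot>\<^bsub>M i\<^esub> e) (carrier (M i))"
     by (auto simp: fun_eq_iff restrict_def)
    then show ?thesis using lin_add[OF sl, of "restrict p (carrier (M i))" "restrict (%x. l x \<odot>\<^bsub>M i\<^esub> e) (carrier (M i))"]
      ml[OF pl] ml[OF el] rs[OF pl] rs[OF el] rs[OF lin_add_map[OF M[OF i] pl el]] by simp
   qed
   ultimately show ?case using add.IH T.l_zero[OF T.zero_closed] by (simp only:)
  next
   case (cong p q)
   have "lin K (M i) (M i) p" "lin K (M i) (M i) q" using frl[OF i] fin_rank.cong[OF cong.hyps(1,2)] cong.hyps(1) by auto
   then have "tmap K I M M (P(i := p)) = tmap K I M M (P(i := q))" using cong.hyps(2) Pj by (intro TT.tmap_cong) auto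
   then show ?case using cong.IH by (simp only:)
  qed
  from this[of "P i"] show ?case using insert.prems by simp
 qed
 from this[OF fin order_refl P] show ?thesis by simp
qed

text \<open>A tensor is a combination of pure tensors and so involves finitely many vectors in each
  slot; maps fixing these fix the tensor.\<close>

lemma tmap_fix_finite:
 assumes z: "z \<in> carrier T"
 shows "\<exists>S. (\<forall>i. finite (S i) \<and> (i \<in> I --> S i <= carrier (M i))) \<and>
  (\<forall>P. (ALL i:I. lin K (M i) (M i) (P i) \<and> (ALL s:S i. P i s = s)) --> tmap K I M M P z = z)"
  (is "\<exists>S. ?fin S \<and> ?fix S z")
 using tensor_module spans_pure z
proof (induction rule: spans_induct)
 case zero
 show ?case by (rule exI[of _ "%_. {}"]) (auto intro!: lin_zero[OF tensor_module tensor_module] TT.tmap_lin)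
next
 case (gen z)
 then obtain x where x: "x \<in> X" "z = pure K I M x" by blast
 have xM: "!!i. i \<in> I ==> x i \<in> carrier (M i)" using x(1) by (rule PiE_mem)
 show ?case
 proof (intro exI[of _ "%i. {x i}"] conjI allI impI)
  fix P assume P: "ALL i:I. lin K (M i) (M i) (P i) \<and> (ALL s:{x i}. P i s = s)"
  have "tmap K I M M P z = pure K I M (%i. P i (x i))" unfolding x(2) by (rule TT.tmap_pure) (use P xM in auto)
  also have "... = z" unfolding x(2) by (rule pure_cong) (use P in auto)
  finally show "tmap K I M M P z = z" .
 qed (use xM in auto)
next
 case (add y z)
 then obtain S S' where S: "?fin S" "?fix S y" and S': "?fin S'" "?fix S' z" by (elim exE conjE)
 show ?case
 proof (intro exI[of _ "%i. S i \<union> S' i"] conjI allI impI)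
  fix P assume P: "ALL i:I. lin K (M i) (M i) (P i) \<and> (ALL s:S i \<union> S' i. P i s = s)"
  then have "tmap K I M M P y = y" "tmap K I M M P z = z" using S(2) S'(2) by auto
  then show "tmap K I M M P (y \<oplus>\<^bsub>T\<^esub> z) = y \<oplus>\<^bsub>T\<^esub> z" using P lin_add[OF TT.tmap_lin add.hyps(1,2), of P] by simp
 qed (use S(1) S'(1) in auto)
next
 case (smult c z)
 then obtain S where S: "?fin S" "?fix S z" by (elim exE conjE)
 show ?case
 proof (intro exI[of _ S] conjI allI impI)
  fix P assume P: "ALL i:I. lin K (M i) (M i) (P i) \<and> (ALL s:S i. P i s = s)"
  then have "tmap K I M M P z = z" using S(2) by auto
  then show "tmap K I M M P (c \<odot>\<^bsub>T\<^esub> z) = c \<odot>\<^bsub>T\<^esub> z" using P lin_smult[OF TT.tmap_lin smult.hyps(1,2), of P] by simp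
 qed (use S(1) in auto)
qed

text \<open>Fix \<open>z\<close> by a tensor product of finite rank maps, then expand that product:
  every rank one term sends \<open>z\<close> to zero, so \<open>z\<close> is zero. The vectors
  \<open>e i\<close> keep the whole argument inside the one space \<open>T\<close>.\<close>

theorem tensor_separated:
 assumes "field K" "finite I" and L: "!!i l. i \<in> I ==> l \<in> L i ==> lin K (M i) (ground_alg K) l"
  and sep: "!!i x. i \<in> I ==> x \<in> carrier (M i) ==> x ~= \<zero>\<^bsub>M i\<^esub> ==> EX l:L i. l x ~= \<zero>\<^bsub>K\<^esub>"
  and z: "z \<in> carrier T"
  and kill: "!!l e. (!!i. i \<in> I ==> l i \<in> L i \<and> e i \<in> carrier (M i)) ==> tmap K I M M (%i x. l i x \<odot>\<^bsub>M i\<^esub> e i) z = \<zero>\<^bsub>T\<^esub>"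
 shows "z = \<zero>\<^bsub>T\<^esub>"
proof -
 from tmap_fix_finite[OF z] obtain S where
  S': "\<forall>i. finite (S i) \<and> (i \<in> I --> S i <= carrier (M i))" and
  fx: "\<forall>P. (ALL i:I. lin K (M i) (M i) (P i) \<and> (ALL s:S i. P i s = s)) --> tmap K I M M P z = z"
  by (elim exE conjE)
 have S: "!!i. finite (S i)" "!!i. i \<in> I ==> S i <= carrier (M i)" using S' by auto
 have "ALL i:I. \<exists>P. fin_rank K (M i) (L i) P \<and> (ALL s:S i. P s = s)" using fin_rank_fix[OF M L assms(1) sep S(1) S(2)] by blast
 then obtain P where P: "!!i. i \<in> I ==> fin_rank K (M i) (L i) (P i) \<and> (ALL s:S i. P i s = s)" by metis
 have "tmap K I M M P z = z" using P fin_rank_lin[OF M L] by (intro fx[rule_format]) blast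
 moreover have "tmap K I M M P z = \<zero>\<^bsub>T\<^esub>" by (rule tmap_fin_rank_zero[OF assms(2) L z kill]) (use P in auto)
 ultimately show ?thesis by simp
qed

end

section \<open>Tensor products of algebras\<close>

lemma module_cong:
 fixes M N :: "('k, 'a) module"
 assumes "module K M" "carrier N = carrier M" "ring.add N = ring.add M" "ring.zero N = ring.zero M" "smult N = smult M"
 shows "module K N"
 using assms
 unfolding module_def abelian_group_def abelian_monoid_def abelian_group_axioms_def module_axioms_def
 by simp

lemma tensor_alg_simps [simp]:
 "carrier (tensor_alg K I A) = carrier (tensor K I A)"
 "ring.add (tensor_alg K I A) = ring.add (tensor K I A)"
 "\<zero>\<^bsub>tensor_alg K I A\<^esub> = \<zero>\<^bsub>tensor K I A\<^esub>"
 "smult (tensor_alg K I A) = smult (tensor K I A)"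
 "\<one>\<^bsub>tensor_alg K I A\<^esub> = pure K I A (%i. \<one>\<^bsub>A i\<^esub>)"
 by (simp_all add: tensor_alg_def)

lemma lin_tensor_alg [simp]:
 "lin K (tensor_alg K I A) N f \<longleftrightarrow> lin K (tensor K I A) N f"
 "lin K M (tensor_alg K I A) g \<longleftrightarrow> lin K M (tensor K I A) g"
 by (simp_all add: lin_def)

lemma cring_one_closed:
 assumes "cring K" shows "\<one>\<^bsub>K\<^esub> \<in> carrier K" "\<ominus>\<^bsub>K\<^esub> \<one>\<^bsub>K\<^esub> \<in> carrier K"
proof -
 interpret K: cring K by fact
 show "\<one>\<^bsub>K\<^esub> \<in> carrier K" "\<ominus>\<^bsub>K\<^esub> \<one>\<^bsub>K\<^esub> \<in> carrier K" by simp_all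
qed

lemma unital_algebra_mult_lin:
 assumes "unital_algebra K A" "a \<in> carrier A"
 shows "lin K A A (%x. a \<otimes>\<^bsub>A\<^esub> x)" and "lin K A A (%x. x \<otimes>\<^bsub>A\<^esub> a)"
proof -
 interpret A: unital_algebra K A by fact
 show "lin K A A (%x. a \<otimes>\<^bsub>A\<^esub> x)" "lin K A A (%x. x \<otimes>\<^bsub>A\<^esub> a)"
  using assms(2) by (auto simp: lin_def A.l_distr A.r_distr A.smult_mult_left A.smult_mult_right)
qed

locale tensor_algs =
 fixes K :: "'k ring" and I :: "'i set" and A :: "'i => ('k, 'a) module"
 assumes K_cring: "cring K" and A: "!!i. i \<in> I ==> unital_algebra K (A i)"
begin

sublocale two_tensor_prods K I A A by (intro two_tensor_prods.intro tensor_prod.intro K_cring unital_algebra.axioms(1)[OF A])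

abbreviation (input) "TA \<equiv> tensor_alg K I A"

lemma A_ring: "i \<in> I ==> ring (A i)" using unital_algebra.axioms(2)[OF A] .

lemma tensor_alg_module: "module K TA" by (rule module_cong[OF M.tensor_module]) simp_all

lemma one_closed: "\<one>\<^bsub>TA\<^esub> \<in> carrier TA" using A_ring by (auto intro!: M.pure_closed monoid.one_closed[OF ring.axioms(2)])

text \<open>The inner lift in the definition of the product is the tensor product of left
  multiplications, so the facts about \<open>tmap\<close> become available.\<close>

lemma mult_eq:
 "Y \<otimes>\<^bsub>TA\<^esub> Z = tensor_lift K I A (tensor K I A) (%x. tmap K I A A (%i v. x i \<otimes>\<^bsub>A i\<^esub> v) Z) Y"
 by (simp add: tensor_alg_def tmap_def)

lemma lmult_lin: "i \<in> I ==> a \<in> carrier (A i) ==> lin K (A i) (A i) (%v. a \<otimes>\<^bsub>A i\<^esub> v)" by (rule unital_algebra_mult_lin(1)[OF A])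

lemma mult_multilin:
 assumes Z: "Z \<in> carrier TA"
 shows "multilin K I A (tensor K I A) (%x. tmap K I A A (%i v. x i \<otimes>\<^bsub>A i\<^esub> v) Z)"
proof (rule multilinI)
 fix x assume "x \<in> (\<Pi>\<^sub>E i\<in>I. carrier (A i))"
 then have x: "!!i. i \<in> I ==> x i \<in> carrier (A i)" by auto
 show "tmap K I A A (%i v. x i \<otimes>\<^bsub>A i\<^esub> v) Z \<in> carrier (tensor K I A)" using Z x lmult_lin by (intro lin_closed[OF tmap_lin]) auto
 fix i assume i: "i \<in> I"
 have "lin K (A i) (tensor K I A) (%u. tmap K I A A ((%i v. x i \<otimes>\<^bsub>A i\<^esub> v)(i := (%v. u \<otimes>\<^bsub>A i\<^esub> v))) Z)"
  by (rule tmap_slot_lin[OF M.M[OF i] i]) (use Z x i lmult_lin unital_algebra_mult_lin(2)[OF A] in auto)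
 moreover have "(%j v. (x(i := u)) j \<otimes>\<^bsub>A j\<^esub> v) = (%i v. x i \<otimes>\<^bsub>A i\<^esub> v)(i := (%v. u \<otimes>\<^bsub>A i\<^esub> v))" for u by auto
 ultimately show "lin K (A i) (tensor K I A) (%u. tmap K I A A (%j v. (x(i := u)) j \<otimes>\<^bsub>A j\<^esub> v) Z)" by simp
qed

lemma mult_lin1: "Z \<in> carrier TA ==> lin K TA TA (%Y. Y \<otimes>\<^bsub>TA\<^esub> Z)"
 unfolding mult_eq using M.tensor_lift_lin[OF M.tensor_module mult_multilin] by simp

lemma mult_closed: "Y \<in> carrier TA ==> Z \<in> carrier TA ==> Y \<otimes>\<^bsub>TA\<^esub> Z \<in> carrier TA" using lin_closed[OF mult_lin1] .

lemma pure_mult: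
 assumes "!!i. i \<in> I ==> x i \<in> carrier (A i)" "Z \<in> carrier TA"
 shows "pure K I A x \<otimes>\<^bsub>TA\<^esub> Z = tmap K I A A (%i v. x i \<otimes>\<^bsub>A i\<^esub> v) Z"
proof -
 have "pure K I A x \<otimes>\<^bsub>TA\<^esub> Z = tmap K I A A (%i v. restrict x I i \<otimes>\<^bsub>A i\<^esub> v) Z"
  unfolding mult_eq by (rule M.tensor_lift_pure[OF M.tensor_module mult_multilin[OF assms(2)] assms(1)])
 also have "tmap K I A A (%i v. restrict x I i \<otimes>\<^bsub>A i\<^esub> v) = tmap K I A A (%i v. x i \<otimes>\<^bsub>A i\<^esub> v)"
  using assms(1) lmult_lin by (intro tmap_cong) auto
 finally show ?thesis .
qed

lemma pure_mult_pure:
 assumes "!!i. i \<in> I ==> x i \<in> carrier (A i)" "!!i. i \<in> I ==> y i \<in> carrier (A i)"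
 shows "pure K I A x \<otimes>\<^bsub>TA\<^esub> pure K I A y = pure K I A (%i. x i \<otimes>\<^bsub>A i\<^esub> y i)"
 using assms lmult_lin by (simp add: pure_mult M.pure_closed tmap_pure)

end

section \<open>Tensor products of operator algebras\<close>

lemma lin_into_end:
 assumes "module K N" "module K Q" "!!q. q \<in> carrier Q ==> f q \<in> linear_maps K N N"
  and "!!x. x \<in> carrier N ==> lin K Q N (%q. f q x)"
 shows "lin K Q (end_alg K N) f"
proof -
 interpret N: module K N by fact
 interpret Q: module K Q by fact
 interpret E: unital_algebra K "end_alg K N" by (rule unital_algebra_end) fact
 show ?thesis
 proof (rule linI)
  fix q assume q: "q \<in> carrier Q"
  then show "f q \<in> carrier (end_alg K N)" using assms(3) by simp
  { fix r assume r: "r \<in> carrier Q"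
   show "f (q \<oplus>\<^bsub>Q\<^esub> r) = f q \<oplus>\<^bsub>end_alg K N\<^esub> f r"
   proof (rule linear_maps_ext)
    show "f q \<oplus>\<^bsub>end_alg K N\<^esub> f r \<in> linear_maps K N N" using E.a_closed[of "f q" "f r"] assms(3) q r by simp
   qed (use q r assms(3) lin_add[OF assms(4)] in auto) }
  fix c assume c: "c \<in> carrier K"
  show "f (c \<odot>\<^bsub>Q\<^esub> q) = c \<odot>\<^bsub>end_alg K N\<^esub> f q"
  proof (rule linear_maps_ext)
   show "c \<odot>\<^bsub>end_alg K N\<^esub> f q \<in> linear_maps K N N" using E.smult_closed[of c "f q"] assms(3) q c by simp
  qed (use q c assms(3) lin_smult[OF assms(4)] in auto)
 qed
qed

lemma end_eval_lin: "module K N ==> x \<in> carrier N ==> lin K (end_alg K N) N (%f. f x)" by (auto simp: lin_def linear_maps_def)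

text \<open>The factors are algebras of operators on spaces \<open>U i\<close>. Their tensor product
  exists twice: abstractly, as \<open>TC\<close>, and as operators on the tensor product of the
  \<open>U i\<close>.\<close>

locale op_tensor =
 fixes K :: "'k ring" and I :: "'i set" and U :: "'i => ('k, 'u) module" and C :: "'i => ('u => 'u) set"
 assumes field: "field K" and fin: "finite I" and U: "!!i. i \<in> I ==> module K (U i)"
  and C_subsp: "!!i. i \<in> I ==> subsp K (end_alg K (U i)) (C i)"
  and C_one: "!!i. i \<in> I ==> \<one>\<^bsub>end_alg K (U i)\<^esub> \<in> C i"
  and C_mult: "!!i f g. i \<in> I ==> f \<in> C i ==> g \<in> C i ==> f \<otimes>\<^bsub>end_alg K (U i)\<^esub> g \<in> C i"
begin

abbreviation (input) "CA \<equiv> %i. (end_alg K (U i))\<lparr>carrier := C i\<rparr>"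
abbreviation (input) "TU \<equiv> tensor K I U"
abbreviation (input) "TC \<equiv> tensor_alg K I CA"

lemma K_cring: "cring K" by (rule cring.intro) (use field in \<open>auto simp: field_def domain_def cring_def\<close>)

sublocale CA: tensor_algs K I CA
 by (intro tensor_algs.intro K_cring unital_algebra_carrier_update unital_algebra_end U C_subsp C_one C_mult)

sublocale U: two_tensor_prods K I U U by (intro two_tensor_prods.intro tensor_prod.intro K_cring U)

lemma C_lin: "i \<in> I ==> f \<in> C i ==> lin K (U i) (U i) f" using C_subsp[of i] by (auto simp: subsp_def linear_maps_lin)

lemma C_lin_maps: "i \<in> I ==> f \<in> C i ==> f \<in> linear_maps K (U i) (U i)" using C_subsp[of i] by (auto simp: subsp_def)

lemma end_TU_module: "module K (end_alg K TU)" using unital_algebra_end[OF U.M.tensor_module] by (rule unital_algebra.axioms)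

lemma C_eval_lin: "i \<in> I ==> x \<in> carrier (U i) ==> lin K (CA i) (U i) (%f. f x)"
 using lin_closed[OF C_lin] by (auto simp: lin_def)

text \<open>The comparison map from the abstract tensor product of operator algebras to operators on
  the tensor product of the spaces.\<close>

definition psi :: "(('i => 'u => 'u) => 'k) set => ('i, 'u, 'k) tens => ('i, 'u, 'k) tens"
 where "psi = tensor_lift K I CA (end_alg K TU) (%f. tmap K I U U f)"

lemma psi_multilin: "multilin K I CA (end_alg K TU) (%f. tmap K I U U f)"
proof (rule multilinI)
 fix f assume "f \<in> (\<Pi>\<^sub>E i\<in>I. carrier (CA i))"
 then have f: "!!i. i \<in> I ==> f i \<in> C i" by auto
 then show "tmap K I U U f \<in> carrier (end_alg K TU)" using C_lin by (auto intro!: U.tmap_linear_maps)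
 fix i assume i: "i \<in> I"
 show "lin K (CA i) (end_alg K TU) (%u. tmap K I U U (f(i := u)))"
 proof (rule lin_into_end[OF U.M.tensor_module CA.M.M[OF i]])
  show "tmap K I U U (f(i := q)) \<in> linear_maps K TU TU" if "q \<in> carrier (CA i)" for q
   using that f i C_lin by (intro U.tmap_linear_maps) auto
  fix z assume "z \<in> carrier TU"
  then show "lin K (CA i) TU (%q. tmap K I U U (f(i := q)) z)"
   using f i C_lin C_eval_lin by (intro U.tmap_slot_lin[OF CA.M.M[OF i] i]) auto
 qed
qed

lemma psi_lin: "lin K TC (end_alg K TU) psi" unfolding psi_def using CA.M.tensor_lift_lin[OF end_TU_module psi_multilin] by simp

lemma psi_closed: "z \<in> carrier TC ==> psi z \<in> linear_maps K TU TU" using lin_closed[OF psi_lin] by simp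

lemma psi_apply_lin: "z \<in> carrier TC ==> lin K TU TU (psi z)" using psi_closed by (rule linear_maps_lin)

lemma psi_pure:
 assumes "!!i. i \<in> I ==> f i \<in> C i" shows "psi (pure K I CA f) = tmap K I U U f"
proof -
 have "psi (pure K I CA f) = tmap K I U U (restrict f I)"
  unfolding psi_def by (rule CA.M.tensor_lift_pure[OF end_TU_module psi_multilin]) (use assms in simp)
 also have "... = tmap K I U U f" using assms C_lin by (intro U.tmap_cong) auto
 finally show ?thesis .
qed

lemma psi_one: "psi \<one>\<^bsub>TC\<^esub> = \<one>\<^bsub>end_alg K TU\<^esub>"
proof (rule linear_maps_ext[of _ K TU TU])
 show "psi \<one>\<^bsub>TC\<^esub> \<in> linear_maps K TU TU" by (rule psi_closed[OF CA.one_closed])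
 show "\<one>\<^bsub>end_alg K TU\<^esub> \<in> linear_maps K TU TU"
  using monoid.one_closed[OF ring.axioms(2)[OF unital_algebra.axioms(2)[OF unital_algebra_end[OF U.M.tensor_module]]]]
  by simp
 fix z assume z: "z \<in> carrier TU"
 have "psi \<one>\<^bsub>TC\<^esub> = tmap K I U U (%i. \<one>\<^bsub>CA i\<^esub>)" unfolding tensor_alg_simps by (rule psi_pure) (use C_one in simp)
 then show "psi \<one>\<^bsub>TC\<^esub> z = \<one>\<^bsub>end_alg K TU\<^esub> z" using z tmap_id[OF U.M.tensor_prod_axioms, of "%i. \<one>\<^bsub>CA i\<^esub>" z] by simp
qed

text \<open>Both sides are linear in \<open>y\<close> and in \<open>z\<close>; for pure tensors the
  claim is that tensor products of maps compose factorwise.\<close>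

lemma psi_mult:
 assumes "y \<in> carrier TC" "z \<in> carrier TC"
 shows "psi (y \<otimes>\<^bsub>TC\<^esub> z) = psi y \<otimes>\<^bsub>end_alg K TU\<^esub> psi z"
proof -
 let ?E = "end_alg K TU"
 interpret E: unital_algebra K ?E by (rule unital_algebra_end[OF U.M.tensor_module])
 have mul: "lin K ?E ?E (%x. a \<otimes>\<^bsub>?E\<^esub> x)" "lin K ?E ?E (%x. x \<otimes>\<^bsub>?E\<^esub> a)" if "a \<in> carrier ?E" for a
  using unital_algebra_mult_lin[OF E.unital_algebra_axioms that] by auto
 have psic: "psi x \<in> carrier ?E" if "x \<in> carrier TC" for x using psi_closed[OF that] by simp
 have pl: "lin K (tensor K I CA) ?E psi" using psi_lin by simp
 show ?thesis
 proof (rule CA.M.tensor_lin_eq[OF E.module_axioms _ lin_comp[OF pl mul(2)[OF psic[OF assms(2)]]]])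
  show "lin K (tensor K I CA) ?E (%y. psi (y \<otimes>\<^bsub>TC\<^esub> z))" using lin_comp[OF CA.mult_lin1[OF assms(2)] psi_lin] by simp
  show "y \<in> carrier (tensor K I CA)" using assms(1) by simp
  fix f assume "f \<in> (\<Pi>\<^sub>E i\<in>I. carrier (CA i))"
  then have f: "!!i. i \<in> I ==> f i \<in> C i" by auto
  have fl: "lin K (CA i) (CA i) (%v. f i \<otimes>\<^bsub>CA i\<^esub> v)" if "i \<in> I" for i using CA.lmult_lin[OF that, of "f i"] f[OF that] by simp
  have fp: "pure K I CA f \<in> carrier (tensor K I CA)" by (rule CA.M.pure_closed) (use f in simp)
  have "psi (pure K I CA f \<otimes>\<^bsub>TC\<^esub> z) = psi (tmap K I CA CA (%i v. f i \<otimes>\<^bsub>CA i\<^esub> v) z)"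
   using f assms(2) by (subst CA.pure_mult) auto
  also have "... = psi (pure K I CA f) \<otimes>\<^bsub>?E\<^esub> psi z"
  proof (rule CA.M.tensor_lin_eq[OF E.module_axioms lin_comp[OF CA.tmap_lin[OF fl] pl] lin_comp[OF pl mul(1)]])
   show "psi (pure K I CA f) \<in> carrier ?E" using psic fp by simp
   show "z \<in> carrier (tensor K I CA)" using assms(2) by simp
   fix g assume "g \<in> (\<Pi>\<^sub>E i\<in>I. carrier (CA i))"
   then have g: "!!i. i \<in> I ==> g i \<in> C i" by auto
   have fg: "!!i. i \<in> I ==> compose (carrier (U i)) (f i) (g i) \<in> C i" using C_mult f g by simp
   have "tmap K I CA CA (%i v. f i \<otimes>\<^bsub>CA i\<^esub> v) (pure K I CA g) = pure K I CA (%i. compose (carrier (U i)) (f i) (g i))"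
    using g by (subst CA.tmap_pure[OF fl]) auto
   then have "psi (tmap K I CA CA (%i v. f i \<otimes>\<^bsub>CA i\<^esub> v) (pure K I CA g)) =
     tmap K I U U (%i. compose (carrier (U i)) (f i) (g i))"
    using psi_pure[of "%i. compose (carrier (U i)) (f i) (g i)"] fg by simp
   also have "... = compose (carrier TU) (tmap K I U U f) (tmap K I U U g)"
   proof (rule linear_maps_ext[of _ K TU TU])
    show "tmap K I U U (%i. compose (carrier (U i)) (f i) (g i)) \<in> linear_maps K TU TU"
     using fg C_lin by (intro U.tmap_linear_maps) auto
    show "compose (carrier TU) (tmap K I U U f) (tmap K I U U g) \<in> linear_maps K TU TU"
     using f g C_lin by (intro compose_linear_maps[of K TU _ TU] U.M.tensor_module U.tmap_linear_maps) auto
    fix w assume w: "w \<in> carrier TU"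
    have "tmap K I U U f (tmap K I U U g w) = tmap K I U U (%i x. f i (g i x)) w"
     using f g C_lin w by (intro tmap_comp U.two_tensor_prods_axioms) auto
    also have "tmap K I U U (%i x. f i (g i x)) = tmap K I U U (%i. compose (carrier (U i)) (f i) (g i))"
     by (rule U.tmap_cong) (use lin_comp[OF C_lin C_lin, OF _ g _ f] C_lin fg in \<open>auto simp: compose_eq\<close>)
    finally show "tmap K I U U (%i. compose (carrier (U i)) (f i) (g i)) w =
      compose (carrier TU) (tmap K I U U f) (tmap K I U U g) w"
     using w by (simp add: compose_eq)
   qed
   also have "... = psi (pure K I CA f) \<otimes>\<^bsub>?E\<^esub> psi (pure K I CA g)" using psi_pure f g by simp
   finally show "psi (tmap K I CA CA (%i v. f i \<otimes>\<^bsub>CA i\<^esub> v) (pure K I CA g)) = psi (pure K I CA f) \<otimes>\<^bsub>?E\<^esub> psi (pure K I CA g)" .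
  qed
  finally show "psi (pure K I CA f \<otimes>\<^bsub>TC\<^esub> z) = psi (pure K I CA f) \<otimes>\<^bsub>?E\<^esub> psi z" .
 qed
qed

text \<open>Apply \<open>tensor_separated\<close> to the operator spaces, with the matrix
  coefficients f \<mapsto> l(f u) as functionals. They separate operators because a nonzero operator
  has a nonzero value and a functional detects it.\<close>

lemma psi_ker:
 assumes z: "z \<in> carrier TC" and "psi z = \<zero>\<^bsub>end_alg K TU\<^esub>"
 shows "z = \<zero>\<^bsub>TC\<^esub>"
proof -
 let ?L = "%i. {%f. l (f u) | l u. lin K (U i) (ground_alg K) l \<and> u \<in> carrier (U i)}"
 interpret UC: two_tensor_prods K I U CA ..
 have z': "z \<in> carrier (tensor K I CA)" using z by simp
 have "z = \<zero>\<^bsub>tensor K I CA\<^esub>"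
 proof (rule CA.M.tensor_separated[OF field fin _ _ z', where L = ?L])
  show "lin K (CA i) (ground_alg K) l" if "i \<in> I" "l \<in> ?L i" for i l using that lin_comp[OF C_eval_lin[OF that(1)]] by blast
 next
  fix i f assume i: "i \<in> I" and f: "f \<in> carrier (CA i)" "f ~= \<zero>\<^bsub>CA i\<^esub>"
  then have fm: "f \<in> linear_maps K (U i) (U i)" using C_lin_maps by simp
  have zm: "\<zero>\<^bsub>CA i\<^esub> \<in> linear_maps K (U i) (U i)" using C_subsp[OF i] unfolding subsp_def by auto
  obtain u where u: "u \<in> carrier (U i)" "f u ~= \<zero>\<^bsub>U i\<^esub>" using linear_maps_ext[OF fm zm] f(2) by auto
  obtain l where "lin K (U i) (ground_alg K) l" "l (f u) ~= \<zero>\<^bsub>K\<^esub>"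
   using functional_nonzero[OF field U[OF i] lin_closed[OF linear_maps_lin[OF fm] u(1)] u(2)] by blast
  with u(1) show "EX l:?L i. l f ~= \<zero>\<^bsub>K\<^esub>" by (intro bexI[of _ "%f. l (f u)"]) auto
 next
  fix l' e assume le: "!!i. i \<in> I ==> l' i \<in> ?L i \<and> e i \<in> carrier (CA i)"
  then have "ALL i:I. \<exists>l u. lin K (U i) (ground_alg K) l \<and> u \<in> carrier (U i) \<and> l' i = (%f. l (f u))" by fast
  then obtain l u where lu: "!!i. i \<in> I ==> lin K (U i) (ground_alg K) (l i) \<and> u i \<in> carrier (U i) \<and> l' i = (%f. l i (f (u i)))"
   by metis
  \<comment> \<open>\<open>?r\<close> is \<open>?w\<close> preceded by evaluation at
    \<open>u i\<close>. Hence the tensor product of the \<open>?r i\<close>, applied to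
    \<open>z\<close>, factors through the value of \<open>psi z\<close> at the pure tensor of the
    \<open>u i\<close>, which is zero.\<close>
  let ?r = "%i x. l' i x \<odot>\<^bsub>CA i\<^esub> e i" and ?w = "%i x. l i x \<odot>\<^bsub>CA i\<^esub> e i"
  have ll: "lin K (U i) (ground_alg K) (l i)" "lin K (CA i) (ground_alg K) (l' i)" "e i \<in> carrier (CA i)" if "i \<in> I" for i
   using lu[OF that] le[OF that] lin_comp[OF C_eval_lin[OF that]] by auto
  have r: "lin K (CA i) (CA i) (?r i)" and w: "lin K (U i) (CA i) (?w i)" if "i \<in> I" for i
   using lin_rank_one[OF CA.M.M[OF that] ll(2)[OF that] ll(3)[OF that]]
    lin_rank_one[OF CA.M.M[OF that] ll(1)[OF that] ll(3)[OF that]] .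
  have pu: "pure K I U u \<in> carrier TU" using lu by (intro U.M.pure_closed) auto
  have "tmap K I CA CA ?r z = tmap K I U CA ?w (psi z (pure K I U u))"
  proof (rule CA.M.tensor_lin_eq[OF CA.M.tensor_module CA.tmap_lin[OF r] _ _ z'])
   show "lin K (tensor K I CA) (tensor K I CA) (%z. tmap K I U CA ?w (psi z (pure K I U u)))"
    using psi_lin by (intro lin_comp[OF lin_comp[OF _ end_eval_lin[OF U.M.tensor_module pu]] UC.tmap_lin[OF w]]) simp_all
   fix f assume "f \<in> (\<Pi>\<^sub>E i\<in>I. carrier (CA i))"
   then have f: "!!i. i \<in> I ==> f i \<in> C i" by auto
   have fu: "!!i. i \<in> I ==> f i (u i) \<in> carrier (U i)" using f lu lin_closed[OF C_lin] by blast
   have "tmap K I U CA ?w (psi (pure K I CA f) (pure K I U u)) = tmap K I U CA ?w (pure K I U (%i. f i (u i)))"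
    using f lu C_lin by (simp add: psi_pure U.tmap_pure)
   also have "... = pure K I CA (%i. ?w i (f i (u i)))" using fu w by (intro UC.tmap_pure)
   also have "... = pure K I CA (%i. ?r i (f i))" using lu by (intro CA.M.pure_cong) simp
   also have "... = tmap K I CA CA ?r (pure K I CA f)" using f by (intro CA.tmap_pure[symmetric] r) simp_all
   finally show "tmap K I CA CA ?r (pure K I CA f) = tmap K I U CA ?w (psi (pure K I CA f) (pure K I U u))" by simp
  qed
  also have "psi z (pure K I U u) = \<zero>\<^bsub>TU\<^esub>" using assms(2) pu by simp
  also have "tmap K I U CA ?w \<zero>\<^bsub>TU\<^esub> = \<zero>\<^bsub>tensor K I CA\<^esub>"
   by (rule lin_zero[OF U.M.tensor_module CA.M.tensor_module UC.tmap_lin[OF w]])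
  finally show "tmap K I CA CA ?r z = \<zero>\<^bsub>tensor K I CA\<^esub>" .
 qed
 then show ?thesis by simp
qed

lemma psi_inj: "inj_on psi (carrier TC)"
proof (rule inj_onI)
 fix y z assume yz: "y \<in> carrier TC" "z \<in> carrier TC" "psi y = psi z"
 interpret T: module K TC by (rule CA.tensor_alg_module)
 interpret E: module K "end_alg K TU" by (rule end_TU_module)
 note one = cring_one_closed[OF K_cring]
 let ?m = "(\<ominus>\<^bsub>K\<^esub> \<one>\<^bsub>K\<^esub>) \<odot>\<^bsub>TC\<^esub> z"
 have m: "?m = \<ominus>\<^bsub>TC\<^esub> z" "?m \<in> carrier TC" using yz(2) T.smult_l_minus[OF one(1) yz(2)] T.smult_one[OF yz(2)]
   T.a_inv_closed[OF yz(2)] by simp_all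
 have pz: "psi z \<in> carrier (end_alg K TU)" using psi_closed[OF yz(2)] by simp
 have "psi (y \<oplus>\<^bsub>TC\<^esub> ?m) = psi y \<oplus>\<^bsub>end_alg K TU\<^esub> (\<ominus>\<^bsub>K\<^esub> \<one>\<^bsub>K\<^esub>) \<odot>\<^bsub>end_alg K TU\<^esub> psi z"
  using lin_add[OF psi_lin yz(1) m(2)] lin_smult[OF psi_lin _ yz(2), of "\<ominus>\<^bsub>K\<^esub> \<one>\<^bsub>K\<^esub>"] one(2)
  by (simp only:)
 also have "... = \<zero>\<^bsub>end_alg K TU\<^esub>" using pz E.smult_l_minus[OF one(1) pz] E.smult_one[OF pz] E.r_neg[OF pz] yz(3) by (simp only:)
 finally have "y \<oplus>\<^bsub>TC\<^esub> ?m = \<zero>\<^bsub>TC\<^esub>" using T.a_closed[OF yz(1) m(2)] by (intro psi_ker)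
 then have "y = \<ominus>\<^bsub>TC\<^esub> ?m" using T.minus_equality[OF _ m(2) yz(1)] by simp
 then show "y = z" using m(1) yz(2) by simp
qed

end

section \<open>Groups given by generators and relations\<close>

lemma word_eq_lists:
 "(u, v) \<in> word_eq S R ==> u \<in> lists (S \<times> UNIV) \<and> v \<in> lists (S \<times> UNIV)"
 by (induction rule: word_eq.induct) auto

lemma equiv_word_eq: "equiv (lists (S \<times> UNIV)) (word_eq S R)"
proof (rule equivI)
 show "word_eq S R <= lists (S \<times> UNIV) \<times> lists (S \<times> UNIV)" using word_eq_lists by (fast dest: word_eq_lists)
 show "refl_on (lists (S \<times> UNIV)) (word_eq S R)" by (auto simp: refl_on_def intro: word_eq.refl)
 show "sym (word_eq S R)" by (auto simp: sym_def intro: word_eq.sym)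
 show "trans (word_eq S R)" by (auto simp: trans_def intro: word_eq.trans)
qed

lemma word_eq_context:
 assumes "(u, v) \<in> word_eq S R" "a \<in> lists (S \<times> UNIV)" "b \<in> lists (S \<times> UNIV)"
 shows "(a @ u @ b, a @ v @ b) \<in> word_eq S R"
 using assms
proof (induction rule: word_eq.induct)
 case (refl w)
 then show ?case by (intro word_eq.refl) auto
next
 case (cancel u v x e)
 then show ?case using word_eq.cancel[of "a @ u" S "v @ b" x e R] by simp
next
 case (relation u v l r)
 then show ?case using word_eq.relation[of "a @ u" S "v @ b" l r R] by simp
qed (auto intro: word_eq.sym word_eq.trans)

lemma word_eq_append:
 assumes u: "(u, u') \<in> word_eq S R" and v: "(v, v') \<in> word_eq S R"
 shows "(u @ v, u' @ v') \<in> word_eq S R"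
 using word_eq_context[OF u, of "[]" v] word_eq_context[OF v, of u' "[]"] word_eq_lists[OF u] word_eq_lists[OF v]
 by (auto intro: word_eq.trans)

definition wcls :: "'g set => ('g word \<times> 'g word) set => 'g word => 'g word set"
 where "wcls S R w = word_eq S R `` {w}"

lemma wcls_eq_iff:
 "u \<in> lists (S \<times> UNIV) ==> v \<in> lists (S \<times> UNIV) ==> wcls S R u = wcls S R v \<longleftrightarrow> (u, v) \<in> word_eq S R"
 unfolding wcls_def by (rule eq_equiv_class_iff[OF equiv_word_eq])

lemma presented_group_carrier: "carrier (presented_group S R) = wcls S R ` lists (S \<times> UNIV)"
 by (auto simp: presented_group_def quotient_def wcls_def)

lemma presented_group_one: "\<one>\<^bsub>presented_group S R\<^esub> = wcls S R []" by (simp add: presented_group_def wcls_def)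

text \<open>The defining union runs over all representatives, but concatenation respects
  \<open>word_eq\<close>, so every member of the union is the same class.\<close>

lemma presented_group_mult:
 assumes "u \<in> lists (S \<times> UNIV)" "v \<in> lists (S \<times> UNIV)"
 shows "wcls S R u \<otimes>\<^bsub>presented_group S R\<^esub> wcls S R v = wcls S R (u @ v)"
proof -
 have *: "wcls S R (u' @ v') = wcls S R (u @ v)" if "u' \<in> wcls S R u" "v' \<in> wcls S R v" for u' v'
 proof -
  have "(u, u') \<in> word_eq S R" "(v, v') \<in> word_eq S R" using that by (auto simp: wcls_def)
  note word_eq_append[OF this]
  then show ?thesis using wcls_eq_iff[of "u @ v" S "u' @ v'" R] word_eq_lists[of "u @ v" "u' @ v'" S R] by blast
 qed
 have ne: "u \<in> wcls S R u" "v \<in> wcls S R v" using assms by (simp_all add: wcls_def word_eq.refl)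
 have "wcls S R u \<otimes>\<^bsub>presented_group S R\<^esub> wcls S R v = (\<Union>u'\<in>wcls S R u. \<Union>v'\<in>wcls S R v. wcls S R (u' @ v'))"
  by (simp add: presented_group_def wcls_def)
 also have "... = (\<Union>u'\<in>wcls S R u. \<Union>v'\<in>wcls S R v. wcls S R (u @ v))" by (rule SUP_cong[OF HOL.refl SUP_cong[OF HOL.refl *]])
 also have "... = wcls S R (u @ v)" using ne by blast
 finally show ?thesis .
qed

lemma word_inverse:
 assumes "w \<in> lists (S \<times> UNIV)"
 shows "(rev (map (%(x, e). (x, \<not> e)) w) @ w, []) \<in> word_eq S R"
 using assms
proof (induction w)
 case Nil
 then show ?case by (auto intro: word_eq.refl)
next
 case (Cons a w)
 obtain x e where a: "a = (x, e)" by (cases a)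
 have "w \<in> lists (S \<times> UNIV)" using Cons.hyps by simp
 moreover have "x \<in> S" using Cons.hyps a by simp
 ultimately have l': "w \<in> lists (S \<times> UNIV)" "x \<in> S" .
 let ?i = "rev (map (%(x, e). (x, \<not> e)) w)"
 have "?i \<in> lists (S \<times> UNIV)" using l'(1) by auto
 note l = this l'
 have "(?i @ [(x, \<not> e), (x, \<not> \<not> e)] @ w, ?i @ w) \<in> word_eq S R" by (rule word_eq.cancel[OF l])
 from word_eq.trans[OF this[simplified] Cons.IH] show ?case by (simp add: a)
qed

lemma presented_group_group: "group (presented_group S R)"
proof (rule groupI)
 let ?G = "presented_group S R"
 fix x assume "x \<in> carrier ?G"
 then obtain w where w: "w \<in> lists (S \<times> UNIV)" "x = wcls S R w" by (auto simp: presented_group_carrier)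
 let ?i = "rev (map (%(x, e). (x, \<not> e)) w)"
 have i: "?i \<in> lists (S \<times> UNIV)" using w(1) by auto
 have "wcls S R ?i \<otimes>\<^bsub>?G\<^esub> x = \<one>\<^bsub>?G\<^esub>" unfolding w(2) presented_group_mult[OF i w(1)] presented_group_one
  using wcls_eq_iff[of "?i @ w" S "[]" R] word_inverse[OF w(1)] i w(1) by simp
 then show "EX y:carrier ?G. y \<otimes>\<^bsub>?G\<^esub> x = \<one>\<^bsub>?G\<^esub>" using i by (auto simp: presented_group_carrier)
qed (auto del: in_listsD in_listsI simp: presented_group_carrier presented_group_one presented_group_mult)

text \<open>Values are given on all letters, formal inverses included. The target then only has to
  be a monoid, as the multiplicative structure of an algebra is.\<close>

definition eval_word :: "('k, 'e) module => ('g \<times> bool => 'e) => 'g word => 'e"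
 where "eval_word E f w = foldr (%l y. f l \<otimes>\<^bsub>E\<^esub> y) w \<one>\<^bsub>E\<^esub>"

context
 fixes E :: "('k, 'e) module" and S :: "'g set" and R :: "('g word \<times> 'g word) set" and f :: "'g \<times> bool => 'e"
 assumes E: "monoid E" and f: "!!l. l \<in> S \<times> UNIV ==> f l \<in> carrier E"
begin

interpretation E: monoid E by (fact E)

lemma eval_word_simps [simp]:
 "eval_word E f [] = \<one>\<^bsub>E\<^esub>" "eval_word E f (l # w) = f l \<otimes>\<^bsub>E\<^esub> eval_word E f w"
 by (simp_all add: eval_word_def)

lemma eval_word_closed: "w \<in> lists (S \<times> UNIV) ==> eval_word E f w \<in> carrier E" by (induction w) (use f in auto)

lemma eval_word_append:
 "u \<in> lists (S \<times> UNIV) ==> v \<in> lists (S \<times> UNIV) ==> eval_word E f (u @ v) = eval_word E f u \<otimes>\<^bsub>E\<^esub> eval_word E f v"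
 by (induction u) (use f eval_word_closed in \<open>auto simp: E.m_assoc\<close>)

lemma eval_word_eq:
 assumes inv: "!!x e. x \<in> S ==> f (x, e) \<otimes>\<^bsub>E\<^esub> f (x, \<not> e) = \<one>\<^bsub>E\<^esub>"
  and rel: "!!l r. (l, r) \<in> R ==> eval_word E f l = eval_word E f r"
 shows "(u, v) \<in> word_eq S R ==> eval_word E f u = eval_word E f v"
proof (induction rule: word_eq.induct)
 case (cancel u v x e)
 have "f (x, e) \<otimes>\<^bsub>E\<^esub> (f (x, \<not> e) \<otimes>\<^bsub>E\<^esub> eval_word E f v) = eval_word E f v"
  using cancel f eval_word_closed inv by (simp flip: E.m_assoc)
 then show ?case using cancel by (simp add: eval_word_append)
next
 case (relation u v l r)
 then show ?case using rel by (simp add: eval_word_append)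
qed auto

lemma presented_group_hom:
 assumes "!!x e. x \<in> S ==> f (x, e) \<otimes>\<^bsub>E\<^esub> f (x, \<not> e) = \<one>\<^bsub>E\<^esub>"
  and "!!l r. (l, r) \<in> R ==> eval_word E f l = eval_word E f r"
 shows "\<exists>h \<in> hom (presented_group S R) E. h \<one>\<^bsub>presented_group S R\<^esub> = \<one>\<^bsub>E\<^esub> \<and> (ALL l:S \<times> UNIV. h (wcls S R [l]) = f l)"
proof -
 define h where "h X = eval_word E f (SOME w. w \<in> X)" for X
 have h: "h (wcls S R w) = eval_word E f w" if w: "w \<in> lists (S \<times> UNIV)" for w
 proof -
  have "w \<in> wcls S R w" using w by (auto simp: wcls_def intro: word_eq.refl)
  then have "(SOME w'. w' \<in> wcls S R w) \<in> wcls S R w" by (rule someI)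
  then have "(w, SOME w'. w' \<in> wcls S R w) \<in> word_eq S R" by (auto simp: wcls_def)
  then show ?thesis unfolding h_def using eval_word_eq[OF assms] by metis
 qed
 have "h \<in> hom (presented_group S R) E"
  by (rule homI) (auto del: in_listsD in_listsI simp: presented_group_carrier presented_group_mult h eval_word_append eval_word_closed)
 moreover have "h \<one>\<^bsub>presented_group S R\<^esub> = \<one>\<^bsub>E\<^esub>" by (simp add: presented_group_one h)
 moreover have "h (wcls S R [l]) = f l" if "l \<in> S \<times> UNIV" for l using h[of "[l]"] f[OF that] that by simp
 ultimately show ?thesis by blast
qed

end

section \<open>Group algebras\<close>

lemma group_alg_simps:
 "carrier (group_alg K G) = carrier (free_mod K (carrier G))"
 "ring.add (group_alg K G) = ring.add (free_mod K (carrier G))"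
 "\<zero>\<^bsub>group_alg K G\<^esub> = \<zero>\<^bsub>free_mod K (carrier G)\<^esub>"
 "smult (group_alg K G) = smult (free_mod K (carrier G))"
 "\<one>\<^bsub>group_alg K G\<^esub> = basis_vec K \<one>\<^bsub>G\<^esub>"
 by (simp_all add: group_alg_def)

lemma lin_group_alg: "lin K (group_alg K G) N f \<longleftrightarrow> lin K (free_mod K (carrier G)) N f" by (simp add: lin_def group_alg_simps)

lemma alg_hom_iff:
 "h \<in> alg_hom K A B \<longleftrightarrow> lin K A B h \<and> (ALL x:carrier A. ALL y:carrier A. h (x \<otimes>\<^bsub>A\<^esub> y) = h x \<otimes>\<^bsub>B\<^esub> h y) \<and> h \<one>\<^bsub>A\<^esub> = \<one>\<^bsub>B\<^esub>"
 by (auto simp: alg_hom_def lin_def ring_hom_def)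

lemma alg_hom_lin: "h \<in> alg_hom K A B ==> lin K A B h" by (simp add: alg_hom_iff)

text \<open>Left translation by \<open>y\<close>, which is left multiplication by the basis vector
  of \<open>y\<close> in the group algebra.\<close>

definition shift :: "'k ring => 'g monoid => 'g => ('g => 'k) => 'g => 'k"
 where "shift K G y g = (%x. if x \<in> carrier G then g (inv\<^bsub>G\<^esub> y \<otimes>\<^bsub>G\<^esub> x) else \<zero>\<^bsub>K\<^esub>)"

context
 fixes K :: "'k ring" and G :: "'g monoid"
 assumes K: "cring K" and G: "group G"
begin

interpretation K: cring K by (fact K)
interpretation G: group G by (fact G)
interpretation F: module K "free_mod K (carrier G)" by (rule free_mod_module[OF K])

abbreviation (input) "F \<equiv> free_mod K (carrier G)"
abbreviation (input) "kG \<equiv> group_alg K G"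

lemma shift_lin:
 assumes y: "y \<in> carrier G" shows "lin K F F (shift K G y)"
proof (rule linI)
 fix g assume g: "g \<in> carrier F"
 have "{x. shift K G y g x ~= \<zero>\<^bsub>K\<^esub>} <= (%x. y \<otimes>\<^bsub>G\<^esub> x) ` {x. g x ~= \<zero>\<^bsub>K\<^esub>}"
 proof
  fix x assume "x \<in> {x. shift K G y g x ~= \<zero>\<^bsub>K\<^esub>}"
  then have x: "x \<in> carrier G" "g (inv\<^bsub>G\<^esub> y \<otimes>\<^bsub>G\<^esub> x) ~= \<zero>\<^bsub>K\<^esub>" by (auto simp: shift_def split: if_splits)
  moreover have "x = y \<otimes>\<^bsub>G\<^esub> (inv\<^bsub>G\<^esub> y \<otimes>\<^bsub>G\<^esub> x)" using x(1) y by (simp flip: G.m_assoc)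
  ultimately show "x \<in> (%x. y \<otimes>\<^bsub>G\<^esub> x) ` {x. g x ~= \<zero>\<^bsub>K\<^esub>}" by blast
 qed
 then have "finite {x. shift K G y g x ~= \<zero>\<^bsub>K\<^esub>}" using g by (auto intro: finite_subset)
 then show "shift K G y g \<in> carrier F" using g by (auto simp: shift_def)
qed (auto simp: shift_def fun_eq_iff)

lemma shift_basis_vec:
 assumes "y \<in> carrier G" "z \<in> carrier G"
 shows "shift K G y (basis_vec K z) = basis_vec K (y \<otimes>\<^bsub>G\<^esub> z)"
 using assms by (auto simp: shift_def basis_vec_def fun_eq_iff G.inv_solve_left')

lemma finsum_free_mod_apply:
 assumes "finite A" "h \<in> A \<rightarrow> carrier F"
 shows "(\<Oplus>\<^bsub>F\<^esub>y\<in>A. h y) x = (\<Oplus>\<^bsub>K\<^esub>y\<in>A. h y x)"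
 using assms
proof (induction A rule: finite_induct)
 case (insert a A)
 then have "(\<Oplus>\<^bsub>F\<^esub>y\<in>insert a A. h y) = h a \<oplus>\<^bsub>F\<^esub> (\<Oplus>\<^bsub>F\<^esub>y\<in>A. h y)" by (intro F.finsum_insert) auto
 moreover have "(\<Oplus>\<^bsub>K\<^esub>y\<in>insert a A. h y x) = h a x \<oplus>\<^bsub>K\<^esub> (\<Oplus>\<^bsub>K\<^esub>y\<in>A. h y x)"
  using insert by (intro K.finsum_insert) (auto simp: Pi_iff)
 ultimately show ?case using insert by simp
qed simp

text \<open>Writes the convolution as a linear extension, so that identities about products can be
  checked on basis vectors.\<close>

lemma group_alg_mult:
 assumes f: "f \<in> carrier F" and g: "g \<in> carrier F"
 shows "f \<otimes>\<^bsub>kG\<^esub> g = free_lift K F (%y. shift K G y g) f"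
proof
 fix x
 have sF: "shift K G y g \<in> carrier F" if "y \<in> carrier G" for y using lin_closed[OF shift_lin[OF that] g] .
 have fin: "finite {y. f y ~= \<zero>\<^bsub>K\<^esub>}" and supp: "!!y. f y ~= \<zero>\<^bsub>K\<^esub> ==> y \<in> carrier G" and fK: "!!y. f y \<in> carrier K"
  using f by auto
 have "free_lift K F (%y. shift K G y g) f x = (\<Oplus>\<^bsub>K\<^esub>y\<in>{y. f y ~= \<zero>\<^bsub>K\<^esub>}. (f y \<odot>\<^bsub>F\<^esub> shift K G y g) x)" unfolding free_lift_def
  by (rule finsum_free_mod_apply[OF fin]) (use sF supp fK F.smult_closed in \<open>auto simp del: free_mod_simps\<close>)
 also have "... = (\<Oplus>\<^bsub>K\<^esub>y\<in>{y. f y ~= \<zero>\<^bsub>K\<^esub>}. f y \<otimes>\<^bsub>K\<^esub> shift K G y g x)" by simp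
 also have "... = (f \<otimes>\<^bsub>kG\<^esub> g) x"
 proof (cases "x \<in> carrier G")
  case True
  then show ?thesis by (simp add: group_alg_def shift_def)
 next
  case False
  have "(\<Oplus>\<^bsub>K\<^esub>y\<in>{y. f y ~= \<zero>\<^bsub>K\<^esub>}. f y \<otimes>\<^bsub>K\<^esub> shift K G y g x) = \<zero>\<^bsub>K\<^esub>"
   using False fK by (intro K.add.finprod_one_eqI) (simp add: shift_def)
  then show ?thesis using False by (simp add: group_alg_def)
 qed
 finally show "(f \<otimes>\<^bsub>kG\<^esub> g) x = free_lift K F (%y. shift K G y g) f x" by simp
qed

lemma basis_vec_mult:
 assumes "y \<in> carrier G" "z \<in> carrier G"
 shows "basis_vec K y \<otimes>\<^bsub>kG\<^esub> basis_vec K z = basis_vec K (y \<otimes>\<^bsub>G\<^esub> z)"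
proof -
 have z: "basis_vec K z \<in> carrier F" using basis_vec_closed[OF K assms(2)] .
 have "basis_vec K y \<otimes>\<^bsub>kG\<^esub> basis_vec K z = free_lift K F (%y. shift K G y (basis_vec K z)) (basis_vec K y)"
  by (rule group_alg_mult[OF basis_vec_closed[OF K assms(1)] z])
 also have "... = shift K G y (basis_vec K z)"
  using lin_closed[OF shift_lin z] by (intro free_lift_basis_vec[OF F.module_axioms _ assms(1)])
 finally show ?thesis using shift_basis_vec[OF assms] by simp
qed

lemma group_alg_hom:
 assumes E: "unital_algebra K E" and h: "h \<in> hom G E" "h \<one>\<^bsub>G\<^esub> = \<one>\<^bsub>E\<^esub>"
 shows "free_lift K E h \<in> alg_hom K kG E"
proof -
 interpret E: unital_algebra K E by fact
 have hc: "h y \<in> carrier E" if "y \<in> carrier G" for y using h(1) that by (auto simp: hom_def)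
 have L: "lin K F E (free_lift K E h)" using hc by (rule free_lift_lin[OF E.module_axioms])
 have mul: "lin K E E (%x. a \<otimes>\<^bsub>E\<^esub> x)" "lin K E E (%x. x \<otimes>\<^bsub>E\<^esub> a)" if "a \<in> carrier E" for a
  using unital_algebra_mult_lin[OF E that] by auto
 have "free_lift K E h (f \<otimes>\<^bsub>kG\<^esub> g) = free_lift K E h f \<otimes>\<^bsub>E\<^esub> free_lift K E h g"
  if f: "f \<in> carrier F" and g: "g \<in> carrier F" for f g
 proof -
  have sF: "shift K G y g \<in> carrier F" if "y \<in> carrier G" for y using lin_closed[OF shift_lin[OF that] g] .
  have Lb: "free_lift K E h (basis_vec K y) = h y" if "y \<in> carrier G" for y
   using hc that by (rule free_lift_basis_vec[OF E.module_axioms])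
  have "free_lift K E h (free_lift K F (%y. shift K G y g) f) = free_lift K E h f \<otimes>\<^bsub>E\<^esub> free_lift K E h g"
  proof (rule lin_eq_on_spans[OF F.module_axioms E.module_axioms spans_basis_vec[OF K] _ _ _ f])
   show "lin K F E (%f. free_lift K E h (free_lift K F (%y. shift K G y g) f))"
    by (rule lin_comp[OF free_lift_lin[OF F.module_axioms sF] L])
   show "lin K F E (%f. free_lift K E h f \<otimes>\<^bsub>E\<^esub> free_lift K E h g)" by (rule lin_comp[OF L mul(2)[OF lin_closed[OF L g]]])
   fix f assume "f \<in> basis_vec K ` carrier G"
   then obtain y where y: "y \<in> carrier G" and f: "f = basis_vec K y" by blast
   have "free_lift K E h (shift K G y g) = h y \<otimes>\<^bsub>E\<^esub> free_lift K E h g"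
   proof (rule lin_eq_on_spans[OF F.module_axioms E.module_axioms spans_basis_vec[OF K] _ _ _ g])
    show "lin K F E (%g. free_lift K E h (shift K G y g))" by (rule lin_comp[OF shift_lin[OF y] L])
    show "lin K F E (%g. h y \<otimes>\<^bsub>E\<^esub> free_lift K E h g)" by (rule lin_comp[OF L mul(1)[OF hc[OF y]]])
    fix g assume "g \<in> basis_vec K ` carrier G"
    then obtain z where z: "z \<in> carrier G" "g = basis_vec K z" by blast
    then show "free_lift K E h (shift K G y g) = h y \<otimes>\<^bsub>E\<^esub> free_lift K E h g"
     using y h(1) by (simp add: shift_basis_vec Lb hom_def)
   qed
   then show "free_lift K E h (free_lift K F (%y. shift K G y g) f) = free_lift K E h f \<otimes>\<^bsub>E\<^esub> free_lift K E h g"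
    unfolding f Lb[OF y]
    by (subst free_lift_basis_vec[where f = "%y. shift K G y g", OF F.module_axioms sF y]) simp_all
  qed
  then show ?thesis by (simp only: group_alg_mult[OF f g])
 qed
 then show ?thesis
  unfolding alg_hom_iff lin_group_alg group_alg_simps using L free_lift_basis_vec[OF E.module_axioms hc G.one_closed] h(2) by simp
qed

end

context
 fixes K :: "'k ring" and S :: "'g set" and R :: "('g word \<times> 'g word) set" and E :: "('k, 'e) module"
 assumes K: "cring K" and E: "unital_algebra K E"
begin

interpretation E: unital_algebra K E by (fact E)

abbreviation (input) "PG \<equiv> presented_group S R"
abbreviation (input) "gen_vec l \<equiv> basis_vec K (wcls S R [l])"

lemma presented_alg_hom_ex:
 assumes f: "!!l. l \<in> S \<times> UNIV ==> f l \<in> carrier E"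
  and "!!x e. x \<in> S ==> f (x, e) \<otimes>\<^bsub>E\<^esub> f (x, \<not> e) = \<one>\<^bsub>E\<^esub>"
  and "!!l r. (l, r) \<in> R ==> eval_word E f l = eval_word E f r"
 shows "EX h:alg_hom K (group_alg K PG) E. ALL l:S \<times> UNIV. h (gen_vec l) = f l"
proof -
 obtain h where h: "h \<in> hom PG E" "h \<one>\<^bsub>PG\<^esub> = \<one>\<^bsub>E\<^esub>" "ALL l:S \<times> UNIV. h (wcls S R [l]) = f l"
  using presented_group_hom[OF E.monoid_axioms assms] by blast
 have "free_lift K E h (gen_vec l) = h (wcls S R [l])" if "l \<in> S \<times> UNIV" for l
 proof (rule free_lift_basis_vec[OF E.module_axioms])
  show "wcls S R [l] \<in> carrier PG" using that by (auto simp: presented_group_carrier)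
  show "h x \<in> carrier E" if "x \<in> carrier PG" for x using h(1) that by (auto simp: hom_def)
 qed
 then show ?thesis using group_alg_hom[OF K presented_group_group E h(1,2)] h(3) by auto
qed

lemma presented_alg_hom_Cons:
 assumes h: "h \<in> alg_hom K (group_alg K PG) E" and "l \<in> S \<times> UNIV" "w \<in> lists (S \<times> UNIV)"
 shows "h (basis_vec K (wcls S R (l # w))) = h (gen_vec l) \<otimes>\<^bsub>E\<^esub> h (basis_vec K (wcls S R w))"
proof -
 have lw: "[l] \<in> lists (S \<times> UNIV)" using assms(2) by simp
 have c: "wcls S R v \<in> carrier PG" if "v \<in> lists (S \<times> UNIV)" for v using that by (auto simp: presented_group_carrier)
 have "basis_vec K (wcls S R ([l] @ w)) = gen_vec l \<otimes>\<^bsub>group_alg K PG\<^esub> basis_vec K (wcls S R w)"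
  using basis_vec_mult[OF K presented_group_group c[OF lw] c[OF assms(3)]] presented_group_mult[OF lw assms(3)]
  by simp
 then show ?thesis using h basis_vec_closed[OF K c[OF lw]] basis_vec_closed[OF K c[OF assms(3)]]
  by (simp add: alg_hom_iff group_alg_simps del: free_mod_simps)
qed

lemma presented_alg_hom_Nil:
 "h \<in> alg_hom K (group_alg K PG) E ==> h (basis_vec K (wcls S R [])) = \<one>\<^bsub>E\<^esub>"
 by (simp add: alg_hom_iff group_alg_simps presented_group_one)

lemma presented_alg_hom_letter_closed:
 assumes h: "h \<in> alg_hom K (group_alg K PG) E" and "l \<in> S \<times> UNIV" shows "h (gen_vec l) \<in> carrier E"
proof (rule lin_closed[OF h[THEN alg_hom_lin]])
 have "wcls S R [l] \<in> carrier PG" using assms(2) by (simp add: presented_group_carrier)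
 then show "gen_vec l \<in> carrier (group_alg K PG)" unfolding group_alg_simps by (rule basis_vec_closed[OF K])
qed

lemma presented_alg_hom_inverse:
 assumes h: "h \<in> alg_hom K (group_alg K PG) E" and x: "x \<in> S"
 shows "h (gen_vec (x, e)) \<otimes>\<^bsub>E\<^esub> h (gen_vec (x, \<not> e)) = \<one>\<^bsub>E\<^esub>"
proof -
 have "h (gen_vec (x, e)) \<otimes>\<^bsub>E\<^esub> h (gen_vec (x, \<not> e)) = h (basis_vec K (wcls S R [(x, e), (x, \<not> e)]))"
  using presented_alg_hom_Cons[OF h, of "(x, e)" "[(x, \<not> e)]"] x by simp
 also have "wcls S R [(x, e), (x, \<not> e)] = wcls S R []"
  using wcls_eq_iff[of "[(x, e), (x, \<not> e)]" S "[]" R] word_eq.cancel[of "[]" S "[]" x e R] x by simp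
 finally show ?thesis using presented_alg_hom_Nil[OF h] by simp
qed

text \<open>An induction principle for images: words grow by one letter on the left, so it suffices
  that \<open>N\<close> contains one and absorbs the image of each letter from the left.\<close>

lemma presented_alg_hom_image_subset:
 assumes h: "h \<in> alg_hom K (group_alg K PG) E" and N: "subsp K E N" "\<one>\<^bsub>E\<^esub> \<in> N"
  and cl: "!!l y. l \<in> S \<times> UNIV ==> y \<in> N ==> h (gen_vec l) \<otimes>\<^bsub>E\<^esub> y \<in> N"
  and x: "x \<in> carrier (group_alg K PG)"
 shows "h x \<in> N"
proof (rule spans_image_closed[where f = h and x = x,
   OF free_mod_module[OF K] E.module_axioms spans_basis_vec[OF K, of "carrier PG"] _ N(1)])
 show "lin K (free_mod K (carrier PG)) E h" using alg_hom_lin[OF h] by (simp add: lin_group_alg)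
 show "x \<in> carrier (free_mod K (carrier PG))" using x by (simp only: group_alg_simps)
 have "h (basis_vec K (wcls S R w)) \<in> N" if "w \<in> lists (S \<times> UNIV)" for w using that
 proof (induction w)
  case Nil
  then show ?case using presented_alg_hom_Nil[OF h] N(2) by simp
 next
  case (Cons l w)
  then show ?case using presented_alg_hom_Cons[OF h, of l w] cl by simp
 qed
 then show "h x \<in> N" if "x \<in> basis_vec K ` carrier PG" for x using that by (auto simp: presented_group_carrier)
qed

text \<open>Agreement on the generators propagates to inverse letters, then to words, then by
  linearity to the group algebra.\<close>

lemma presented_alg_hom_unique:
 assumes h: "h \<in> alg_hom K (group_alg K PG) E" and h': "h' \<in> alg_hom K (group_alg K PG) E"
  and eq: "!!x. x \<in> S ==> h (gen_vec (x, True)) = h' (gen_vec (x, True))"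
  and x: "x \<in> carrier (group_alg K PG)"
 shows "h x = h' x"
proof -
 have L: "lin K (free_mod K (carrier PG)) E h" "lin K (free_mod K (carrier PG)) E h'"
  using alg_hom_lin[OF h] alg_hom_lin[OF h'] unfolding lin_group_alg .
 have x': "x \<in> carrier (free_mod K (carrier PG))" using x unfolding group_alg_simps .
 have eql: "h (gen_vec l) = h' (gen_vec l)" if "l \<in> S \<times> UNIV" for l
 proof -
  obtain y e where l: "l = (y, e)" "y \<in> S" using \<open>l \<in> S \<times> UNIV\<close> by auto
  have c: "h (gen_vec (y, e)) \<in> carrier E" "h' (gen_vec (y, e)) \<in> carrier E" for e
   using presented_alg_hom_letter_closed[OF h] presented_alg_hom_letter_closed[OF h'] l by auto
  show ?thesis
  proof (cases e)
   case False
   \<comment> \<open>Both values are inverse to the common value at the positive letter.\<close>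
   have "h (gen_vec (y, False)) = h' (gen_vec (y, False))" by (rule E.inv_unique[where x = "h (gen_vec (y, True))"])
     (use c presented_alg_hom_inverse[OF h l(2), of False] presented_alg_hom_inverse[OF h' l(2), of True] eq[OF l(2)]
      in simp_all)
   then show ?thesis using False l by simp
  qed (use l eq in simp)
 qed
 have "h (basis_vec K (wcls S R w)) = h' (basis_vec K (wcls S R w))" if "w \<in> lists (S \<times> UNIV)" for w using that
 proof (induction w)
  case Nil
  then show ?case using presented_alg_hom_Nil[OF h] presented_alg_hom_Nil[OF h'] by simp
 next
  case (Cons l w)
  then show ?case using presented_alg_hom_Cons[OF h, of l w] presented_alg_hom_Cons[OF h', of l w] eql by simp
 qed
 then have "h z = h' z" if "z \<in> basis_vec K ` carrier PG" for z using that by (auto simp: presented_group_carrier)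
 from lin_eq_on_spans[OF free_mod_module[OF K] E.module_axioms spans_basis_vec[OF K] L this x']
 show ?thesis .
qed

end

lemma pgen_wcls: "pgen S R x = wcls S R [(x, True)]" by (simp add: pgen_def wcls_def)

declare One_nat_def [simp del]

lemma spans_mono: "spans K M G ==> G <= G' ==> G' <= carrier M ==> spans K M G'" unfolding spans_def by blast

section \<open>Direct sums\<close>

lemma dsum_simps:
 "carrier (dsum I M) = (\<Pi>\<^sub>E i\<in>I. carrier (M i))"
 "x \<oplus>\<^bsub>dsum I M\<^esub> y = (\<lambda>i\<in>I. x i \<oplus>\<^bsub>M i\<^esub> y i)"
 "\<zero>\<^bsub>dsum I M\<^esub> = (\<lambda>i\<in>I. \<zero>\<^bsub>M i\<^esub>)"
 "c \<odot>\<^bsub>dsum I M\<^esub> x = (\<lambda>i\<in>I. c \<odot>\<^bsub>M i\<^esub> x i)"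
 by (simp_all add: dsum_def)

lemma dsum_module:
 assumes K: "cring K" and M: "!!i. i \<in> I ==> module K (M i)" shows "module K (dsum I M)"
proof -
 have f: "abelian_group (M i)" if "i \<in> I" for i using M[OF that] by (rule module.axioms)
 note ag = abelian_groupE[OF f]
 have "abelian_group (dsum I M)"
 proof (rule abelian_groupI)
  fix x assume x: "x \<in> carrier (dsum I M)"
  then have "ALL i:I. EX y:carrier (M i). y \<oplus>\<^bsub>M i\<^esub> x i = \<zero>\<^bsub>M i\<^esub>" using ag(6) by (auto simp: dsum_simps)
  then obtain y where "!!i. i \<in> I ==> y i \<in> carrier (M i) \<and> y i \<oplus>\<^bsub>M i\<^esub> x i = \<zero>\<^bsub>M i\<^esub>" by metis
  then show "EX y:carrier (dsum I M). y \<oplus>\<^bsub>dsum I M\<^esub> x = \<zero>\<^bsub>dsum I M\<^esub>" by (intro bexI[of _ "restrict y I"]) (auto simp: dsum_simps)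
 next
  fix x y z assume xyz: "x \<in> carrier (dsum I M)" "y \<in> carrier (dsum I M)" "z \<in> carrier (dsum I M)"
  then have c: "!!i. i \<in> I ==> x i \<in> carrier (M i)" "!!i. i \<in> I ==> y i \<in> carrier (M i)"
   "!!i. i \<in> I ==> z i \<in> carrier (M i)" by (auto simp: dsum_simps)
  show "x \<oplus>\<^bsub>dsum I M\<^esub> y \<oplus>\<^bsub>dsum I M\<^esub> z = x \<oplus>\<^bsub>dsum I M\<^esub> (y \<oplus>\<^bsub>dsum I M\<^esub> z)"
   using c ag(3) by (auto simp: dsum_simps fun_eq_iff restrict_def)
 next
  fix x y assume xyz: "x \<in> carrier (dsum I M)" "y \<in> carrier (dsum I M)"
  then have c: "!!i. i \<in> I ==> x i \<in> carrier (M i)" "!!i. i \<in> I ==> y i \<in> carrier (M i)" by (auto simp: dsum_simps)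
  show "x \<oplus>\<^bsub>dsum I M\<^esub> y = y \<oplus>\<^bsub>dsum I M\<^esub> x" using c ag(4) by (auto simp: dsum_simps fun_eq_iff restrict_def)
  show "x \<oplus>\<^bsub>dsum I M\<^esub> y \<in> carrier (dsum I M)" using c ag(1) by (auto simp: dsum_simps)
 next
  fix x assume x: "x \<in> carrier (dsum I M)"
  then show "\<zero>\<^bsub>dsum I M\<^esub> \<oplus>\<^bsub>dsum I M\<^esub> x = x"
   using ag(5) by (auto simp: dsum_simps fun_eq_iff restrict_def PiE_iff extensional_def)
 next
  show "\<zero>\<^bsub>dsum I M\<^esub> \<in> carrier (dsum I M)" using ag(2) by (auto simp: dsum_simps)
 qed
 note ab = this
 show ?thesis
 proof (rule moduleI[OF K ab])
  fix a b x assume c: "a \<in> carrier K" "b \<in> carrier K" "x \<in> carrier (dsum I M)"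
  show "(a \<oplus>\<^bsub>K\<^esub> b) \<odot>\<^bsub>dsum I M\<^esub> x = a \<odot>\<^bsub>dsum I M\<^esub> x \<oplus>\<^bsub>dsum I M\<^esub> b \<odot>\<^bsub>dsum I M\<^esub> x"
   "(a \<otimes>\<^bsub>K\<^esub> b) \<odot>\<^bsub>dsum I M\<^esub> x = a \<odot>\<^bsub>dsum I M\<^esub> (b \<odot>\<^bsub>dsum I M\<^esub> x)"
   using c module.smult_l_distr[OF M] module.smult_assoc1[OF M]
   by (auto simp: dsum_simps fun_eq_iff restrict_def PiE_iff)
 next
  fix a x y assume c: "a \<in> carrier K" "x \<in> carrier (dsum I M)" "y \<in> carrier (dsum I M)"
  show "a \<odot>\<^bsub>dsum I M\<^esub> (x \<oplus>\<^bsub>dsum I M\<^esub> y) = a \<odot>\<^bsub>dsum I M\<^esub> x \<oplus>\<^bsub>dsum I M\<^esub> a \<odot>\<^bsub>dsum I M\<^esub> y"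
   using c module.smult_r_distr[OF M] by (auto simp: dsum_simps fun_eq_iff restrict_def PiE_iff)
 next
  fix x assume c: "x \<in> carrier (dsum I M)"
  show "\<one>\<^bsub>K\<^esub> \<odot>\<^bsub>dsum I M\<^esub> x = x"
   using c module.smult_one[OF M] by (auto simp: dsum_simps fun_eq_iff restrict_def PiE_iff extensional_def)
 next
  fix a x assume c: "a \<in> carrier K" "x \<in> carrier (dsum I M)"
  show "a \<odot>\<^bsub>dsum I M\<^esub> x \<in> carrier (dsum I M)" using c module.smult_closed[OF M] by (auto simp: dsum_simps)
 qed
qed

lemma dsum_proj_lin: "i \<in> I ==> lin K (dsum I M) (M i) (%x. x i)" by (auto simp: lin_def dsum_simps)

lemma dsum_in_lin:
 assumes M: "!!i. i \<in> I ==> module K (M i)" and b: "b \<in> I"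
 shows "lin K (M b) (dsum I M) (dsum_in I M b)"
proof -
 have z: "\<zero>\<^bsub>M i\<^esub> \<in> carrier (M i)" "\<zero>\<^bsub>M i\<^esub> \<oplus>\<^bsub>M i\<^esub> \<zero>\<^bsub>M i\<^esub> = \<zero>\<^bsub>M i\<^esub>"
  "c \<in> carrier K ==> c \<odot>\<^bsub>M i\<^esub> \<zero>\<^bsub>M i\<^esub> = \<zero>\<^bsub>M i\<^esub>" if "i \<in> I" for i c
 proof -
  interpret Mi: module K "M i" using M[OF that] .
  show "\<zero>\<^bsub>M i\<^esub> \<in> carrier (M i)" "\<zero>\<^bsub>M i\<^esub> \<oplus>\<^bsub>M i\<^esub> \<zero>\<^bsub>M i\<^esub> = \<zero>\<^bsub>M i\<^esub>"
   "c \<in> carrier K ==> c \<odot>\<^bsub>M i\<^esub> \<zero>\<^bsub>M i\<^esub> = \<zero>\<^bsub>M i\<^esub>" by auto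
 qed
 show ?thesis using b z by (auto simp: lin_def dsum_simps dsum_in_def fun_eq_iff)
qed

lemma dsum_in_apply: "c \<in> I ==> dsum_in I M b v c = (if c = b then v else \<zero>\<^bsub>M c\<^esub>)" by (simp add: dsum_in_def)

lemma spans_dsum_in:
 assumes I: "finite I" and M: "!!i. i \<in> I ==> module K (M i)"
 shows "spans K (dsum I M) {dsum_in I M b v | b v. b \<in> I \<and> v \<in> carrier (M b)}" (is "spans K ?W ?G")
 unfolding spans_def
proof (intro conjI allI impI)
 show "?G <= carrier ?W" using lin_closed[OF dsum_in_lin[where M = M and K = K, OF M]] by blast
 fix N assume N: "subsp K ?W N" and G: "?G <= N"
 \<comment> \<open>\<open>J\<close> holds the coordinates in which \<open>x\<close> may be
   nonzero.\<close>
 have "x \<in> N" if "finite J" "J <= I" "x \<in> carrier ?W" "!!i. i \<in> I - J ==> x i = \<zero>\<^bsub>M i\<^esub>" for J x using that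
 proof (induction J arbitrary: x rule: finite_induct)
  case empty
  then have "x = \<zero>\<^bsub>?W\<^esub>" by (auto simp: dsum_simps fun_eq_iff PiE_iff extensional_def)
  then show ?case using N by (auto simp: subsp_def)
 next
  case (insert b J)
  have b: "b \<in> I" using insert by auto
  have xM: "!!i. i \<in> I ==> x i \<in> carrier (M i)" using insert.prems(2) by (auto simp: dsum_simps)
  have z: "\<zero>\<^bsub>M i\<^esub> \<in> carrier (M i)" "y \<in> carrier (M i) ==> \<zero>\<^bsub>M i\<^esub> \<oplus>\<^bsub>M i\<^esub> y = y"
   "y \<in> carrier (M i) ==> y \<oplus>\<^bsub>M i\<^esub> \<zero>\<^bsub>M i\<^esub> = y" if "i \<in> I" for i y
  proof -
   interpret Mi: module K "M i" using M[OF that] .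
   show "\<zero>\<^bsub>M i\<^esub> \<in> carrier (M i)" "y \<in> carrier (M i) ==> \<zero>\<^bsub>M i\<^esub> \<oplus>\<^bsub>M i\<^esub> y = y"
    "y \<in> carrier (M i) ==> y \<oplus>\<^bsub>M i\<^esub> \<zero>\<^bsub>M i\<^esub> = y" by auto
  qed
  have "x(b := \<zero>\<^bsub>M b\<^esub>) \<in> N"
  proof (rule insert.IH)
   show "x(b := \<zero>\<^bsub>M b\<^esub>) \<in> carrier ?W" using insert.prems(2) b z unfolding dsum_simps by (intro fun_upd_PiE) auto
  qed (use insert.prems in auto)
  moreover have "dsum_in I M b (x b) \<in> N" using G b xM by blast
  ultimately have "x(b := \<zero>\<^bsub>M b\<^esub>) \<oplus>\<^bsub>?W\<^esub> dsum_in I M b (x b) \<in> N" using N unfolding subsp_def by blast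
  also have "x(b := \<zero>\<^bsub>M b\<^esub>) \<oplus>\<^bsub>?W\<^esub> dsum_in I M b (x b) = x"
   using b xM z insert.prems(2) by (auto simp: dsum_simps dsum_in_def fun_eq_iff PiE_iff extensional_def)
  finally show ?case .
 qed
 from this[OF I order_refl] show "carrier ?W <= N" by auto
qed

section \<open>Words and ranks\<close>

text \<open>A position \<open>i\<close> (counted from 1) of a word is identified with the pair of its letter and its rank,
 i.e. the number of occurrences of that letter up to \<open>i\<close>.\<close>

definition letter :: "nat list => nat => nat" where "letter w i = w ! (i - 1)"
definition rank :: "nat list => nat => nat" where "rank w i = count_list (take i w) (letter w i)"
definition position :: "nat list => nat => nat => nat"
 where "position w b j = (THE i. i \<in> {1..length w} \<and> letter w i = b \<and> rank w i = j)"
definition content :: "nat => nat list => nat => nat" where "content d w = (\<lambda>b\<in>{1..d}. count_list w b)"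
definition words :: "nat => nat => nat list set" where "words d n = {w. length w = n \<and> set w <= {1..d}}"

lemma letter_snoc:
 "i \<in> {1..length w} ==> letter (w @ [c]) i = letter w i" "letter (w @ [c]) (Suc (length w)) = c"
 by (auto simp: letter_def nth_append)

lemma rank_snoc:
 "i \<in> {1..length w} ==> rank (w @ [c]) i = rank w i" "rank (w @ [c]) (Suc (length w)) = Suc (count_list w c)"
 by (auto simp: rank_def letter_snoc)

lemma rank_bounds:
 "i \<in> {1..length w} ==> 1 \<le> rank w i \<and> rank w i \<le> count_list w (letter w i)"
proof (induction w rule: rev_induct)
 case (snoc c w)
 show ?case
 proof (cases "i = Suc (length w)")
  case True
  then show ?thesis by (simp add: rank_snoc letter_snoc)
 next
  case False
  then have "i \<in> {1..length w}" using snoc.prems by auto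
  then show ?thesis using snoc.IH by (auto simp: rank_snoc letter_snoc)
 qed
qed simp

text \<open>Appending a letter \<open>c\<close> creates exactly one new pair of letter and rank,
  namely \<open>c\<close> with its old count plus one, at the last position. The case split isolates
  this pair.\<close>

lemma position_ex1:
 "1 \<le> j ==> j \<le> count_list w b ==> \<exists>!i. i \<in> {1..length w} \<and> letter w i = b \<and> rank w i = j"
proof (induction w arbitrary: j rule: rev_induct)
 case (snoc c w)
 show ?case
 proof (cases "b = c \<and> j = Suc (count_list w c)")
  case True
  show ?thesis
  proof (rule ex1I[of _ "Suc (length w)"])
   fix i assume i: "i \<in> {1..length (w @ [c])} \<and> letter (w @ [c]) i = b \<and> rank (w @ [c]) i = j"
   show "i = Suc (length w)"
   proof (rule ccontr)
    assume "i ~= Suc (length w)"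
    then have "i \<in> {1..length w}" using i by auto
    then show False using i rank_bounds[of i w] True by (simp add: rank_snoc letter_snoc)
   qed
  qed (use True in \<open>simp add: rank_snoc letter_snoc\<close>)
 next
  case False
  then have j: "j \<le> count_list w b" using snoc.prems by (auto split: if_splits)
  obtain i where i: "i \<in> {1..length w} \<and> letter w i = b \<and> rank w i = j"
   and u: "!!i'. i' \<in> {1..length w} \<and> letter w i' = b \<and> rank w i' = j ==> i' = i"
   using snoc.IH[OF snoc.prems(1) j] by (elim ex1E) blast
  show ?thesis
  proof (rule ex1I[of _ i])
   fix i' assume i': "i' \<in> {1..length (w @ [c])} \<and> letter (w @ [c]) i' = b \<and> rank (w @ [c]) i' = j"
   have "i' ~= Suc (length w)" using i' False rank_snoc(2)[of w c] letter_snoc(2)[of w c] by metis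
   then have "i' \<in> {1..length w}" using i' by auto
   then show "i' = i" using i' by (intro u) (simp add: rank_snoc letter_snoc)
  qed (use i in \<open>simp add: rank_snoc letter_snoc\<close>)
 qed
qed simp

lemma position:
 assumes "1 \<le> j" "j \<le> count_list w b"
 shows "position w b j \<in> {1..length w}" "letter w (position w b j) = b" "rank w (position w b j) = j"
 using theI'[OF position_ex1[OF assms]] by (auto simp: position_def)

lemma position_unique:
 assumes "i \<in> {1..length w}" shows "position w (letter w i) (rank w i) = i"
proof -
 have "1 \<le> rank w i" "rank w i \<le> count_list w (letter w i)" using rank_bounds[OF assms] by auto
 then show ?thesis unfolding position_def using assms by (intro the1_equality[OF position_ex1]) auto
qed

lemma letter_in: "w \<in> words d n ==> i \<in> {1..n} ==> letter w i \<in> {1..d}" by (auto simp: words_def letter_def subset_iff)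

lemma words_eqI:
 assumes "w \<in> words d n" "w' \<in> words d n" "!!i. i \<in> {1..n} ==> letter w i = letter w' i" shows "w = w'"
proof (rule nth_equalityI)
 show "w ! k = w' ! k" if "k < length w" for k using assms(3)[of "Suc k"] assms(1,2) that by (simp add: letter_def words_def)
qed (use assms in \<open>simp add: words_def\<close>)

lemma content_apply: "b \<in> {1..d} ==> content d w b = count_list w b" by (simp add: content_def)

section \<open>Homogeneous components of the tensor powers of a direct sum\<close>

locale word_tensor =
 fixes K :: "'k ring" (structure) and d :: nat and V :: "nat => ('k, 'v) module"
 assumes field: "field K" and V: "!!b. b \<in> {1..d} ==> module K (V b)"
begin

abbreviation "W \<equiv> box_mod d V"
abbreviation "linmapsW n \<equiv> linear_maps K (tpow K W n) (tpow K W n)"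
abbreviation "linW n \<equiv> lin K (tpow K W n) (tpow K W n)"
abbreviation "carW n \<equiv> carrier (tpow K W n)"
abbreviation "emb b \<equiv> dsum_in {1..d} V b"
abbreviation "U \<nu> \<equiv> tensor K {1..d} (%b. tpow K (V b) (\<nu> b))"
abbreviation "pp \<nu> v \<equiv> pure K {1..d} (%b. tpow K (V b) (\<nu> b)) (%b. tpure K (V b) (\<nu> b) (v b))"
abbreviation "cont \<equiv> content d"

text \<open>Only the entries in the index ranges are constrained. Without extensionality, families
  can be written as plain functions such as \<open>%b j. x (position w b j) b\<close>.\<close>

definition fam :: "(nat => nat) => (nat => nat => 'v) => bool"
 where "fam \<nu> v \<longleftrightarrow> (ALL b:{1..d}. ALL j:{1..\<nu> b}. v b j \<in> carrier (V b))"

lemma K_cring: "cring K" by (rule cring.intro) (use field in \<open>auto simp: field_def domain_def cring_def\<close>)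

lemma W_module: "module K W" by (rule dsum_module[OF K_cring V])

sublocale TW: tensor_prod K "{1..n}" "%_. W" for n by (intro tensor_prod.intro K_cring W_module)

sublocale NT: nested_tensor K "{1..d}" "%b. {1..\<nu> b}" V for \<nu> by (intro nested_tensor.intro K_cring V) auto

lemma emb_lin: "b \<in> {1..d} ==> lin K (V b) W (emb b)" by (rule dsum_in_lin[OF V])

lemma emb_closed: "b \<in> {1..d} ==> v \<in> carrier (V b) ==> emb b v \<in> carrier W" by (rule lin_closed[OF emb_lin])

lemma tpowV: "b \<in> {1..d} ==> tensor_prod K {1..m} (%_. V b)" by (intro tensor_prod.intro K_cring V)

lemma tpowV_module: "b \<in> {1..d} ==> module K (tpow K (V b) m)" by (rule tensor_prod.tensor_module[OF tpowV])

lemma U_module: "module K (U \<nu>)" by (rule NT.outer.tensor_module)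

lemma pp_restrict:
 "pp \<nu> (\<lambda>b\<in>{1..d}. \<lambda>j\<in>{1..\<nu> b}. v b j) = pp \<nu> v"
 by (rule NT.outer.pure_cong) (simp add: tensor_prod.pure_restrict[OF tpowV])

lemma pp_cong:
 assumes "!!b j. b \<in> {1..d} ==> j \<in> {1..\<nu> b} ==> v b j = v' b j" shows "pp \<nu> v = pp \<nu> v'"
 by (rule NT.outer.pure_cong, rule tensor_prod.pure_cong[OF tpowV]) (use assms in auto)

lemma tpure_fam: "fam \<nu> v ==> b \<in> {1..d} ==> tpure K (V b) (\<nu> b) (v b) \<in> carrier (tpow K (V b) (\<nu> b))"
 by (rule tensor_prod.pure_closed[OF tpowV]) (auto simp: fam_def)

lemma pp_closed: "fam \<nu> v ==> pp \<nu> v \<in> carrier (U \<nu>)" by (rule NT.outer.pure_closed) (rule tpure_fam)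

lemma U_lin_eq:
 assumes "module K P" "lin K (U \<nu>) P f" "lin K (U \<nu>) P g"
  and "!!v. fam \<nu> v ==> f (pp \<nu> v) = g (pp \<nu> v)" and "z \<in> carrier (U \<nu>)"
 shows "f z = g z"
 by (rule NT.nested_lin_eq[OF assms(1-3) _ assms(5)], rule assms(4)) (fastforce simp: fam_def PiE_iff)

lemma pp_slot_lin:
 assumes v: "fam \<nu> v" and b: "b \<in> {1..d}" and j: "j \<in> {1..\<nu> b}"
 shows "lin K (V b) (U \<nu>) (%u. pp \<nu> (v(b := (v b)(j := u))))"
proof -
 have "lin K (V b) (U \<nu>) (%u. pure K {1..d} (%b. tpow K (V b) (\<nu> b))
   ((%b. tpure K (V b) (\<nu> b) (v b))(b := tpure K (V b) (\<nu> b) ((v b)(j := u)))))"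
 proof (rule lin_comp[OF tensor_prod.pure_lin[OF tpowV[OF b]] NT.outer.pure_lin])
  show "tpure K (V c) (\<nu> c) (v c) \<in> carrier (tpow K (V c) (\<nu> c))" if "c \<in> {1..d}" for c using v that by (rule tpure_fam)
 qed (use v b j in \<open>auto simp: fam_def\<close>)
 moreover have "(%b. tpure K (V b) (\<nu> b) (v b))(b := tpure K (V b) (\<nu> b) ((v b)(j := u))) =
   (%c. tpure K (V c) (\<nu> c) ((v(b := (v b)(j := u))) c))" for u by (auto simp: fun_eq_iff)
 ultimately show ?thesis by simp
qed

text \<open>Embeds the component of \<open>w\<close>: the factors, sorted by letter, are distributed
  over the positions of \<open>w\<close>, position \<open>i\<close> receiving the one with its
  letter and rank. The \<open>SOME\<close> picks a map provided by \<open>iota_ex\<close>, since the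
  nested universal property is an existence statement.\<close>

definition iota :: "nat list => ((nat => (nat, 'v, 'k) tens) => 'k) set => (nat, nat => 'v, 'k) tens"
 where "iota w = (SOME G. lin K (U (cont w)) (tpow K W (length w)) G \<and> (\<forall>v. fam (cont w) v -->
  G (pp (cont w) v) = tpure K W (length w) (%i. emb (letter w i) (v (letter w i) (rank w i)))))"

text \<open>The way back: the \<open>j\<close>-th factor of the block of \<open>b\<close> is the
  \<open>b\<close>-component of the vector at the \<open>j\<close>-th occurrence of \<open>b\<close>
  in \<open>w\<close>.\<close>

definition prj :: "nat list => (nat, nat => 'v, 'k) tens => ((nat => (nat, 'v, 'k) tens) => 'k) set"
 where "prj w = tensor_lift K {1..length w} (%_. W) (U (cont w)) (%x. pp (cont w) (%b j. x (position w b j) b))"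

context
 fixes w :: "nat list" and n :: nat
 assumes w: "w \<in> words d n"
begin

lemma len: "length w = n" using w by (simp add: words_def)

lemma fam_letter:
 assumes "fam (cont w) v" "i \<in> {1..n}" shows "v (letter w i) (rank w i) \<in> carrier (V (letter w i))"
 using assms letter_in[OF w assms(2)] rank_bounds[of i w] len by (auto simp: fam_def content_apply)

lemma position_cont:
 assumes "b \<in> {1..d}" "j \<in> {1..cont w b}"
 shows "position w b j \<in> {1..n}" "letter w (position w b j) = b" "rank w (position w b j) = j"
 using position[of j w b] assms len by (auto simp: content_apply)

lemma iota_ex: "\<exists>G. lin K (U (cont w)) (tpow K W n) G \<and> (\<forall>v. fam (cont w) v -->
  G (pp (cont w) v) = tpure K W n (%i. emb (letter w i) (v (letter w i) (rank w i))))"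
proof -
 let ?f = "%v. tpure K W n (%i. emb (letter w i) (v (letter w i) (rank w i)))"
 let ?VV = "\<Pi>\<^sub>E b\<in>{1..d}. \<Pi>\<^sub>E j\<in>{1..cont w b}. carrier (V b)"
 have "NT.multilin2 (cont w) (tpow K W n) ?f" unfolding NT.multilin2_def
 proof (intro ballI conjI)
  fix v assume "v \<in> ?VV"
  then have v: "fam (cont w) v" by (fastforce simp: fam_def PiE_iff)
  have xi: "emb (letter w i) (v (letter w i) (rank w i)) \<in> carrier W" if "i \<in> {1..n}" for i
   using fam_letter[OF v that] letter_in[OF w that] by (intro emb_closed)
  then show "?f v \<in> carW n" by (rule TW.pure_closed)
  fix b j assume b: "b \<in> {1..d}" and j: "j \<in> {1..cont w b}"
  let ?i = "position w b j"
  note i = position_cont[OF b j]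
  have "lin K (V b) (tpow K W n) (%u. tpure K W n ((%i. emb (letter w i) (v (letter w i) (rank w i)))(?i := emb b u)))"
   by (rule lin_comp[OF emb_lin[OF b] TW.pure_lin]) (use xi i in auto)
  moreover have "tpure K W n ((%i. emb (letter w i) (v (letter w i) (rank w i)))(?i := emb b u)) =
    ?f (v(b := (v b)(j := u)))" for u
   using i position_unique[of _ w] len by (intro TW.pure_cong) auto
  ultimately show "lin K (V b) (tpow K W n) (%u. ?f (v(b := (v b)(j := u))))" by simp
 qed
 from NT.nested_lift[OF TW.tensor_module this] obtain G where G: "lin K (U (cont w)) (tpow K W n) G"
  and Gp: "!!v. v \<in> ?VV ==> G (pp (cont w) v) = ?f v" by blast
 have "G (pp (cont w) v) = ?f v" if v: "fam (cont w) v" for v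
 proof -
  let ?v = "\<lambda>b\<in>{1..d}. \<lambda>j\<in>{1..cont w b}. v b j"
  have "G (pp (cont w) ?v) = ?f ?v" by (rule Gp) (use v in \<open>auto simp: fam_def\<close>)
  \<comment> \<open>Every letter and rank occurring in \<open>w\<close> lies in the index ranges, so
    truncating the family changes nothing.\<close>
  also have "... = ?f v" using letter_in[OF w] rank_bounds[of _ w] len by (intro TW.pure_cong) (auto simp: content_apply)
  finally show ?thesis unfolding pp_restrict .
 qed
 then show ?thesis using G by blast
qed

lemma iota_lin: "lin K (U (cont w)) (tpow K W n) (iota w)"
 and iota_pp: "fam (cont w) v ==> iota w (pp (cont w) v) = tpure K W n (%i. emb (letter w i) (v (letter w i) (rank w i)))"
 using someI_ex[OF iota_ex] unfolding iota_def len by blast+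

lemma prj_multilin:
 "multilin K {1..n} (%_. W) (U (cont w)) (%x. pp (cont w) (%b j. x (position w b j) b))"
proof (rule multilinI)
 fix x assume "x \<in> (\<Pi>\<^sub>E i\<in>{1..n}. carrier W)"
 then have "x i \<in> carrier W" if "i \<in> {1..n}" for i using that by auto
 then have x: "x i b \<in> carrier (V b)" if "i \<in> {1..n}" "b \<in> {1..d}" for i b
  using PiE_mem[OF _ that(2), of "x i" "%b. carrier (V b)"] \<open>!!i. i \<in> {1..n} ==> x i \<in> carrier W\<close>[OF that(1)]
  by (simp add: dsum_simps)
 have f: "fam (cont w) (%b j. x (position w b j) b)" using x position_cont by (auto simp: fam_def)
 then show "pp (cont w) (%b j. x (position w b j) b) \<in> carrier (U (cont w))" by (rule pp_closed)
 fix i assume i: "i \<in> {1..n}"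
 let ?b = "letter w i" and ?j = "rank w i"
 have b: "?b \<in> {1..d}" using letter_in[OF w i] .
 have j: "?j \<in> {1..cont w ?b}" using rank_bounds[of i w] i len b by (simp add: content_apply)
 let ?v = "%b j. x (position w b j) b"
 \<comment> \<open>The vector at position \<open>i\<close> enters the sorted tensor through a single
   entry, the one with the letter and rank of \<open>i\<close>.\<close>
 have "lin K W (U (cont w)) (%u. pp (cont w) (?v(?b := (?v ?b)(?j := u ?b))))"
  by (rule lin_comp[OF dsum_proj_lin[OF b, of K V] pp_slot_lin[OF f b j]])
 moreover have "pp (cont w) (?v(?b := (?v ?b)(?j := u ?b))) = pp (cont w) (%b j. (x(i := u)) (position w b j) b)" for u
 proof (rule pp_cong)
  fix c k assume "c \<in> {1..d}" "k \<in> {1..cont w c}"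
  note p = position_cont[OF this]
  have "position w ?b ?j = i" using position_unique[of i w] i len by simp
  then show "(?v(?b := (?v ?b)(?j := u ?b))) c k = (x(i := u)) (position w c k) c" using p by auto
 qed
 ultimately show "lin K W (U (cont w)) (%u. pp (cont w) (%b j. (x(i := u)) (position w b j) b))" by simp
qed

lemma prj_lin: "lin K (tpow K W n) (U (cont w)) (prj w)"
 unfolding prj_def len by (rule TW.tensor_lift_lin[OF U_module prj_multilin])

lemma prj_tpure:
 assumes "!!i. i \<in> {1..n} ==> x i \<in> carrier W"
 shows "prj w (tpure K W n x) = pp (cont w) (%b j. x (position w b j) b)"
proof -
 have "prj w (tpure K W n x) = pp (cont w) (%b j. restrict x {1..n} (position w b j) b)"
  unfolding prj_def len by (rule TW.tensor_lift_pure[OF U_module prj_multilin assms])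
 also have "... = pp (cont w) (%b j. x (position w b j) b)" by (rule pp_cong) (use position_cont in simp)
 finally show ?thesis .
qed

text \<open>Reads \<open>iota_pp\<close> backwards: a pure tensor of homogeneous vectors lies in the
  component of the word of their letters.\<close>

lemma homogeneous_tpure:
 assumes "!!i. i \<in> {1..n} ==> v i \<in> carrier (V (letter w i))"
 shows "fam (cont w) (%b j. v (position w b j))"
  and "tpure K W n (%i. emb (letter w i) (v i)) = iota w (pp (cont w) (%b j. v (position w b j)))"
proof -
 show f: "fam (cont w) (%b j. v (position w b j))" unfolding fam_def
 proof (intro ballI)
  fix b j assume bj: "b \<in> {1..d}" "j \<in> {1..cont w b}"
  show "v (position w b j) \<in> carrier (V b)" using assms[OF position_cont(1)[OF bj]] position_cont(2)[OF bj] by simp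
 qed
 show "tpure K W n (%i. emb (letter w i) (v i)) = iota w (pp (cont w) (%b j. v (position w b j)))"
  unfolding iota_pp[OF f] using position_unique[of _ w] len by (intro TW.pure_cong) simp
qed

end

lemma iota_closed: "w \<in> words d n ==> y \<in> carrier (U (cont w)) ==> iota w y \<in> carW n"
 by (rule lin_closed[OF iota_lin])

lemma prj_closed: "w \<in> words d n ==> x \<in> carW n ==> prj w x \<in> carrier (U (cont w))" by (rule lin_closed[OF prj_lin])

text \<open>Two different words disagree at some position. There \<open>prj w\<close> takes the
  component at one letter of a vector embedded at another letter, and this zero entry makes the
  sorted pure tensor vanish.\<close>

lemma prj_iota:
 assumes w: "w \<in> words d n" and w': "w' \<in> words d n" and y: "y \<in> carrier (U (cont w'))"
 shows "prj w (iota w' y) = (if w = w' then y else \<zero>\<^bsub>U (cont w)\<^esub>)"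
proof (cases "w = w'")
 case True
 have "prj w (iota w y) = y" if y: "y \<in> carrier (U (cont w))"
 proof (rule U_lin_eq[OF U_module lin_comp[OF iota_lin[OF w] prj_lin[OF w]] lin_id _ y])
  fix v assume v: "fam (cont w) v"
  have "prj w (iota w (pp (cont w) v)) =
    pp (cont w) (%b j. emb (letter w (position w b j)) (v (letter w (position w b j)) (rank w (position w b j))) b)"
   unfolding iota_pp[OF w v] using fam_letter[OF w v] letter_in[OF w]
   by (intro prj_tpure[OF w] emb_closed) auto
  also have "... = pp (cont w) v" by (rule pp_cong) (use position_cont[OF w] in \<open>simp add: dsum_in_apply\<close>)
  finally show "prj w (iota w (pp (cont w) v)) = pp (cont w) v" .
 qed
 then show ?thesis using True y by simp
next
 case False
 then obtain i where i: "i \<in> {1..n}" "letter w i ~= letter w' i" using words_eqI[OF w w'] by blast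
 let ?b = "letter w i" and ?j = "rank w i"
 have b: "?b \<in> {1..d}" using letter_in[OF w i(1)] .
 have j: "?j \<in> {1..cont w ?b}" using rank_bounds[of i w] i len[OF w] b by (simp add: content_apply)
 have "prj w (iota w' y) = \<zero>\<^bsub>U (cont w)\<^esub>"
 proof (rule U_lin_eq[OF U_module lin_comp[OF iota_lin[OF w'] prj_lin[OF w]] lin_zero_map[OF U_module] _ y])
  fix v assume v: "fam (cont w') v"
  let ?x = "%i. emb (letter w' i) (v (letter w' i) (rank w' i))"
  let ?u = "%b j. ?x (position w b j) b"
  have x: "?x i \<in> carrier W" if "i \<in> {1..n}" for i using fam_letter[OF w' v that] letter_in[OF w' that] by (intro emb_closed)
  have u: "fam (cont w) ?u" unfolding fam_def
  proof (intro ballI)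
   fix b j assume bj: "b \<in> {1..d}" "j \<in> {1..cont w b}"
   show "?u b j \<in> carrier (V b)" using x[OF position_cont(1)[OF w bj]] bj(1) by (auto simp: dsum_simps)
  qed
  have "?u ?b ?j = \<zero>\<^bsub>V ?b\<^esub>" using position_unique[of i w] i len[OF w] b by (simp add: dsum_in_apply)
  \<comment> \<open>Writing the zero entry as an update exposes the slot in which linearity is
    applied.\<close>
  then have upd: "?u(?b := (?u ?b)(?j := \<zero>\<^bsub>V ?b\<^esub>)) = ?u" by (intro ext) auto
  have "prj w (iota w' (pp (cont w') v)) = pp (cont w) ?u" unfolding iota_pp[OF w' v] by (rule prj_tpure[OF w x])
  also have "... = pp (cont w) (?u(?b := (?u ?b)(?j := \<zero>\<^bsub>V ?b\<^esub>)))" unfolding upd ..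
  also have "... = \<zero>\<^bsub>U (cont w)\<^esub>" by (rule lin_zero[OF V[OF b] U_module pp_slot_lin[OF u b j]])
  finally show "prj w (iota w' (pp (cont w') v)) = \<zero>\<^bsub>U (cont w)\<^esub>" .
 qed
 then show ?thesis using False by simp
qed

text \<open>Homogeneous vectors span \<open>W\<close>, so their pure tensors span the power; each of
  these belongs to the component of its word of letters.\<close>

lemma spans_iota:
 "spans K (tpow K W n) (\<Union>w\<in>words d n. iota w ` pp (cont w) ` Collect (fam (cont w)))"
proof -
 let ?G = "{emb b v | b v. b \<in> {1..d} \<and> v \<in> carrier (V b)}"
 have "spans K W ?G" by (rule spans_dsum_in) (use V in auto)
 then have sp: "spans K (tpow K W n) (tpure K W n ` (\<Pi>\<^sub>E i\<in>{1..n}. ?G))" by (intro TW.spans_pure_gen) auto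
 have "z \<in> (\<Union>w\<in>words d n. iota w ` pp (cont w) ` Collect (fam (cont w)))" if z: "z \<in> tpure K W n ` (\<Pi>\<^sub>E i\<in>{1..n}. ?G)" for z
 proof -
  obtain x where x: "z = tpure K W n x" "x \<in> (\<Pi>\<^sub>E i\<in>{1..n}. ?G)" using z by (rule imageE)
  have "ALL i:{1..n}. \<exists>b v. b \<in> {1..d} \<and> v \<in> carrier (V b) \<and> x i = emb b v" using PiE_mem[OF x(2)] by blast
  then obtain b v where bv: "!!i. i \<in> {1..n} ==> b i \<in> {1..d} \<and> v i \<in> carrier (V (b i)) \<and> x i = emb (b i) (v i)" by metis
  define w where "w = map b [1..<Suc n]"
  have lw: "letter w i = b i" if "i \<in> {1..n}" for i using that by (auto simp: w_def letter_def simp del: upt_Suc)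
  have w: "w \<in> words d n" using bv by (auto simp: words_def w_def)
  have "z = tpure K W n (%i. emb (letter w i) (v i))" unfolding x(1) using bv lw by (intro TW.pure_cong) simp
  moreover have "v i \<in> carrier (V (letter w i))" if "i \<in> {1..n}" for i using bv[OF that] lw[OF that] by simp
  note h = homogeneous_tpure[OF w this]
  have "iota w (pp (cont w) (%b j. v (position w b j))) \<in> iota w ` pp (cont w) ` Collect (fam (cont w))"
   using h(1) by (intro imageI) simp
  ultimately show ?thesis using h(2) by (intro UN_I[OF w]) simp
 qed
 then have "tpure K W n ` (\<Pi>\<^sub>E i\<in>{1..n}. ?G) <= (\<Union>w\<in>words d n. iota w ` pp (cont w) ` Collect (fam (cont w)))" by (rule subsetI)
 moreover have "(\<Union>w\<in>words d n. iota w ` pp (cont w) ` Collect (fam (cont w))) <= carW n"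
 proof (intro UN_least image_subsetI)
  fix w y assume w: "w \<in> words d n" and "y \<in> pp (cont w) ` Collect (fam (cont w))"
  then obtain v where v: "fam (cont w) v" and y: "y = pp (cont w) v" by blast
  show "iota w y \<in> carW n" unfolding y by (rule iota_closed[OF w pp_closed[OF v]])
 qed
 ultimately show ?thesis by (rule spans_mono[OF sp])
qed

lemma iota_lin_eq:
 assumes "module K P" "lin K (tpow K W n) P f" "lin K (tpow K W n) P g"
  and "!!w y. w \<in> words d n ==> y \<in> carrier (U (cont w)) ==> f (iota w y) = g (iota w y)"
  and "z \<in> carW n"
 shows "f z = g z"
proof (rule lin_eq_on_spans[OF TW.tensor_module assms(1) spans_iota assms(2,3) _ assms(5)])
 fix x assume "x \<in> (\<Union>w\<in>words d n. iota w ` pp (cont w) ` Collect (fam (cont w)))"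
 then obtain w v where w: "w \<in> words d n" and v: "fam (cont w) v" and x: "x = iota w (pp (cont w) v)" by blast
 show "f x = g x" unfolding x by (rule assms(4)[OF w pp_closed[OF v]])
qed

end

section \<open>Unit laws in a tensor product of algebras\<close>

context tensor_algs
begin

lemma l_one: "z \<in> carrier TA ==> \<one>\<^bsub>TA\<^esub> \<otimes>\<^bsub>TA\<^esub> z = z" using A_ring
 by (simp add: pure_mult monoid.one_closed[OF ring.axioms(2)] monoid.l_one[OF ring.axioms(2)]
   tmap_id[OF M.tensor_prod_axioms])

lemma r_one:
 assumes z: "z \<in> carrier TA" shows "z \<otimes>\<^bsub>TA\<^esub> \<one>\<^bsub>TA\<^esub> = z"
proof -
 have "lin K (tensor K I A) (tensor K I A) (%z. z \<otimes>\<^bsub>TA\<^esub> \<one>\<^bsub>TA\<^esub>)" using mult_lin1[OF one_closed] by simp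
 then show ?thesis
 proof (rule M.tensor_lin_eq[OF M.tensor_module _ lin_id])
  show "z \<in> carrier (tensor K I A)" using z by simp
  fix x assume x: "x \<in> (\<Pi>\<^sub>E i\<in>I. carrier (A i))"
  have xc: "x i \<in> carrier (A i)" if "i \<in> I" for i using x that by (rule PiE_mem)
  have "pure K I A x \<otimes>\<^bsub>TA\<^esub> \<one>\<^bsub>TA\<^esub> = pure K I A (%i. x i \<otimes>\<^bsub>A i\<^esub> \<one>\<^bsub>A i\<^esub>)" unfolding tensor_alg_simps
   by (rule pure_mult_pure) (use xc A_ring monoid.one_closed[OF ring.axioms(2)] in auto)
  also have "... = pure K I A x" by (rule M.pure_cong) (rule monoid.r_one[OF ring.axioms(2)[OF A_ring] xc])
  finally show "pure K I A x \<otimes>\<^bsub>TA\<^esub> \<one>\<^bsub>TA\<^esub> = pure K I A x" .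
 qed
qed

end

section \<open>Monomial operators\<close>

text \<open>Leaves the braid groups aside: \<open>C b m\<close> is any algebra of operators on the
  \<open>m\<close>-th power of \<open>V b\<close>. Later it is the image of the group algebra of the
  braid group on \<open>m\<close> strands.\<close>

locale block_tensor = word_tensor K d V for K :: "'k ring" (structure) and d :: nat and V :: "nat => ('k, 'v) module" +
 fixes C :: "nat => nat => ((nat, 'v, 'k) tens => (nat, 'v, 'k) tens) set"
 assumes C_subsp: "!!b m. b \<in> {1..d} ==> subsp K (end_alg K (tpow K (V b) m)) (C b m)"
  and C_one: "!!b m. b \<in> {1..d} ==> \<one>\<^bsub>end_alg K (tpow K (V b) m)\<^esub> \<in> C b m"
  and C_mult: "!!b m f g. b \<in> {1..d} ==> f \<in> C b m ==> g \<in> C b m ==> f \<otimes>\<^bsub>end_alg K (tpow K (V b) m)\<^esub> g \<in> C b m"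
begin

sublocale O: op_tensor K "{1..d}" "%b. tpow K (V b) (\<nu> b)" "%b. C b (\<nu> b)" for \<nu>
 by (intro op_tensor.intro field finite_atLeastAtMost tpowV_module C_subsp C_one C_mult)

abbreviation "CA \<nu> \<equiv> %b. (end_alg K (tpow K (V b) (\<nu> b)))\<lparr>carrier := C b (\<nu> b)\<rparr>"
abbreviation "TC \<nu> \<equiv> tensor_alg K {1..d} (CA \<nu>)"
abbreviation "psi \<equiv> O.psi"

lemma finite_words: "finite (words d n)"
proof -
 have "words d n = {w. set w <= {1..d} \<and> length w = n}" by (auto simp: words_def)
 then show ?thesis using finite_lists_length_eq[of "{1..d}" n] by simp
qed

text \<open>The rearrangement \<open>s\<close> preserves contents, so the components of
  \<open>w\<close> and \<open>s w\<close> are two copies of the same space \<open>U (cont w)\<close>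
  and a block can act between them.\<close>

definition compatible :: "nat => (nat list => nat list) => (nat list => 'k) => _ => bool"
 where "compatible n s c X \<longleftrightarrow> (ALL w:words d n. s w \<in> words d n \<and> cont (s w) = cont w \<and> c w \<in> carrier K \<and>
  X w \<in> carrier (TC (cont w)))"

text \<open>A block matrix with one block per column: component \<open>w\<close> goes to component
  \<open>s w\<close> by the scalar \<open>c w\<close> times the operator of \<open>X w\<close>.
  Keeping the three data apart lets \<tau> use only the scalar, and \<sigma> only the rearrangement
  and the block.\<close>

definition mon :: "nat => (nat list => nat list) => (nat list => 'k) => (nat list => _) =>
  (nat, nat => 'v, 'k) tens => (nat, nat => 'v, 'k) tens"
 where "mon n s c X = (\<lambda>x\<in>carW n.
  \<Oplus>\<^bsub>tpow K W n\<^esub>w\<in>words d n. c w \<odot>\<^bsub>tpow K W n\<^esub> iota (s w) (psi (cont w) (X w) (prj w x)))"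

lemma iota_lin': "w' \<in> words d n ==> cont w' = cont w ==> lin K (U (cont w)) (tpow K W n) (iota w')"
 using iota_lin[of w' n] by simp

lemma mon_term_lin:
 assumes "w \<in> words d n" "w' \<in> words d n" "cont w' = cont w" "c \<in> carrier K" "X \<in> carrier (TC (cont w))"
 shows "linW n (%x. c \<odot>\<^bsub>tpow K W n\<^esub> iota w' (psi (cont w) X (prj w x)))"
 by (rule lin_smult_map[OF TW.tensor_module
    lin_comp[OF lin_comp[OF prj_lin[OF assms(1)] O.psi_apply_lin[OF assms(5)]] iota_lin'[OF assms(2,3)]] assms(4)])

lemma mon_closed:
 assumes "compatible n s c X" shows "mon n s c X \<in> linmapsW n"
proof -
 have t: "linW n (%x. c w \<odot>\<^bsub>tpow K W n\<^esub> iota (s w) (psi (cont w) (X w) (prj w x)))"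
  if "w \<in> words d n" for w
  using assms that by (intro mon_term_lin) (auto simp: compatible_def)
 show ?thesis unfolding mon_def
  by (rule restrict_linear_maps[OF TW.tensor_module lin_finsum_map[OF TW.tensor_module finite_words t]])
qed

lemma finsum_single:
 assumes M: "module K M" and A: "finite A" "a \<in> A" and f: "!!i. i \<in> A ==> i ~= a ==> f i = \<zero>\<^bsub>M\<^esub>" "f a \<in> carrier M"
 shows "(\<Oplus>\<^bsub>M\<^esub>i\<in>A. f i) = f a"
proof -
 interpret M: module K M by fact
 have "(\<Oplus>\<^bsub>M\<^esub>i\<in>A. f i) = (\<Oplus>\<^bsub>M\<^esub>i\<in>insert a (A - {a}). f i)" using A(2) by (simp add: insert_absorb)
 also have "... = f a \<oplus>\<^bsub>M\<^esub> (\<Oplus>\<^bsub>M\<^esub>i\<in>A - {a}. f i)" by (rule M.finsum_insert) (use A f in auto)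
 also have "(\<Oplus>\<^bsub>M\<^esub>i\<in>A - {a}. f i) = \<zero>\<^bsub>M\<^esub>" by (rule M.add.finprod_one_eqI) (use f in auto)
 finally show ?thesis using f(2) by simp
qed

lemma psi_closed':
 "X \<in> carrier (TC \<nu>) ==> y \<in> carrier (U \<nu>) ==> psi \<nu> X y \<in> carrier (U \<nu>)"
 by (rule lin_closed[OF O.psi_apply_lin])

lemma mon_iota:
 assumes comp: "compatible n s c X" and w: "w \<in> words d n" and y: "y \<in> carrier (U (cont w))"
 shows "mon n s c X (iota w y) = c w \<odot>\<^bsub>tpow K W n\<^esub> iota (s w) (psi (cont w) (X w) y)"
proof -
 let ?f = "%u. c u \<odot>\<^bsub>tpow K W n\<^esub> iota (s u) (psi (cont u) (X u) (prj u (iota w y)))"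
 have t: "linW n (%x. c u \<odot>\<^bsub>tpow K W n\<^esub> iota (s u) (psi (cont u) (X u) (prj u x)))"
  if "u \<in> words d n" for u
  using comp that by (intro mon_term_lin) (auto simp: compatible_def)
 have iw: "iota w y \<in> carW n" by (rule iota_closed[OF w y])
 have "mon n s c X (iota w y) = (\<Oplus>\<^bsub>tpow K W n\<^esub>u\<in>words d n. ?f u)" unfolding mon_def using iw by simp
 also have "... = ?f w"
 proof (rule finsum_single[where f = ?f and a = w, OF TW.tensor_module finite_words w _ lin_closed[OF t[OF w] iw]])
  fix u assume u: "u \<in> words d n" "u ~= w"
  have X: "X u \<in> carrier (TC (cont u))" "c u \<in> carrier K" "s u \<in> words d n" "cont (s u) = cont u"
   using comp u(1) by (auto simp: compatible_def)
  have "prj u (iota w y) = \<zero>\<^bsub>U (cont u)\<^esub>" using prj_iota[OF u(1) w y] u(2) by simp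
  then have "?f u = c u \<odot>\<^bsub>tpow K W n\<^esub> \<zero>\<^bsub>tpow K W n\<^esub>" using lin_zero[OF U_module U_module O.psi_apply_lin[OF X(1)]]
    lin_zero[OF U_module TW.tensor_module iota_lin'[OF X(3,4)]] by simp
  then show "?f u = \<zero>\<^bsub>tpow K W n\<^esub>" using TW.T.smult_r_null[OF X(2)] by simp
 qed
 also have "... = c w \<odot>\<^bsub>tpow K W n\<^esub> iota (s w) (psi (cont w) (X w) y)" using prj_iota[OF w w y] by simp
 finally show ?thesis .
qed

lemma linear_maps_iota_eq:
 assumes "f \<in> linear_maps K (tpow K W n) P" "g \<in> linear_maps K (tpow K W n) P" "module K P"
  and "!!w y. w \<in> words d n ==> y \<in> carrier (U (cont w)) ==> f (iota w y) = g (iota w y)"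
 shows "f = g"
 using assms(1,2)
 by (rule linear_maps_ext) (rule iota_lin_eq[OF assms(3) linear_maps_lin[OF assms(1)] linear_maps_lin[OF assms(2)] assms(4)])

lemma mon_unique:
 assumes "compatible n s c X" "f \<in> linmapsW n"
  and "!!w y. w \<in> words d n ==> y \<in> carrier (U (cont w)) ==> f (iota w y) = c w \<odot>\<^bsub>tpow K W n\<^esub> iota (s w) (psi (cont w) (X w) y)"
 shows "mon n s c X = f"
 by (rule linear_maps_iota_eq[OF mon_closed[OF assms(1)] assms(2) TW.tensor_module]) (simp add: mon_iota[OF assms(1)] assms(3))

lemma mon_cong:
 assumes "compatible n s c X" "compatible n s' c' X'"
  and "!!w. w \<in> words d n ==> s w = s' w \<and> c w = c' w \<and> X w = X' w"
 shows "mon n s c X = mon n s' c' X'"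
 by (rule mon_unique[OF assms(1) mon_closed[OF assms(2)]]) (simp add: mon_iota[OF assms(2)] assms(3))

lemma compatible_comp:
 assumes "compatible n s c X" "compatible n s' c' X'"
 shows "compatible n (%w. s (s' w)) (%w. c (s' w) \<otimes> c' w) (%w. X (s' w) \<otimes>\<^bsub>TC (cont w)\<^esub> X' w)"
proof -
 interpret K: cring K by (rule K_cring)
 show ?thesis unfolding compatible_def
 proof (intro ballI conjI)
  fix w assume w: "w \<in> words d n"
  have s': "s' w \<in> words d n" "cont (s' w) = cont w" "c' w \<in> carrier K" "X' w \<in> carrier (TC (cont w))"
   using assms(2) w unfolding compatible_def by blast+
  have s: "s (s' w) \<in> words d n" "cont (s (s' w)) = cont (s' w)" "c (s' w) \<in> carrier K"
   "X (s' w) \<in> carrier (TC (cont (s' w)))"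
   using assms(1) s'(1) unfolding compatible_def by blast+
  show "s (s' w) \<in> words d n" "cont (s (s' w)) = cont w" "c (s' w) \<otimes> c' w \<in> carrier K" using s s' by simp_all
  show "X (s' w) \<otimes>\<^bsub>TC (cont w)\<^esub> X' w \<in> carrier (TC (cont w))" by (rule O.CA.mult_closed[OF s(4)[unfolded s'(2)] s'(4)])
 qed
qed

text \<open>Monomial operators are closed under products, with explicit data. Since
  \<open>mon_cong\<close> compares data, identities between such operators can be checked word by
  word, without touching tensors.\<close>

lemma mon_mult:
 assumes "compatible n s c X" "compatible n s' c' X'"
 shows "mon n s c X \<otimes>\<^bsub>end_alg K (tpow K W n)\<^esub> mon n s' c' X' =
  mon n (%w. s (s' w)) (%w. c (s' w) \<otimes> c' w) (%w. X (s' w) \<otimes>\<^bsub>TC (cont w)\<^esub> X' w)"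
  (is "_ = ?r")
proof (rule mon_unique[OF compatible_comp[OF assms], symmetric])
 interpret K: cring K by (rule K_cring)
 show "mon n s c X \<otimes>\<^bsub>end_alg K (tpow K W n)\<^esub> mon n s' c' X' \<in> linmapsW n"
  using compose_linear_maps[OF TW.tensor_module mon_closed[OF assms(1)] mon_closed[OF assms(2)]] by simp
 fix w y assume w: "w \<in> words d n" and y: "y \<in> carrier (U (cont w))"
 let ?T = "tpow K W n"
 have s': "s' w \<in> words d n" "cont (s' w) = cont w" "c' w \<in> carrier K" "X' w \<in> carrier (TC (cont w))"
  using assms(2) w unfolding compatible_def by blast+
 have s: "s (s' w) \<in> words d n" "cont (s (s' w)) = cont w" "c (s' w) \<in> carrier K"
  "X (s' w) \<in> carrier (TC (cont w))"
  using assms(1) s'(1,2) unfolding compatible_def by fastforce+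
 let ?y = "psi (cont w) (X' w) y"
 have y': "?y \<in> carrier (U (cont w))" by (rule psi_closed'[OF s'(4) y])
 have iy': "iota (s' w) ?y \<in> carrier ?T" using iota_closed[OF s'(1)] y' s'(2) by simp
 have y'': "iota (s (s' w)) (psi (cont w) (X (s' w)) ?y) \<in> carrier ?T"
  using iota_closed[OF s(1)] psi_closed'[OF s(4) y'] s(2) by simp
 have "(mon n s c X \<otimes>\<^bsub>end_alg K ?T\<^esub> mon n s' c' X') (iota w y) = mon n s c X (mon n s' c' X' (iota w y))"
  using iota_closed[OF w y] by (simp add: compose_eq)
 also have "... = mon n s c X (c' w \<odot>\<^bsub>?T\<^esub> iota (s' w) ?y)" using mon_iota[OF assms(2) w y] by simp
 also have "... = c' w \<odot>\<^bsub>?T\<^esub> mon n s c X (iota (s' w) ?y)"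
  by (rule lin_smult[OF linear_maps_lin[OF mon_closed[OF assms(1)]] s'(3) iy'])
 also have "mon n s c X (iota (s' w) ?y) = c (s' w) \<odot>\<^bsub>?T\<^esub> iota (s (s' w)) (psi (cont w) (X (s' w)) ?y)"
  using mon_iota[OF assms(1) s'(1)] y' s'(2) by simp
 also have "c' w \<odot>\<^bsub>?T\<^esub> (c (s' w) \<odot>\<^bsub>?T\<^esub> iota (s (s' w)) (psi (cont w) (X (s' w)) ?y)) =
   (c (s' w) \<otimes> c' w) \<odot>\<^bsub>?T\<^esub> iota (s (s' w)) (psi (cont w) (X (s' w)) ?y)"
  using TW.T.smult_assoc1[OF s'(3) s(3) y''] comm_monoid.m_comm[OF cring.axioms(2)[OF K_cring] s'(3) s(3)] by simp
 also have "psi (cont w) (X (s' w)) ?y = psi (cont w) (X (s' w) \<otimes>\<^bsub>TC (cont w)\<^esub> X' w) y"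
  using O.psi_mult[OF s(4) s'(4)] y by (simp add: compose_eq)
 finally show "(mon n s c X \<otimes>\<^bsub>end_alg K ?T\<^esub> mon n s' c' X') (iota w y) =
   (c (s' w) \<otimes> c' w) \<odot>\<^bsub>?T\<^esub> iota (s (s' w)) (psi (cont w) (X (s' w) \<otimes>\<^bsub>TC (cont w)\<^esub> X' w) y)" .
qed

lemma compatible_one: "compatible n (%w. w) (%w. \<one>) (%w. \<one>\<^bsub>TC (cont w)\<^esub>)" unfolding compatible_def
 by (simp del: tensor_alg_simps add: O.CA.one_closed cring_one_closed[OF K_cring])

lemma mon_one: "mon n (%w. w) (%w. \<one>) (%w. \<one>\<^bsub>TC (cont w)\<^esub>) = \<one>\<^bsub>end_alg K (tpow K W n)\<^esub>"
proof (rule mon_unique[OF compatible_one])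
 show "\<one>\<^bsub>end_alg K (tpow K W n)\<^esub> \<in> linmapsW n"
  using restrict_linear_maps[OF TW.tensor_module lin_id] by simp
 fix w y assume w: "w \<in> words d n" and y: "y \<in> carrier (U (cont w))"
 show "\<one>\<^bsub>end_alg K (tpow K W n)\<^esub> (iota w y) = \<one> \<odot>\<^bsub>tpow K W n\<^esub> iota w (psi (cont w) \<one>\<^bsub>TC (cont w)\<^esub> y)"
  using iota_closed[OF w y] y TW.T.smult_one[OF iota_closed[OF w y]] unfolding O.psi_one by simp
qed

definition slot :: "(nat => nat) => nat => ((nat, 'v, 'k) tens => (nat, 'v, 'k) tens) => _"
 where "slot \<nu> b f = pure K {1..d} (CA \<nu>) (%c. if c = b then f else \<one>\<^bsub>CA \<nu> c\<^esub>)"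

lemma CA_one: "b \<in> {1..d} ==> \<one>\<^bsub>CA \<nu> b\<^esub> \<in> carrier (CA \<nu> b)" using C_one by simp

lemma slot_closed:
 assumes "b \<in> {1..d}" "f \<in> C b (\<nu> b)" shows "slot \<nu> b f \<in> carrier (TC \<nu>)"
 unfolding slot_def tensor_alg_simps
 by (rule O.CA.M.pure_closed) (use assms C_one in auto)

lemma CA_l_r_one:
 assumes b: "b \<in> {1..d}" and f: "f \<in> C b (\<nu> b)"
 shows "\<one>\<^bsub>CA \<nu> b\<^esub> \<otimes>\<^bsub>CA \<nu> b\<^esub> f = f" "f \<otimes>\<^bsub>CA \<nu> b\<^esub> \<one>\<^bsub>CA \<nu> b\<^esub> = f"
proof -
 interpret M: Group.monoid "CA \<nu> b" by (rule ring.axioms(2)[OF O.CA.A_ring[OF b]])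
 have "f \<in> carrier (CA \<nu> b)" using f by simp
 then show "\<one>\<^bsub>CA \<nu> b\<^esub> \<otimes>\<^bsub>CA \<nu> b\<^esub> f = f" "f \<otimes>\<^bsub>CA \<nu> b\<^esub> \<one>\<^bsub>CA \<nu> b\<^esub> = f" by (rule M.l_one M.r_one)+
qed

lemma slot_mult:
 assumes b: "b \<in> {1..d}" and f: "f \<in> C b (\<nu> b)" "g \<in> C b (\<nu> b)"
 shows "slot \<nu> b f \<otimes>\<^bsub>TC \<nu>\<^esub> slot \<nu> b g = slot \<nu> b (f \<otimes>\<^bsub>end_alg K (tpow K (V b) (\<nu> b))\<^esub> g)"
proof -
 have "slot \<nu> b f \<otimes>\<^bsub>TC \<nu>\<^esub> slot \<nu> b g = pure K {1..d} (CA \<nu>) (%c.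
   (if c = b then f else \<one>\<^bsub>CA \<nu> c\<^esub>) \<otimes>\<^bsub>CA \<nu> c\<^esub> (if c = b then g else \<one>\<^bsub>CA \<nu> c\<^esub>))"
  unfolding slot_def by (rule O.CA.pure_mult_pure) (use f C_one in auto)
 also have "... = slot \<nu> b (f \<otimes>\<^bsub>end_alg K (tpow K (V b) (\<nu> b))\<^esub> g)" unfolding slot_def
 proof (rule O.CA.M.pure_cong)
  fix c assume c: "c \<in> {1..d}"
  show "(if c = b then f else \<one>\<^bsub>CA \<nu> c\<^esub>) \<otimes>\<^bsub>CA \<nu> c\<^esub> (if c = b then g else \<one>\<^bsub>CA \<nu> c\<^esub>) =
   (if c = b then f \<otimes>\<^bsub>end_alg K (tpow K (V b) (\<nu> b))\<^esub> g else \<one>\<^bsub>CA \<nu> c\<^esub>)"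
   using CA_l_r_one(1)[where \<nu> = \<nu> and f = "\<one>\<^bsub>CA \<nu> c\<^esub>", OF c] CA_one[OF c, of \<nu>] by (cases "c = b") simp_all
 qed
 finally show ?thesis .
qed

lemma slot_commute:
 assumes b: "b \<in> {1..d}" "c \<in> {1..d}" "b ~= c" and f: "f \<in> C b (\<nu> b)" "g \<in> C c (\<nu> c)"
 shows "slot \<nu> b f \<otimes>\<^bsub>TC \<nu>\<^esub> slot \<nu> c g = slot \<nu> c g \<otimes>\<^bsub>TC \<nu>\<^esub> slot \<nu> b f"
proof -
 let ?f = "%e. if e = b then f else \<one>\<^bsub>CA \<nu> e\<^esub>" and ?g = "%e. if e = c then g else \<one>\<^bsub>CA \<nu> e\<^esub>"
 have "slot \<nu> b f \<otimes>\<^bsub>TC \<nu>\<^esub> slot \<nu> c g = pure K {1..d} (CA \<nu>) (%e. ?f e \<otimes>\<^bsub>CA \<nu> e\<^esub> ?g e)"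
  unfolding slot_def by (rule O.CA.pure_mult_pure) (use f C_one in auto)
 also have "... = pure K {1..d} (CA \<nu>) (%e. ?g e \<otimes>\<^bsub>CA \<nu> e\<^esub> ?f e)"
 proof (rule O.CA.M.pure_cong)
  fix e assume e: "e \<in> {1..d}"
  show "?f e \<otimes>\<^bsub>CA \<nu> e\<^esub> ?g e = ?g e \<otimes>\<^bsub>CA \<nu> e\<^esub> ?f e"
   using CA_l_r_one[where \<nu> = \<nu>, OF b(1) f(1)] CA_l_r_one[where \<nu> = \<nu>, OF b(2) f(2)] b(3)
   by (cases "e = b"; cases "e = c") (simp_all only: if_True if_False simp_thms)
 qed
 also have "... = slot \<nu> c g \<otimes>\<^bsub>TC \<nu>\<^esub> slot \<nu> b f"
  unfolding slot_def by (rule O.CA.pure_mult_pure[symmetric]) (use f C_one in auto)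
 finally show ?thesis .
qed

lemma slot_one: "b \<in> {1..d} ==> slot \<nu> b \<one>\<^bsub>end_alg K (tpow K (V b) (\<nu> b))\<^esub> = \<one>\<^bsub>TC \<nu>\<^esub>"
 unfolding slot_def tensor_alg_simps by (rule O.CA.M.pure_cong) simp

end

section \<open>Adjacent transpositions of words\<close>

text \<open>Positions are counted from 1, so the entries exchanged have list indices
  \<open>i - 1\<close> and \<open>i\<close>.\<close>

definition sw :: "nat => nat list => nat list"
 where "sw i w = take (i - 1) w @ [w ! i, w ! (i - 1)] @ drop (i + 1) w"

lemma word_split:
 assumes "1 \<le> i" "i < length w"
 obtains u a b v where "w = u @ a # b # v" "length u = i - 1"
proof
 have "w = take (i - 1) w @ w ! (i - 1) # drop (Suc (i - 1)) w" using assms by (intro id_take_nth_drop) simp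
 moreover have "drop (Suc (i - 1)) w = w ! i # drop (Suc i) w" using assms Cons_nth_drop_Suc[of i w] by simp
 ultimately show "w = take (i - 1) w @ w ! (i - 1) # w ! i # drop (i + 1) w" by (simp only: Suc_eq_plus1)
qed (use assms in simp)

lemma sw_split: "1 \<le> i ==> length u = i - 1 ==> sw i (u @ a # b # v) = u @ b # a # v"
 by (auto simp: sw_def nth_append Suc_diff_le)

lemma letter_append:
 assumes "length u = i - 1" "1 \<le> i" "1 \<le> k"
 shows "letter (u @ a # b # v) k =
  (if k < i then letter u k else if k = i then a else if k = i + 1 then b else letter v (k - i - 1))"
proof -
 consider "k < i" | "k = i" | "k = i + 1" | m where "k = i + 2 + m"
  by (metis add_2_eq_Suc' add_Suc_right less_antisym less_iff_Suc_add linorder_neqE_nat add.commute Suc_eq_plus1 add.assoc one_add_one)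
 then show ?thesis using assms by cases (auto simp: letter_def nth_append)
qed

lemma letter_sw:
 assumes "1 \<le> i" "i < length w" "1 \<le> k"
 shows "letter (sw i w) k = letter w (transpose i (i + 1) k)"
proof -
 obtain u a b v where w: "w = u @ a # b # v" "length u = i - 1" using word_split[OF assms(1,2)] .
 show ?thesis unfolding w(1) sw_split[OF assms(1) w(2)] using assms by (auto simp: letter_append[OF w(2)] transpose_def)
qed

lemma count_sw:
 assumes "1 \<le> i" "i < length w" shows "count_list (sw i w) c = count_list w c"
proof -
 obtain u a b v where w: "w = u @ a # b # v" "length u = i - 1" using word_split[OF assms] .
 show ?thesis unfolding w(1) sw_split[OF assms(1) w(2)] by simp
qed

lemma length_sw: "1 \<le> i ==> i < length w ==> length (sw i w) = length w" by (simp add: sw_def)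

lemma set_sw:
 assumes "1 \<le> i" "i < length w" shows "set (sw i w) = set w"
proof -
 obtain u a b v where w: "w = u @ a # b # v" "length u = i - 1" using word_split[OF assms] .
 show ?thesis unfolding w(1) sw_split[OF assms(1) w(2)] by auto
qed

text \<open>Distinct letters carry their ranks along when they are exchanged. For equal letters this
  would fail: the word stays the same while the transposition exchanges two different ranks.\<close>

lemma rank_sw:
 assumes "1 \<le> i" "i < length w" "letter w i ~= letter w (i + 1)" "1 \<le> k"
 shows "rank (sw i w) k = rank w (transpose i (i + 1) k)"
proof -
 obtain u a b v where w: "w = u @ a # b # v" "length u = i - 1" using word_split[OF assms(1,2)] .
 have ab: "a ~= b" using assms(1,3) unfolding w(1) by (simp add: letter_append[OF w(2)])
 have l: "letter (u @ b # a # v) k = letter (u @ a # b # v) (transpose i (i + 1) k)"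
  using letter_sw[OF assms(1,2,4)] unfolding w(1) sw_split[OF assms(1) w(2)] .
 have t: "k < i ==> take k (u @ z) = take k u" "take i (u @ x # y # v) = u @ [x]" "take (i + 1) (u @ x # y # v) = u @ [x, y]"
  "i + 1 < k ==> take k (u @ x # y # v) = u @ x # y # take (k - i - 1) v" for x y z
  using w(2) assms(1) by (auto simp: take_Cons')
 consider "k < i" | "k = i" | "k = i + 1" | "i + 1 < k" by linarith
 then show ?thesis unfolding w(1) sw_split[OF assms(1) w(2)] rank_def l
 proof cases
  case 1
  then show "count_list (take k (u @ b # a # v)) (letter (u @ a # b # v) (transpose i (i + 1) k)) =
   count_list (take (transpose i (i + 1) k) (u @ a # b # v)) (letter (u @ a # b # v) (transpose i (i + 1) k))"
   using assms(1) t(1)[OF 1, of "b # a # v"] t(1)[OF 1, of "a # b # v"] by (simp add: transpose_def del: take_append)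
 next
  case 2
  then show "count_list (take k (u @ b # a # v)) (letter (u @ a # b # v) (transpose i (i + 1) k)) =
   count_list (take (transpose i (i + 1) k) (u @ a # b # v)) (letter (u @ a # b # v) (transpose i (i + 1) k))"
   using assms(1) ab t(2)[of b a] t(3)[of a b] by (simp add: letter_append[OF w(2)] del: append.simps)
 next
  case 3
  then show "count_list (take k (u @ b # a # v)) (letter (u @ a # b # v) (transpose i (i + 1) k)) =
   count_list (take (transpose i (i + 1) k) (u @ a # b # v)) (letter (u @ a # b # v) (transpose i (i + 1) k))"
   using assms(1) ab t(2)[of a b] t(3)[of b a] by (simp add: letter_append[OF w(2)] del: append.simps)
 next
  case 4
  then have "transpose i (i + 1) k = k" by (simp add: transpose_def)
  then show "count_list (take k (u @ b # a # v)) (letter (u @ a # b # v) (transpose i (i + 1) k)) =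
   count_list (take (transpose i (i + 1) k) (u @ a # b # v)) (letter (u @ a # b # v) (transpose i (i + 1) k))"
   using t(4)[OF 4, of b a] t(4)[OF 4, of a b] ab by (simp only:) simp
 qed
qed

lemma sw_same:
 assumes "1 \<le> i" "i < length w" "letter w i = letter w (i + 1)" shows "sw i w = w"
proof -
 obtain u a b v where w: "w = u @ a # b # v" "length u = i - 1" using word_split[OF assms(1,2)] .
 have "a = b" using assms(1,3) unfolding w(1) by (simp add: letter_append[OF w(2)])
 then show ?thesis unfolding w(1) sw_split[OF assms(1) w(2)] by simp
qed

lemma rank_Suc:
 assumes "1 \<le> i" "i < length w" "letter w i = letter w (i + 1)" shows "rank w (i + 1) = rank w i + 1"
proof -
 have "take (i + 1) w = take i w @ [letter w (i + 1)]"
  using assms take_Suc_conv_app_nth[of i w] by (simp add: letter_def flip: Suc_eq_plus1)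
 then show ?thesis using assms(3) by (simp add: rank_def)
qed

lemma rank_mono:
 assumes "1 \<le> i" "i < j" "j \<le> length w" "letter w i = letter w j" shows "rank w i < rank w j"
proof -
 have "take j w = take i w @ take (j - i) (drop i w)" using assms(2) by (metis less_imp_add_positive add_diff_cancel_left' take_add)
 moreover have "letter w j \<in> set (take (j - i) (drop i w))"
  using assms by (auto simp: letter_def in_set_conv_nth intro!: exI[of _ "j - i - 1"])
 then have "count_list (take (j - i) (drop i w)) (letter w j) ~= 0" by (simp add: count_list_0_iff)
 ultimately show ?thesis using assms(4) by (simp add: rank_def)
qed

lemma sw_words: "1 \<le> i ==> i < n ==> w \<in> words d n ==> sw i w \<in> words d n" by (auto simp: words_def length_sw set_sw)

lemma content_sw: "1 \<le> i ==> i < length w ==> content d (sw i w) = content d w" by (simp add: content_def count_sw)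

lemma sw_sw:
 assumes "1 \<le> i" "i < length w" shows "sw i (sw i w) = w"
proof -
 obtain u a b v where w: "w = u @ a # b # v" "length u = i - 1" using word_split[OF assms] .
 show ?thesis unfolding w(1) sw_split[OF assms(1) w(2)] ..
qed

section \<open>The framed braid group acts by monomial operators\<close>

text \<open>Transports a defining relation along a homomorphism that is given; this is how the
  operators of the braid generators are known to satisfy the braid relations.\<close>

lemma presented_alg_hom_relation:
 assumes "cring K" "unital_algebra K E" and h: "h \<in> alg_hom K (group_alg K (presented_group S R)) E"
  and "(l, r) \<in> R" and lr: "l \<in> lists (S \<times> UNIV)" "r \<in> lists (S \<times> UNIV)"
 shows "eval_word E (%x. h (basis_vec K (wcls S R [x]))) l = eval_word E (%x. h (basis_vec K (wcls S R [x]))) r"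
proof -
 have ev: "h (basis_vec K (wcls S R w)) = eval_word E (%x. h (basis_vec K (wcls S R [x]))) w" if "w \<in> lists (S \<times> UNIV)" for w
  using that
 proof (induction w)
  case Nil
  then show ?case using presented_alg_hom_Nil[OF assms(1,2) h] by (simp add: eval_word_def)
 next
  case (Cons x w)
  then show ?case using presented_alg_hom_Cons[OF assms(1,2) h, of x w] by (simp add: eval_word_def)
 qed
 have "wcls S R l = wcls S R r" using wcls_eq_iff[OF lr] word_eq.relation[of "[]" S "[]" l r R] assms(4) lr by simp
 then show ?thesis using ev[OF lr(1)] ev[OF lr(2)] by simp
qed

lemma group_alg_hom_image:
 assumes K: "cring K" and G: "group G" and E: "unital_algebra K E" and h: "h \<in> alg_hom K (group_alg K G) E"
 shows "subsp K E (h ` carrier (group_alg K G))" and "\<one>\<^bsub>E\<^esub> \<in> h ` carrier (group_alg K G)"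
  and "f \<in> h ` carrier (group_alg K G) ==> g \<in> h ` carrier (group_alg K G) ==> f \<otimes>\<^bsub>E\<^esub> g \<in> h ` carrier (group_alg K G)"
proof -
 let ?F = "free_mod K (carrier G)" and ?k = "group_alg K G"
 interpret F: module K ?F by (rule free_mod_module[OF K])
 interpret E: unital_algebra K E by fact
 have l: "lin K ?F E h" using alg_hom_lin[OF h] by (simp only: lin_group_alg)
 show "subsp K E (h ` carrier ?k)" unfolding subsp_def group_alg_simps
 proof (intro conjI ballI)
  show "h ` carrier ?F <= carrier E" by (rule image_subsetI) (rule lin_closed[OF l])
  show "\<zero>\<^bsub>E\<^esub> \<in> h ` carrier ?F" using lin_zero[OF F.module_axioms E.module_axioms l] F.zero_closed by (metis image_eqI)
  fix x assume "x \<in> h ` carrier ?F"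
  then obtain f where f: "x = h f" "f \<in> carrier ?F" by (rule imageE)
  { fix y assume "y \<in> h ` carrier ?F"
   then obtain g where g: "y = h g" "g \<in> carrier ?F" by (rule imageE)
   show "x \<oplus>\<^bsub>E\<^esub> y \<in> h ` carrier ?F"
    unfolding f(1) g(1) using lin_add[OF l f(2) g(2)] F.a_closed[OF f(2) g(2)] by (metis image_eqI) }
  fix c assume c: "c \<in> carrier K"
  show "c \<odot>\<^bsub>E\<^esub> x \<in> h ` carrier ?F" unfolding f(1) using lin_smult[OF l c f(2)] F.smult_closed[OF c f(2)] by (metis image_eqI)
 qed
 have "h \<one>\<^bsub>?k\<^esub> = \<one>\<^bsub>E\<^esub>" using h unfolding alg_hom_iff by blast
 moreover have "\<one>\<^bsub>?k\<^esub> \<in> carrier ?k"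
  unfolding group_alg_simps by (rule basis_vec_closed[OF K]) (rule monoid.one_closed[OF group.is_monoid[OF G]])
 ultimately show "\<one>\<^bsub>E\<^esub> \<in> h ` carrier ?k" by (metis image_eqI)
 assume fg: "f \<in> h ` carrier ?k" "g \<in> h ` carrier ?k"
 obtain x where x: "f = h x" "x \<in> carrier ?k" using fg(1) by (rule imageE)
 obtain y where y: "g = h y" "y \<in> carrier ?k" using fg(2) by (rule imageE)
 have xy: "x \<in> carrier ?F" "y \<in> carrier ?F" using x y by (simp_all only: group_alg_simps)
 have "lin K ?F ?F (free_lift K ?F (%z. shift K G z y))"
  by (rule free_lift_lin[OF F.module_axioms lin_closed[OF shift_lin[OF K G] xy(2)]])
 then have "x \<otimes>\<^bsub>?k\<^esub> y \<in> carrier ?k" unfolding group_alg_simps group_alg_mult[OF K G xy] using xy(1) by (rule lin_closed)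
 moreover have "h (x \<otimes>\<^bsub>?k\<^esub> y) = f \<otimes>\<^bsub>E\<^esub> g" using h x y unfolding alg_hom_iff by blast
 ultimately show "f \<otimes>\<^bsub>E\<^esub> g \<in> h ` carrier ?k" by (metis image_eqI)
qed

locale braid_setup = word_tensor K d V for K :: "'k ring" (structure) and d :: nat and V :: "nat => ('k, 'v) module" +
 fixes \<phi> :: "nat => nat => (fb_gen word set => 'k) => (nat, 'v, 'k) tens => (nat, 'v, 'k) tens"
  and \<zeta> :: 'k
 assumes phi_hom: "!!b m. b \<in> {1..d} ==> \<phi> b m \<in> alg_hom K (group_alg K (braid_group m)) (end_alg K (tpow K (V b) m))"
  and zeta: "\<zeta> \<in> carrier K" "\<zeta> [^] d = \<one>" and d_pos: "1 \<le> d"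
begin

definition Cb :: "nat => nat => ((nat, 'v, 'k) tens => (nat, 'v, 'k) tens) set"
 where "Cb b m = \<phi> b m ` carrier (group_alg K (braid_group m))"

abbreviation "EV b m \<equiv> end_alg K (tpow K (V b) m)"

lemma EV: "b \<in> {1..d} ==> unital_algebra K (EV b m)" by (rule unital_algebra_end[OF tpowV_module])

lemma braid_group_group: "group (braid_group m)" unfolding braid_group_def by (rule presented_group_group)

lemma Cb_subsp: "b \<in> {1..d} ==> subsp K (EV b m) (Cb b m)"
 and Cb_one: "b \<in> {1..d} ==> \<one>\<^bsub>EV b m\<^esub> \<in> Cb b m"
 and Cb_mult: "b \<in> {1..d} ==> f \<in> Cb b m ==> g \<in> Cb b m ==> f \<otimes>\<^bsub>EV b m\<^esub> g \<in> Cb b m"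
 unfolding Cb_def
 by (rule group_alg_hom_image[OF K_cring braid_group_group EV phi_hom], assumption+)+

sublocale block_tensor K d V Cb by (intro block_tensor.intro block_tensor_axioms.intro word_tensor_axioms Cb_subsp Cb_one Cb_mult)

text \<open>The flag \<open>e\<close> selects the generator (\<open>True\<close>) or its inverse
  (\<open>False\<close>), as in the letters of a word.\<close>

definition ph :: "nat => nat => nat => bool => (nat, 'v, 'k) tens => (nat, 'v, 'k) tens"
 where "ph b m r e = \<phi> b m (basis_vec K (wcls (braid_gens m) (braid_rels m) [(Sg r, e)]))"

lemma phi_hom': "b \<in> {1..d} ==> \<phi> b m \<in> alg_hom K (group_alg K (presented_group (braid_gens m) (braid_rels m))) (EV b m)"
 using phi_hom unfolding braid_group_def .

lemma Sg_gen: "Sg r \<in> braid_gens m \<longleftrightarrow> 1 \<le> r \<and> r < m" by (auto simp: braid_gens_def)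

lemma ph_Cb:
 assumes "1 \<le> r" "r < m" shows "ph b m r e \<in> Cb b m"
proof -
 have "wcls (braid_gens m) (braid_rels m) [(Sg r, e)] \<in> carrier (braid_group m)"
  unfolding braid_group_def presented_group_carrier using assms by (intro imageI) (simp add: Sg_gen)
 then show ?thesis unfolding Cb_def ph_def group_alg_simps by (intro imageI basis_vec_closed[OF K_cring])
qed

lemma ph_inverse:
 assumes "b \<in> {1..d}" "1 \<le> r" "r < m" shows "ph b m r e \<otimes>\<^bsub>EV b m\<^esub> ph b m r (\<not> e) = \<one>\<^bsub>EV b m\<^esub>"
 unfolding ph_def
 by (rule presented_alg_hom_inverse[OF K_cring EV[OF assms(1)] phi_hom'[OF assms(1)]]) (use assms in \<open>simp add: Sg_gen\<close>)

lemma ph_far: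
 assumes b: "b \<in> {1..d}" and r: "1 \<le> r" "r < m" "1 \<le> r'" "r' < m" "r + 1 < r' \<or> r' + 1 < r"
 shows "ph b m r True \<otimes>\<^bsub>EV b m\<^esub> ph b m r' True = ph b m r' True \<otimes>\<^bsub>EV b m\<^esub> ph b m r True"
proof -
 interpret E: unital_algebra K "EV b m" by (rule EV[OF b])
 have "([pos (Sg r), pos (Sg r')], [pos (Sg r'), pos (Sg r)]) \<in> braid_rels m"
  unfolding braid_rels_def using r by (intro UnI1 CollectI exI[of _ r] exI[of _ r']) auto
 from presented_alg_hom_relation[OF K_cring EV[OF b] phi_hom'[OF b] this]
 have "eval_word (EV b m) (%x. \<phi> b m (basis_vec K (wcls (braid_gens m) (braid_rels m) [x]))) [pos (Sg r), pos (Sg r')] =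
  eval_word (EV b m) (%x. \<phi> b m (basis_vec K (wcls (braid_gens m) (braid_rels m) [x]))) [pos (Sg r'), pos (Sg r)]"
  using r by (simp add: Sg_gen)
 moreover have "ph b m s True \<in> carrier (EV b m)" if "1 \<le> s" "s < m" for s
  using ph_Cb[OF that] Cb_subsp[OF b] unfolding subsp_def by blast
 ultimately show ?thesis using r E.r_one by (simp add: eval_word_def ph_def del: end_alg_simps)
qed

lemma ph_braid:
 assumes b: "b \<in> {1..d}" and r: "1 \<le> r" "r + 1 < m"
 shows "ph b m r True \<otimes>\<^bsub>EV b m\<^esub> (ph b m (r + 1) True \<otimes>\<^bsub>EV b m\<^esub> ph b m r True) =
  ph b m (r + 1) True \<otimes>\<^bsub>EV b m\<^esub> (ph b m r True \<otimes>\<^bsub>EV b m\<^esub> ph b m (r + 1) True)"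
proof -
 interpret E: unital_algebra K "EV b m" by (rule EV[OF b])
 let ?r = "r + 1"
 have "([pos (Sg r), pos (Sg ?r), pos (Sg r)], [pos (Sg ?r), pos (Sg r), pos (Sg ?r)]) \<in> braid_rels m"
  unfolding braid_rels_def using r by (intro UnI2 CollectI exI[of _ r] exI[of _ ?r]) auto
 from presented_alg_hom_relation[OF K_cring EV[OF b] phi_hom'[OF b] this]
 have "eval_word (EV b m) (%x. \<phi> b m (basis_vec K (wcls (braid_gens m) (braid_rels m) [x]))) [pos (Sg r), pos (Sg ?r), pos (Sg r)] =
  eval_word (EV b m) (%x. \<phi> b m (basis_vec K (wcls (braid_gens m) (braid_rels m) [x]))) [pos (Sg ?r), pos (Sg r), pos (Sg ?r)]"
  using r by (simp add: Sg_gen)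
 moreover have "ph b m s True \<in> carrier (EV b m)" if "1 \<le> s" "s < m" for s
  using ph_Cb[OF that] Cb_subsp[OF b] unfolding subsp_def by blast
 ultimately show ?thesis using r E.r_one by (simp add: eval_word_def ph_def del: end_alg_simps)
qed

text \<open>The block of \<open>\<sigma>\<^sub>i\<close> on the component of \<open>w\<close>.\<close>

definition gX :: "bool => nat => nat list => _"
 where "gX e i w = (if letter w i = letter w (i + 1)
  then slot (cont w) (letter w i) (ph (letter w i) (cont w (letter w i)) (rank w i) e) else \<one>\<^bsub>TC (cont w)\<^esub>)"

lemma gX_neq: "letter w i ~= letter w (i + 1) ==> gX e i w = \<one>\<^bsub>TC (cont w)\<^esub>" by (simp add: gX_def)

lemma gX_cong:
 assumes "cont w = cont w'" "letter w i = letter w' j" "letter w (i + 1) = letter w' (j + 1)"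
  and "letter w i = letter w (i + 1) ==> rank w i = rank w' j"
 shows "gX e i w = gX e j w'"
 using assms by (simp add: gX_def)

context
 fixes n :: nat
begin

abbreviation "En \<equiv> end_alg K (tpow K W n)"

lemma En: "unital_algebra K En" by (rule unital_algebra_end[OF TW.tensor_module])

lemma same_letter_rank:
 assumes w: "w \<in> words d n" and i: "1 \<le> i" "i < n" and eq: "letter w i = letter w (i + 1)"
 shows "letter w i \<in> {1..d}" "1 \<le> rank w i" "rank w i < cont w (letter w i)"
proof -
 have lw: "length w = n" using w by (simp add: words_def)
 show b: "letter w i \<in> {1..d}" using letter_in[OF w] i by auto
 have "i \<in> {1..length w}" "i + 1 \<in> {1..length w}" using i lw by auto
 then show "1 \<le> rank w i" "rank w i < cont w (letter w i)"
  using rank_bounds[of i w] rank_bounds[of "i + 1" w] rank_Suc[of i w] eq i lw b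
  by (auto simp: content_apply)
qed

lemma gX_closed:
 assumes w: "w \<in> words d n" and i: "1 \<le> i" "i < n" shows "gX e i w \<in> carrier (TC (cont w))"
 unfolding gX_def using slot_closed ph_Cb same_letter_rank[OF w i] O.CA.one_closed by simp

definition sig :: "bool => nat => _" where "sig e i = mon n (sw i) (%_. \<one>) (gX e i)"

text \<open>As the \<open>d\<close>-th power of \<zeta> is one, exponent \<open>d - 1\<close>
  produces the inverse of \<zeta>, so both signs are given by natural powers.\<close>

definition ta :: "bool => nat => _"
 where "ta e i = mon n (%w. w) (%w. \<zeta> [^] ((letter w i - 1) * (if e then 1 else d - 1))) (%w. \<one>\<^bsub>TC (cont w)\<^esub>)"

lemma sig_compatible: "1 \<le> i ==> i < n ==> compatible n (sw i) (%_. \<one>) (gX e i)" unfolding compatible_def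
proof (intro ballI conjI)
 fix w assume i: "1 \<le> i" "i < n" and w: "w \<in> words d n"
 show "sw i w \<in> words d n" by (rule sw_words[OF i w])
 show "cont (sw i w) = cont w" using i w by (intro content_sw) (simp_all add: words_def)
 show "\<one> \<in> carrier K" by (rule cring_one_closed[OF K_cring])
 show "gX e i w \<in> carrier (TC (cont w))" by (rule gX_closed[OF w i])
qed

lemma zeta_pow: "\<zeta> [^] (k::nat) \<in> carrier K"
 by (rule monoid.nat_pow_closed[OF ring.axioms(2)[OF cring.axioms(1)[OF K_cring]] zeta(1)])

lemma ta_compatible:
 "compatible n (%w. w) (%w. \<zeta> [^] ((letter w i - 1) * (if e then 1 else d - 1))) (%w. \<one>\<^bsub>TC (cont w)\<^esub>)"
 unfolding compatible_def using zeta_pow O.CA.one_closed by simp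

lemma TC_one_mult: "\<one>\<^bsub>TC \<nu>\<^esub> \<otimes>\<^bsub>TC \<nu>\<^esub> \<one>\<^bsub>TC \<nu>\<^esub> = \<one>\<^bsub>TC \<nu>\<^esub>" by (rule O.CA.l_one[OF O.CA.one_closed])

lemma K_facts:
 "\<one> \<otimes> \<one> = \<one>"
 "\<zeta> [^] (k::nat) \<otimes> \<zeta> [^] (l::nat) = \<zeta> [^] (k + l)"
 "\<zeta> [^] (0::nat) = \<one>" "\<zeta> [^] (k * d) = \<one>"
 "\<one> \<otimes> \<zeta> [^] k = \<zeta> [^] k" "\<zeta> [^] k \<otimes> \<one> = \<zeta> [^] k"
proof -
 have m: "Group.monoid K" by (rule ring.axioms(2)[OF cring.axioms(1)[OF K_cring]])
 show "\<one> \<otimes> \<one> = \<one>" by (rule monoid.l_one[OF m cring_one_closed(1)[OF K_cring]])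
 show "\<zeta> [^] k \<otimes> \<zeta> [^] l = \<zeta> [^] (k + l)" by (rule monoid.nat_pow_mult[OF m zeta(1)])
 show "\<zeta> [^] (0::nat) = \<one>" by (rule monoid.nat_pow_0[OF m])
 show "\<zeta> [^] (k * d) = \<one>" using monoid.nat_pow_pow[OF m zeta(1), of d k] zeta(2) by (simp add: mult.commute)
 show "\<one> \<otimes> \<zeta> [^] k = \<zeta> [^] k" "\<zeta> [^] k \<otimes> \<one> = \<zeta> [^] k" using monoid.l_one[OF m zeta_pow] monoid.r_one[OF m zeta_pow] by auto
qed

lemma sig_inverse:
 assumes i: "1 \<le> i" "i < n" shows "sig e i \<otimes>\<^bsub>En\<^esub> sig (\<not> e) i = \<one>\<^bsub>En\<^esub>"
 unfolding sig_def mon_mult[OF sig_compatible[OF i] sig_compatible[OF i]] mon_one[symmetric]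
proof (rule mon_cong[OF compatible_comp[OF sig_compatible[OF i] sig_compatible[OF i]] compatible_one], intro conjI)
 fix w assume w: "w \<in> words d n"
 have lw: "i < length w" "length w = n" using w i by (simp_all add: words_def)
 show "sw i (sw i w) = w" by (rule sw_sw[OF i(1) lw(1)])
 show "gX e i (sw i w) \<otimes>\<^bsub>TC (cont w)\<^esub> gX (\<not> e) i w = \<one>\<^bsub>TC (cont w)\<^esub>"
 proof (cases "letter w i = letter w (i + 1)")
  case True
  note sr = same_letter_rank[OF w i True]
  have "sw i w = w" by (rule sw_same[OF i(1) lw(1) True])
  moreover have g: "gX e i w = slot (cont w) (letter w i) (ph (letter w i) (cont w (letter w i)) (rank w i) e)" for e
   unfolding gX_def by (rule if_P[OF True])
  have "gX e i w \<otimes>\<^bsub>TC (cont w)\<^esub> gX (\<not> e) i w = \<one>\<^bsub>TC (cont w)\<^esub>"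
   unfolding g slot_mult[where \<nu> = "cont w", OF sr(1) ph_Cb[OF sr(2,3)] ph_Cb[OF sr(2,3)]]
    ph_inverse[OF sr] by (rule slot_one[OF sr(1)])
  ultimately show ?thesis by (simp only:)
 next
  case False
  have "letter (sw i w) i ~= letter (sw i w) (i + 1)" using False i lw by (simp add: letter_sw)
  then show ?thesis
   unfolding gX_neq[OF False] gX_neq[OF \<open>letter (sw i w) i ~= letter (sw i w) (i + 1)\<close>] content_sw[OF i(1) lw(1)]
   by (intro TC_one_mult)
 qed
qed (rule K_facts(1))

lemma ta_inverse: "ta e i \<otimes>\<^bsub>En\<^esub> ta (\<not> e) i = \<one>\<^bsub>En\<^esub>" unfolding ta_def mon_mult[OF ta_compatible ta_compatible] mon_one[symmetric]
proof (rule mon_cong[OF compatible_comp[OF ta_compatible ta_compatible] compatible_one], intro conjI)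
 fix w assume w: "w \<in> words d n"
 \<comment> \<open>The two factors 1 and \<open>d - 1\<close> add up to \<open>d\<close>, whichever
   sign comes first.\<close>
 have "(letter w i - 1) * (if e then 1 else d - 1) + (letter w i - 1) * (if \<not> e then 1 else d - 1) = (letter w i - 1) * d"
 proof -
  obtain d' where "d = Suc d'" using d_pos by (cases d) auto
  then show ?thesis by (cases e) simp_all
 qed
 then show "\<zeta> [^] ((letter w i - 1) * (if e then 1 else d - 1)) \<otimes> \<zeta> [^] ((letter w i - 1) * (if \<not> e then 1 else d - 1)) = \<one>"
  by (simp only: K_facts(2,4))
qed (auto simp only: TC_one_mult)

lemma ta_commute: "ta e i \<otimes>\<^bsub>En\<^esub> ta e' j = ta e' j \<otimes>\<^bsub>En\<^esub> ta e i" unfolding ta_def mon_mult[OF ta_compatible ta_compatible]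
 by (rule mon_cong[OF compatible_comp[OF ta_compatible ta_compatible] compatible_comp[OF ta_compatible ta_compatible]])
  (simp only: K_facts(2) add.commute simp_thms)

lemma ta_power: "eval_word En (%_. ta True i) (replicate k x) =
  mon n (%w. w) (%w. \<zeta> [^] ((letter w i - 1) * k)) (%w. \<one>\<^bsub>TC (cont w)\<^esub>)"
proof (induction k)
 case 0
 show ?case using mon_one by (simp add: eval_word_def K_facts(3) del: tensor_alg_simps end_alg_simps)
next
 case (Suc k)
 have c: "compatible n (%w. w) (%w. \<zeta> [^] ((letter w i - 1) * k)) (%w. \<one>\<^bsub>TC (cont w)\<^esub>)" for k
  unfolding compatible_def using zeta_pow O.CA.one_closed by simp
 have "eval_word En (%_. ta True i) (replicate (Suc k) x) = ta True i \<otimes>\<^bsub>En\<^esub>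
   mon n (%w. w) (%w. \<zeta> [^] ((letter w i - 1) * k)) (%w. \<one>\<^bsub>TC (cont w)\<^esub>)"
  using Suc.IH by (simp add: eval_word_def del: tensor_alg_simps end_alg_simps)
 also have "... = mon n (%w. w) (%w. \<zeta> [^] ((letter w i - 1) * Suc k)) (%w. \<one>\<^bsub>TC (cont w)\<^esub>)"
  unfolding ta_def mon_mult[OF ta_compatible c]
  by (rule mon_cong[OF compatible_comp[OF ta_compatible c] c])
   (simp only: K_facts(2) TC_one_mult if_True mult_Suc_right mult_1_right simp_thms)
 finally show ?case .
qed

text \<open>The letter of the swapped word at the transposed position is the letter of
  \<open>w\<close> at \<open>j\<close>, so the eigenvalues on the two sides agree; the blocks of
  \<tau> are trivial.\<close>

lemma sig_ta:
 assumes i: "1 \<le> i" "i < n" and j: "j \<in> {1..n}"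
 shows "sig True i \<otimes>\<^bsub>En\<^esub> ta True j = ta True (transpose i (i + 1) j) \<otimes>\<^bsub>En\<^esub> sig True i"
 unfolding ta_def sig_def mon_mult[OF sig_compatible[OF i] ta_compatible] mon_mult[OF ta_compatible sig_compatible[OF i]]
proof (rule mon_cong[OF compatible_comp[OF sig_compatible[OF i] ta_compatible]
   compatible_comp[OF ta_compatible sig_compatible[OF i]]], intro conjI)
 fix w assume w: "w \<in> words d n"
 have lw: "i < length w" using w i by (simp add: words_def)
 have "1 \<le> transpose i (i + 1) j" using i j by (auto simp: transpose_def)
 then have "letter (sw i w) (transpose i (i + 1) j) = letter w j" by (simp add: letter_sw[OF i(1) lw])
 then show "\<one> \<otimes> \<zeta> [^] ((letter w j - 1) * (if True then 1 else d - 1)) =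
   \<zeta> [^] ((letter (sw i w) (transpose i (i + 1) j) - 1) * (if True then 1 else d - 1)) \<otimes> \<one>"
  by (simp only: K_facts)
 show "gX True i w \<otimes>\<^bsub>TC (cont w)\<^esub> \<one>\<^bsub>TC (cont w)\<^esub> = \<one>\<^bsub>TC (cont (sw i w))\<^esub> \<otimes>\<^bsub>TC (cont w)\<^esub> gX True i w"
  unfolding content_sw[OF i(1) lw] O.CA.r_one[OF gX_closed[OF w i]] O.CA.l_one[OF gX_closed[OF w i]] ..
qed (rule HOL.refl)

lemma rank_sw_other:
 assumes "1 \<le> j" "j < length w" "1 \<le> k" "k ~= j" "k ~= j + 1" shows "rank (sw j w) k = rank w k"
 using rank_sw[of j w k] sw_same[of j w] assms by (cases "letter w j = letter w (j + 1)") (auto simp: transpose_def)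

lemma gX_sw_other:
 assumes w: "w \<in> words d n" and i: "1 \<le> i" "i < n" and j: "1 \<le> j" "j < n" and ij: "i + 1 < j \<or> j + 1 < i"
 shows "gX e i (sw j w) = gX e i w"
proof (rule gX_cong)
 have lw: "j < length w" using w j by (simp add: words_def)
 show "cont (sw j w) = cont w" by (rule content_sw[OF j(1) lw])
 show "letter (sw j w) i = letter w i" "letter (sw j w) (i + 1) = letter w (i + 1)"
  using letter_sw[OF j(1) lw, of i] letter_sw[OF j(1) lw, of "i + 1"] i ij by (auto simp: transpose_def)
 show "rank (sw j w) i = rank w i" using j lw i ij by (intro rank_sw_other) auto
qed

lemma sig_far:
 assumes i: "1 \<le> i" "i < n" and j: "1 \<le> j" "j < n" and ij: "i + 1 < j"
 shows "sig True i \<otimes>\<^bsub>En\<^esub> sig True j = sig True j \<otimes>\<^bsub>En\<^esub> sig True i"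
 unfolding sig_def mon_mult[OF sig_compatible[OF i] sig_compatible[OF j]]
  mon_mult[OF sig_compatible[OF j] sig_compatible[OF i]]
proof (rule mon_cong[OF compatible_comp[OF sig_compatible[OF i] sig_compatible[OF j]]
   compatible_comp[OF sig_compatible[OF j] sig_compatible[OF i]]], intro conjI)
 fix w assume w: "w \<in> words d n"
 have lw: "length w = n" using w by (simp add: words_def)
 have wi: "sw i w \<in> words d n" and wj: "sw j w \<in> words d n" by (rule sw_words[OF i w] sw_words[OF j w])+
 have lwi: "length (sw i w) = n" "length (sw j w) = n" using wi wj by (simp_all add: words_def)
 show "sw i (sw j w) = sw j (sw i w)"
 proof (rule words_eqI[OF sw_words[OF i wj] sw_words[OF j wi]])
  fix k assume k: "k \<in> {1..n}"
  have t: "1 \<le> transpose i (i + 1) k" "1 \<le> transpose j (j + 1) k" using k i j by (auto simp: transpose_def)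
  have "letter (sw i (sw j w)) k = letter w (transpose j (j + 1) (transpose i (i + 1) k))"
   using k i j lw lwi t by (simp add: letter_sw)
  moreover have "letter (sw j (sw i w)) k = letter w (transpose i (i + 1) (transpose j (j + 1) k))"
   using k i j lw lwi t by (simp add: letter_sw)
  moreover have "transpose j (j + 1) (transpose i (i + 1) k) = transpose i (i + 1) (transpose j (j + 1) k)"
   using ij by (auto simp: transpose_def)
  ultimately show "letter (sw i (sw j w)) k = letter (sw j (sw i w)) k" by simp
 qed
 have other: "gX True i (sw j w) = gX True i w" "gX True j (sw i w) = gX True j w"
  using gX_sw_other[OF w i j] gX_sw_other[OF w j i] ij by auto
 note cl = gX_closed[OF w i, of True] gX_closed[OF w j, of True]
 show "gX True i (sw j w) \<otimes>\<^bsub>TC (cont w)\<^esub> gX True j w = gX True j (sw i w) \<otimes>\<^bsub>TC (cont w)\<^esub> gX True i w" unfolding other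
 proof (cases "letter w i = letter w (i + 1) \<and> letter w j = letter w (j + 1)")
  case True
  then have Ti: "letter w i = letter w (i + 1)" and Tj: "letter w j = letter w (j + 1)" by auto
  note ri = same_letter_rank[OF w i Ti] and rj = same_letter_rank[OF w j Tj]
  let ?b = "letter w i" and ?c = "letter w j"
  let ?f = "ph ?b (cont w ?b) (rank w i) True" and ?g = "ph ?c (cont w ?c) (rank w j) True"
  have g: "gX True i w = slot (cont w) ?b ?f" "gX True j w = slot (cont w) ?c ?g"
   unfolding gX_def by (rule if_P[OF Ti] if_P[OF Tj])+
  have f: "?f \<in> Cb ?b (cont w ?b)" "?g \<in> Cb ?c (cont w ?c)" by (rule ph_Cb[OF ri(2,3)] ph_Cb[OF rj(2,3)])+
  show "gX True i w \<otimes>\<^bsub>TC (cont w)\<^esub> gX True j w = gX True j w \<otimes>\<^bsub>TC (cont w)\<^esub> gX True i w"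
  proof (cases "?b = ?c")
   case False
   then show ?thesis unfolding g by (intro slot_commute ri(1) rj(1) f)
  next
   case bc: True
   \<comment> \<open>All four letters are equal: position \<open>i + 1\<close> has rank one more
     than \<open>i\<close> and precedes \<open>j\<close>, so the ranks differ by at least two and
     the commutation relation inside one block applies.\<close>
   have "rank w i + 1 < rank w j" using rank_Suc[of i w] rank_mono[of "i + 1" j w] i j ij lw Ti bc by simp
   then have "?f \<otimes>\<^bsub>EV ?b (cont w ?b)\<^esub> ph ?b (cont w ?b) (rank w j) True =
     ph ?b (cont w ?b) (rank w j) True \<otimes>\<^bsub>EV ?b (cont w ?b)\<^esub> ?f"
    using ri rj(2,3) bc by (intro ph_far) auto
   then show ?thesis unfolding g bc[symmetric] using f(2)[folded bc] by (subst (1 2) slot_mult) (use ri(1) f in simp_all)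
  qed
 next
  case False
  then consider "letter w i ~= letter w (i + 1)" | "letter w j ~= letter w (j + 1)" by blast
  then show "gX True i w \<otimes>\<^bsub>TC (cont w)\<^esub> gX True j w = gX True j w \<otimes>\<^bsub>TC (cont w)\<^esub> gX True i w"
  proof cases
   case 1
   show ?thesis unfolding gX_neq[OF 1] O.CA.l_one[OF cl(2)] O.CA.r_one[OF cl(2)] ..
  next
   case 2
   show ?thesis unfolding gX_neq[OF 2] O.CA.l_one[OF cl(1)] O.CA.r_one[OF cl(1)] ..
  qed
 qed
qed (rule HOL.refl)

text \<open>The cases compare the three letters a, b, c at the positions involved. If all agree,
  this is the braid relation in their block. Otherwise each side has at most one nontrivial factor,
  and these factors coincide because exchanging distinct letters preserves the ranks of the equal
  ones.\<close>

lemma sig_braid: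
 assumes i: "1 \<le> i" "i + 1 < n"
 shows "sig True i \<otimes>\<^bsub>En\<^esub> (sig True (i + 1) \<otimes>\<^bsub>En\<^esub> sig True i) = sig True (i + 1) \<otimes>\<^bsub>En\<^esub> (sig True i \<otimes>\<^bsub>En\<^esub> sig True (i + 1))"
proof -
 define j where "j = i + 1"
 have i': "1 \<le> i" "i < n" and j: "1 \<le> j" "j < n" using i by (auto simp: j_def)
 note ci = sig_compatible[OF i'] and cj = sig_compatible[OF j]
 have "sig True i \<otimes>\<^bsub>En\<^esub> (sig True j \<otimes>\<^bsub>En\<^esub> sig True i) = sig True j \<otimes>\<^bsub>En\<^esub> (sig True i \<otimes>\<^bsub>En\<^esub> sig True j)"
  unfolding sig_def mon_mult[OF ci cj] mon_mult[OF cj ci] mon_mult[OF ci compatible_comp[OF cj ci]]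
   mon_mult[OF cj compatible_comp[OF ci cj]]
 proof (rule mon_cong[OF compatible_comp[OF ci compatible_comp[OF cj ci]] compatible_comp[OF cj compatible_comp[OF ci cj]]],
   intro conjI)
  fix w assume w: "w \<in> words d n"
  let ?wi = "sw i w" and ?wj = "sw j w"
  have wi: "?wi \<in> words d n" and wj: "?wj \<in> words d n" by (rule sw_words[OF i' w] sw_words[OF j w])+
  have wji: "sw j ?wi \<in> words d n" and wij: "sw i ?wj \<in> words d n" by (rule sw_words[OF j wi] sw_words[OF i' wj])+
  have len: "length w = n" "length ?wi = n" "length ?wj = n" "length (sw j ?wi) = n" "length (sw i ?wj) = n"
   using w wi wj wji wij by (simp_all add: words_def)
  have L: "1 \<le> k ==> u \<in> words d n ==> letter (sw i u) k = letter u (transpose i j k)"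
   "1 \<le> k ==> u \<in> words d n ==> letter (sw j u) k = letter u (transpose j (j + 1) k)" for k u
   using letter_sw[of i u k] letter_sw[of j u k] i' j by (auto simp: words_def j_def)
  show "sw i (sw j ?wi) = sw j (sw i ?wj)"
  proof (rule words_eqI[OF sw_words[OF i' wji] sw_words[OF j wij]])
   fix k assume k: "k \<in> {1..n}"
   have t: "1 \<le> transpose i j k" "1 \<le> transpose j (j + 1) k" "1 \<le> transpose i j (transpose j (j + 1) k)"
    "1 \<le> transpose j (j + 1) (transpose i j k)"
    using k i j by (auto simp: transpose_def)
   have "transpose i j (transpose j (j + 1) (transpose i j k)) = transpose j (j + 1) (transpose i j (transpose j (j + 1) k))"
    by (auto simp: transpose_def j_def)
   then show "letter (sw i (sw j ?wi)) k = letter (sw j (sw i ?wj)) k" using k t by (simp add: L w wi wj wij wji)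
  qed
  have ct: "cont ?wi = cont w" "cont ?wj = cont w" "cont (sw j ?wi) = cont w" "cont (sw i ?wj) = cont w"
   using i' j len by (simp_all add: content_sw)
  let ?a = "letter w i" and ?b = "letter w j" and ?c = "letter w (j + 1)"
  have tr: "transpose i j i = j" "transpose i j j = i" "transpose i j (j + 1) = j + 1"
   "transpose j (j + 1) i = i" "transpose j (j + 1) j = j + 1" "transpose j (j + 1) (j + 1) = j"
   by (auto simp: transpose_def j_def)
  have l1: "letter ?wi i = ?b" "letter ?wi j = ?a" "letter ?wi (j + 1) = ?c"
   "letter ?wj i = ?a" "letter ?wj j = ?c" "letter ?wj (j + 1) = ?b"
   using i' j by (simp_all add: L w tr)
  have l2: "letter (sw j ?wi) i = ?b" "letter (sw j ?wi) j = ?c" "letter (sw i ?wj) j = ?a" "letter (sw i ?wj) (j + 1) = ?b"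
   using i' j by (simp_all add: L wi wj tr l1)
  have N: "u \<in> words d n ==> cont u = cont w ==> letter u i ~= letter u j ==> gX True i u = \<one>\<^bsub>TC (cont w)\<^esub>"
   "u \<in> words d n ==> cont u = cont w ==> letter u j ~= letter u (j + 1) ==> gX True j u = \<one>\<^bsub>TC (cont w)\<^esub>" for u
   using gX_neq[of u i True] gX_neq[of u j True] by (simp_all add: j_def del: tensor_alg_simps)
  have cl: "gX True i w \<in> carrier (TC (cont w))" "gX True j w \<in> carrier (TC (cont w))"
   "gX True i ?wj \<in> carrier (TC (cont w))" "gX True j ?wi \<in> carrier (TC (cont w))"
   using gX_closed[OF w i', of True] gX_closed[OF w j, of True] gX_closed[OF wj i', of True] gX_closed[OF wi j, of True]
   unfolding ct by (simp_all del: tensor_alg_simps)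
  note units = O.CA.l_one[OF O.CA.one_closed] O.CA.l_one[OF cl(1)] O.CA.l_one[OF cl(2)] O.CA.l_one[OF cl(3)] O.CA.l_one[OF cl(4)]
   O.CA.r_one[OF cl(1)] O.CA.r_one[OF cl(2)] O.CA.r_one[OF cl(3)] O.CA.r_one[OF cl(4)]
  have ri: "?a ~= ?b ==> rank ?wi k = rank w (transpose i j k)" if "1 \<le> k" for k
   using rank_sw[of i w k] that i' len by (simp add: j_def)
  have rj: "?b ~= ?c ==> rank ?wj k = rank w (transpose j (j + 1) k)" if "1 \<le> k" for k
   using rank_sw[of j w k] that j len by simp
  have rji: "?a ~= ?c ==> rank (sw j ?wi) k = rank ?wi (transpose j (j + 1) k)" if "1 \<le> k" for k
   using rank_sw[of j ?wi k] that j len l1 by simp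
  have rij: "?a ~= ?c ==> rank (sw i ?wj) k = rank ?wj (transpose i j k)" if "1 \<le> k" for k
   using rank_sw[of i ?wj k] that i' len l1 by (simp add: j_def)
  have same: "?a = ?b ==> ?wi = w" "?b = ?c ==> ?wj = w" using sw_same[of i w] sw_same[of j w] i' j len by (simp_all add: j_def)
  show "gX True i (sw j ?wi) \<otimes>\<^bsub>TC (cont w)\<^esub> (gX True j ?wi \<otimes>\<^bsub>TC (cont w)\<^esub> gX True i w) =
   gX True j (sw i ?wj) \<otimes>\<^bsub>TC (cont w)\<^esub> (gX True i ?wj \<otimes>\<^bsub>TC (cont w)\<^esub> gX True j w)"
  proof (cases "?a = ?b")
   case ab: True
   show ?thesis
   proof (cases "?b = ?c")
    case bc: True
    have Ti: "letter w i = letter w (i + 1)" and Tj: "letter w j = letter w (j + 1)" using ab bc by (simp_all add: j_def)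
    note si = same_letter_rank[OF w i' Ti] and sj = same_letter_rank[OF w j Tj]
    have rk: "rank w j = rank w i + 1" using rank_Suc[of i w] i' len Ti by (simp add: j_def)
    have g: "gX True i w = slot (cont w) ?a (ph ?a (cont w ?a) (rank w i) True)"
     "gX True j w = slot (cont w) ?a (ph ?a (cont w ?a) (rank w i + 1) True)"
     using Ti Tj ab unfolding gX_def rk by (simp_all del: tensor_alg_simps)
    have r: "rank w i + 1 < cont w ?a" using sj(3) rk ab by simp
    have f: "ph ?a (cont w ?a) (rank w i) True \<in> Cb ?a (cont w ?a)"
     "ph ?a (cont w ?a) (rank w i + 1) True \<in> Cb ?a (cont w ?a)"
     using r si by (auto intro: ph_Cb)
    show ?thesis unfolding same(1)[OF ab] same(2)[OF bc] g
      slot_mult[where \<nu> = "cont w", OF si(1) f(1) f(2)] slot_mult[where \<nu> = "cont w", OF si(1) f(2) f(1)]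
      slot_mult[where \<nu> = "cont w", OF si(1) f(1) Cb_mult[OF si(1) f(2) f(1)]]
      slot_mult[where \<nu> = "cont w", OF si(1) f(2) Cb_mult[OF si(1) f(1) f(2)]]
      ph_braid[OF si(1,2) r] ..
   next
    case bc: False
    \<comment> \<open>The word a a c has become c a a: the equal pair has moved from
      \<open>i\<close> to \<open>j\<close> with unchanged ranks.\<close>
    have "gX True j (sw i ?wj) = gX True i w"
    proof (rule gX_cong)
     show "rank (sw i ?wj) j = rank w i" using rij[OF j(1)] rj[OF i'(1)] ab bc tr by simp
    qed (use ct l2 ab in \<open>simp_all add: j_def\<close>)
    moreover have "gX True i (sw j w) = \<one>\<^bsub>TC (cont w)\<^esub>" by (rule N(1)[OF wj ct(2)]) (use l1 ab bc in simp)
    moreover have "gX True j w = \<one>\<^bsub>TC (cont w)\<^esub>" by (rule N(2)[OF w HOL.refl bc])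
    ultimately show ?thesis unfolding same(1)[OF ab] by (simp only: units)
   qed
  next
   case ab: False
   have g1: "gX True i w = \<one>\<^bsub>TC (cont w)\<^esub>" by (rule N(1)[OF w HOL.refl ab])
   show ?thesis
   proof (cases "?b = ?c")
    case bc: True
    have "gX True i (sw j ?wi) = gX True j w"
    proof (rule gX_cong)
     show "rank (sw j ?wi) i = rank w j" using rji[OF i'(1)] ri[OF i'(1)] ab bc tr by simp
    qed (use ct l2 bc in \<open>simp_all add: j_def\<close>)
    moreover have "gX True j ?wi = \<one>\<^bsub>TC (cont w)\<^esub>" by (rule N(2)[OF wi ct(1)]) (use l1 ab bc in simp)
    moreover have "gX True j (sw i w) = \<one>\<^bsub>TC (cont w)\<^esub>" by (rule N(2)[OF wi ct(1)]) (use l1 ab bc in simp)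
    ultimately show ?thesis unfolding same(2)[OF bc] by (simp only: units g1)
   next
    case bc: False
    have g3: "gX True j w = \<one>\<^bsub>TC (cont w)\<^esub>" by (rule N(2)[OF w HOL.refl bc])
    have g4: "gX True i (sw j ?wi) = \<one>\<^bsub>TC (cont w)\<^esub>" by (rule N(1)[OF wji ct(3)]) (use l2 bc in simp)
    have g5: "gX True j (sw i ?wj) = \<one>\<^bsub>TC (cont w)\<^esub>" by (rule N(2)[OF wij ct(4)]) (use l2 ab in simp)
    \<comment> \<open>Covers both a = c, where the outer letters meet in the middle step, and three
      distinct letters, where both blocks are trivial.\<close>
    have "gX True j ?wi = gX True i ?wj"
    proof (rule gX_cong)
     show "rank ?wi j = rank ?wj i" using ri[OF j(1) ab] rj[OF i'(1) bc] tr by simp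
    qed (use ct l1 in \<open>simp_all add: j_def\<close>)
    then show ?thesis unfolding g1 g3 g4 g5 by (simp only: units)
   qed
  qed
 qed (simp only: K_facts(1))
 then show ?thesis unfolding j_def .
qed

definition gop :: "fb_gen \<times> bool => _"
 where "gop l = (case fst l of Sg i => sig (snd l) i | Tg i => ta (snd l) i)"

lemma gop_simps: "gop (Sg i, e) = sig e i" "gop (Tg i, e) = ta e i" by (simp_all add: gop_def)

lemma framed_gens_iff: "Sg i \<in> framed_gens n \<longleftrightarrow> 1 \<le> i \<and> i < n" "Tg i \<in> framed_gens n \<longleftrightarrow> i \<in> {1..n}"
 by (auto simp: framed_gens_def braid_gens_def)

lemma sig_closed: "1 \<le> i ==> i < n ==> sig e i \<in> carrier En" unfolding sig_def using mon_closed[OF sig_compatible] by simp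

lemma ta_closed: "ta e i \<in> carrier En" unfolding ta_def using mon_closed[OF ta_compatible] by simp

lemma Phi_ex:
 "\<exists>\<Phi>\<in>alg_hom K (group_alg K (framed_braid_group d n)) En. ALL l:framed_gens n \<times> UNIV.
  \<Phi> (basis_vec K (wcls (framed_gens n) (framed_rels d n) [l])) = gop l"
 unfolding framed_braid_group_def
proof (rule presented_alg_hom_ex[OF K_cring En])
 interpret E: unital_algebra K En by (rule En)
 show "gop l \<in> carrier En" if "l \<in> framed_gens n \<times> UNIV" for l
  using that sig_closed ta_closed by (cases l; cases "fst l") (auto simp: gop_simps framed_gens_iff simp del: end_alg_simps)
 show "gop (x, e) \<otimes>\<^bsub>En\<^esub> gop (x, \<not> e) = \<one>\<^bsub>En\<^esub>" if "x \<in> framed_gens n" for x e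
  using that sig_inverse ta_inverse by (cases x) (simp_all only: gop_simps framed_gens_iff)
 have ev1: "eval_word En gop [l, l'] = gop l \<otimes>\<^bsub>En\<^esub> gop l'" if "gop l' \<in> carrier En" for l l'
  using E.r_one[OF that] by (simp add: eval_word_def del: end_alg_simps)
 have ev2: "eval_word En gop [l, l', l''] = gop l \<otimes>\<^bsub>En\<^esub> (gop l' \<otimes>\<^bsub>En\<^esub> gop l'')" if "gop l'' \<in> carrier En" for l l' l''
  using E.r_one[OF that] by (simp add: eval_word_def del: end_alg_simps)
 have sT: "gop (Sg i, e) \<in> carrier En" if "1 \<le> i" "i < n" for i e unfolding gop_simps by (rule sig_closed[OF that])
 have tT: "gop (Tg i, e) \<in> carrier En" for i e unfolding gop_simps by (rule ta_closed)
 fix l r assume "(l, r) \<in> framed_rels d n"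
 then consider
  (far) i j where "l = [pos (Sg i), pos (Sg j)]" "r = [pos (Sg j), pos (Sg i)]"
   "1 \<le> i" "i < n" "1 \<le> j" "j < n" "\<bar>int i - int j\<bar> > 1"
 | (braid) i j where "l = [pos (Sg i), pos (Sg j), pos (Sg i)]" "r = [pos (Sg j), pos (Sg i), pos (Sg j)]"
   "1 \<le> i" "i < n" "1 \<le> j" "j < n" "\<bar>int i - int j\<bar> = 1"
 | (power) i where "l = replicate d (pos (Tg i))" "r = []" "i \<in> {1..n}"
 | (tt) i j where "l = [pos (Tg i), pos (Tg j)]" "r = [pos (Tg j), pos (Tg i)]"
 | (st) i j where "l = [pos (Sg i), pos (Tg j)]" "r = [pos (Tg (transpose i (i + 1) j)), pos (Sg i)]"
   "1 \<le> i" "i < n" "j \<in> {1..n}"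
  unfolding framed_rels_def braid_rels_def by blast
 then show "eval_word En gop l = eval_word En gop r"
 proof cases
  case far
  have "i + 1 < j \<or> j + 1 < i" using far(7) by linarith
  then show ?thesis unfolding far(1,2) ev1[OF sT[OF far(5,6)]] ev1[OF sT[OF far(3,4)]] gop_simps
   using sig_far[OF far(3-6)] sig_far[OF far(5,6,3,4)] by metis
 next
  case braid
  have "j = i + 1 \<or> i = j + 1" using braid(7) by linarith
  then show ?thesis unfolding braid(1,2) ev2[OF sT[OF braid(5,6)]] ev2[OF sT[OF braid(3,4)]] gop_simps
   using sig_braid[OF braid(3)] sig_braid[OF braid(5)] braid(4,6) by metis
 next
  case power
  have "eval_word En gop (replicate k (pos (Tg i))) = eval_word En (%_. ta True i) (replicate k (pos (Tg i)))" for k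
   by (induction k) (simp_all add: eval_word_def gop_simps del: end_alg_simps)
  moreover have "eval_word En (%_. ta True i) (replicate d (pos (Tg i))) = \<one>\<^bsub>En\<^esub>"
   unfolding ta_power K_facts(4) by (rule mon_one)
  ultimately show ?thesis unfolding power(1,2) by (simp add: eval_word_def del: end_alg_simps)
 next
  case tt
  show ?thesis unfolding tt ev1[OF tT] gop_simps by (rule ta_commute)
 next
  case st
  show ?thesis unfolding st(1,2) ev1[OF tT] ev1[OF sT[OF st(3,4)]] gop_simps by (rule sig_ta[OF st(3-5)])
 qed
qed

end

end

section \<open>Operators on one or two adjacent tensor factors\<close>

lemma on_factor_tmap: "on_factor K M n i f = tmap K {1..n} (%_. M) (%_. M) (%j v. if j = i then f v else v)"
 by (simp add: on_factor_def tensor_map_tmap)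

locale tensor_powers =
 fixes K :: "'k ring" and M :: "('k, 'v) module"
 assumes K: "cring K" and M: "module K M"
begin

sublocale T: tensor_prod K "{1..n}" "%_. M" for n by (intro tensor_prod.intro K M)

lemma pure2_closed: "v \<in> carrier M ==> w \<in> carrier M ==> pure2 K M v w \<in> carrier (tpow K M 2)"
 unfolding pure2_def by (rule T.pure_closed) simp

lemma pure2_lin:
 assumes "v \<in> carrier M"
 shows "lin K M (tpow K M 2) (%u. pure2 K M u v)" and "lin K M (tpow K M 2) (%u. pure2 K M v u)"
proof -
 have "lin K M (tpow K M 2) (%u. tpure K M 2 ((%_. v)(i := u)))" if "i \<in> {1..2}" for i
  by (rule T.pure_lin) (use that assms in auto)
 from this[of 1] this[of 2]
 have "lin K M (tpow K M 2) (%u. tpure K M 2 ((%_. v)(1 := u)))" "lin K M (tpow K M 2) (%u. tpure K M 2 ((%_. v)(2 := u)))"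
  by simp_all
 moreover have "tpure K M 2 ((%_. v)(1 := u)) = pure2 K M u v" "tpure K M 2 ((%_. v)(2 := u)) = pure2 K M v u" for u
  unfolding pure2_def by (rule T.pure_cong; auto)+
 ultimately show "lin K M (tpow K M 2) (%u. pure2 K M u v)" "lin K M (tpow K M 2) (%u. pure2 K M v u)" by simp_all
qed

lemma tpure_pure2: "tpure K M 2 z = pure2 K M (z 1) (z 2)" unfolding pure2_def
proof (rule T.pure_cong)
 fix i :: nat assume "i \<in> {1..2}"
 then have "i = 1 \<or> i = 2" by auto
 then show "z i = (if i = 1 then z 1 else z 2)" by auto
qed

text \<open>The inner lift of \<open>on_factors\<close>, isolated because it is linear in the
  inserted tensor and ignores the entries of \<open>v\<close> at \<open>i\<close> and
  \<open>i + 1\<close>.\<close>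

definition insert2 :: "nat => nat => (nat => 'v) => (nat, 'v, 'k) tens => (nat, 'v, 'k) tens"
 where "insert2 n i v = tpow_lift K M 2 (tpow K M n) (%y. tpure K M n (v(i := y 1, i + 1 := y 2)))"

context
 fixes n i :: nat
 assumes i: "1 \<le> i" "i < n"
begin

lemma insert2_multilin:
 assumes v: "!!j. j \<in> {1..n} ==> j ~= i ==> j ~= i + 1 ==> v j \<in> carrier M"
 shows "multilin K {1..2::nat} (%_. M) (tpow K M n) (%y. tpure K M n (v(i := y 1, i + 1 := y 2)))"
proof (rule multilinI)
 fix y assume y: "y \<in> (\<Pi>\<^sub>E j\<in>{1..2::nat}. carrier M)"
 have yM: "y 1 \<in> carrier M" "y 2 \<in> carrier M" by (rule PiE_mem[OF y]; simp)+
 have vM: "(v(i := y 1, i + 1 := y 2)) j \<in> carrier M" if "j \<in> {1..n}" for j using v[OF that] yM by auto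
 then show "tpure K M n (v(i := y 1, i + 1 := y 2)) \<in> carrier (tpow K M n)" by (rule T.pure_closed)
 fix k :: nat assume "k \<in> {1..2}"
 then have "k = 1 \<or> k = 2" by auto
 then show "lin K M (tpow K M n) (%u. tpure K M n (v(i := (y(k := u)) 1, i + 1 := (y(k := u)) 2)))"
 proof
  assume k: "k = 1"
  have "lin K M (tpow K M n) (%u. tpure K M n ((v(i := y 1, i + 1 := y 2))(i := u)))"
   by (rule T.pure_lin[OF vM]) (use i in auto)
  moreover have "(v(i := y 1, i + 1 := y 2))(i := u) = v(i := (y(k := u)) 1, i + 1 := (y(k := u)) 2)" for u
   using k by (auto simp: fun_eq_iff)
  ultimately show ?thesis by simp
 next
  assume k: "k = 2"
  have "lin K M (tpow K M n) (%u. tpure K M n ((v(i := y 1, i + 1 := y 2))(i + 1 := u)))"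
   by (rule T.pure_lin[OF vM]) (use i in auto)
  moreover have "(v(i := y 1, i + 1 := y 2))(i + 1 := u) = v(i := (y(k := u)) 1, i + 1 := (y(k := u)) 2)" for u
   using k by (auto simp: fun_eq_iff)
  ultimately show ?thesis by simp
 qed
qed

lemma insert2_lin:
 assumes "!!j. j \<in> {1..n} ==> j ~= i ==> j ~= i + 1 ==> v j \<in> carrier M"
 shows "lin K (tpow K M 2) (tpow K M n) (insert2 n i v)"
 unfolding insert2_def by (rule T.tensor_lift_lin[OF T.tensor_module insert2_multilin[OF assms]])

lemma insert2_pure2:
 assumes "!!j. j \<in> {1..n} ==> j ~= i ==> j ~= i + 1 ==> v j \<in> carrier M" "p \<in> carrier M" "q \<in> carrier M"
 shows "insert2 n i v (pure2 K M p q) = tpure K M n (v(i := p, i + 1 := q))"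
 unfolding insert2_def pure2_def
 by (subst T.tensor_lift_pure[OF T.tensor_module insert2_multilin[OF assms(1)]]) (use assms in \<open>auto split: if_splits\<close>)

lemma on_factors_multilin:
 assumes g: "lin K (tpow K M 2) (tpow K M 2) g"
 shows "multilin K {1..n} (%_. M) (tpow K M n) (%v. insert2 n i v (g (pure2 K M (v i) (v (i + 1)))))"
proof (rule multilinI)
 fix v assume v': "v \<in> (\<Pi>\<^sub>E j\<in>{1..n}. carrier M)"
 have v: "v j \<in> carrier M" if "j \<in> {1..n}" for j using v' that by (rule PiE_mem)
 have vi: "v i \<in> carrier M" "v (i + 1) \<in> carrier M" using v i by auto
 note gz = lin_closed[OF g pure2_closed[OF vi]]
 show "insert2 n i v (g (pure2 K M (v i) (v (i + 1)))) \<in> carrier (tpow K M n)" by (rule lin_closed[OF insert2_lin gz]) (rule v)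
 fix k assume k: "k \<in> {1..n}"
 show "lin K M (tpow K M n) (%u. insert2 n i (v(k := u)) (g (pure2 K M ((v(k := u)) i) ((v(k := u)) (i + 1)))))"
 proof (cases "k = i \<or> k = i + 1")
  case True
  \<comment> \<open>The updated entry is overwritten, so \<open>u\<close> acts only through the
    tensor that is fed to \<open>g\<close>.\<close>
  have ins: "insert2 n i (v(k := u)) = insert2 n i v" for u
  proof -
   have "(v(k := u))(i := y (1::nat), i + 1 := y (2::nat)) = v(i := y 1, i + 1 := y 2)" for y
    using True by (auto simp: fun_eq_iff)
   then show ?thesis unfolding insert2_def by simp
  qed
  have il: "lin K (tpow K M 2) (tpow K M n) (insert2 n i v)" by (rule insert2_lin) (rule v)
  from True show ?thesis
  proof
   assume "k = i"
   then show ?thesis unfolding ins using lin_comp[OF lin_comp[OF pure2_lin(1)[OF vi(2)] g] il] by simp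
  next
   assume "k = i + 1"
   then show ?thesis unfolding ins using lin_comp[OF lin_comp[OF pure2_lin(2)[OF vi(1)] g] il] by simp
  qed
 next
  case False
  \<comment> \<open>Now the inserted tensor is fixed, and \<open>u\<close> is a parameter of the
    lift.\<close>
  have "lin K M (tpow K M n) (%u. insert2 n i (v(k := u)) (g (pure2 K M (v i) (v (i + 1)))))" unfolding insert2_def
  proof (rule T.lift_param_lin[OF M T.tensor_module insert2_multilin _ gz])
   show "(v(k := u)) j \<in> carrier M" if "u \<in> carrier M" "j \<in> {1..n}" for u j using v that by auto
   fix y assume y: "y \<in> (\<Pi>\<^sub>E j\<in>{1..2::nat}. carrier M)"
   have yM: "y 1 \<in> carrier M" "y 2 \<in> carrier M" by (rule PiE_mem[OF y]; simp)+
   have "lin K M (tpow K M n) (%u. tpure K M n ((v(i := y 1, i + 1 := y 2))(k := u)))"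
    by (rule T.pure_lin) (use v yM k in auto)
   moreover have "(v(i := y 1, i + 1 := y 2))(k := u) = (v(k := u))(i := y 1, i + 1 := y 2)" for u
    using False by (auto simp: fun_eq_iff)
   ultimately show "lin K M (tpow K M n) (%u. tpure K M n ((v(k := u))(i := y 1, i + 1 := y 2)))" by simp
  qed
  then show ?thesis using False by simp
 qed
qed

lemma on_factors_insert2:
 "on_factors K M n i g = tpow_lift K M n (tpow K M n) (%v. insert2 n i v (g (pure2 K M (v i) (v (i + 1)))))"
 by (simp add: on_factors_def insert2_def)

lemma on_factors_linear_maps:
 "lin K (tpow K M 2) (tpow K M 2) g ==> on_factors K M n i g \<in> linear_maps K (tpow K M n) (tpow K M n)"
 unfolding on_factors_insert2 by (rule T.tensor_lift_linear_maps[OF T.tensor_module on_factors_multilin])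

lemma on_factors_tpure:
 assumes "lin K (tpow K M 2) (tpow K M 2) g" "!!j. j \<in> {1..n} ==> v j \<in> carrier M"
 shows "on_factors K M n i g (tpure K M n v) = insert2 n i v (g (pure2 K M (v i) (v (i + 1))))"
proof -
 have "on_factors K M n i g (tpure K M n v) =
   insert2 n i (restrict v {1..n}) (g (pure2 K M (restrict v {1..n} i) (restrict v {1..n} (i + 1))))"
  unfolding on_factors_insert2
  by (rule T.tensor_lift_pure[OF T.tensor_module on_factors_multilin[OF assms(1)] assms(2)])
 also have "insert2 n i (restrict v {1..n}) = insert2 n i v"
 proof -
  have "tpure K M n ((restrict v {1..n})(i := p, i + 1 := q)) = tpure K M n (v(i := p, i + 1 := q))" for p q
   by (rule T.pure_cong) auto
  then show ?thesis unfolding insert2_def by simp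
 qed
 finally show ?thesis using i by simp
qed

end

end

section \<open>Identification of the monomial operators\<close>

context block_tensor
begin

lemma psi_slot:
 assumes b: "b \<in> {1..d}" and f: "f \<in> C b (\<nu> b)" and Y: "!!c. c \<in> {1..d} ==> Y c \<in> carrier (tpow K (V c) (\<nu> c))"
 shows "psi \<nu> (slot \<nu> b f) (pure K {1..d} (%b. tpow K (V b) (\<nu> b)) Y) = pure K {1..d} (%b. tpow K (V b) (\<nu> b)) (Y(b := f (Y b)))"
proof -
 let ?f = "%c. if c = b then f else \<one>\<^bsub>CA \<nu> c\<^esub>"
 have fC: "?f c \<in> C c (\<nu> c)" if "c \<in> {1..d}" for c using that f C_one by auto
 have "psi \<nu> (slot \<nu> b f) = tmap K {1..d} (%b. tpow K (V b) (\<nu> b)) (%b. tpow K (V b) (\<nu> b)) ?f"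
  unfolding slot_def by (rule O.psi_pure[OF fC])
 moreover have "lin K (tpow K (V c) (\<nu> c)) (tpow K (V c) (\<nu> c)) (?f c)" if "c \<in> {1..d}" for c
  by (rule O.C_lin[where \<nu> = \<nu>, OF that fC[OF that]])
 from O.U.tmap_pure[OF this Y]
 have "tmap K {1..d} (%b. tpow K (V b) (\<nu> b)) (%b. tpow K (V b) (\<nu> b)) ?f
   (pure K {1..d} (%b. tpow K (V b) (\<nu> b)) Y) = pure K {1..d} (%b. tpow K (V b) (\<nu> b)) (%c. ?f c (Y c))" .
 ultimately have "psi \<nu> (slot \<nu> b f) (pure K {1..d} (%b. tpow K (V b) (\<nu> b)) Y) =
   pure K {1..d} (%b. tpow K (V b) (\<nu> b)) (%c. ?f c (Y c))"
  by (simp only:)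
 also have "... = pure K {1..d} (%b. tpow K (V b) (\<nu> b)) (Y(b := f (Y b)))" by (rule NT.outer.pure_cong) (use Y in auto)
 finally show ?thesis .
qed

lemma iota_slot_lin:
 assumes w: "w \<in> words d n" and b: "b \<in> {1..d}" and Y: "!!c. c \<in> {1..d} ==> Y c \<in> carrier (tpow K (V c) (cont w c))"
 shows "lin K (tpow K (V b) (cont w b)) (tpow K W n) (%Z. iota w (pure K {1..d} (%b. tpow K (V b) (cont w b)) (Y(b := Z))))"
 by (rule lin_comp[OF NT.outer.pure_lin iota_lin[OF w]]) (use Y b in auto)

end

locale braid_ops = braid_setup K d V \<phi> \<zeta>
 for K :: "'k ring" (structure) and d :: nat and V :: "nat => ('k, 'v) module" and \<phi> and \<zeta> :: 'k +
 fixes R :: "nat => (nat, 'v, 'k) tens => (nat, 'v, 'k) tens"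
 assumes R: "!!b. b \<in> {1..d} ==> R b \<in> linear_maps K (tpow K (V b) 2) (tpow K (V b) 2)"
  and phi_R: "!!b m i. b \<in> {1..d} ==> 1 \<le> i ==> i < m ==> \<phi> b m (braid_elt K m (Sg i)) = on_factors K (V b) m i (R b)"
begin

sublocale WP: tensor_powers K W by (intro tensor_powers.intro K_cring W_module)

lemma VP: "b \<in> {1..d} ==> tensor_powers K (V b)" by (intro tensor_powers.intro K_cring V)

lemma ph_R: "b \<in> {1..d} ==> 1 \<le> i ==> i < m ==> ph b m i True = on_factors K (V b) m i (R b)"
 using phi_R by (simp add: ph_def braid_elt_def pgen_wcls)

abbreviation "hom2 b \<equiv> tensor_map K (V b) W 2 (%_. emb b)"

lemma two_prods: "b \<in> {1..d} ==> two_tensor_prods K {1..m} (%_. V b) (%_. W)"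
 by (intro two_tensor_prods.intro tpowV TW.tensor_prod_axioms)

lemma hom2_lin: "b \<in> {1..d} ==> lin K (tpow K (V b) 2) (tpow K W 2) (hom2 b)"
 unfolding tensor_map_tmap by (rule two_tensor_prods.tmap_lin[OF two_prods emb_lin])

lemma hom2_pure2:
 assumes b: "b \<in> {1..d}" and "v \<in> carrier (V b)" "w \<in> carrier (V b)"
 shows "hom2 b (pure2 K (V b) v w) = pure2 K W (emb b v) (emb b w)"
proof -
 have "hom2 b (pure2 K (V b) v w) = tpure K W 2 (%i. emb b (if i = 1 then v else w))" unfolding tensor_map_tmap pure2_def
  by (rule two_tensor_prods.tmap_pure[OF two_prods[OF b] emb_lin[OF b]]) (use assms in auto)
 then show ?thesis unfolding pure2_def by (simp add: if_distrib)
qed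

text \<open>Both sides are linear in the image of the two factors under \<open>R\<close>, so it suffices to compare them on pure tensors.\<close>

lemma sig_iota_same:
 assumes w: "w \<in> words d n" and i: "1 \<le> i" "i < n" and eq: "letter w i = letter w (i + 1)" and v: "fam (cont w) v"
 shows "sig n True i (iota w (pp (cont w) v)) = WP.insert2 n i (%k. emb (letter w k) (v (letter w k) (rank w k)))
   (hom2 (letter w i) (R (letter w i) (pure2 K (V (letter w i)) (v (letter w i) (rank w i)) (v (letter w i) (rank w i + 1)))))"
proof -
 let ?b = "letter w i" and ?r = "rank w i"
 let ?m = "cont w ?b" and ?x = "%k. emb (letter w k) (v (letter w k) (rank w k))"
 note sr = same_letter_rank[OF w i eq]
 interpret B: tensor_powers K "V ?b" by (rule VP[OF sr(1)])
 have lw: "length w = n" using w by (simp add: words_def)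
 have rk: "rank w (i + 1) = ?r + 1" using rank_Suc[of i w] i lw eq by simp
 have vb: "v ?b j \<in> carrier (V ?b)" if "j \<in> {1..?m}" for j using v sr(1) that by (auto simp: fam_def)
 have vr: "v ?b ?r \<in> carrier (V ?b)" "v ?b (?r + 1) \<in> carrier (V ?b)" using vb sr by auto
 have Rl: "lin K (tpow K (V ?b) 2) (tpow K (V ?b) 2) (R ?b)" using R[OF sr(1)] by (rule linear_maps_lin)
 let ?Z = "R ?b (pure2 K (V ?b) (v ?b ?r) (v ?b (?r + 1)))"
 have Z: "?Z \<in> carrier (tpow K (V ?b) 2)" by (rule lin_closed[OF Rl B.pure2_closed[OF vr]])
 let ?Y = "%c. tpure K (V c) (cont w c) (v c)"
 have Y: "?Y c \<in> carrier (tpow K (V c) (cont w c))" if "c \<in> {1..d}" for c using v that by (rule tpure_fam)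
 have x: "?x k \<in> carrier W" if "k \<in> {1..n}" for k using fam_letter[OF w v that] letter_in[OF w that] by (intro emb_closed)
 have pc: "pp (cont w) v \<in> carrier (U (cont w))" by (rule pp_closed[OF v])
 have "sig n True i (iota w (pp (cont w) v)) = iota (sw i w) (psi (cont w) (gX True i w) (pp (cont w) v))"
  unfolding sig_def mon_iota[OF sig_compatible[OF i] w pc]
 proof (rule TW.T.smult_one)
  have "sw i w = w" using sw_same[of i w] i lw eq by simp
  then show "iota (sw i w) (psi (cont w) (gX True i w) (pp (cont w) v)) \<in> carW n"
   using iota_closed[OF w psi_closed'[OF gX_closed[OF w i] pc]] by simp
 qed
 also have "sw i w = w" using sw_same[of i w] i lw eq by simp
 also have "gX True i w = slot (cont w) ?b (ph ?b ?m ?r True)" unfolding gX_def by (rule if_P[OF eq])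
 also have "psi (cont w) (slot (cont w) ?b (ph ?b ?m ?r True)) (pp (cont w) v) =
   pure K {1..d} (%b. tpow K (V b) (cont w b)) (?Y(?b := ph ?b ?m ?r True (?Y ?b)))"
  by (rule psi_slot[OF sr(1) ph_Cb[OF sr(2,3)] Y])
 also have "ph ?b ?m ?r True (?Y ?b) = B.insert2 ?m ?r (v ?b) ?Z"
  unfolding ph_R[OF sr] by (rule B.on_factors_tpure[OF sr(2,3) Rl vb])
 also have "iota w (pure K {1..d} (%b. tpow K (V b) (cont w b)) (?Y(?b := B.insert2 ?m ?r (v ?b) ?Z))) =
   WP.insert2 n i ?x (hom2 ?b ?Z)"
 proof (rule B.T.tensor_lin_eq[OF TW.tensor_module _ _ _ Z])
  show "lin K (tpow K (V ?b) 2) (tpow K W n)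
    (%Z. iota w (pure K {1..d} (%b. tpow K (V b) (cont w b)) (?Y(?b := B.insert2 ?m ?r (v ?b) Z))))"
   by (rule lin_comp[OF B.insert2_lin[OF sr(2,3)] iota_slot_lin[OF w sr(1) Y]]) (rule vb)
  show "lin K (tpow K (V ?b) 2) (tpow K W n) (%Z. WP.insert2 n i ?x (hom2 ?b Z))"
   by (rule lin_comp[OF hom2_lin[OF sr(1)] WP.insert2_lin[OF i]]) (rule x)
  fix z assume z: "z \<in> (\<Pi>\<^sub>E j\<in>{1..2::nat}. carrier (V ?b))"
  have zM: "z 1 \<in> carrier (V ?b)" "z 2 \<in> carrier (V ?b)" by (rule PiE_mem[OF z]; simp)+
  let ?v = "v(?b := (v ?b)(?r := z 1, ?r + 1 := z 2))"
  have fv: "fam (cont w) ?v" using v zM by (auto simp: fam_def)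
  have "B.insert2 ?m ?r (v ?b) (tpure K (V ?b) 2 z) = tpure K (V ?b) ?m ((v ?b)(?r := z 1, ?r + 1 := z 2))"
   unfolding B.tpure_pure2 by (rule B.insert2_pure2[OF sr(2,3) _ zM]) (rule vb)
  moreover have "?Y(?b := tpure K (V ?b) ?m ((v ?b)(?r := z 1, ?r + 1 := z 2))) = (%c. tpure K (V c) (cont w c) (?v c))"
   by (auto simp: fun_eq_iff)
  ultimately have "iota w (pure K {1..d} (%b. tpow K (V b) (cont w b)) (?Y(?b := B.insert2 ?m ?r (v ?b) (tpure K (V ?b) 2 z)))) =
    iota w (pp (cont w) ?v)" by (simp only:)
  also have "... = tpure K W n (%k. emb (letter w k) (?v (letter w k) (rank w k)))" by (rule iota_pp[OF w fv])
  also have "... = tpure K W n (?x(i := emb ?b (z 1), i + 1 := emb ?b (z 2)))"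
  proof (rule TW.pure_cong)
   fix k assume k: "k \<in> {1..n}"
   \<comment> \<open>Letter and rank determine the position, so altering two entries of the family
     alters exactly the positions \<open>i\<close> and \<open>i + 1\<close>.\<close>
   have "k = k'" if "k' \<in> {1..n}" "letter w k = letter w k'" "rank w k = rank w k'" for k'
    using position_unique[of k w] position_unique[of k' w] k that lw by metis
   from this[of i] this[of "i + 1"] i rk eq
   show "emb (letter w k) (?v (letter w k) (rank w k)) = (?x(i := emb ?b (z 1), i + 1 := emb ?b (z 2))) k"
    by (cases "k = i"; cases "k = i + 1") auto
  qed
  also have "... = WP.insert2 n i ?x (hom2 ?b (tpure K (V ?b) 2 z))" unfolding B.tpure_pure2 hom2_pure2[OF sr(1) zM]
   by (rule WP.insert2_pure2[OF i x, symmetric]) (use emb_closed[OF sr(1)] zM in auto)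
  finally show "iota w (pure K {1..d} (%b. tpow K (V b) (cont w b)) (?Y(?b := B.insert2 ?m ?r (v ?b) (tpure K (V ?b) 2 z)))) =
    WP.insert2 n i ?x (hom2 ?b (tpure K (V ?b) 2 z))" .
 qed
 finally show ?thesis .
qed

text \<open>The block is trivial here, and \<open>sw\<close> moves letters and ranks together, so
  each vector travels to the neighbouring position.\<close>

lemma sig_iota_neq:
 assumes w: "w \<in> words d n" and i: "1 \<le> i" "i < n" and ne: "letter w i ~= letter w (i + 1)" and v: "fam (cont w) v"
 defines "x \<equiv> %k. emb (letter w k) (v (letter w k) (rank w k))"
 shows "sig n True i (iota w (pp (cont w) v)) = tpure K W n (x(i := x (i + 1), i + 1 := x i))"
proof -
 have lw: "length w = n" using w by (simp add: words_def)
 have pc: "pp (cont w) v \<in> carrier (U (cont w))" by (rule pp_closed[OF v])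
 have sww: "sw i w \<in> words d n" by (rule sw_words[OF i w])
 have ct: "cont (sw i w) = cont w" using i lw by (intro content_sw) simp_all
 have ic: "iota (sw i w) (pp (cont w) v) \<in> carW n" using iota_closed[OF sww] pc ct by simp
 have "psi (cont w) (gX True i w) (pp (cont w) v) = pp (cont w) v" unfolding gX_neq[OF ne] O.psi_one using pc by simp
 then have "sig n True i (iota w (pp (cont w) v)) = iota (sw i w) (pp (cont w) v)"
  unfolding sig_def mon_iota[OF sig_compatible[OF i] w pc] using TW.T.smult_one[OF ic] by simp
 also have "... = tpure K W n (%k. emb (letter (sw i w) k) (v (letter (sw i w) k) (rank (sw i w) k)))"
  using iota_pp[OF sww, of v] v ct by simp
 also have "... = tpure K W n (x(i := x (i + 1), i + 1 := x i))"
 proof (rule TW.pure_cong)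
  fix k assume k: "k \<in> {1..n}"
  have "letter (sw i w) k = letter w (transpose i (i + 1) k)" "rank (sw i w) k = rank w (transpose i (i + 1) k)"
   using letter_sw[of i w k] rank_sw[of i w k] i lw ne k by simp_all
  then show "emb (letter (sw i w) k) (v (letter (sw i w) k) (rank (sw i w) k)) = (x(i := x (i + 1), i + 1 := x i)) k"
   by (auto simp: x_def transpose_def)
 qed
 finally show ?thesis .
qed

text \<open>A pure tensor of two homogeneous vectors lies in the component of a two-letter word.
  This gives the equations that characterise \<open>sigma_op\<close>.\<close>

lemma sig_pure2:
 assumes b: "b \<in> {1..d}" "c \<in> {1..d}" and v: "v \<in> carrier (V b)" "w \<in> carrier (V c)"
 shows "sig 2 True 1 (pure2 K W (emb b v) (emb c w)) =
  (if b ~= c then pure2 K W (emb c w) (emb b v) else hom2 b (R b (pure2 K (V b) v w)))"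
proof -
 have i: "(1::nat) \<le> 1" "(1::nat) < 2" by auto
 have two: "pure2 K W (x 1) (x 2) = tpure K W 2 x" for x by (rule WP.tpure_pure2[symmetric])
 let ?w = "[b, c]" and ?u = "\<lambda>k::nat. if k = 1 then v else w"
 have ww: "?w \<in> words d 2" using b by (simp add: words_def)
 have lt: "letter ?w 1 = b" "letter ?w 2 = c" by (simp_all add: letter_def)
 have uV: "?u k \<in> carrier (V (letter ?w k))" if "k \<in> {1..2}" for k
 proof -
  have "k = 1 \<or> k = 2" using that by auto
  then show ?thesis using v lt by auto
 qed
 let ?f = "%b j. ?u (position ?w b j)"
 note hp = homogeneous_tpure[OF ww uV]
 have p: "position ?w (letter ?w k) (rank ?w k) = k" if "k \<in> {1..2}" for k using position_unique[of k ?w] that by simp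
 have x: "(%k. emb (letter ?w k) (?f (letter ?w k) (rank ?w k))) 1 = emb b v"
  "(%k. emb (letter ?w k) (?f (letter ?w k) (rank ?w k))) 2 = emb c w"
  using p[of 1] p[of 2] lt by simp_all
 let ?x = "%k. emb (letter ?w k) (?f (letter ?w k) (rank ?w k))"
 have io: "iota ?w (pp (cont ?w) ?f) = pure2 K W (emb b v) (emb c w)" using iota_pp[OF ww hp(1)] two[of ?x] x by simp
 show ?thesis
 proof (cases "b = c")
  case False
  have ne: "letter ?w 1 ~= letter ?w (1 + 1)" using lt False by simp
  have "sig 2 True 1 (iota ?w (pp (cont ?w) ?f)) = tpure K W 2 (?x(1 := ?x (1 + 1), 1 + 1 := ?x 1))"
   by (rule sig_iota_neq[OF ww i ne hp(1)])
  also have "... = pure2 K W (emb c w) (emb b v)" unfolding WP.tpure_pure2 using x by simp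
  finally show ?thesis using io False by simp
 next
  case True
  have eq: "letter ?w 1 = letter ?w (1 + 1)" using lt True by simp
  have rk: "rank ?w (1 + 1) = rank ?w 1 + 1" by (rule rank_Suc[OF _ _ eq]) auto
  have "?f b (rank ?w 1) = v" "?f b (rank ?w 1 + 1) = w" using p[of 1] p[of 2] lt rk True by simp_all
  then have "sig 2 True 1 (iota ?w (pp (cont ?w) ?f)) = WP.insert2 2 1 ?x (hom2 b (R b (pure2 K (V b) v w)))"
   using sig_iota_same[OF ww i eq hp(1)] lt(1) by simp
  \<comment> \<open>Inserting a tensor into a power that has only two factors returns that
    tensor.\<close>
  also have "... = hom2 b (R b (pure2 K (V b) v w))"
  proof -
   have "w \<in> carrier (V b)" using v True by simp
   then have c: "hom2 b (R b (pure2 K (V b) v w)) \<in> carrier (tpow K W 2)"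
    using lin_closed[OF hom2_lin[OF b(1)] lin_closed[OF linear_maps_lin[OF R[OF b(1)]]
     tensor_powers.pure2_closed[OF VP[OF b(1)] v(1)]]] by blast
   have xW: "?x j \<in> carrier W" if "j \<in> {1..2}" for j
    using fam_letter[OF ww hp(1) that] letter_in[OF ww that] by (intro emb_closed)
   show ?thesis
   proof (rule TW.tensor_lin_eq[OF TW.tensor_module WP.insert2_lin[OF i] lin_id _ c])
    fix z assume z: "z \<in> (\<Pi>\<^sub>E j\<in>{1..2::nat}. carrier W)"
    have zM: "z 1 \<in> carrier W" "z 2 \<in> carrier W" by (rule PiE_mem[OF z]; simp)+
    have "WP.insert2 2 1 ?x (pure2 K W (z 1) (z 2)) = tpure K W 2 (?x(1 := z 1, 1 + 1 := z 2))"
     by (rule WP.insert2_pure2[OF i xW zM])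
    then show "WP.insert2 2 1 ?x (tpure K W 2 z) = tpure K W 2 z" unfolding WP.tpure_pure2 by simp
   qed (rule xW)
  qed
  finally show ?thesis using io True by simp
 qed
qed

text \<open>Existence for the definite description is supplied by the monomial operator; uniqueness
  holds since pure tensors of homogeneous vectors span.\<close>

lemma sigma_op_eq: "sigma_op K d V R = sig 2 True 1"
proof -
 let ?P = "%s. s \<in> linear_maps K (tpow K W 2) (tpow K W 2) \<and> (ALL b:{1..d}. ALL c:{1..d}. ALL v:carrier (V b). ALL w:carrier (V c).
     s (pure2 K W (emb b v) (emb c w)) =
     (if b ~= c then pure2 K W (emb c w) (emb b v) else hom2 b (R b (pure2 K (V b) v w))))"
 have i: "(1::nat) \<le> 1" "(1::nat) < 2" by auto
 have sl: "sig 2 True 1 \<in> linear_maps K (tpow K W 2) (tpow K W 2)" using sig_closed[OF i] by simp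
 have P: "?P (sig 2 True 1)" using sl sig_pure2 by blast
 have "s = sig 2 True 1" if s: "?P s" for s
 proof (rule linear_maps_ext[OF s[THEN conjunct1] sl])
  fix z assume z: "z \<in> carrier (tpow K W 2)"
  show "s z = sig 2 True 1 z"
  proof (rule lin_eq_on_spans[OF TW.tensor_module TW.tensor_module spans_iota
     linear_maps_lin[OF s[THEN conjunct1]] linear_maps_lin[OF sl] _ z])
   fix y assume "y \<in> (\<Union>w\<in>words d 2. iota w ` pp (cont w) ` Collect (fam (cont w)))"
   then obtain w v where w: "w \<in> words d 2" and v: "fam (cont w) v" and y: "y = iota w (pp (cont w) v)" by blast
   have y': "y = pure2 K W (emb (letter w 1) (v (letter w 1) (rank w 1))) (emb (letter w 2) (v (letter w 2) (rank w 2)))"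
    unfolding y iota_pp[OF w v] WP.tpure_pure2 ..
   have "letter w k \<in> {1..d}" "v (letter w k) (rank w k) \<in> carrier (V (letter w k))" if "k \<in> {1..2}" for k
    using letter_in[OF w that] fam_letter[OF w v that] by auto
   from this[of 1] this[of 2] show "s y = sig 2 True 1 y" unfolding y' using s P by simp
  qed
 qed
 with P show ?thesis unfolding sigma_op_def Let_def by (intro the_equality) blast+
qed

lemma sig_on_factors:
 assumes i: "1 \<le> i" "i < n" shows "sig n True i = on_factors K W n i (sigma_op K d V R)"
proof -
 have i2: "(1::nat) \<le> 1" "(1::nat) < 2" by auto
 have sl: "sig 2 True 1 \<in> linear_maps K (tpow K W 2) (tpow K W 2)" using sig_closed[OF i2] by simp
 note sl' = linear_maps_lin[OF sl]
 note ol = WP.on_factors_linear_maps[OF i sl']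
 have snl: "sig n True i \<in> linmapsW n" using sig_closed[OF i] by simp
 show ?thesis unfolding sigma_op_eq
 proof (rule linear_maps_ext[OF snl ol])
  fix z assume z: "z \<in> carW n"
  show "sig n True i z = on_factors K W n i (sig 2 True 1) z"
  proof (rule lin_eq_on_spans[OF TW.tensor_module TW.tensor_module spans_iota linear_maps_lin[OF snl] linear_maps_lin[OF ol] _ z])
   fix y assume "y \<in> (\<Union>w\<in>words d n. iota w ` pp (cont w) ` Collect (fam (cont w)))"
   then obtain w v where w: "w \<in> words d n" and v: "fam (cont w) v" and y: "y = iota w (pp (cont w) v)" by blast
   let ?x = "%k. emb (letter w k) (v (letter w k) (rank w k))"
   have x: "?x k \<in> carrier W" if "k \<in> {1..n}" for k using fam_letter[OF w v that] letter_in[OF w that] by (intro emb_closed)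
   have R: "on_factors K W n i (sig 2 True 1) y = WP.insert2 n i ?x (sig 2 True 1 (pure2 K W (?x i) (?x (i + 1))))"
    unfolding y iota_pp[OF w v] by (rule WP.on_factors_tpure[OF i sl' x])
   have ii: "i \<in> {1..n}" "i + 1 \<in> {1..n}" using i by auto
   note li = letter_in[OF w ii(1)] letter_in[OF w ii(2)] fam_letter[OF w v ii(1)] fam_letter[OF w v ii(2)]
   let ?w = "[letter w i, letter w (i + 1)]"
   have w2: "?w \<in> words d 2" using li by (simp add: words_def)
   let ?u = "\<lambda>k::nat. if k = 1 then v (letter w i) (rank w i) else v (letter w (i + 1)) (rank w (i + 1))"
   have lt: "letter ?w 1 = letter w i" "letter ?w 2 = letter w (i + 1)" by (simp_all add: letter_def)
   have spec: "sig 2 True 1 (pure2 K W (?x i) (?x (i + 1))) =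
    (if letter w i ~= letter w (i + 1) then pure2 K W (?x (i + 1)) (?x i)
     else hom2 (letter w i) (R (letter w i) (pure2 K (V (letter w i)) (v (letter w i) (rank w i)) (v (letter w (i + 1)) (rank w (i + 1))))))"
    by (rule sig_pure2[OF li])
   show "sig n True i y = on_factors K W n i (sig 2 True 1) y"
   proof (cases "letter w i = letter w (i + 1)")
    case True
    have "rank w (i + 1) = rank w i + 1" using rank_Suc[of i w] i w True by (simp add: words_def)
    then show ?thesis unfolding R spec unfolding y sig_iota_same[OF w i True v] using True by simp
   next
    case False
    have "WP.insert2 n i ?x (pure2 K W (?x (i + 1)) (?x i)) = tpure K W n (?x(i := ?x (i + 1), i + 1 := ?x i))"
     by (rule WP.insert2_pure2[OF i x x[OF ii(2)] x[OF ii(1)]])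
    then show ?thesis unfolding R spec unfolding y sig_iota_neq[OF w i False v] using False by simp
   qed
  qed
 qed
qed

lemma tau_op_lin: "lin K W W (tau_op K d \<zeta> V)"
proof (rule linI)
 interpret W: module K W by (rule W_module)
 fix x assume x: "x \<in> carrier W"
 then have xb: "x b \<in> carrier (V b)" if "b \<in> {1..d}" for b using that by (auto simp: dsum_simps)
 show "tau_op K d \<zeta> V x \<in> carrier W"
  using x xb module.smult_closed[OF V zeta_pow] by (simp add: tau_op_def) (simp add: dsum_simps)
 { fix y assume y: "y \<in> carrier W"
  then have yb: "y b \<in> carrier (V b)" if "b \<in> {1..d}" for b using that by (auto simp: dsum_simps)
  show "tau_op K d \<zeta> V (x \<oplus>\<^bsub>W\<^esub> y) = tau_op K d \<zeta> V x \<oplus>\<^bsub>W\<^esub> tau_op K d \<zeta> V y"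
   using W.a_closed[OF x y] x y xb yb module.smult_r_distr[OF V zeta_pow]
   by (simp add: tau_op_def) (auto simp: dsum_simps fun_eq_iff) }
 fix c assume c: "c \<in> carrier K"
 have "\<zeta> [^] (b - 1) \<odot>\<^bsub>V b\<^esub> (c \<odot>\<^bsub>V b\<^esub> x b) = c \<odot>\<^bsub>V b\<^esub> (\<zeta> [^] (b - 1) \<odot>\<^bsub>V b\<^esub> x b)" if b: "b \<in> {1..d}" for b
  using module.smult_assoc1[OF V[OF b] zeta_pow c xb[OF b]] module.smult_assoc1[OF V[OF b] c zeta_pow xb[OF b]]
   comm_monoid.m_comm[OF cring.axioms(2)[OF K_cring] c zeta_pow] by metis
 then show "tau_op K d \<zeta> V (c \<odot>\<^bsub>W\<^esub> x) = c \<odot>\<^bsub>W\<^esub> tau_op K d \<zeta> V x"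
  using W.smult_closed[OF c x] x by (simp add: tau_op_def) (auto simp: dsum_simps fun_eq_iff)
qed

lemma tau_op_emb:
 assumes b: "b \<in> {1..d}" and v: "v \<in> carrier (V b)"
 shows "tau_op K d \<zeta> V (emb b v) = \<zeta> [^] (b - 1) \<odot>\<^bsub>W\<^esub> emb b v"
proof -
 have "\<zeta> [^] (c - 1) \<odot>\<^bsub>V c\<^esub> emb b v c = \<zeta> [^] (b - 1) \<odot>\<^bsub>V c\<^esub> emb b v c" if c: "c \<in> {1..d}" for c
  using module.smult_r_null[OF V[OF c] zeta_pow] c by (simp add: dsum_in_apply)
 then show ?thesis using emb_closed[OF b v] by (simp add: tau_op_def) (auto simp: dsum_simps fun_eq_iff)
qed

lemma ta_on_factor:
 assumes i: "i \<in> {1..n}" shows "ta n True i = on_factor K W n i (tau_op K d \<zeta> V)"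
proof -
 interpret TT: two_tensor_prods K "{1..n}" "%_. W" "%_. W" by (intro two_tensor_prods.intro TW.tensor_prod_axioms)
 let ?f = "%j v. if j = i then tau_op K d \<zeta> V v else v"
 have fl: "lin K W W (?f j)" if "j \<in> {1..n}" for j using tau_op_lin lin_id by (cases "j = i") auto
 have ol: "on_factor K W n i (tau_op K d \<zeta> V) \<in> linmapsW n"
  unfolding on_factor_tmap by (rule TT.tmap_linear_maps[OF fl])
 show ?thesis unfolding ta_def
 proof (rule mon_unique[OF ta_compatible ol])
  fix w y assume w: "w \<in> words d n" and y: "y \<in> carrier (U (cont w))"
  have c: "\<zeta> [^] ((letter w i - 1) * (if True then 1 else d - 1)) = \<zeta> [^] (letter w i - 1)" by simp
  have "on_factor K W n i (tau_op K d \<zeta> V) (iota w y) = \<zeta> [^] (letter w i - 1) \<odot>\<^bsub>tpow K W n\<^esub> iota w y"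
  proof (rule U_lin_eq[OF TW.tensor_module lin_comp[OF iota_lin[OF w] linear_maps_lin[OF ol]]
     lin_smult_map[OF TW.tensor_module iota_lin[OF w] zeta_pow] _ y])
   fix v assume v: "fam (cont w) v"
   let ?x = "%k. emb (letter w k) (v (letter w k) (rank w k))"
   have x: "?x k \<in> carrier W" if "k \<in> {1..n}" for k using fam_letter[OF w v that] letter_in[OF w that] by (intro emb_closed)
   have "on_factor K W n i (tau_op K d \<zeta> V) (iota w (pp (cont w) v)) = tpure K W n (%j. ?f j (?x j))"
    unfolding iota_pp[OF w v] on_factor_tmap by (rule TT.tmap_pure[OF fl x])
   also have "... = tpure K W n (?x(i := \<zeta> [^] (letter w i - 1) \<odot>\<^bsub>W\<^esub> ?x i))"
    using tau_op_emb[OF letter_in[OF w i] fam_letter[OF w v i]] by (intro TW.pure_cong) auto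
   also have "... = \<zeta> [^] (letter w i - 1) \<odot>\<^bsub>tpow K W n\<^esub> tpure K W n (?x(i := ?x i))"
    by (rule lin_smult[OF TW.pure_lin[OF x i] zeta_pow x[OF i]])
   also have "tpure K W n (?x(i := ?x i)) = iota w (pp (cont w) v)"
    unfolding iota_pp[OF w v] by (rule arg_cong[of _ _ "tpure K W n"]) (rule fun_upd_triv)
   finally show "on_factor K W n i (tau_op K d \<zeta> V) (iota w (pp (cont w) v)) =
     \<zeta> [^] (letter w i - 1) \<odot>\<^bsub>tpow K W n\<^esub> iota w (pp (cont w) v)" .
  qed
  then show "on_factor K W n i (tau_op K d \<zeta> V) (iota w y) =
    \<zeta> [^] ((letter w i - 1) * (if True then 1 else d - 1)) \<odot>\<^bsub>tpow K W n\<^esub> iota w (psi (cont w) \<one>\<^bsub>TC (cont w)\<^esub> y)"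
   unfolding c O.psi_one using y by simp
 qed
qed

end

section \<open>Concatenation of tensors\<close>

context tensor_powers
begin

abbreviation "cc m x y \<equiv> (%i. if i \<le> m then x i else y (i - m))"

lemma cc_multilin2:
 assumes x: "!!i. i \<in> {1..m} ==> x i \<in> carrier M"
 shows "multilin K {1..n} (%_. M) (tpow K M (m + n)) (%y. tpure K M (m + n) (cc m x y))"
proof (rule multilinI)
 fix y assume y': "y \<in> (\<Pi>\<^sub>E i\<in>{1..n}. carrier M)"
 have y: "y i \<in> carrier M" if "i \<in> {1..n}" for i using y' that by (rule PiE_mem)
 have xy: "cc m x y i \<in> carrier M" if i: "i \<in> {1..m + n}" for i
 proof (cases "i \<le> m")
  case False
  then have "i - m \<in> {1..n}" using i by (simp only: atLeastAtMost_iff) arith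
  then show ?thesis using y False by simp
 qed (use x i in auto)
 then show "tpure K M (m + n) (cc m x y) \<in> carrier (tpow K M (m + n))" by (rule T.pure_closed)
 fix i assume i: "i \<in> {1..n}"
 have "lin K M (tpow K M (m + n)) (%u. tpure K M (m + n) ((cc m x y)(m + i := u)))" by (rule T.pure_lin[OF xy]) (use i in auto)
 moreover have "(cc m x y)(m + i := u) = cc m x (y(i := u))" for u using i by (auto simp: fun_eq_iff)
 ultimately show "lin K M (tpow K M (m + n)) (%u. tpure K M (m + n) (cc m x (y(i := u))))" by simp
qed

lemma cc_multilin1:
 assumes Y: "Y \<in> carrier (tpow K M n)"
 shows "multilin K {1..m} (%_. M) (tpow K M (m + n))
  (%x. tpow_lift K M n (tpow K M (m + n)) (%y. tpure K M (m + n) (cc m x y)) Y)"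
proof (rule multilinI)
 fix x assume x': "x \<in> (\<Pi>\<^sub>E i\<in>{1..m}. carrier M)"
 have x: "x i \<in> carrier M" if "i \<in> {1..m}" for i using x' that by (rule PiE_mem)
 show "tpow_lift K M n (tpow K M (m + n)) (%y. tpure K M (m + n) (cc m x y)) Y \<in> carrier (tpow K M (m + n))"
  by (rule lin_closed[OF T.tensor_lift_lin[OF T.tensor_module cc_multilin2[OF x]] Y])
 fix k assume k: "k \<in> {1..m}"
 show "lin K M (tpow K M (m + n)) (%u. tpow_lift K M n (tpow K M (m + n)) (%y. tpure K M (m + n) (cc m (x(k := u)) y)) Y)"
 proof (rule T.lift_param_lin[OF M T.tensor_module cc_multilin2 _ Y])
  show "(x(k := u)) i \<in> carrier M" if "u \<in> carrier M" "i \<in> {1..m}" for u i using x that by auto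
  fix y assume y': "y \<in> (\<Pi>\<^sub>E i\<in>{1..n}. carrier M)"
  have y: "y i \<in> carrier M" if "i \<in> {1..n}" for i using y' that by (rule PiE_mem)
  have xy: "cc m x y i \<in> carrier M" if i: "i \<in> {1..m + n}" for i
  proof (cases "i \<le> m")
   case False
   then have "i - m \<in> {1..n}" using i by (simp only: atLeastAtMost_iff) arith
   then show ?thesis using y False by simp
  qed (use x i in auto)
  have "lin K M (tpow K M (m + n)) (%u. tpure K M (m + n) ((cc m x y)(k := u)))" by (rule T.pure_lin[OF xy]) (use k in auto)
  moreover have "(cc m x y)(k := u) = cc m (x(k := u)) y" for u using k by (auto simp: fun_eq_iff)
  ultimately show "lin K M (tpow K M (m + n)) (%u. tpure K M (m + n) (cc m (x(k := u)) y))" by simp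
 qed
qed

lemma tconcat_lin1: "Y \<in> carrier (tpow K M n) ==> lin K (tpow K M m) (tpow K M (m + n)) (%X. tconcat K M m n X Y)"
 unfolding tconcat_def by (rule T.tensor_lift_lin[OF T.tensor_module cc_multilin1])

lemma tconcat_lin2:
 assumes X: "X \<in> carrier (tpow K M m)"
 shows "lin K (tpow K M n) (tpow K M (m + n)) (%Y. tconcat K M m n X Y)"
 unfolding tconcat_def
proof (rule T.lift_param_lin[OF T.tensor_module T.tensor_module cc_multilin1 _ X])
 fix x assume x': "x \<in> (\<Pi>\<^sub>E i\<in>{1..m}. carrier M)"
 have x: "x i \<in> carrier M" if "i \<in> {1..m}" for i using x' that by (rule PiE_mem)
 show "lin K (tpow K M n) (tpow K M (m + n)) (tpow_lift K M n (tpow K M (m + n)) (%y. tpure K M (m + n) (cc m x y)))"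
  by (rule T.tensor_lift_lin[OF T.tensor_module cc_multilin2[OF x]])
qed

lemma tconcat_tpure:
 assumes x: "!!i. i \<in> {1..m} ==> x i \<in> carrier M" and y: "!!i. i \<in> {1..n} ==> y i \<in> carrier M"
 shows "tconcat K M m n (tpure K M m x) (tpure K M n y) = tpure K M (m + n) (cc m x y)"
proof -
 have Y: "tpure K M n y \<in> carrier (tpow K M n)" using y by (rule T.pure_closed)
 have rx: "restrict x {1..m} i \<in> carrier M" if "i \<in> {1..m}" for i using x that by simp
 have "tconcat K M m n (tpure K M m x) (tpure K M n y) =
   tpow_lift K M n (tpow K M (m + n)) (%y. tpure K M (m + n) (cc m (restrict x {1..m}) y)) (tpure K M n y)"
  unfolding tconcat_def by (rule T.tensor_lift_pure[OF T.tensor_module cc_multilin1[OF Y] x])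
 also have "... = tpure K M (m + n) (cc m (restrict x {1..m}) (restrict y {1..n}))"
  by (rule T.tensor_lift_pure[OF T.tensor_module cc_multilin2[OF rx] y])
 also have "... = tpure K M (m + n) (cc m x y)" by (rule T.pure_cong) auto
 finally show ?thesis .
qed

lemma pure1_closed: "u \<in> carrier M ==> pure1 K M u \<in> carrier (tpow K M 1)" unfolding pure1_def by (rule T.pure_closed)

lemma pure1_lin: "lin K M (tpow K M 1) (pure1 K M)"
proof -
 have "lin K M (tpow K M 1) (%u. tpure K M 1 ((%_. \<zero>\<^bsub>M\<^esub>)(1 := u)))" by (rule T.pure_lin) auto
 moreover have "tpure K M 1 ((%_. \<zero>\<^bsub>M\<^esub>)(1 := u)) = pure1 K M u" for u unfolding pure1_def by (rule T.pure_cong) auto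
 ultimately show ?thesis by simp
qed

lemma tconcat_pure1:
 assumes x: "!!i. i \<in> {1..m} ==> x i \<in> carrier M" and u: "u \<in> carrier M"
 shows "tconcat K M m 1 (tpure K M m x) (pure1 K M u) = tpure K M (m + 1) (x(m + 1 := u))"
proof -
 have "tconcat K M m 1 (tpure K M m x) (pure1 K M u) = tpure K M (m + 1) (cc m x (%_. u))"
  unfolding pure1_def by (rule tconcat_tpure) (use x u in auto)
 also have "... = tpure K M (m + 1) (x(m + 1 := u))" by (rule T.pure_cong) auto
 finally show ?thesis .
qed

text \<open>The common shape of two constructions: one more step of the iterated coproduct, and the
  action on a tensor with one more factor.\<close>

lemma bilin_snoc:
 assumes f: "lin K N (tpow K M m) f" and g: "lin K N M g" and N: "module K N"
 shows "multilin K {1..2::nat} (%_. N) (tpow K M (m + 1)) (%x. tconcat K M m 1 (f (x 1)) (pure1 K M (g (x 2))))"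
proof (rule multilinI)
 fix x assume x': "x \<in> (\<Pi>\<^sub>E i\<in>{1..2::nat}. carrier N)"
 have x: "x 1 \<in> carrier N" "x 2 \<in> carrier N" by (rule PiE_mem[OF x']; simp)+
 note fx = lin_closed[OF f x(1)] and gx = pure1_closed[OF lin_closed[OF g x(2)]]
 show "tconcat K M m 1 (f (x 1)) (pure1 K M (g (x 2))) \<in> carrier (tpow K M (m + 1))"
  by (rule lin_closed[OF tconcat_lin1[OF gx] fx])
 fix k :: nat assume "k \<in> {1..2}"
 then have "k = 1 \<or> k = 2" by auto
 then show "lin K N (tpow K M (m + 1)) (%u. tconcat K M m 1 (f ((x(k := u)) 1)) (pure1 K M (g ((x(k := u)) 2))))"
  using lin_comp[OF f tconcat_lin1[OF gx]] lin_comp[OF lin_comp[OF g pure1_lin] tconcat_lin2[OF fx]]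
  by auto
qed

end

section \<open>Iterated comultiplication and tensor powers of modules\<close>

text \<open>Linearity of the structure maps is enough to unfold the action on tensor powers, so one
  locale serves each \<open>A b\<close> acting on \<open>V b\<close> as well as the box algebra
  acting on \<open>W\<close>.\<close>

locale rep_data =
 fixes K :: "'k ring" and A :: "('k, 'a) module" and \<Delta> :: "'a => (nat, 'a, 'k) tens" and \<epsilon> :: "'a => 'k"
  and M :: "('k, 'v) module" and \<rho> :: "'a => 'v => 'v"
 assumes K: "cring K" and A: "module K A" and M: "module K M"
  and \<Delta>: "lin K A (tpow K A 2) \<Delta>" and \<epsilon>: "lin K A (ground_alg K) \<epsilon>" and \<rho>: "lin K A (end_alg K M) \<rho>"
begin

sublocale AP: tensor_powers K A by (intro tensor_powers.intro K A)
sublocale MP: tensor_powers K M by (intro tensor_powers.intro K M)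
sublocale MM: two_tensor_prods K "{1..n}" "%_. M" "%_. M" for n by (intro two_tensor_prods.intro MP.T.tensor_prod_axioms)

abbreviation "Rep n a \<equiv> tpow_rep K A \<Delta> \<epsilon> M \<rho> n a"
abbreviation "ic n a \<equiv> iter_comult K A \<Delta> \<epsilon> n a"

lemma rho_lin: "a \<in> carrier A ==> lin K M M (\<rho> a)" using lin_closed[OF \<rho>] by (simp add: linear_maps_lin)

lemma rho_eval_lin: "v \<in> carrier M ==> lin K A M (%a. \<rho> a v)" by (rule lin_comp[OF \<rho>]) (auto simp: lin_def linear_maps_def)

lemma ic_lin: "lin K A (tpow K A n) (ic n)"
proof (induction n)
 case 0
 have "tpure K A 0 (%_. undefined) \<in> carrier (tpow K A 0)" by (rule AP.T.pure_closed) simp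
 then have "lin K A (tpow K A 0) (%a. \<epsilon> a \<odot>\<^bsub>tpow K A 0\<^esub> tpure K A 0 (%_. undefined))"
  by (rule lin_rank_one[OF AP.T.tensor_module \<epsilon>])
 moreover have "iter_comult K A \<Delta> \<epsilon> 0 = (%a. \<epsilon> a \<odot>\<^bsub>tpow K A 0\<^esub> tpure K A 0 (%_. undefined))"
  by (rule ext) (rule iter_comult.simps(1))
 ultimately show ?case by (simp only:)
next
 case (Suc n)
 show ?case using lin_comp[OF \<Delta> AP.T.tensor_lift_lin[OF AP.T.tensor_module AP.bilin_snoc[OF Suc.IH lin_id A]]]
  by (simp flip: Suc_eq_plus1)
qed

text \<open>The action of the \<open>n\<close>-th tensor power of the algebra on that of the module;
  \<open>Rep n\<close> is this after the iterated coproduct.\<close>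

definition Th :: "nat => (nat, 'a, 'k) tens => (nat, 'v, 'k) tens => (nat, 'v, 'k) tens"
 where "Th n = tpow_lift K A n (end_alg K (tpow K M n)) (%x. tensor_map K M M n (%i. \<rho> (x i)))"

lemma Rep_Th: "Rep n a = Th n (ic n a)" by (simp add: tpow_rep_def Th_def)

lemma Th_multilin:
 "multilin K {1..n} (%_. A) (end_alg K (tpow K M n)) (%x. tensor_map K M M n (%i. \<rho> (x i)))"
 unfolding tensor_map_tmap
proof (rule multilinI)
 fix x assume x': "x \<in> (\<Pi>\<^sub>E i\<in>{1..n}. carrier A)"
 have x: "x i \<in> carrier A" if "i \<in> {1..n}" for i using x' that by (rule PiE_mem)
 show "tmap K {1..n} (%_. M) (%_. M) (%i. \<rho> (x i)) \<in> carrier (end_alg K (tpow K M n))"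
  using MM.tmap_linear_maps[OF rho_lin[OF x]] by simp
 fix k assume k: "k \<in> {1..n}"
 have e: "(%i. \<rho> ((x(k := u)) i)) = (%i. \<rho> (x i))(k := \<rho> u)" for u by (auto simp: fun_eq_iff)
 show "lin K A (end_alg K (tpow K M n)) (%u. tmap K {1..n} (%_. M) (%_. M) (%i. \<rho> ((x(k := u)) i)))" unfolding e
 proof (rule lin_into_end[OF MP.T.tensor_module A])
  show "tmap K {1..n} (%_. M) (%_. M) ((%i. \<rho> (x i))(k := \<rho> u)) \<in> linear_maps K (tpow K M n) (tpow K M n)"
   if "u \<in> carrier A" for u
   by (rule MM.tmap_linear_maps) (use rho_lin x that in auto)
  show "lin K A (tpow K M n) (%u. tmap K {1..n} (%_. M) (%_. M) ((%i. \<rho> (x i))(k := \<rho> u)) z)"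
   if "z \<in> carrier (tpow K M n)" for z
   by (rule MM.tmap_slot_lin[OF A k _ _ _ that]) (use rho_lin x rho_eval_lin in auto)
 qed
qed

lemma end_module: "module K (end_alg K (tpow K M n))"
 using unital_algebra_end[OF MP.T.tensor_module] by (rule unital_algebra.axioms)

lemma Th_lin: "lin K (tpow K A n) (end_alg K (tpow K M n)) (Th n)"
 unfolding Th_def by (rule AP.T.tensor_lift_lin[OF end_module Th_multilin])

lemma Th_closed: "Y \<in> carrier (tpow K A n) ==> Th n Y \<in> linear_maps K (tpow K M n) (tpow K M n)"
 using lin_closed[OF Th_lin] by simp

lemma Th_tpure:
 assumes x: "!!i. i \<in> {1..n} ==> x i \<in> carrier A" and v: "!!i. i \<in> {1..n} ==> v i \<in> carrier M"
 shows "Th n (tpure K A n x) (tpure K M n v) = tpure K M n (%i. \<rho> (x i) (v i))"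
proof -
 have "Th n (tpure K A n x) = tensor_map K M M n (%i. \<rho> (restrict x {1..n} i))"
  unfolding Th_def by (rule AP.T.tensor_lift_pure[OF end_module Th_multilin x])
 moreover have "tensor_map K M M n (%i. \<rho> (restrict x {1..n} i)) (tpure K M n v) =
   tpure K M n (%i. \<rho> (restrict x {1..n} i) (v i))"
  unfolding tensor_map_tmap by (rule MM.tmap_pure) (use rho_lin x v in auto)
 moreover have "... = tpure K M n (%i. \<rho> (x i) (v i))" by (rule MP.T.pure_cong) auto
 ultimately show ?thesis by simp
qed

lemma Rep_lin: "lin K A (end_alg K (tpow K M n)) (Rep n)" unfolding Rep_Th by (rule lin_comp[OF ic_lin Th_lin])

lemma Rep_closed: "a \<in> carrier A ==> Rep n a \<in> linear_maps K (tpow K M n) (tpow K M n)" using lin_closed[OF Rep_lin] by simp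

lemma end_eval: "z \<in> carrier (tpow K M n) ==> lin K (end_alg K (tpow K M n)) (tpow K M n) (%f. f z)"
 by (auto simp: lin_def linear_maps_def)

lemma Rep_eval_lin: "z \<in> carrier (tpow K M n) ==> lin K A (tpow K M n) (%a. Rep n a z)" by (rule lin_comp[OF Rep_lin end_eval])

lemma Rep_0:
 assumes a: "a \<in> carrier A" and z: "z \<in> carrier (tpow K M 0)"
 shows "Rep 0 a z = \<epsilon> a \<odot>\<^bsub>tpow K M 0\<^esub> z"
proof -
 let ?t = "tpure K A 0 (%_. undefined)"
 have t: "?t \<in> carrier (tpow K A 0)" by (rule AP.T.pure_closed) simp
 have e: "\<epsilon> a \<in> carrier K" using lin_closed[OF \<epsilon> a] by simp
 have "Th 0 ?t z = z"
 proof (rule MP.T.tensor_lin_eq[OF MP.T.tensor_module linear_maps_lin[OF Th_closed[OF t]] lin_id _ z])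
  fix x assume "x \<in> (\<Pi>\<^sub>E i\<in>{1..0::nat}. carrier M)"
  have "Th 0 ?t (tpure K M 0 x) = tpure K M 0 (%i. \<rho> undefined (x i))" by (rule Th_tpure) simp_all
  also have "... = tpure K M 0 x" by (rule MP.T.pure_cong) simp
  finally show "Th 0 ?t (tpure K M 0 x) = tpure K M 0 x" .
 qed
 then show ?thesis unfolding Rep_Th using lin_smult[OF Th_lin e t] z by simp
qed

text \<open>The action on a pure tensor with \<open>n + 1\<close> factors as a linear function of
  the coproduct: the first leg acts on the first \<open>n\<close> factors, the second leg on the
  last one. It is stated for arbitrary tensors since a coproduct is rarely pure.\<close>

definition Lam :: "nat => (nat => 'v) => (nat, 'a, 'k) tens => (nat, 'v, 'k) tens"
 where "Lam n v = tpow_lift K A 2 (tpow K M (n + 1))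
  (%x. tconcat K M n 1 (Rep n (x 1) (tpure K M n v)) (pure1 K M (\<rho> (x 2) (v (n + 1)))))"

context
 fixes n :: nat and v :: "nat => 'v"
 assumes v: "!!i. i \<in> {1..n + 1} ==> v i \<in> carrier M"
begin

lemma tpure_v: "tpure K M n v \<in> carrier (tpow K M n)" by (rule MP.T.pure_closed) (use v in auto)

lemma Lam_multilin: "multilin K {1..2::nat} (%_. A) (tpow K M (n + 1))
  (%x. tconcat K M n 1 (Rep n (x 1) (tpure K M n v)) (pure1 K M (\<rho> (x 2) (v (n + 1)))))"
 by (rule MP.bilin_snoc[OF Rep_eval_lin[OF tpure_v] rho_eval_lin A]) (use v in auto)

lemma Lam_lin: "lin K (tpow K A 2) (tpow K M (n + 1)) (Lam n v)"
 unfolding Lam_def by (rule AP.T.tensor_lift_lin[OF MP.T.tensor_module Lam_multilin])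

lemma Lam_pure2:
 assumes "p \<in> carrier A" "q \<in> carrier A"
 shows "Lam n v (pure2 K A p q) = tconcat K M n 1 (Rep n p (tpure K M n v)) (pure1 K M (\<rho> q (v (n + 1))))"
 unfolding Lam_def pure2_def
 by (subst AP.T.tensor_lift_pure[OF MP.T.tensor_module Lam_multilin]) (use assms in auto)

lemma Rep_Suc:
 assumes a: "a \<in> carrier A" shows "Rep (n + 1) a (tpure K M (n + 1) v) = Lam n v (\<Delta> a)"
proof -
 let ?F = "%x. tconcat K A n 1 (ic n (x 1)) (pure1 K A (x (2::nat)))"
 have Fm: "multilin K {1..2::nat} (%_. A) (tpow K A (n + 1)) ?F" by (rule AP.bilin_snoc[OF ic_lin lin_id A])
 have tv: "tpure K M (n + 1) v \<in> carrier (tpow K M (n + 1))" by (rule MP.T.pure_closed[OF v])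
 have v': "v i \<in> carrier M" if "i \<in> {1..n}" for i using v that by simp
 have vn: "v (n + 1) \<in> carrier M" using v by simp
 have "Th (n + 1) (tpow_lift K A 2 (tpow K A (n + 1)) ?F Z) (tpure K M (n + 1) v) = Lam n v Z" if Z: "Z \<in> carrier (tpow K A 2)" for Z
 proof (rule AP.T.tensor_lin_eq[OF MP.T.tensor_module
    lin_comp[OF lin_comp[OF AP.T.tensor_lift_lin[OF AP.T.tensor_module Fm] Th_lin] end_eval[OF tv]] Lam_lin _ Z])
  fix x assume x': "x \<in> (\<Pi>\<^sub>E i\<in>{1..2::nat}. carrier A)"
  have x: "x 1 \<in> carrier A" "x 2 \<in> carrier A" by (rule PiE_mem[OF x']; simp)+
  have p1: "pure1 K A (x 2) \<in> carrier (tpow K A 1)" by (rule AP.pure1_closed[OF x(2)])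
  have p2: "pure1 K M (\<rho> (x 2) (v (n + 1))) \<in> carrier (tpow K M 1)"
   by (rule MP.pure1_closed[OF lin_closed[OF rho_lin[OF x(2)] vn]])
  \<comment> \<open>Stated for all \<open>Y\<close>, because the iterated coproduct to be
    substituted is in general not pure; linearity in \<open>Y\<close> reduces to pure
    tensors.\<close>
  have "Th (n + 1) (tconcat K A n 1 Y (pure1 K A (x 2))) (tpure K M (n + 1) v) =
    tconcat K M n 1 (Th n Y (tpure K M n v)) (pure1 K M (\<rho> (x 2) (v (n + 1))))"
   if Y: "Y \<in> carrier (tpow K A n)" for Y
  proof (rule AP.T.tensor_lin_eq[OF MP.T.tensor_module
     lin_comp[OF lin_comp[OF AP.tconcat_lin1[OF p1] Th_lin] end_eval[OF tv]]
     lin_comp[OF lin_comp[OF Th_lin end_eval[OF tpure_v]] MP.tconcat_lin1[OF p2]] _ Y])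
   fix y assume y': "y \<in> (\<Pi>\<^sub>E i\<in>{1..n}. carrier A)"
   have y: "y i \<in> carrier A" if "i \<in> {1..n}" for i using y' that by (rule PiE_mem)
   have yx: "(y(n + 1 := x 2)) i \<in> carrier A" if "i \<in> {1..n + 1}" for i using y x that by auto
   have "Th (n + 1) (tconcat K A n 1 (tpure K A n y) (pure1 K A (x 2))) (tpure K M (n + 1) v) =
     tpure K M (n + 1) (%i. \<rho> ((y(n + 1 := x 2)) i) (v i))"
    by (subst AP.tconcat_pure1[where m = n and x = y and u = "x 2"])
      (erule y, rule x(2), rule Th_tpure[OF yx v])
   also have "... = tpure K M (n + 1) ((%i. \<rho> (y i) (v i))(n + 1 := \<rho> (x 2) (v (n + 1))))" by (rule MP.T.pure_cong) auto
   also have "... = tconcat K M n 1 (tpure K M n (%i. \<rho> (y i) (v i))) (pure1 K M (\<rho> (x 2) (v (n + 1))))"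
    by (rule MP.tconcat_pure1[symmetric]) (use lin_closed[OF rho_lin] y x v' vn in auto)
   also have "tpure K M n (%i. \<rho> (y i) (v i)) = Th n (tpure K A n y) (tpure K M n v)" by (rule Th_tpure[OF y v', symmetric])
   finally show "Th (n + 1) (tconcat K A n 1 (tpure K A n y) (pure1 K A (x 2))) (tpure K M (n + 1) v) =
     tconcat K M n 1 (Th n (tpure K A n y) (tpure K M n v)) (pure1 K M (\<rho> (x 2) (v (n + 1))))" .
  qed
  from this[OF lin_closed[OF ic_lin x(1)]]
  show "Th (n + 1) (tpow_lift K A 2 (tpow K A (n + 1)) ?F (tpure K A 2 x)) (tpure K M (n + 1) v) = Lam n v (tpure K A 2 x)"
   unfolding AP.T.tensor_lift_pure'[OF AP.T.tensor_module Fm x']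
   unfolding AP.tpure_pure2 Lam_pure2[OF x] Rep_Th .
 qed
 from this[OF lin_closed[OF \<Delta> a]] show ?thesis by (simp add: Rep_Th flip: Suc_eq_plus1)
qed

end

end

text \<open>Spreads a product of scalars over single factors. It turns the product of counits by
  which the box acts into one counit per block.\<close>

lemma (in tensor_prod) pure_smult_all:
 assumes J: "finite J" "J <= I" and c: "!!i. i \<in> J ==> c i \<in> carrier K" and x: "!!i. i \<in> I ==> x i \<in> carrier (M i)"
 shows "pure K I M (%i. if i \<in> J then c i \<odot>\<^bsub>M i\<^esub> x i else x i) = (\<Otimes>\<^bsub>K\<^esub>i\<in>J. c i) \<odot>\<^bsub>T\<^esub> pure K I M x"
 using J c
proof (induction J rule: finite_induct)
 case empty
 have "comm_monoid K" by (rule cring.axioms(2)[OF K])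
 then show ?case using T.smult_one[OF pure_closed[OF x]] comm_monoid.finprod_empty by simp
next
 case (insert j J)
 let ?y = "%i. if i \<in> J then c i \<odot>\<^bsub>M i\<^esub> x i else x i"
 have cm: "comm_monoid K" by (rule cring.axioms(2)[OF K])
 have j: "j \<in> I" "c j \<in> carrier K" using insert.prems by auto
 have y: "?y i \<in> carrier (M i)" if "i \<in> I" for i using insert.prems x that M_closed(2)[OF that] by auto
 have "pure K I M (%i. if i \<in> insert j J then c i \<odot>\<^bsub>M i\<^esub> x i else x i) = pure K I M (?y(j := c j \<odot>\<^bsub>M j\<^esub> x j))"
  by (rule pure_cong) auto
 also have "... = c j \<odot>\<^bsub>T\<^esub> pure K I M (?y(j := x j))" by (rule lin_smult[OF pure_lin j(2) x[OF j(1)]]) (use y j in auto)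
 also have "pure K I M (?y(j := x j)) = pure K I M ?y" by (rule pure_cong) (use insert.hyps in auto)
 also have "... = (\<Otimes>\<^bsub>K\<^esub>i\<in>J. c i) \<odot>\<^bsub>T\<^esub> pure K I M x" using insert by auto
 also have "c j \<odot>\<^bsub>T\<^esub> ((\<Otimes>\<^bsub>K\<^esub>i\<in>J. c i) \<odot>\<^bsub>T\<^esub> pure K I M x) = (c j \<otimes>\<^bsub>K\<^esub> (\<Otimes>\<^bsub>K\<^esub>i\<in>J. c i)) \<odot>\<^bsub>T\<^esub> pure K I M x"
  by (rule T.smult_assoc1[symmetric]) (use j insert.prems comm_monoid.finprod_closed[OF cm] pure_closed[OF x] in auto)
 also have "c j \<otimes>\<^bsub>K\<^esub> (\<Otimes>\<^bsub>K\<^esub>i\<in>J. c i) = (\<Otimes>\<^bsub>K\<^esub>i\<in>insert j J. c i)"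
  by (rule comm_monoid.finprod_insert[OF cm, symmetric]) (use insert in auto)
 finally show ?case .
qed

lemma finprod_multilin:
 assumes K: "cring K" and M: "!!i. i \<in> I ==> module K (M i)" and J: "finite J" "J <= I" and l: "!!i. i \<in> J ==> lin K (M i) (ground_alg K) (l i)"
  and x: "!!i. i \<in> I ==> x i \<in> carrier (M i)"
 shows "(\<Otimes>\<^bsub>K\<^esub>i\<in>J. l i (x i)) \<in> carrier K"
  and "i \<in> J ==> lin K (M i) (ground_alg K) (%u. \<Otimes>\<^bsub>K\<^esub>j\<in>J. l j ((x(i := u)) j))"
proof -
 have cm: "comm_monoid K" by (rule cring.axioms(2)[OF K])
 have lx: "l i (x i) \<in> carrier K" if "i \<in> J" for i using lin_closed[OF l[OF that] x] J that by auto
 then show "(\<Otimes>\<^bsub>K\<^esub>i\<in>J. l i (x i)) \<in> carrier K" by (intro comm_monoid.finprod_closed[OF cm]) auto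
 assume i: "i \<in> J"
 let ?p = "\<Otimes>\<^bsub>K\<^esub>j\<in>J - {i}. l j (x j)"
 have p: "?p \<in> carrier K" using lx by (intro comm_monoid.finprod_closed[OF cm]) auto
 have "(\<Otimes>\<^bsub>K\<^esub>j\<in>J. l j ((x(i := u)) j)) = ?p \<odot>\<^bsub>ground_alg K\<^esub> l i u" if u: "u \<in> carrier (M i)" for u
 proof -
  have lu: "l i u \<in> carrier K" using lin_closed[OF l[OF i] u] by simp
  have "(\<Otimes>\<^bsub>K\<^esub>j\<in>J. l j ((x(i := u)) j)) = (\<Otimes>\<^bsub>K\<^esub>j\<in>insert i (J - {i}). l j ((x(i := u)) j))" using i by (simp add: insert_absorb)
  also have "... = l i ((x(i := u)) i) \<otimes>\<^bsub>K\<^esub> (\<Otimes>\<^bsub>K\<^esub>j\<in>J - {i}. l j ((x(i := u)) j))"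
   by (rule comm_monoid.finprod_insert[OF cm]) (use J lx lu in auto)
  also have "(\<Otimes>\<^bsub>K\<^esub>j\<in>J - {i}. l j ((x(i := u)) j)) = ?p" by (rule comm_monoid.finprod_cong'[OF cm]) (use lx in auto)
  finally show ?thesis using comm_monoid.m_comm[OF cm lu p] by simp
 qed
 then show "lin K (M i) (ground_alg K) (%u. \<Otimes>\<^bsub>K\<^esub>j\<in>J. l j ((x(i := u)) j))"
  by (subst lin_cong[where g = "%u. ?p \<odot>\<^bsub>ground_alg K\<^esub> l i u"])
   (use M J i lin_smult_map[OF ground_alg_module[OF K] l[OF i] p] in auto)
qed

section \<open>The action of the tensor product of the bialgebras\<close>

lemma (in rep_data) Rep_zero:
 "m = 0 ==> a \<in> carrier A ==> z \<in> carrier (tpow K M m) ==> Rep m a z = \<epsilon> a \<odot>\<^bsub>tpow K M m\<^esub> z"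
 by (hypsubst, rule Rep_0)

locale box_setup = word_tensor K d V for K :: "'k ring" (structure) and d :: nat and V :: "nat => ('k, 'v) module" +
 fixes A :: "nat => ('k, 'a) module" and \<Delta> :: "nat => 'a => (nat, 'a, 'k) tens"
  and \<epsilon> :: "nat => 'a => 'k" and \<rho> :: "nat => 'a => 'v => 'v"
 assumes bialg: "!!b. b \<in> {1..d} ==> bialgebra K (A b) (\<Delta> b) (\<epsilon> b)"
  and rho_hom: "!!b. b \<in> {1..d} ==> \<rho> b \<in> alg_hom K (A b) (end_alg K (V b))"
begin

sublocale BA: tensor_algs K "{1..d}" A by (intro tensor_algs.intro K_cring bialgebra.axioms(1)[OF bialg])

abbreviation "Bx \<equiv> box_alg K d A"

sublocale BP: tensor_powers K Bx by (intro tensor_powers.intro K_cring BA.tensor_alg_module)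

sublocale WT: tensor_powers K W by (intro tensor_powers.intro K_cring W_module)

lemma A_module: "b \<in> {1..d} ==> module K (A b)" by (rule BA.M.M)

lemma Delta_lin: "b \<in> {1..d} ==> lin K (A b) (tpow K (A b) 2) (\<Delta> b)" using alg_hom_lin[OF bialgebra.comult_hom[OF bialg]] by simp

lemma eps_lin: "b \<in> {1..d} ==> lin K (A b) (ground_alg K) (\<epsilon> b)" by (rule alg_hom_lin[OF bialgebra.counit_hom[OF bialg]])

lemma rep: "b \<in> {1..d} ==> rep_data K (A b) (\<Delta> b) (\<epsilon> b) (V b) (\<rho> b)"
 by (intro rep_data.intro K_cring A_module V Delta_lin eps_lin alg_hom_lin[OF rho_hom])

lemma AP: "b \<in> {1..d} ==> tensor_powers K (A b)" by (intro tensor_powers.intro K_cring A_module)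

sublocale N2: nested_tensor K "{1..d}" "%_. {1..2::nat}" A by (intro nested_tensor.intro K_cring A_module) simp_all

abbreviation "A2 \<equiv> %b. tpow K (A b) 2"
abbreviation "ppair x y \<equiv> pure K {1..d} A2 (%b. pure2 K (A b) (x b) (y b))"

lemma N2_ppure: "pure K {1..d} A2 (%b. tpure K (A b) 2 (v b)) = ppair (%b. v b 1) (%b. v b 2)"
 by (rule N2.outer.pure_cong) (rule tensor_powers.tpure_pure2[OF AP])

lemma ppair_lin_eq:
 assumes "module K P" "lin K (tensor K {1..d} A2) P f" "lin K (tensor K {1..d} A2) P g"
  and fg: "!!x y. (!!b. b \<in> {1..d} ==> x b \<in> carrier (A b)) ==> (!!b. b \<in> {1..d} ==> y b \<in> carrier (A b)) ==>
   f (ppair x y) = g (ppair x y)" and "z \<in> carrier (tensor K {1..d} A2)"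
 shows "f z = g z"
proof (rule N2.nested_lin_eq[OF assms(1-3) _ assms(5)])
 fix v assume v: "v \<in> (\<Pi>\<^sub>E b\<in>{1..d}. \<Pi>\<^sub>E j\<in>{1..2::nat}. carrier (A b))"
 show "f (pure K {1..d} A2 (%b. tpure K (A b) 2 (v b))) = g (pure K {1..d} A2 (%b. tpure K (A b) 2 (v b)))"
  unfolding N2_ppure by (rule fg) (auto intro: PiE_mem[OF PiE_mem[OF v]])
qed

lemma shuffle_ex:
 "\<exists>G. lin K (tensor K {1..d} A2) (tpow K Bx 2) G \<and>
  (\<forall>x y. (ALL b:{1..d}. x b \<in> carrier (A b)) --> (ALL b:{1..d}. y b \<in> carrier (A b)) -->
   G (ppair x y) = pure2 K Bx (pure K {1..d} A x) (pure K {1..d} A y))"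
proof -
 let ?f = "%z. pure2 K Bx (pure K {1..d} A (%b. z b 1)) (pure K {1..d} A (%b. z b (2::nat)))"
 have f: "N2.multilin2 (tpow K Bx 2) ?f" unfolding N2.multilin2_def
 proof (intro ballI conjI)
  fix z assume z: "z \<in> (\<Pi>\<^sub>E b\<in>{1..d}. \<Pi>\<^sub>E j\<in>{1..2::nat}. carrier (A b))"
  have z1: "z b 1 \<in> carrier (A b)" and z2: "z b 2 \<in> carrier (A b)" if "b \<in> {1..d}" for b
   by (auto intro!: PiE_mem[OF PiE_mem[OF z that]])
  have p: "pure K {1..d} A (%b. z b 1) \<in> carrier Bx" "pure K {1..d} A (%b. z b 2) \<in> carrier Bx"
   using BA.M.pure_closed z1 z2 by simp_all
  then show "?f z \<in> carrier (tpow K Bx 2)" by (rule BP.pure2_closed)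
  fix b j assume b: "b \<in> {1..d}" and "j \<in> {1..2::nat}"
  then have j: "j = 1 \<or> j = 2" by auto
  have l: "lin K (A b) Bx (%u. pure K {1..d} A ((%b. z b 1)(b := u)))"
   "lin K (A b) Bx (%u. pure K {1..d} A ((%b. z b 2)(b := u)))"
   using BA.M.pure_lin[OF z1 b] BA.M.pure_lin[OF z2 b] by simp_all
  have e: "(%c. (z(b := (z b)(1 := u))) c 1) = (%b. z b 1)(b := u)" "(%c. (z(b := (z b)(1 := u))) c 2) = (%b. z b 2)"
   "(%c. (z(b := (z b)(2 := u))) c 2) = (%b. z b 2)(b := u)" "(%c. (z(b := (z b)(2 := u))) c 1) = (%b. z b 1)"
   for u by (auto simp: fun_eq_iff)
  from j show "lin K (A b) (tpow K Bx 2) (%u. ?f (z(b := (z b)(j := u))))"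
  proof
   assume "j = 1"
   then show ?thesis unfolding \<open>j = 1\<close> e by (intro lin_comp[OF l(1) BP.pure2_lin(1)[OF p(2)]])
  next
   assume "j = 2"
   then show ?thesis unfolding \<open>j = 2\<close> e by (intro lin_comp[OF l(2) BP.pure2_lin(2)[OF p(1)]])
  qed
 qed
 from N2.nested_lift[OF BP.T.tensor_module f] obtain G where G: "lin K (tensor K {1..d} A2) (tpow K Bx 2) G"
  and Gp: "!!v. v \<in> (\<Pi>\<^sub>E b\<in>{1..d}. \<Pi>\<^sub>E j\<in>{1..2::nat}. carrier (A b)) ==>
   G (pure K {1..d} A2 (%b. tpure K (A b) 2 (v b))) = ?f v" by blast
 have "G (ppair x y) = pure2 K Bx (pure K {1..d} A x) (pure K {1..d} A y)"
  if x: "ALL b:{1..d}. x b \<in> carrier (A b)" and y: "ALL b:{1..d}. y b \<in> carrier (A b)" for x y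
 proof -
  let ?v = "\<lambda>b\<in>{1..d}. \<lambda>j\<in>{1..2::nat}. if j = 1 then x b else y b"
  have v: "?v \<in> (\<Pi>\<^sub>E b\<in>{1..d}. \<Pi>\<^sub>E j\<in>{1..2::nat}. carrier (A b))" using x y by auto
  have "ppair x y = pure K {1..d} A2 (%b. tpure K (A b) 2 (?v b))" unfolding N2_ppure by (rule N2.outer.pure_cong) simp
  then have "G (ppair x y) = ?f ?v" using Gp[OF v] by simp
  also have "pure K {1..d} A (%b. ?v b 1) = pure K {1..d} A x" by (rule BA.M.pure_cong) simp
  also have "pure K {1..d} A (%b. ?v b 2) = pure K {1..d} A y" by (rule BA.M.pure_cong) simp
  finally show ?thesis .
 qed
 with G show ?thesis by blast
qed

text \<open>Existence for the definite description comes from the nested universal property,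
  uniqueness from the spanning by pairs of pure tensors.\<close>

lemma shuffle_lin: "lin K (tensor K {1..d} A2) (tpow K Bx 2) (box_shuffle K d A)"
 and shuffle_pair: "\<lbrakk>!!b. b \<in> {1..d} ==> x b \<in> carrier (A b); !!b. b \<in> {1..d} ==> y b \<in> carrier (A b)\<rbrakk> \<Longrightarrow>
  box_shuffle K d A (ppair x y) = pure2 K Bx (pure K {1..d} A x) (pure K {1..d} A y)"
proof -
 let ?T = "tensor K {1..d} A2"
 let ?Q = "%g. g \<in> linear_maps K ?T (tpow K Bx 2) \<and> (ALL x:(\<Pi>\<^sub>E b\<in>{1..d}. carrier (A b)). ALL y:(\<Pi>\<^sub>E b\<in>{1..d}. carrier (A b)).
    g (ppair x y) = pure2 K Bx (pure K {1..d} A x) (pure K {1..d} A y))"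
 obtain G where G: "lin K ?T (tpow K Bx 2) G" and Gp: "!!x y. (ALL b:{1..d}. x b \<in> carrier (A b)) ==>
   (ALL b:{1..d}. y b \<in> carrier (A b)) ==> G (ppair x y) = pure2 K Bx (pure K {1..d} A x) (pure K {1..d} A y)"
  using shuffle_ex by (elim exE conjE) (simp only:)
 let ?g = "restrict G (carrier ?T)"
 have pc: "ppair x y \<in> carrier ?T" if "ALL b:{1..d}. x b \<in> carrier (A b)" "ALL b:{1..d}. y b \<in> carrier (A b)" for x y
  using that by (intro N2.outer.pure_closed tensor_powers.pure2_closed[OF AP]) simp_all
 have g: "?Q ?g" using restrict_linear_maps[OF N2.outer.tensor_module G] by (auto simp: pc Gp PiE_iff)
 have "g = ?g" if g': "?Q g" for g
 proof (rule linear_maps_ext[OF conjunct1[OF g'] conjunct1[OF g]])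
  fix z assume z: "z \<in> carrier ?T"
  show "g z = ?g z"
  proof (rule ppair_lin_eq[OF BP.T.tensor_module linear_maps_lin[OF conjunct1[OF g']] linear_maps_lin[OF conjunct1[OF g]] _ z])
   fix x y assume xy: "!!b. b \<in> {1..d} ==> x b \<in> carrier (A b)" "!!b. b \<in> {1..d} ==> y b \<in> carrier (A b)"
   have r: "restrict x {1..d} \<in> (\<Pi>\<^sub>E b\<in>{1..d}. carrier (A b))" "restrict y {1..d} \<in> (\<Pi>\<^sub>E b\<in>{1..d}. carrier (A b))"
    using xy by auto
   have "ppair x y = ppair (restrict x {1..d}) (restrict y {1..d})" by (rule N2.outer.pure_cong) simp
   then show "g (ppair x y) = ?g (ppair x y)"
    using conjunct2[OF g', rule_format, OF r] conjunct2[OF g, rule_format, OF r] by (simp only:)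
  qed
 qed
 then have "box_shuffle K d A = ?g" unfolding box_shuffle_def using g by (intro the_equality) 
 then show "lin K ?T (tpow K Bx 2) (box_shuffle K d A)"
  and "\<lbrakk>!!b. b \<in> {1..d} ==> x b \<in> carrier (A b); !!b. b \<in> {1..d} ==> y b \<in> carrier (A b)\<rbrakk> \<Longrightarrow>
   box_shuffle K d A (ppair x y) = pure2 K Bx (pure K {1..d} A x) (pure K {1..d} A y)"
  using G N2.outer.tensor_module by (simp_all add: pc Gp)
qed

lemma comult_multilin:
 "multilin K {1..d} A (tpow K Bx 2) (%a. box_shuffle K d A (pure K {1..d} A2 (%b. \<Delta> b (a b))))"
proof (rule multilinI)
 fix a assume a': "a \<in> (\<Pi>\<^sub>E b\<in>{1..d}. carrier (A b))"
 have a: "\<Delta> b (a b) \<in> carrier (A2 b)" if "b \<in> {1..d}" for b by (rule lin_closed[OF Delta_lin[OF that] PiE_mem[OF a' that]])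
 then show "box_shuffle K d A (pure K {1..d} A2 (%b. \<Delta> b (a b))) \<in> carrier (tpow K Bx 2)"
  by (intro lin_closed[OF shuffle_lin] N2.outer.pure_closed)
 fix c assume c: "c \<in> {1..d}"
 have e: "(%b. \<Delta> b ((a(c := u)) b)) = (%b. \<Delta> b (a b))(c := \<Delta> c u)" for u by (auto simp: fun_eq_iff)
 show "lin K (A c) (tpow K Bx 2) (%u. box_shuffle K d A (pure K {1..d} A2 (%b. \<Delta> b ((a(c := u)) b))))"
  unfolding e by (rule lin_comp[OF lin_comp[OF Delta_lin[OF c] N2.outer.pure_lin[OF a c]] shuffle_lin])
qed

lemma comult_lin: "lin K Bx (tpow K Bx 2) (box_comult K d A \<Delta>)"
 unfolding box_comult_def using BA.M.tensor_lift_lin[OF BP.T.tensor_module comult_multilin] by simp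

lemma comult_pure:
 assumes "!!b. b \<in> {1..d} ==> a b \<in> carrier (A b)"
 shows "box_comult K d A \<Delta> (pure K {1..d} A a) = box_shuffle K d A (pure K {1..d} A2 (%b. \<Delta> b (a b)))"
proof -
 have "box_comult K d A \<Delta> (pure K {1..d} A a) = box_shuffle K d A (pure K {1..d} A2 (%b. \<Delta> b (restrict a {1..d} b)))"
  unfolding box_comult_def by (rule BA.M.tensor_lift_pure[OF BP.T.tensor_module comult_multilin assms])
 also have "pure K {1..d} A2 (%b. \<Delta> b (restrict a {1..d} b)) = pure K {1..d} A2 (%b. \<Delta> b (a b))"
  by (rule N2.outer.pure_cong) simp
 finally show ?thesis .
qed

lemma finprod_eps:
 assumes J: "J <= {1..d}" and x: "!!b. b \<in> {1..d} ==> x b \<in> carrier (A b)"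
 shows "(\<Otimes>b\<in>J. \<epsilon> b (x b)) \<in> carrier K"
  and "i \<in> J ==> lin K (A i) (ground_alg K) (%u. \<Otimes>b\<in>J. \<epsilon> b ((x(i := u)) b))"
 by (rule finprod_multilin[OF K_cring A_module finite_subset[OF J] J eps_lin x]; use J in auto)+

lemma finprod_eps_cong:
 assumes J: "J <= {1..d}" and x: "!!b. b \<in> {1..d} ==> x b \<in> carrier (A b)" and xy: "!!b. b \<in> J ==> y b = x b"
 shows "(\<Otimes>b\<in>J. \<epsilon> b (y b)) = (\<Otimes>b\<in>J. \<epsilon> b (x b))"
 by (rule comm_monoid.finprod_cong'[OF cring.axioms(2)[OF K_cring]]) (use lin_closed[OF eps_lin x] J xy in auto)

lemma counit_multilin: "multilin K {1..d} A (ground_alg K) (%a. \<Otimes>b\<in>{1..d}. \<epsilon> b (a b))"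
proof (rule multilinI)
 fix a assume a: "a \<in> (\<Pi>\<^sub>E b\<in>{1..d}. carrier (A b))"
 show "(\<Otimes>b\<in>{1..d}. \<epsilon> b (a b)) \<in> carrier (ground_alg K)" using finprod_eps(1)[OF order_refl PiE_mem[OF a]] by simp
 show "lin K (A i) (ground_alg K) (%u. \<Otimes>b\<in>{1..d}. \<epsilon> b ((a(i := u)) b))" if "i \<in> {1..d}" for i
  by (rule finprod_eps(2)[OF order_refl PiE_mem[OF a] that])
qed

lemma counit_lin: "lin K Bx (ground_alg K) (box_counit K d A \<epsilon>)"
 unfolding box_counit_def using BA.M.tensor_lift_lin[OF ground_alg_module[OF K_cring] counit_multilin] by simp

lemma counit_pure:
 assumes a: "!!b. b \<in> {1..d} ==> a b \<in> carrier (A b)"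
 shows "box_counit K d A \<epsilon> (pure K {1..d} A a) = (\<Otimes>b\<in>{1..d}. \<epsilon> b (a b))"
proof -
 have "box_counit K d A \<epsilon> (pure K {1..d} A a) = (\<Otimes>b\<in>{1..d}. \<epsilon> b (restrict a {1..d} b))"
  unfolding box_counit_def by (rule BA.M.tensor_lift_pure[OF ground_alg_module[OF K_cring] counit_multilin a])
 also have "... = (\<Otimes>b\<in>{1..d}. \<epsilon> b (a b))" by (rule finprod_eps_cong[OF order_refl a]) simp_all
 finally show ?thesis .
qed

lemma end_V_module: "b \<in> {1..d} ==> module K (end_alg K (V b))" by (rule unital_algebra.axioms(1)[OF unital_algebra_end[OF V]])

lemma rho_act:
 assumes "b \<in> {1..d}"
 shows "a \<in> carrier (A b) ==> lin K (V b) (V b) (\<rho> b a)" "v \<in> carrier (V b) ==> lin K (A b) (V b) (%a. \<rho> b a v)"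
 by (rule rep_data.rho_lin[OF rep[OF assms]], assumption) (rule rep_data.rho_eval_lin[OF rep[OF assms]])

lemma inflate_multilin:
 assumes b: "b \<in> {1..d}"
 shows "multilin K {1..d} A (end_alg K (V b)) (%a. \<lambda>v\<in>carrier (V b). (\<Otimes>c\<in>{1..d} - {b}. \<epsilon> c (a c)) \<odot>\<^bsub>V b\<^esub> \<rho> b (a b) v)"
proof (rule multilinI)
 let ?h = "%a. \<lambda>v\<in>carrier (V b). (\<Otimes>c\<in>{1..d} - {b}. \<epsilon> c (a c)) \<odot>\<^bsub>V b\<^esub> \<rho> b (a b) v"
 have cl: "?h a \<in> linear_maps K (V b) (V b)" if a: "!!c. c \<in> {1..d} ==> a c \<in> carrier (A c)" for a
  by (rule restrict_linear_maps[OF V[OF b] lin_smult_map[OF V[OF b] rho_act(1)[OF b a[OF b]] finprod_eps(1)[OF _ a]]]) auto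
 fix a assume a': "a \<in> (\<Pi>\<^sub>E b\<in>{1..d}. carrier (A b))"
 have a: "a b \<in> carrier (A b)" if "b \<in> {1..d}" for b by (rule PiE_mem[OF a' that])
 show "?h a \<in> carrier (end_alg K (V b))" using cl[OF a] by simp
 fix i assume i: "i \<in> {1..d}"
 show "lin K (A i) (end_alg K (V b)) (%u. ?h (a(i := u)))"
 proof (rule lin_into_end[OF V[OF b] A_module[OF i]])
  show "?h (a(i := u)) \<in> linear_maps K (V b) (V b)" if "u \<in> carrier (A i)" for u by (rule cl) (use a that in auto)
  fix v assume v: "v \<in> carrier (V b)"
  \<comment> \<open>At \<open>i = b\<close> the module action varies and the product of counits is
    constant; at any other index a single counit factor varies.\<close>
  have "lin K (A i) (V b) (%u. (\<Otimes>c\<in>{1..d} - {b}. \<epsilon> c ((a(i := u)) c)) \<odot>\<^bsub>V b\<^esub> \<rho> b ((a(i := u)) b) v)"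
  proof (cases "i = b")
   case True
   have "(\<Otimes>c\<in>{1..d} - {b}. \<epsilon> c ((a(i := u)) c)) = (\<Otimes>c\<in>{1..d} - {b}. \<epsilon> c (a c))" for u
    by (rule finprod_eps_cong[OF _ a]) (use True in auto)
   then show ?thesis using lin_smult_map[OF V[OF b] rho_act(2)[OF b v] finprod_eps(1)[OF Diff_subset a]] True by simp
  next
   case False
   have "lin K (A i) (ground_alg K) (%u. \<Otimes>c\<in>{1..d} - {b}. \<epsilon> c ((a(i := u)) c))"
    by (rule finprod_eps(2)[OF Diff_subset a]) (use i False in auto)
   from lin_rank_one[OF V[OF b] this lin_closed[OF rho_act(1)[OF b a[OF b]] v]]
   show ?thesis using False by simp
  qed
  then show "lin K (A i) (V b) (%u. ?h (a(i := u)) v)" using v by simp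
 qed
qed

lemma inflate_lin: "b \<in> {1..d} ==> lin K Bx (end_alg K (V b)) (inflate_rep K d A \<epsilon> V \<rho> b)"
 unfolding inflate_rep_def using BA.M.tensor_lift_lin[OF end_V_module inflate_multilin] by simp

lemma inflate_pure:
 assumes b: "b \<in> {1..d}" and a: "!!b. b \<in> {1..d} ==> a b \<in> carrier (A b)" and v: "v \<in> carrier (V b)"
 shows "inflate_rep K d A \<epsilon> V \<rho> b (pure K {1..d} A a) v = (\<Otimes>c\<in>{1..d} - {b}. \<epsilon> c (a c)) \<odot>\<^bsub>V b\<^esub> \<rho> b (a b) v"
proof -
 have "inflate_rep K d A \<epsilon> V \<rho> b (pure K {1..d} A a) =
   (\<lambda>v\<in>carrier (V b). (\<Otimes>c\<in>{1..d} - {b}. \<epsilon> c (restrict a {1..d} c)) \<odot>\<^bsub>V b\<^esub> \<rho> b (restrict a {1..d} b) v)"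
  unfolding inflate_rep_def by (rule BA.M.tensor_lift_pure[OF end_V_module[OF b] inflate_multilin[OF b] a])
 moreover have "(\<Otimes>c\<in>{1..d} - {b}. \<epsilon> c (restrict a {1..d} c)) = (\<Otimes>c\<in>{1..d} - {b}. \<epsilon> c (a c))"
  by (rule finprod_eps_cong[OF Diff_subset a]) simp_all
 ultimately show ?thesis using v b by simp
qed

lemma inflate_act:
 assumes "b \<in> {1..d}"
 shows "X \<in> carrier Bx ==> lin K (V b) (V b) (inflate_rep K d A \<epsilon> V \<rho> b X)"
  and "v \<in> carrier (V b) ==> lin K Bx (V b) (%X. inflate_rep K d A \<epsilon> V \<rho> b X v)"
 using lin_closed[OF inflate_lin[OF assms]]
 by (simp_all add: linear_maps_lin del: tensor_alg_simps lin_tensor_alg)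
  (rule lin_comp[OF inflate_lin[OF assms]], auto simp: lin_def linear_maps_def)

lemma box_rep_act: shows "X \<in> carrier Bx ==> lin K W W (%v. \<lambda>b\<in>{1..d}. inflate_rep K d A \<epsilon> V \<rho> b X (v b))"
  and "v \<in> carrier W ==> lin K Bx W (%X. \<lambda>b\<in>{1..d}. inflate_rep K d A \<epsilon> V \<rho> b X (v b))"
proof -
 have Wb: "v b \<in> carrier (V b)" if "v \<in> carrier W" "b \<in> {1..d}" for v b using that by (auto simp: dsum_simps)
 { assume X: "X \<in> carrier Bx"
  note l = inflate_act(1)[OF _ X]
  show "lin K W W (%v. \<lambda>b\<in>{1..d}. inflate_rep K d A \<epsilon> V \<rho> b X (v b))"
  proof (rule linI)
   show "(\<lambda>b\<in>{1..d}. inflate_rep K d A \<epsilon> V \<rho> b X (x b)) \<in> carrier W" if "x \<in> carrier W" for x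
    unfolding dsum_simps(1) using lin_closed[OF l] Wb[OF that] by auto
  qed (simp_all only: dsum_simps(2,4), (rule restrict_ext, simp add: Wb lin_add[OF l] lin_smult[OF l])+) }
 { assume v: "v \<in> carrier W"
  have l: "lin K Bx (V b) (%X. inflate_rep K d A \<epsilon> V \<rho> b X (v b))" if "b \<in> {1..d}" for b
   by (rule inflate_act(2)[OF that Wb[OF v that]])
  show "lin K Bx W (%X. \<lambda>b\<in>{1..d}. inflate_rep K d A \<epsilon> V \<rho> b X (v b))"
  proof (rule linI)
   show "(\<lambda>b\<in>{1..d}. inflate_rep K d A \<epsilon> V \<rho> b X (v b)) \<in> carrier W" if "X \<in> carrier Bx" for X
    unfolding dsum_simps(1) using lin_closed[OF l that] by (auto simp del: tensor_alg_simps)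
  qed (simp_all only: dsum_simps(2,4), (rule restrict_ext, simp add: lin_add[OF l] lin_smult[OF l] del: tensor_alg_simps)+) }
qed

lemma box_rep_lin: "lin K Bx (end_alg K W) (box_rep K d A \<epsilon> V \<rho>)"
proof (rule lin_into_end[OF W_module BA.tensor_alg_module])
 show "box_rep K d A \<epsilon> V \<rho> X \<in> linear_maps K W W" if "X \<in> carrier Bx" for X
  unfolding box_rep_def by (rule restrict_linear_maps[OF W_module box_rep_act(1)[OF that]])
 show "lin K Bx W (%X. box_rep K d A \<epsilon> V \<rho> X v)" if "v \<in> carrier W" for v
  using box_rep_act(2)[OF that] that by (simp add: box_rep_def del: lin_tensor_alg)
qed

lemma box_rep_emb:
 assumes c: "c \<in> {1..d}" and a: "!!b. b \<in> {1..d} ==> a b \<in> carrier (A b)" and u: "u \<in> carrier (V c)"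
 shows "box_rep K d A \<epsilon> V \<rho> (pure K {1..d} A a) (emb c u) = emb c ((\<Otimes>b\<in>{1..d} - {c}. \<epsilon> b (a b)) \<odot>\<^bsub>V c\<^esub> \<rho> c (a c) u)"
proof -
 have p: "pure K {1..d} A a \<in> carrier Bx" using BA.M.pure_closed[OF a] by simp
 have "inflate_rep K d A \<epsilon> V \<rho> b (pure K {1..d} A a) (emb c u b) =
   emb c ((\<Otimes>b\<in>{1..d} - {c}. \<epsilon> b (a b)) \<odot>\<^bsub>V c\<^esub> \<rho> c (a c) u) b" if b: "b \<in> {1..d}" for b
  using inflate_pure[OF c a u] lin_zero[OF V[OF b] V[OF b] inflate_act(1)[OF b p]] by (simp add: dsum_in_apply[OF b])
 then show ?thesis unfolding box_rep_def using emb_closed[OF c u] by (auto simp: dsum_in_def restrict_def)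
qed

sublocale WR: rep_data K Bx "box_comult K d A \<Delta>" "box_counit K d A \<epsilon>" W "box_rep K d A \<epsilon> V \<rho>"
 by (intro rep_data.intro K_cring BA.tensor_alg_module W_module comult_lin counit_lin box_rep_lin)

end

section \<open>The action of the box algebra on a homogeneous component\<close>

lemma snoc_words: "w @ [c] \<in> words d (n + 1) \<longleftrightarrow> w \<in> words d n \<and> c \<in> {1..d}" by (auto simp: words_def)

lemma content_snoc: "b \<in> {1..d} ==> content d (w @ [c]) b = content d w b + (if b = c then 1 else 0)" by (simp add: content_apply)

context box_setup
begin

abbreviation "RB b m a \<equiv> tpow_rep K (A b) (\<Delta> b) (\<epsilon> b) (V b) (\<rho> b) m a"
abbreviation "UV \<nu> \<equiv> %b. tpow K (V b) (\<nu> b)"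

lemma VV: "two_tensor_prods K {1..d} (UV \<nu>) (UV \<nu>')" by (intro two_tensor_prods.intro tensor_prod.intro K_cring tpowV_module)

lemma VT: "b \<in> {1..d} ==> tensor_powers K (V b)" by (intro tensor_powers.intro K_cring V)

text \<open>A letter \<open>c\<close> appended to \<open>w\<close> takes the next rank among the
  letters \<open>c\<close>, so it lengthens the block of \<open>c\<close> at its end and leaves the
  others alone.\<close>

lemma iota_snoc:
 assumes w: "w \<in> words d n" and c: "c \<in> {1..d}" and u: "u \<in> carrier (V c)"
  and Y: "!!b. b \<in> {1..d} ==> Y b \<in> carrier (UV (cont w) b)"
 shows "tconcat K W n 1 (iota w (pure K {1..d} (UV (cont w)) Y)) (pure1 K W (emb c u)) =
  iota (w @ [c]) (pure K {1..d} (UV (cont (w @ [c]))) (Y(c := tconcat K (V c) (cont w c) 1 (Y c) (pure1 K (V c) u))))"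
proof -
 interpret VV: two_tensor_prods K "{1..d}" "UV (cont w)" "UV (cont (w @ [c]))" by (rule VV)
 interpret Vc: tensor_powers K "V c" by (rule VT[OF c])
 have wc: "w @ [c] \<in> words d (n + 1)" using w c snoc_words by blast
 let ?f = "%b y. if b = c then tconcat K (V c) (cont w c) 1 y (pure1 K (V c) u) else y"
 have f: "lin K (UV (cont w) b) (UV (cont (w @ [c])) b) (?f b)" if b: "b \<in> {1..d}" for b
  using Vc.tconcat_lin1[OF Vc.pure1_closed[OF u]] lin_id by (auto simp: content_snoc[OF b])
 have e: "emb c u \<in> carrier W" by (rule emb_closed[OF c u])
 have "tconcat K W n 1 (iota w z) (pure1 K W (emb c u)) =
   iota (w @ [c]) (tmap K {1..d} (UV (cont w)) (UV (cont (w @ [c]))) ?f z)" if z: "z \<in> carrier (U (cont w))" for z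
 proof (rule U_lin_eq[OF TW.tensor_module lin_comp[OF iota_lin[OF w] WT.tconcat_lin1[OF WT.pure1_closed[OF e]]]
    lin_comp[OF VV.tmap_lin[OF f] iota_lin[OF wc]] _ z])
  fix v assume v: "fam (cont w) v"
  let ?v = "v(c := (v c)(cont w c + 1 := u))"
  have lw: "length w = n" using w by (rule len)
  have x: "emb (letter w i) (v (letter w i) (rank w i)) \<in> carrier W" if i: "i \<in> {1..n}" for i
   by (rule emb_closed[OF letter_in[OF w i] fam_letter[OF w v i]])
  have v': "fam (cont (w @ [c])) ?v" using v u unfolding fam_def by (auto simp: content_snoc)
  have "tconcat K W n 1 (iota w (pp (cont w) v)) (pure1 K W (emb c u)) =
    tpure K W (n + 1) ((%i. emb (letter w i) (v (letter w i) (rank w i)))(n + 1 := emb c u))"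
   unfolding iota_pp[OF w v] by (rule WT.tconcat_pure1[OF x e])
  also have "... = tpure K W (n + 1) (%i. emb (letter (w @ [c]) i) (?v (letter (w @ [c]) i) (rank (w @ [c]) i)))"
  proof (rule TW.pure_cong)
   fix i assume i: "i \<in> {1..n + 1}"
   show "((%i. emb (letter w i) (v (letter w i) (rank w i)))(n + 1 := emb c u)) i =
     emb (letter (w @ [c]) i) (?v (letter (w @ [c]) i) (rank (w @ [c]) i))"
   proof (cases "i = n + 1")
    case True
    have "letter (w @ [c]) (n + 1) = c" "rank (w @ [c]) (n + 1) = cont w c + 1"
     using letter_snoc(2)[of w c] rank_snoc(2)[of w c] lw content_apply[OF c, of w] by (simp_all flip: Suc_eq_plus1)
    then show ?thesis using True by simp
   next
    case False
    then have i': "i \<in> {1..length w}" using i lw by simp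
    have r: "rank w i \<le> cont w (letter w i)" using rank_bounds[OF i'] letter_in[OF w, of i] i' lw by (simp add: content_apply)
    show ?thesis using False r by (auto simp: letter_snoc(1)[OF i'] rank_snoc(1)[OF i'])
   qed
  qed
  also have "... = iota (w @ [c]) (pp (cont (w @ [c])) ?v)" by (rule iota_pp[OF wc v', symmetric])
  also have "pp (cont (w @ [c])) ?v = tmap K {1..d} (UV (cont w)) (UV (cont (w @ [c]))) ?f (pp (cont w) v)"
  proof -
   have "tmap K {1..d} (UV (cont w)) (UV (cont (w @ [c]))) ?f (pp (cont w) v) =
     pure K {1..d} (UV (cont (w @ [c]))) (%b. ?f b (tpure K (V b) (cont w b) (v b)))"
    by (rule VV.tmap_pure[OF f tpure_fam[OF v]])
   also have "... = pp (cont (w @ [c])) ?v"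
   proof (rule NT.outer.pure_cong)
    fix b assume b: "b \<in> {1..d}"
    show "?f b (tpure K (V b) (cont w b) (v b)) = tpure K (V b) (cont (w @ [c]) b) (?v b)"
    proof (cases "b = c")
     case True
     have "v c j \<in> carrier (V c)" if "j \<in> {1..cont w c}" for j using v c that by (simp add: fam_def)
     from Vc.tconcat_pure1[OF this u] show ?thesis using True by (simp add: content_snoc[OF c])
    qed (simp add: content_snoc[OF b])
   qed
   finally show ?thesis by (rule HOL.sym)
  qed
  finally show "tconcat K W n 1 (iota w (pp (cont w) v)) (pure1 K W (emb c u)) =
    iota (w @ [c]) (tmap K {1..d} (UV (cont w)) (UV (cont (w @ [c]))) ?f (pp (cont w) v))" .
 qed
 note main = this
 have "tmap K {1..d} (UV (cont w)) (UV (cont (w @ [c]))) ?f (pure K {1..d} (UV (cont w)) Y) =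
   pure K {1..d} (UV (cont (w @ [c]))) (%b. ?f b (Y b))"
  by (rule VV.tmap_pure[OF f Y])
 also have "... = pure K {1..d} (UV (cont (w @ [c]))) (Y(c := tconcat K (V c) (cont w c) 1 (Y c) (pure1 K (V c) u)))"
  by (rule NT.outer.pure_cong) simp
 finally show ?thesis using main[OF NT.outer.pure_closed[OF Y]] by (simp only:)
qed

lemma RB_lin: "b \<in> {1..d} ==> a \<in> carrier (A b) ==> lin K (tpow K (V b) m) (tpow K (V b) m) (RB b m a)"
 by (rule linear_maps_lin[OF rep_data.Rep_closed[OF rep]])

text \<open>Induction on the last letter \<open>c\<close>. On the last factor each
  \<open>A b\<close> with b \<noteq> c acts by its counit, and the counit law contracts its
  coproduct, so the block of \<open>b\<close> sees just \<open>a b\<close>. For \<open>c\<close> the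
  coproduct is shared between the old block and the new factor, which is one step of the action on
  the longer block.\<close>

lemma rep_iota_pp:
 assumes "w \<in> words d n" "!!b. b \<in> {1..d} ==> a b \<in> carrier (A b)" "fam (cont w) v"
 shows "WR.Rep n (pure K {1..d} A a) (iota w (pp (cont w) v)) =
  iota w (pure K {1..d} (UV (cont w)) (%b. RB b (cont w b) (a b) (tpure K (V b) (cont w b) (v b))))"
 using assms
proof (induction w arbitrary: n a v rule: rev_induct)
 case Nil
 note a = Nil(2)
 have n: "n = 0" using Nil(1) by (simp add: words_def)
 have p: "pure K {1..d} A a \<in> carrier Bx" using BA.M.pure_closed[OF a] by simp
 interpret VV: two_tensor_prods K "{1..d}" "UV (cont [])" "UV (cont [])" by (rule VV)
 have t: "tpure K (V b) (cont [] b) (v b) \<in> carrier (UV (cont []) b)" if "b \<in> {1..d}" for b by (rule tpure_fam[OF Nil(3) that])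
 have e: "\<epsilon> b (a b) \<in> carrier K" if "b \<in> {1..d}" for b using lin_closed[OF eps_lin[OF that] a[OF that]] by simp
 have "WR.Rep n (pure K {1..d} A a) (iota [] (pp (cont []) v)) = (\<Otimes>b\<in>{1..d}. \<epsilon> b (a b)) \<odot>\<^bsub>tpow K W n\<^esub> iota [] (pp (cont []) v)"
  unfolding WR.Rep_zero[OF n p lin_closed[OF iota_lin[OF Nil(1)] pp_closed[OF Nil(3)]]] by (simp only: counit_pure[OF a])
 also have "... = iota [] ((\<Otimes>b\<in>{1..d}. \<epsilon> b (a b)) \<odot>\<^bsub>U (cont [])\<^esub> pp (cont []) v)"
  by (rule lin_smult[OF iota_lin[OF Nil(1)] finprod_eps(1)[OF order_refl a] pp_closed[OF Nil(3)], symmetric])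
 \<comment> \<open>For the empty word every block is a zeroth power, on which the action is by the
   counit.\<close>
 also have "(\<Otimes>b\<in>{1..d}. \<epsilon> b (a b)) \<odot>\<^bsub>U (cont [])\<^esub> pp (cont []) v =
   pure K {1..d} (UV (cont [])) (%b. if b \<in> {1..d} then \<epsilon> b (a b) \<odot>\<^bsub>UV (cont []) b\<^esub> tpure K (V b) (cont [] b) (v b)
    else tpure K (V b) (cont [] b) (v b))"
  by (rule NT.outer.pure_smult_all[OF finite_atLeastAtMost order_refl e t, symmetric])
 also have "... = pure K {1..d} (UV (cont [])) (%b. RB b (cont [] b) (a b) (tpure K (V b) (cont [] b) (v b)))"
 proof (rule NT.outer.pure_cong)
  fix b assume b: "b \<in> {1..d}"
  have "cont [] b = 0" using b by (simp add: content_apply)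
  from rep_data.Rep_zero[OF rep[OF b] this a[OF b] t[OF b]] b
  show "(if b \<in> {1..d} then \<epsilon> b (a b) \<odot>\<^bsub>UV (cont []) b\<^esub> tpure K (V b) (cont [] b) (v b)
    else tpure K (V b) (cont [] b) (v b)) = RB b (cont [] b) (a b) (tpure K (V b) (cont [] b) (v b))" by simp
 qed
 finally show ?case .
next
 case (snoc c w)
 note a = snoc(3) and fv = snoc(4)
 define n' where "n' = length w"
 have n: "n = n' + 1" and wc: "w @ [c] \<in> words d (n' + 1)" using snoc(2) by (simp_all add: words_def n'_def)
 then have w: "w \<in> words d n'" and c: "c \<in> {1..d}" using snoc_words by blast+
 have fv': "fam (cont w) v" using fv unfolding fam_def by (auto simp: content_snoc)
 have cw: "cont (w @ [c]) c = cont w c + 1" and cw': "!!b. b \<in> {1..d} ==> b ~= c ==> cont (w @ [c]) b = cont w b"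
  by (simp_all add: content_snoc[OF c] content_snoc)
 interpret AV: two_tensor_prods K "{1..d}" A2 "UV (cont (w @ [c]))"
  by (intro two_tensor_prods.intro N2.outer.tensor_prod_axioms two_tensor_prods.axioms(1)[OF VV])
 interpret Vc: tensor_powers K "V c" by (rule VT[OF c])
 interpret Rc: rep_data K "A c" "\<Delta> c" "\<epsilon> c" "V c" "\<rho> c" by (rule rep[OF c])
 let ?u = "v c (cont w c + 1)"
 have vc: "v c j \<in> carrier (V c)" if "j \<in> {1..cont w c + 1}" for j using fv c that by (simp add: fam_def cw)
 have u: "?u \<in> carrier (V c)" by (rule vc) simp
 let ?x = "%i. emb (letter (w @ [c]) i) (v (letter (w @ [c]) i) (rank (w @ [c]) i))"
 have x: "?x i \<in> carrier W" if i: "i \<in> {1..n' + 1}" for i by (rule emb_closed[OF letter_in[OF wc i] fam_letter[OF wc fv i]])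
 have xn: "?x (n' + 1) = emb c ?u"
  using letter_snoc(2)[of w c] rank_snoc(2)[of w c] content_apply[OF c, of w] by (simp add: n'_def flip: Suc_eq_plus1)
 have xw: "tpure K W n' ?x = iota w (pp (cont w) v)" unfolding iota_pp[OF w fv']
  by (rule TW.pure_cong) (simp add: letter_snoc(1) rank_snoc(1) n'_def)
 \<comment> \<open>Contraction of the second leg by the counit; on a coproduct it returns the
   element, by the right counit law.\<close>
 let ?h = "%b Z. tpow_lift K (A b) 2 (A b) (%x. \<epsilon> b (x 2) \<odot>\<^bsub>A b\<^esub> x 1) Z"
 let ?Q = "%b Z. if b = c then Rc.Lam (cont w c) (v c) Z else RB b (cont w b) (?h b Z) (tpure K (V b) (cont w b) (v b))"
 have hm: "multilin K {1..2::nat} (%_. A b) (A b) (%x. \<epsilon> b (x 2) \<odot>\<^bsub>A b\<^esub> x 1)" if b: "b \<in> {1..d}" for b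
 proof (rule multilinI)
  fix x assume x': "x \<in> (\<Pi>\<^sub>E i\<in>{1..2::nat}. carrier (A b))"
  have x: "x 1 \<in> carrier (A b)" "x 2 \<in> carrier (A b)" by (rule PiE_mem[OF x']; simp)+
  have e: "\<epsilon> b (x 2) \<in> carrier K" using lin_closed[OF eps_lin[OF b] x(2)] by simp
  show "\<epsilon> b (x 2) \<odot>\<^bsub>A b\<^esub> x 1 \<in> carrier (A b)" by (rule lin_closed[OF lin_smult_map[OF A_module[OF b] lin_id e] x(1)])
  fix i :: nat assume "i \<in> {1..2}"
  then have "i = 1 \<or> i = 2" by auto
  then show "lin K (A b) (A b) (%u. \<epsilon> b ((x(i := u)) 2) \<odot>\<^bsub>A b\<^esub> (x(i := u)) 1)"
   using lin_smult_map[OF A_module[OF b] lin_id e] lin_rank_one[OF A_module[OF b] eps_lin[OF b] x(1)] by auto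
 qed
 have hp: "?h b (pure2 K (A b) p q) = \<epsilon> b q \<odot>\<^bsub>A b\<^esub> p" if b: "b \<in> {1..d}" and "p \<in> carrier (A b)" "q \<in> carrier (A b)" for b p q
  unfolding pure2_def
  by (subst tensor_prod.tensor_lift_pure[OF N2.inner[OF b] A_module[OF b] hm[OF b]]) (use that in auto)
 have Q: "lin K (A2 b) (UV (cont (w @ [c])) b) (?Q b)" if b: "b \<in> {1..d}" for b
 proof (cases "b = c")
  case True
  then show ?thesis using Rc.Lam_lin[of "cont w c" "v c", OF vc] cw by simp
 next
  case False
  have "lin K (A2 b) (tpow K (V b) (cont w b)) (%Z. RB b (cont w b) (?h b Z) (tpure K (V b) (cont w b) (v b)))"
   by (rule lin_comp[OF tensor_prod.tensor_lift_lin[OF N2.inner[OF b] A_module[OF b] hm[OF b]]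
      rep_data.Rep_eval_lin[OF rep[OF b] tpure_fam[OF fv' b]]])
  then show ?thesis using False cw'[OF b] by simp
 qed
 let ?G = "tmap K {1..d} A2 (UV (cont (w @ [c]))) ?Q"
 \<comment> \<open>Formulated before the coproducts are substituted: both sides are linear in
   \<open>Z\<close>, so they can be compared where every factor is a pure pair.\<close>
 have key: "WR.Lam n' ?x (box_shuffle K d A Z) = iota (w @ [c]) (?G Z)" if Z: "Z \<in> carrier (tensor K {1..d} A2)" for Z
 proof (rule ppair_lin_eq[OF TW.tensor_module lin_comp[OF shuffle_lin WR.Lam_lin[OF x]]
    lin_comp[OF AV.tmap_lin[OF Q] iota_lin[OF wc]] _ Z])
  fix p q assume p: "!!b. b \<in> {1..d} ==> p b \<in> carrier (A b)" and q: "!!b. b \<in> {1..d} ==> q b \<in> carrier (A b)"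
  have pq: "pure K {1..d} A p \<in> carrier Bx" "pure K {1..d} A q \<in> carrier Bx" using BA.M.pure_closed p q by simp_all
  let ?Y = "%b. RB b (cont w b) (p b) (tpure K (V b) (cont w b) (v b))"
  let ?e = "\<Otimes>b\<in>{1..d} - {c}. \<epsilon> b (q b)"
  let ?u' = "\<rho> c (q c) ?u"
  let ?Y' = "?Y(c := tconcat K (V c) (cont w c) 1 (?Y c) (pure1 K (V c) ?u'))"
  have e: "?e \<in> carrier K" by (rule finprod_eps(1)[OF Diff_subset q])
  have eb: "\<epsilon> b (q b) \<in> carrier K" if "b \<in> {1..d}" for b using lin_closed[OF eps_lin[OF that] q[OF that]] by simp
  have u': "?u' \<in> carrier (V c)" by (rule lin_closed[OF rho_act(1)[OF c q[OF c]] u])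
  have Y: "?Y b \<in> carrier (UV (cont w) b)" if b: "b \<in> {1..d}" for b
   by (rule lin_closed[OF RB_lin[OF b p[OF b]] tpure_fam[OF fv' b]])
  have Y': "?Y' b \<in> carrier (UV (cont (w @ [c])) b)" if b: "b \<in> {1..d}" for b
  proof (cases "b = c")
   case True
   then show ?thesis using lin_closed[OF Vc.tconcat_lin1[OF Vc.pure1_closed[OF u']] Y[OF c]] cw by simp
  next
   case False
   then show ?thesis using Y[OF b] cw'[OF b] by simp
  qed
  have iw: "iota w (pure K {1..d} (UV (cont w)) ?Y) \<in> carrier (tpow K W n')"
   by (rule lin_closed[OF iota_lin[OF w] tensor_prod.pure_closed[OF two_tensor_prods.axioms(1)[OF VV] Y]])
  have "WR.Lam n' ?x (box_shuffle K d A (ppair p q)) = tconcat K W n' 1 (WR.Rep n' (pure K {1..d} A p) (tpure K W n' ?x))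
     (pure1 K W (box_rep K d A \<epsilon> V \<rho> (pure K {1..d} A q) (?x (n' + 1))))"
   by (simp only: shuffle_pair[OF p q]) (rule WR.Lam_pure2[OF x pq])
  also have "... = tconcat K W n' 1 (iota w (pure K {1..d} (UV (cont w)) ?Y)) (pure1 K W (emb c (?e \<odot>\<^bsub>V c\<^esub> ?u')))"
   by (simp only: xw xn snoc.IH[OF w p fv'] box_rep_emb[OF c q u])
  also have "... = ?e \<odot>\<^bsub>tpow K W (n' + 1)\<^esub> tconcat K W n' 1 (iota w (pure K {1..d} (UV (cont w)) ?Y)) (pure1 K W (emb c ?u'))"
   by (rule lin_smult[OF lin_comp[OF lin_comp[OF emb_lin[OF c] WT.pure1_lin] WT.tconcat_lin2[OF iw]] e u'])
  also have "tconcat K W n' 1 (iota w (pure K {1..d} (UV (cont w)) ?Y)) (pure1 K W (emb c ?u')) =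
    iota (w @ [c]) (pure K {1..d} (UV (cont (w @ [c]))) ?Y')"
   by (rule iota_snoc[OF w c u' Y])
  also have "?e \<odot>\<^bsub>tpow K W (n' + 1)\<^esub> ... = iota (w @ [c]) (?e \<odot>\<^bsub>U (cont (w @ [c]))\<^esub> pure K {1..d} (UV (cont (w @ [c]))) ?Y')"
   by (rule lin_smult[OF iota_lin[OF wc] e NT.outer.pure_closed[OF Y'], symmetric])
  also have "?e \<odot>\<^bsub>U (cont (w @ [c]))\<^esub> pure K {1..d} (UV (cont (w @ [c]))) ?Y' = pure K {1..d} (UV (cont (w @ [c])))
    (%b. if b \<in> {1..d} - {c} then \<epsilon> b (q b) \<odot>\<^bsub>UV (cont (w @ [c])) b\<^esub> ?Y' b else ?Y' b)"
   by (rule NT.outer.pure_smult_all[OF _ _ _ Y', symmetric]) (use eb in auto)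
  also have "... = pure K {1..d} (UV (cont (w @ [c]))) (%b. ?Q b (pure2 K (A b) (p b) (q b)))"
  proof (rule NT.outer.pure_cong)
   fix b assume b: "b \<in> {1..d}"
   show "(if b \<in> {1..d} - {c} then \<epsilon> b (q b) \<odot>\<^bsub>UV (cont (w @ [c])) b\<^esub> ?Y' b else ?Y' b) = ?Q b (pure2 K (A b) (p b) (q b))"
   proof (cases "b = c")
    case True
    then show ?thesis using Rc.Lam_pure2[of "cont w c" "v c", OF vc p[OF c] q[OF c]] by simp
   next
    case False
    have "RB b (cont w b) (\<epsilon> b (q b) \<odot>\<^bsub>A b\<^esub> p b) (tpure K (V b) (cont w b) (v b)) = \<epsilon> b (q b) \<odot>\<^bsub>UV (cont w) b\<^esub> ?Y b"
     by (rule lin_smult[OF rep_data.Rep_eval_lin[OF rep[OF b] tpure_fam[OF fv' b]] eb[OF b] p[OF b]])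
    then show ?thesis using False b by (simp add: hp[OF b p[OF b] q[OF b]] cw'[OF b])
   qed
  qed
  also have "... = ?G (ppair p q)"
   by (rule AV.tmap_pure[OF Q, symmetric]) (use p q in \<open>auto intro: tensor_powers.pure2_closed[OF AP]\<close>)
  finally show "WR.Lam n' ?x (box_shuffle K d A (ppair p q)) = iota (w @ [c]) (?G (ppair p q))" .
 qed
 have D: "\<Delta> b (a b) \<in> carrier (A2 b)" if "b \<in> {1..d}" for b by (rule lin_closed[OF Delta_lin[OF that] a[OF that]])
 have pa: "pure K {1..d} A a \<in> carrier Bx" using BA.M.pure_closed[OF a] by simp
 have "WR.Rep n (pure K {1..d} A a) (iota (w @ [c]) (pp (cont (w @ [c])) v)) = WR.Lam n' ?x (box_comult K d A \<Delta> (pure K {1..d} A a))"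
  unfolding iota_pp[OF wc fv] n by (rule WR.Rep_Suc[OF x pa])
 also have "... = iota (w @ [c]) (?G (pure K {1..d} A2 (%b. \<Delta> b (a b))))"
  by (simp only: comult_pure[OF a]) (rule key[OF N2.outer.pure_closed[OF D]])
 also have "?G (pure K {1..d} A2 (%b. \<Delta> b (a b))) = pure K {1..d} (UV (cont (w @ [c]))) (%b. ?Q b (\<Delta> b (a b)))"
  by (rule AV.tmap_pure[OF Q D])
 also have "... = pure K {1..d} (UV (cont (w @ [c])))
   (%b. RB b (cont (w @ [c]) b) (a b) (tpure K (V b) (cont (w @ [c]) b) (v b)))"
 proof (rule NT.outer.pure_cong)
  fix b assume b: "b \<in> {1..d}"
  show "?Q b (\<Delta> b (a b)) = RB b (cont (w @ [c]) b) (a b) (tpure K (V b) (cont (w @ [c]) b) (v b))"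
  proof (cases "b = c")
   case True
   have "RB c (cont w c + 1) (a c) (tpure K (V c) (cont w c + 1) (v c)) = Rc.Lam (cont w c) (v c) (\<Delta> c (a c))"
    by (rule Rc.Rep_Suc[OF vc a[OF c]])
   then show ?thesis using True by (simp add: cw)
  next
   case False
   then show ?thesis using bialgebra.counit_right[OF bialg[OF b] a[OF b]] by (simp add: cw'[OF b])
  qed
 qed
 finally show ?case .
qed

lemma rep_iota:
 assumes w: "w \<in> words d n" and a: "!!b. b \<in> {1..d} ==> a b \<in> carrier (A b)" and y: "y \<in> carrier (U (cont w))"
 shows "WR.Rep n (pure K {1..d} A a) (iota w y) =
  iota w (tmap K {1..d} (UV (cont w)) (UV (cont w)) (%b. RB b (cont w b) (a b)) y)"
proof (rule U_lin_eq[OF TW.tensor_module _ _ _ y])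
 have p: "pure K {1..d} A a \<in> carrier Bx" using BA.M.pure_closed[OF a] by simp
 have R: "lin K (UV (cont w) b) (UV (cont w) b) (RB b (cont w b) (a b))" if "b \<in> {1..d}" for b
  by (rule RB_lin[OF that a[OF that]])
 show "lin K (U (cont w)) (tpow K W n) (%y. WR.Rep n (pure K {1..d} A a) (iota w y))"
  by (rule lin_comp[OF iota_lin[OF w] linear_maps_lin[OF WR.Rep_closed[OF p]]])
 show "lin K (U (cont w)) (tpow K W n) (%y. iota w (tmap K {1..d} (UV (cont w)) (UV (cont w)) (%b. RB b (cont w b) (a b)) y))"
  by (rule lin_comp[OF two_tensor_prods.tmap_lin[OF VV R] iota_lin[OF w]])
 show "WR.Rep n (pure K {1..d} A a) (iota w (pp (cont w) v)) =
   iota w (tmap K {1..d} (UV (cont w)) (UV (cont w)) (%b. RB b (cont w b) (a b)) (pp (cont w) v))" if v: "fam (cont w) v" for v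
 proof -
  have "tmap K {1..d} (UV (cont w)) (UV (cont w)) (%b. RB b (cont w b) (a b)) (pp (cont w) v) =
    pure K {1..d} (UV (cont w)) (%b. RB b (cont w b) (a b) (tpure K (V b) (cont w b) (v b)))"
   by (rule two_tensor_prods.tmap_pure[OF VV R tpure_fam[OF v]])
  with rep_iota_pp[OF w a v] show ?thesis by (simp only:)
 qed
qed

end

section \<open>Equivariance of the monomial operators\<close>

locale full_setup = braid_ops K d V \<phi> \<zeta> R + box_setup K d V A \<Delta> \<epsilon> \<rho>
 for K :: "'k ring" (structure) and d :: nat and V :: "nat => ('k, 'v) module" and \<phi> and \<zeta> :: 'k and R
  and A :: "nat => ('k, 'a) module" and \<Delta> \<epsilon> \<rho> +
 assumes phi_equivariant: "!!b m f a x. b \<in> {1..d} ==> f \<in> Cb b m ==> a \<in> carrier (A b) ==> x \<in> carrier (tpow K (V b) m) ==>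
   f (tpow_rep K (A b) (\<Delta> b) (\<epsilon> b) (V b) (\<rho> b) m a x) = tpow_rep K (A b) (\<Delta> b) (\<epsilon> b) (V b) (\<rho> b) m a (f x)"
begin

lemma psi_equivariant:
 assumes a: "!!b. b \<in> {1..d} ==> a b \<in> carrier (A b)" and X: "X \<in> carrier (TC \<nu>)" and y: "y \<in> carrier (U \<nu>)"
 defines "r \<equiv> tmap K {1..d} (UV \<nu>) (UV \<nu>) (%b. RB b (\<nu> b) (a b))"
 shows "psi \<nu> X (r y) = r (psi \<nu> X y)"
proof -
 have Rl: "lin K (UV \<nu> b) (UV \<nu> b) (RB b (\<nu> b) (a b))" if "b \<in> {1..d}" for b by (rule RB_lin[OF that a[OF that]])
 have r: "lin K (U \<nu>) (U \<nu>) r" unfolding r_def by (rule two_tensor_prods.tmap_lin[OF VV Rl])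
 have psi_eval: "lin K (TC \<nu>) (U \<nu>) (%X. psi \<nu> X z)" if "z \<in> carrier (U \<nu>)" for z
  by (rule lin_comp[OF O.psi_lin end_eval_lin[OF U_module that]])
 show ?thesis
 proof (rule O.CA.M.tensor_lin_eq[where \<nu> = \<nu>, OF U_module])
  show "lin K (tensor K {1..d} (CA \<nu>)) (U \<nu>) (%X. psi \<nu> X (r y))" using psi_eval[OF lin_closed[OF r y]] by simp
  show "lin K (tensor K {1..d} (CA \<nu>)) (U \<nu>) (%X. r (psi \<nu> X y))" using lin_comp[OF psi_eval[OF y] r] by simp
  show "X \<in> carrier (tensor K {1..d} (CA \<nu>))" using X by simp
  fix f assume f': "f \<in> (\<Pi>\<^sub>E b\<in>{1..d}. carrier (CA \<nu> b))"
  have f: "f b \<in> Cb b (\<nu> b)" if "b \<in> {1..d}" for b using PiE_mem[OF f' that] by simp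
  have fl: "lin K (UV \<nu> b) (UV \<nu> b) (f b)" if "b \<in> {1..d}" for b by (rule O.C_lin[where \<nu> = \<nu>, OF that f[OF that]])
  have "tmap K {1..d} (UV \<nu>) (UV \<nu>) (%b x. f b (RB b (\<nu> b) (a b) x)) =
    tmap K {1..d} (UV \<nu>) (UV \<nu>) (%b x. RB b (\<nu> b) (a b) (f b x))"
   by (rule two_tensor_prods.tmap_cong[OF VV lin_comp[OF Rl fl] lin_comp[OF fl Rl]]) (use phi_equivariant f a in auto)
  then show "psi \<nu> (pure K {1..d} (CA \<nu>) f) (r y) = r (psi \<nu> (pure K {1..d} (CA \<nu>) f) y)"
   by (simp only: r_def O.psi_pure[where \<nu> = \<nu>, OF f] tmap_comp[OF VV VV Rl fl y] tmap_comp[OF VV VV fl Rl y])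
 qed
qed

text \<open>By \<open>rep_iota\<close> a pure element of the box acts on a component through an
  operator that depends only on the content of its word. It is thus unaffected by the rearrangement
  \<open>s\<close>, and it commutes with the blocks by \<open>psi_equivariant\<close>.\<close>

lemma mon_equivariant:
 assumes comp: "compatible n s c X" and a: "a \<in> carrier Bx" and z: "z \<in> carW n"
 shows "mon n s c X (WR.Rep n a z) = WR.Rep n a (mon n s c X z)"
proof -
 let ?f = "mon n s c X"
 have fl: "linW n ?f" by (rule linear_maps_lin[OF mon_closed[OF comp]])
 show ?thesis
 proof (rule BA.M.tensor_lin_eq[OF TW.tensor_module])
  show "lin K (tensor K {1..d} A) (tpow K W n) (%a. ?f (WR.Rep n a z))" using lin_comp[OF WR.Rep_eval_lin[OF z] fl] by simp
  show "lin K (tensor K {1..d} A) (tpow K W n) (%a. WR.Rep n a (?f z))" using WR.Rep_eval_lin[OF lin_closed[OF fl z]] by simp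
  show "a \<in> carrier (tensor K {1..d} A)" using a by simp
  fix a assume a': "a \<in> (\<Pi>\<^sub>E b\<in>{1..d}. carrier (A b))"
  have a: "a b \<in> carrier (A b)" if "b \<in> {1..d}" for b by (rule PiE_mem[OF a' that])
  have p: "pure K {1..d} A a \<in> carrier Bx" using BA.M.pure_closed[OF a] by simp
  have rl: "linW n (WR.Rep n (pure K {1..d} A a))" by (rule linear_maps_lin[OF WR.Rep_closed[OF p]])
  show "?f (WR.Rep n (pure K {1..d} A a) z) = WR.Rep n (pure K {1..d} A a) (?f z)"
  proof (rule iota_lin_eq[OF TW.tensor_module lin_comp[OF rl fl] lin_comp[OF fl rl] _ z])
   fix w y assume w: "w \<in> words d n" and y: "y \<in> carrier (U (cont w))"
   have sw: "s w \<in> words d n" "cont (s w) = cont w" "c w \<in> carrier K" "X w \<in> carrier (TC (cont w))"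
    using comp w unfolding compatible_def by blast+
   let ?r = "tmap K {1..d} (UV (cont w)) (UV (cont w)) (%b. RB b (cont w b) (a b))"
   have r: "?r y \<in> carrier (U (cont w))" by (rule lin_closed[OF two_tensor_prods.tmap_lin[OF VV] y]) (rule RB_lin[OF _ a])
   have q: "psi (cont w) (X w) y \<in> carrier (U (cont (s w)))" unfolding sw(2) by (rule psi_closed'[OF sw(4) y])
   have "?f (WR.Rep n (pure K {1..d} A a) (iota w y)) = c w \<odot>\<^bsub>tpow K W n\<^esub> iota (s w) (psi (cont w) (X w) (?r y))"
    by (subst rep_iota[OF w _ y], erule a, rule mon_iota[OF comp w r])
   also have "... = c w \<odot>\<^bsub>tpow K W n\<^esub> WR.Rep n (pure K {1..d} A a) (iota (s w) (psi (cont w) (X w) y))"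
    using rep_iota[OF sw(1) a q] psi_equivariant[OF a sw(4) y] by (simp only: sw(2))
   also have "... = WR.Rep n (pure K {1..d} A a) (?f (iota w y))"
    unfolding mon_iota[OF comp w y] by (rule lin_smult[OF rl sw(3) lin_closed[OF iota_lin[OF sw(1)] q], symmetric])
   finally show "?f (WR.Rep n (pure K {1..d} A a) (iota w y)) = WR.Rep n (pure K {1..d} A a) (?f (iota w y))" .
  qed
 qed
qed

end

section \<open>Matrix units\<close>

text \<open>Bring the first letter \<open>a\<close> of \<open>w'\<close> to the front of
  \<open>w\<close>, then recurse on the tails with the set of all \<open>v\<close> such that
  \<open>a # v\<close> is in \<open>Q\<close>. Passing an equal letter requires no exchange.\<close>

lemma adjacent_swaps_connect:
 assumes "!!u a b v. u @ a # b # v \<in> Q ==> a ~= b ==> u @ b # a # v \<in> Q" and "w \<in> Q" "mset w = mset w'"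
 shows "w' \<in> Q"
 using assms
proof (induction w' arbitrary: w Q)
 case (Cons a w')
 note sw = Cons.prems(1)
 from Cons.prems(3) have "a \<in> set w" by (metis list.set_intros(1) mset_eq_setD)
 then obtain p q where w: "w = p @ a # q" by (meson split_list)
 have "a # p @ q \<in> Q" using Cons.prems(2) unfolding w
 proof (induction p arbitrary: q rule: rev_induct)
  case (snoc x p)
  have "p @ a # x # q \<in> Q" using snoc.prems sw[of p x a q] by (cases "x = a") auto
  from snoc.IH[OF this] show ?case by simp
 qed simp
 moreover have "mset (p @ q) = mset w'" using Cons.prems(3) w by simp
 moreover have "u @ c # b # v \<in> {v. a # v \<in> Q}" if "u @ b # c # v \<in> {v. a # v \<in> Q}" "b ~= c" for u b c v
  using sw[of "a # u" b c v] that by simp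
 ultimately show ?case using Cons.IH[of "{v. a # v \<in> Q}" "p @ q"] by blast
qed simp

lemma content_eq_mset:
 assumes "w \<in> words d n" "w' \<in> words d n" "content d w = content d w'" shows "mset w = mset w'"
proof (rule multiset_eqI)
 fix b
 show "count (mset w) b = count (mset w') b"
 proof (cases "b \<in> {1..d}")
  case True
  then show ?thesis using fun_cong[OF assms(3), of b] by (simp add: content_apply count_mset)
 next
  case False
  then have "b \<notin> set w" "b \<notin> set w'" using assms(1,2) by (auto simp: words_def)
  then show ?thesis by (simp add: count_mset)
 qed
qed

text \<open>Supplies the linear Lagrange factor g(x - b), equal to one at a and zero at b, phrased
  as the multiplications in which \<open>Dg_separate\<close> meets it.\<close>

lemma field_separate:
 fixes K (structure)
 assumes "field K" and a: "a \<in> carrier K" and b: "b \<in> carrier K" and ab: "a ~= b"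
 shows "\<exists>g. g \<in> carrier K \<and> \<ominus> b \<in> carrier K \<and> (g \<otimes> (a \<oplus> \<ominus> b)) \<otimes> \<one> = \<one> \<and>
  (ALL c:carrier K. (g \<otimes> (b \<oplus> \<ominus> b)) \<otimes> c = \<zero> \<and> (g \<otimes> (c \<oplus> \<ominus> b)) \<otimes> \<zero> = \<zero>)"
proof -
 interpret field K by fact
 have "a = (a \<oplus> \<ominus> b) \<oplus> b" using a b by (simp add: a_assoc l_neg)
 then have "a \<oplus> \<ominus> b \<in> Units K" using ab a b by (auto simp: field_Units)
 then show ?thesis by (intro exI[of _ "inv\<^bsub>K\<^esub> (a \<oplus> \<ominus> b)"]) (use a b in \<open>simp add: r_neg\<close>)
qed

section \<open>Products of matrix units and diagonal operators\<close>

context braid_setup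
begin

lemma iota_zero: "w \<in> words d n ==> cont w = \<nu> ==> iota w \<zero>\<^bsub>U \<nu>\<^esub> = \<zero>\<^bsub>tpow K W n\<^esub>"
 using lin_zero[OF U_module TW.tensor_module iota_lin] by blast

text \<open>The matrix unit with entry \<open>X\<close> in row \<open>w'\<close> and column
  \<open>w\<close>: like one block of \<open>mon\<close>, and zero on the components of all other
  words.\<close>

definition eu :: "nat => nat list => nat list => _ => (nat, nat => 'v, 'k) tens => (nat, nat => 'v, 'k) tens"
 where "eu n w' w X = (\<lambda>x\<in>carW n. iota w' (psi (cont w) X (prj w x)))"

lemma eu_closed:
 assumes w: "w \<in> words d n" "w' \<in> words d n" "cont w' = cont w" and X: "X \<in> carrier (TC (cont w))"
 shows "eu n w' w X \<in> linmapsW n"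
 unfolding eu_def
 by (rule restrict_linear_maps[OF TW.tensor_module
    lin_comp[OF lin_comp[OF prj_lin[OF w(1)] O.psi_apply_lin[OF X]] iota_lin'[OF w(2,3)]]])

lemma eu_iota:
 assumes w: "w \<in> words d n" "w' \<in> words d n" "cont w' = cont w" and X: "X \<in> carrier (TC (cont w))"
  and u: "u \<in> words d n" and y: "y \<in> carrier (U (cont u))"
 shows "eu n w' w X (iota u y) = (if u = w then iota w' (psi (cont w) X y) else \<zero>\<^bsub>tpow K W n\<^esub>)"
proof -
 have "eu n w' w X (iota u y) = iota w' (psi (cont w) X (prj w (iota u y)))"
  unfolding eu_def by (rule restrict_apply') (rule iota_closed[OF u y])
 then show ?thesis using lin_zero[OF U_module U_module O.psi_apply_lin[OF X]] iota_zero[OF w(2,3)]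
  by (simp add: prj_iota[OF w(1) u y])
qed

lemma eu_lin:
 assumes w: "w \<in> words d n" "w' \<in> words d n" "cont w' = cont w"
 shows "lin K (TC (cont w)) (En n) (eu n w' w)"
proof (rule lin_into_end[OF TW.tensor_module O.CA.tensor_alg_module])
 show "eu n w' w X \<in> linmapsW n" if "X \<in> carrier (TC (cont w))" for X by (rule eu_closed[OF w that])
 show "lin K (TC (cont w)) (tpow K W n) (%X. eu n w' w X x)" if x: "x \<in> carW n" for x
  unfolding eu_def restrict_apply'[OF x]
  by (rule lin_comp[OF lin_comp[OF O.psi_lin end_eval_lin[OF U_module prj_closed[OF w(1) x]]] iota_lin'[OF w(2,3)]])
qed

lemma psi_mult':
 assumes "X \<in> carrier (TC \<nu>)" "Y \<in> carrier (TC \<nu>)" "y \<in> carrier (U \<nu>)"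
 shows "psi \<nu> (X \<otimes>\<^bsub>TC \<nu>\<^esub> Y) y = psi \<nu> X (psi \<nu> Y y)"
 using assms(3) by (simp add: O.psi_mult[OF assms(1,2)] compose_def del: tensor_alg_simps)

lemma psi_one': "y \<in> carrier (U \<nu>) ==> psi \<nu> \<one>\<^bsub>TC \<nu>\<^esub> y = y" by (simp add: O.psi_one del: tensor_alg_simps)

lemma En_mult: "x \<in> carW n ==> (f \<otimes>\<^bsub>En n\<^esub> g) x = f (g x)" by (simp add: compose_def)

lemma mon_eu:
 assumes w: "w \<in> words d n" "w' \<in> words d n" "cont w' = cont w" and X: "X \<in> carrier (TC (cont w))"
  and comp: "compatible n s c Z"
 shows "mon n s c Z \<otimes>\<^bsub>En n\<^esub> eu n w' w X = c w' \<odot>\<^bsub>En n\<^esub> eu n (s w') w (Z w' \<otimes>\<^bsub>TC (cont w)\<^esub> X)"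
proof (rule linear_maps_iota_eq[OF _ _ TW.tensor_module])
 interpret E: unital_algebra K "En n" by (rule En)
 interpret T: module K "tpow K W n" by (rule TW.tensor_module)
 have s: "s w' \<in> words d n" "cont (s w') = cont w" "c w' \<in> carrier K" "Z w' \<in> carrier (TC (cont w))"
  using comp w unfolding compatible_def by auto
 have ZX: "Z w' \<otimes>\<^bsub>TC (cont w)\<^esub> X \<in> carrier (TC (cont w))" by (rule O.CA.mult_closed[OF s(4) X])
 note cl = eu_closed[OF w X] eu_closed[OF w(1) s(1,2) ZX] mon_closed[OF comp]
 have "mon n s c Z \<otimes>\<^bsub>En n\<^esub> eu n w' w X \<in> carrier (En n)" by (rule E.m_closed) (use cl in simp_all)
 then show "mon n s c Z \<otimes>\<^bsub>En n\<^esub> eu n w' w X \<in> linmapsW n" by simp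
 have "c w' \<odot>\<^bsub>En n\<^esub> eu n (s w') w (Z w' \<otimes>\<^bsub>TC (cont w)\<^esub> X) \<in> carrier (En n)" by (rule E.smult_closed[OF s(3)]) (use cl in simp)
 then show "c w' \<odot>\<^bsub>En n\<^esub> eu n (s w') w (Z w' \<otimes>\<^bsub>TC (cont w)\<^esub> X) \<in> linmapsW n" by simp
 fix u y assume u: "u \<in> words d n" and y: "y \<in> carrier (U (cont u))"
 have iu: "iota u y \<in> carW n" by (rule iota_closed[OF u y])
 have r: "(c w' \<odot>\<^bsub>En n\<^esub> f) (iota u y) = c w' \<odot>\<^bsub>tpow K W n\<^esub> f (iota u y)" for f using iu by simp
 show "(mon n s c Z \<otimes>\<^bsub>En n\<^esub> eu n w' w X) (iota u y) = (c w' \<odot>\<^bsub>En n\<^esub> eu n (s w') w (Z w' \<otimes>\<^bsub>TC (cont w)\<^esub> X)) (iota u y)"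
 proof (cases "u = w")
  case True
  have p: "psi (cont w) X y \<in> carrier (U (cont w'))" unfolding w(3) by (rule psi_closed'[OF X]) (use y True in simp)
  have "mon n s c Z (iota w' (psi (cont w) X y)) = c w' \<odot>\<^bsub>tpow K W n\<^esub> iota (s w') (psi (cont w) (Z w') (psi (cont w) X y))"
   using mon_iota[OF comp w(2) p] by (simp only: w(3))
  then show ?thesis unfolding r En_mult[OF iu] eu_iota[OF w X u y] eu_iota[OF w(1) s(1,2) ZX u y]
   using True y by (simp add: psi_mult'[OF s(4) X] del: tensor_alg_simps end_alg_simps)
 next
  case False
  then show ?thesis unfolding r En_mult[OF iu] eu_iota[OF w X u y] eu_iota[OF w(1) s(1,2) ZX u y]
   using lin_zero[OF TW.tensor_module TW.tensor_module linear_maps_lin[OF mon_closed[OF comp]]] s(3) by simp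
 qed
qed

lemma eu_mult:
 assumes w: "w1 \<in> words d n" "w2 \<in> words d n" "w3 \<in> words d n" "cont w1 = \<nu>" "cont w2 = \<nu>" "cont w3 = \<nu>"
  and X: "X \<in> carrier (TC \<nu>)" and Y: "Y \<in> carrier (TC \<nu>)"
 shows "eu n w1 w2 X \<otimes>\<^bsub>En n\<^esub> eu n w2 w3 Y = eu n w1 w3 (X \<otimes>\<^bsub>TC \<nu>\<^esub> Y)"
proof (rule linear_maps_iota_eq[OF _ _ TW.tensor_module])
 interpret E: unital_algebra K "En n" by (rule En)
 have eq: "cont w1 = cont w2" "cont w2 = cont w3" "cont w1 = cont w3" using w by simp_all
 have X': "X \<in> carrier (TC (cont w2))" and Y': "Y \<in> carrier (TC (cont w3))"
  and XY: "X \<otimes>\<^bsub>TC \<nu>\<^esub> Y \<in> carrier (TC (cont w3))"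
  unfolding w(5) w(6) using X Y O.CA.mult_closed by blast+
 note cl = eu_closed[OF w(2,1) eq(1) X'] eu_closed[OF w(3,2) eq(2) Y'] eu_closed[OF w(3,1) eq(3) XY]
 have "eu n w1 w2 X \<otimes>\<^bsub>En n\<^esub> eu n w2 w3 Y \<in> carrier (En n)" by (rule E.m_closed) (use cl in simp_all)
 then show "eu n w1 w2 X \<otimes>\<^bsub>En n\<^esub> eu n w2 w3 Y \<in> linmapsW n" by simp
 show "eu n w1 w3 (X \<otimes>\<^bsub>TC \<nu>\<^esub> Y) \<in> linmapsW n" by (rule cl(3))
 fix u y assume u: "u \<in> words d n" and y: "y \<in> carrier (U (cont u))"
 have iu: "iota u y \<in> carW n" by (rule iota_closed[OF u y])
 show "(eu n w1 w2 X \<otimes>\<^bsub>En n\<^esub> eu n w2 w3 Y) (iota u y) = eu n w1 w3 (X \<otimes>\<^bsub>TC \<nu>\<^esub> Y) (iota u y)"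
 proof (cases "u = w3")
  case True
  have y': "y \<in> carrier (U \<nu>)" using y True w(6) by simp
  have p: "psi \<nu> Y y \<in> carrier (U (cont w2))" unfolding w(5) by (rule psi_closed'[OF Y y'])
  show ?thesis unfolding En_mult[OF iu] eu_iota[OF w(3,2) eq(2) Y' u y] eu_iota[OF w(3,1) eq(3) XY u y]
   using True by (simp add: eu_iota[OF w(2,1) eq(1) X' w(2) p] w(5,6) psi_mult'[OF X Y y'] del: tensor_alg_simps)
 next
  case False
  then show ?thesis unfolding En_mult[OF iu] eu_iota[OF w(3,2) eq(2) Y' u y] eu_iota[OF w(3,1) eq(3) XY u y]
   using lin_zero[OF TW.tensor_module TW.tensor_module linear_maps_lin[OF cl(1)]] by simp
 qed
qed

abbreviation "dg n c \<equiv> mon n (%w. w) c (%w. \<one>\<^bsub>TC (cont w)\<^esub>)"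

lemma dg_compatible: "(!!w. w \<in> words d n ==> c w \<in> carrier K) ==> compatible n (%w. w) c (%w. \<one>\<^bsub>TC (cont w)\<^esub>)"
 unfolding compatible_def using O.CA.one_closed by blast

lemma dg_iota:
 assumes "!!w. w \<in> words d n ==> c w \<in> carrier K" "w \<in> words d n" "y \<in> carrier (U (cont w))"
 shows "dg n c (iota w y) = c w \<odot>\<^bsub>tpow K W n\<^esub> iota w y"
proof -
 have "dg n c (iota w y) = c w \<odot>\<^bsub>tpow K W n\<^esub> iota w (psi (cont w) \<one>\<^bsub>TC (cont w)\<^esub> y)"
  by (rule mon_iota[OF dg_compatible[OF assms(1)] assms(2,3)])
 then show ?thesis unfolding psi_one'[OF assms(3)] .
qed

lemma dg_eqI:
 assumes c: "!!w. w \<in> words d n ==> c w \<in> carrier K" and f: "f \<in> carrier (En n)"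
  and "!!w y. w \<in> words d n ==> y \<in> carrier (U (cont w)) ==> f (iota w y) = c w \<odot>\<^bsub>tpow K W n\<^esub> iota w y"
 shows "dg n c = f"
 by (rule linear_maps_iota_eq[OF mon_closed[OF dg_compatible[OF c]] _ TW.tensor_module])
  (use f assms(3) dg_iota[OF c] in simp_all)

lemma dg_eu: "w \<in> words d n ==> dg n (%v. if v = w then \<one> else \<zero>) = eu n w w \<one>\<^bsub>TC (cont w)\<^esub>"
proof (rule dg_eqI)
 interpret K: cring K by (rule K_cring)
 interpret T: module K "tpow K W n" by (rule TW.tensor_module)
 assume w: "w \<in> words d n"
 have one: "\<one>\<^bsub>TC (cont w)\<^esub> \<in> carrier (TC (cont w))" by (rule O.CA.one_closed)
 show "(if v = w then \<one> else \<zero>) \<in> carrier K" for v by simp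
 show "eu n w w \<one>\<^bsub>TC (cont w)\<^esub> \<in> carrier (En n)" using eu_closed[OF w w HOL.refl one] by simp
 fix u y assume u: "u \<in> words d n" and y: "y \<in> carrier (U (cont u))"
 show "eu n w w \<one>\<^bsub>TC (cont w)\<^esub> (iota u y) = (if u = w then \<one> else \<zero>) \<odot>\<^bsub>tpow K W n\<^esub> iota u y"
  unfolding eu_iota[OF w w HOL.refl one u y]
  using psi_one'[of y "cont w"] y iota_closed[OF u y] by (cases "u = w") (simp_all del: tensor_alg_simps)
qed

end

text \<open>\<open>B\<close> stands for the image of the representation, described by the properties
  that the argument uses: a subalgebra that contains the generating operators and lies in every
  subspace containing the monomial ones. Primitivity of \<zeta> enters here, to tell the letters
  apart.\<close>

locale gen_setup = braid_setup K d V \<phi> \<zeta>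
 for K :: "'k ring" (structure) and d :: nat and V :: "nat => ('k, 'v) module" and \<phi> and \<zeta> :: 'k +
 fixes n :: nat and B :: "((nat, nat => 'v, 'k) tens => (nat, nat => 'v, 'k) tens) set"
 assumes primitive: "!!m. 1 \<le> m ==> m < d ==> \<zeta> [^] m ~= \<one>"
  and B_subsp: "subsp K (En n) B" and B_one: "\<one>\<^bsub>En n\<^esub> \<in> B"
  and B_mult: "!!f g. f \<in> B ==> g \<in> B ==> f \<otimes>\<^bsub>En n\<^esub> g \<in> B"
  and B_sig: "!!e i. 1 \<le> i ==> i < n ==> sig n e i \<in> B"
  and B_ta: "!!i. i \<in> {1..n} ==> ta n True i \<in> B"
  and B_least: "!!N. subsp K (En n) N ==> (!!s c X. compatible n s c X ==> mon n s c X \<in> N) ==> B <= N"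
begin

interpretation E: unital_algebra K "En n" by (rule En)

text \<open>If the powers with exponents k and k + m agree, multiplying by the power with exponent d
  - k makes the m-th power equal to one, against primitivity. In this form only natural exponents
  occur.\<close>

lemma zeta_neq:
 assumes "a \<in> {1..d}" "b \<in> {1..d}" "a ~= b" shows "\<zeta> [^] (a - 1) ~= \<zeta> [^] (b - 1)"
proof -
 have z: "\<zeta> [^] k ~= \<zeta> [^] (k + m)" if "1 \<le> m" "k + m < d" for k m :: nat
 proof
  assume eq: "\<zeta> [^] k = \<zeta> [^] (k + m)"
  have "\<zeta> [^] (k + m) \<otimes> \<zeta> [^] (d - k) = \<zeta> [^] (m + 1 * d)"
   unfolding K_facts(2) using that by (intro arg_cong[where f = "%k. \<zeta> [^] (k::nat)"]) simp
  also have "... = \<zeta> [^] m" unfolding K_facts(2)[symmetric] K_facts(4) using zeta_pow by simp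
  also have "\<zeta> [^] (k + m) \<otimes> \<zeta> [^] (d - k) = \<zeta> [^] d" unfolding eq[symmetric] K_facts(2) using that by simp
  finally show False using primitive[of m] zeta that by simp
 qed
 show ?thesis
 proof (cases "a < b")
  case True
  then show ?thesis using z[of "b - a" "a - 1"] assms by simp
 next
  case False
  then have "1 \<le> a - b" "b - 1 + (a - b) < d" "b - 1 + (a - b) = a - 1" using assms by (simp_all only: atLeastAtMost_iff) arith+
  then show ?thesis using z[of "a - b" "b - 1"] by metis
 qed
qed

lemma B_En: "f \<in> B ==> f \<in> carrier (En n)" using B_subsp unfolding subsp_def by blast

lemma B_add: "f \<in> B ==> g \<in> B ==> f \<oplus>\<^bsub>En n\<^esub> g \<in> B" and B_smult: "c \<in> carrier K ==> f \<in> B ==> c \<odot>\<^bsub>En n\<^esub> f \<in> B"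
 using B_subsp unfolding subsp_def by blast+

text \<open>The coefficient functions whose diagonal operators lie in \<open>B\<close>. They are
  closed under pointwise sums and products, so the interpolation is done with functions on words
  instead of operators.\<close>

definition Dg :: "(nat list => 'k) set" where "Dg = {c. (ALL w:words d n. c w \<in> carrier K) \<and> dg n c \<in> B}"

lemma Dg_iota: "c \<in> Dg ==> w \<in> words d n ==> y \<in> carrier (U (cont w)) ==> dg n c (iota w y) = c w \<odot>\<^bsub>tpow K W n\<^esub> iota w y"
 by (rule dg_iota) (auto simp: Dg_def)

lemma DgI:
 assumes "!!w. w \<in> words d n ==> c w \<in> carrier K" and f: "f \<in> B"
  and "!!w y. w \<in> words d n ==> y \<in> carrier (U (cont w)) ==> f (iota w y) = c w \<odot>\<^bsub>tpow K W n\<^esub> iota w y"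
 shows "c \<in> Dg"
 unfolding Dg_def using assms(1) f dg_eqI[OF assms(1) B_En[OF f] assms(3)] by simp

lemma Dg_K: "c \<in> Dg ==> w \<in> words d n ==> c w \<in> carrier K" by (simp add: Dg_def)

lemma Dg_const:
 assumes "a \<in> carrier K" shows "(%w. a) \<in> Dg"
proof (rule DgI[where f = "a \<odot>\<^bsub>En n\<^esub> \<one>\<^bsub>En n\<^esub>"])
 show "a \<odot>\<^bsub>En n\<^esub> \<one>\<^bsub>En n\<^esub> \<in> B" by (rule B_smult[OF assms B_one])
qed (use assms iota_closed in simp_all)

lemma Dg_add:
 assumes c: "c \<in> Dg" "c' \<in> Dg" shows "(%w. c w \<oplus> c' w) \<in> Dg"
proof (rule DgI[where f = "dg n c \<oplus>\<^bsub>En n\<^esub> dg n c'"])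
 show "dg n c \<oplus>\<^bsub>En n\<^esub> dg n c' \<in> B" using c by (intro B_add) (simp_all add: Dg_def)
 fix w y assume w: "w \<in> words d n" and y: "y \<in> carrier (U (cont w))"
 show "(dg n c \<oplus>\<^bsub>En n\<^esub> dg n c') (iota w y) = (c w \<oplus> c' w) \<odot>\<^bsub>tpow K W n\<^esub> iota w y"
  using Dg_iota[OF c(1) w y] Dg_iota[OF c(2) w y] iota_closed[OF w y] Dg_K[OF _ w] c
  by (simp add: module.smult_l_distr[OF TW.tensor_module] del: tensor_alg_simps)
qed (use c in \<open>simp add: Dg_K\<close>)

lemma Dg_mult:
 assumes c: "c \<in> Dg" "c' \<in> Dg" shows "(%w. c w \<otimes> c' w) \<in> Dg"
proof (rule DgI[where f = "dg n c \<otimes>\<^bsub>En n\<^esub> dg n c'"])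
 show "dg n c \<otimes>\<^bsub>En n\<^esub> dg n c' \<in> B" using c by (intro B_mult) (simp_all add: Dg_def)
 fix w y assume w: "w \<in> words d n" and y: "y \<in> carrier (U (cont w))"
 have iw: "iota w y \<in> carW n" by (rule iota_closed[OF w y])
 have "dg n c \<in> carrier (En n)" using c(1) B_En unfolding Dg_def by blast
 then have l: "linW n (dg n c)" using linear_maps_lin by simp
 show "(dg n c \<otimes>\<^bsub>En n\<^esub> dg n c') (iota w y) = (c w \<otimes> c' w) \<odot>\<^bsub>tpow K W n\<^esub> iota w y"
  unfolding En_mult[OF iw] Dg_iota[OF c(2) w y] lin_smult[OF l Dg_K[OF c(2) w] iw] Dg_iota[OF c(1) w y]
  using Dg_K[OF _ w] c iw by (simp add: module.smult_assoc1[OF TW.tensor_module, symmetric] comm_monoid.m_comm[OF cring.axioms(2)[OF K_cring]])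
qed (use c in \<open>simp add: Dg_K\<close>)

lemma Dg_zeta: "i \<in> {1..n} ==> (%w. \<zeta> [^] (letter w i - 1)) \<in> Dg" using B_ta[of i] zeta_pow unfolding Dg_def ta_def by simp

text \<open>The projections to the homogeneous components are Lagrange interpolation polynomials in the \<open>\<tau>\<^sub>i\<close>.\<close>

lemma Dg_separate:
 assumes w: "w \<in> words d n" and S: "finite S" "S <= words d n - {w}"
 shows "EX c:Dg. c w = \<one> \<and> (ALL u:S. c u = \<zero>)"
 using S
proof (induction S rule: finite_induct)
 case empty
 then show ?case by (intro bexI[of _ "%w. \<one>"] Dg_const[OF cring_one_closed(1)[OF K_cring]]) simp
next
 case (insert u S)
 then obtain c where c: "c \<in> Dg" "c w = \<one>" "ALL u:S. c u = \<zero>" by blast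
 have u: "u \<in> words d n" "u ~= w" using insert.prems by auto
 then obtain i where i: "i \<in> {1..n}" "letter u i ~= letter w i" using words_eqI[OF u(1) w] by blast
 let ?z = "%v. \<zeta> [^] (letter v i - 1)"
 have "?z w ~= ?z u" using zeta_neq[OF letter_in[OF w i(1)] letter_in[OF u(1) i(1)]] i(2) by metis
 from field_separate[OF field zeta_pow zeta_pow this] obtain g where g: "g \<in> carrier K" "\<ominus> ?z u \<in> carrier K"
   "(g \<otimes> (?z w \<oplus> \<ominus> ?z u)) \<otimes> \<one> = \<one>"
   "ALL c:carrier K. (g \<otimes> (?z u \<oplus> \<ominus> ?z u)) \<otimes> c = \<zero> \<and> (g \<otimes> (c \<oplus> \<ominus> ?z u)) \<otimes> \<zero> = \<zero>" by (elim exE conjE)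
 \<comment> \<open>One more linear factor, equal to one at \<open>w\<close> and zero at
   \<open>u\<close>; the old zeros persist.\<close>
 let ?c = "%v. (g \<otimes> (?z v \<oplus> \<ominus> ?z u)) \<otimes> c v"
 have "?c \<in> Dg" by (rule Dg_mult[OF Dg_mult[OF Dg_const[OF g(1)] Dg_add[OF Dg_zeta[OF i(1)] Dg_const[OF g(2)]]] c(1)])
 moreover have "?c w = \<one>" unfolding c(2) by (rule g(3))
 moreover have "?c u = \<zero>" using g(4) Dg_K[OF c(1) u(1)] by blast
 moreover have "?c v = \<zero>" if "v \<in> S" for v using g(4) zeta_pow c(3) that by simp
 ultimately show ?case by (intro bexI[of _ ?c]) auto
qed

lemma eu_diag:
 assumes w: "w \<in> words d n" shows "eu n w w \<one>\<^bsub>TC (cont w)\<^esub> \<in> B"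
proof -
 have "finite (words d n - {w})" using finite_words[of n] by (rule finite_Diff)
 from Dg_separate[OF w this order_refl]
 obtain c where c: "c \<in> Dg" "c w = \<one>" "ALL u:words d n - {w}. c u = \<zero>" by (elim bexE conjE)
 have "dg n (%v. if v = w then \<one> else \<zero>) = dg n c" by (rule mon_cong[OF dg_compatible dg_compatible]) (use c Dg_K in auto)
 then show ?thesis using c(1) unfolding dg_eu[OF w] Dg_def by simp
qed

lemma sig_eu:
 assumes w: "w \<in> words d n" "w' \<in> words d n" "cont w' = cont w" and X: "X \<in> carrier (TC (cont w))" and i: "1 \<le> i" "i < n"
 shows "sig n e i \<otimes>\<^bsub>En n\<^esub> eu n w' w X = eu n (sw i w') w (gX e i w' \<otimes>\<^bsub>TC (cont w)\<^esub> X)"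
proof -
 have g: "gX e i w' \<otimes>\<^bsub>TC (cont w)\<^esub> X \<in> carrier (TC (cont w))" using O.CA.mult_closed[OF gX_closed[OF w(2) i, unfolded w(3)] X] .
 have s: "sw i w' \<in> words d n" "cont (sw i w') = cont w" using sig_compatible[OF i] w unfolding compatible_def by auto
 have "eu n (sw i w') w (gX e i w' \<otimes>\<^bsub>TC (cont w)\<^esub> X) \<in> carrier (En n)" using eu_closed[OF w(1) s g] by simp
 then show ?thesis unfolding sig_def mon_eu[OF w X sig_compatible[OF i]] by (rule E.smult_one)
qed

text \<open>Multiplying a matrix unit by \<sigma> from the left exchanges two neighbours in its row
  word. For distinct letters the block is trivial, so the entry stays one. Starting from the
  diagonal unit, every word of the same content is reached.\<close>

lemma eu_one:
 assumes w: "w \<in> words d n" "w' \<in> words d n" "cont w' = cont w" shows "eu n w' w \<one>\<^bsub>TC (cont w)\<^esub> \<in> B"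
proof -
 let ?Q = "{v \<in> words d n. cont v = cont w \<and> eu n v w \<one>\<^bsub>TC (cont w)\<^esub> \<in> B}"
 have one: "\<one>\<^bsub>TC (cont w)\<^esub> \<in> carrier (TC (cont w))" by (rule O.CA.one_closed)
 have "w' \<in> ?Q"
 proof (rule adjacent_swaps_connect)
  show "w \<in> ?Q" using w eu_diag by blast
  show "mset w = mset w'" by (rule content_eq_mset[OF w(1,2) w(3)[symmetric]])
  fix u a b v assume q: "u @ a # b # v \<in> ?Q" and ab: "a ~= b"
  \<comment> \<open>Positions start at 1, so \<open>a\<close> stands at
    \<open>length u + 1\<close>.\<close>
  let ?q = "u @ a # b # v" and ?i = "length u + 1"
  have qw: "?q \<in> words d n" "cont ?q = cont w" "eu n ?q w \<one>\<^bsub>TC (cont w)\<^esub> \<in> B" using q by auto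
  have i: "1 \<le> ?i" "?i < n" using qw(1) by (auto simp: words_def)
  have sq: "sw ?i ?q = u @ b # a # v" by (rule sw_split) auto
  have "letter ?q ?i ~= letter ?q (?i + 1)" using ab by (simp add: letter_def nth_append)
  then have "gX True ?i ?q = \<one>\<^bsub>TC (cont w)\<^esub>" using gX_neq[of ?q ?i True] by (simp only: qw(2) simp_thms)
  then have "sig n True ?i \<otimes>\<^bsub>En n\<^esub> eu n ?q w \<one>\<^bsub>TC (cont w)\<^esub> = eu n (sw ?i ?q) w \<one>\<^bsub>TC (cont w)\<^esub>"
   using sig_eu[OF w(1) qw(1,2) one i, of True] by (simp only: TC_one_mult)
  then have "eu n (u @ b # a # v) w \<one>\<^bsub>TC (cont w)\<^esub> \<in> B" using B_mult[OF B_sig[OF i] qw(3), of True] sq by simp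
  then show "u @ b # a # v \<in> ?Q" using sig_compatible[OF i, of True] qw(1,2) sq unfolding compatible_def by auto
 qed
 then show ?thesis by blast
qed

text \<open>The word \<open>w0\<close> lists all letters \<open>b\<close> first, so position
  \<open>r\<close> has rank \<open>r\<close>, and \<sigma> at \<open>r\<close> acts on this
  component by the \<open>r\<close>-th braid generator of the block of \<open>b\<close>. Matrix
  units with entry one carry this from \<open>w0\<close> back to \<open>w\<close>.\<close>

lemma eu_slot_letter:
 assumes w: "w \<in> words d n" and b: "b \<in> {1..d}" and r: "1 \<le> r" "r < cont w b"
 shows "eu n w w (slot (cont w) b (ph b (cont w b) r e)) \<in> B"
proof -
 let ?\<nu> = "cont w" and ?m = "cont w b"
 define w0 where "w0 = replicate ?m b @ filter (%c. c ~= b) w"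
 have mw: "mset w0 = mset w"
  unfolding w0_def using b by (intro multiset_eqI) (auto simp: content_apply count_mset count_list_eq_length_filter)
 have w0: "w0 \<in> words d n" using w mset_eq_setD[OF mw] mset_eq_length[OF mw] by (simp add: words_def)
 have cw0: "cont w0 = ?\<nu>" using mw by (auto simp: content_def fun_eq_iff count_mset[symmetric])
 have mn: "?m \<le> n" using w0 by (simp add: w0_def words_def)
 then have i: "1 \<le> r" "r < n" using r by auto
 have l: "letter w0 r = b" "letter w0 (r + 1) = b" using r by (auto simp: w0_def letter_def nth_append)
 have rk: "rank w0 r = r"
 proof -
  have "take r w0 = replicate r b" using r by (simp add: w0_def min_def)
  moreover have "count_list (replicate r b) b = r" by (induction r) auto
  ultimately show ?thesis using l by (simp add: rank_def)
 qed
 let ?s = "slot ?\<nu> b (ph b ?m r e)"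
 have s: "?s \<in> carrier (TC ?\<nu>)" using slot_closed[where \<nu> = ?\<nu>, OF b] ph_Cb[OF r] by blast
 have one: "\<one>\<^bsub>TC ?\<nu>\<^esub> \<in> carrier (TC ?\<nu>)" by (rule O.CA.one_closed)
 have "gX e r w0 = ?s" by (simp only: gX_def l rk cw0 if_True simp_thms)
 moreover have "sw r w0 = w0" using w0 i l by (intro sw_same) (auto simp: words_def)
 ultimately have "sig n e r \<otimes>\<^bsub>En n\<^esub> eu n w0 w \<one>\<^bsub>TC ?\<nu>\<^esub> = eu n w0 w ?s"
  using sig_eu[OF w w0 cw0 one i, of e] O.CA.r_one[OF s] by simp
 then have "eu n w0 w ?s \<in> B" using B_mult[OF B_sig[OF i] eu_one[OF w w0 cw0], of e] by simp
 from B_mult[OF eu_one[OF w0 w cw0[symmetric]] this]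
 show ?thesis unfolding cw0 eu_mult[OF w w0 w HOL.refl cw0 HOL.refl one s] O.CA.l_one[OF s] .
qed

lemma slot_lin: "b \<in> {1..d} ==> lin K (CA \<nu> b) (TC \<nu>) (slot \<nu> b)"
proof -
 assume b: "b \<in> {1..d}"
 have "lin K (CA \<nu> b) (TC \<nu>) (%f. pure K {1..d} (CA \<nu>) ((%c. \<one>\<^bsub>CA \<nu> c\<^esub>)(b := f)))"
  using O.CA.M.pure_lin[where \<nu> = \<nu> and x = "%c. \<one>\<^bsub>CA \<nu> c\<^esub>", OF CA_one[where \<nu> = \<nu>] b] by simp
 moreover have "slot \<nu> b = (%f. pure K {1..d} (CA \<nu>) ((%c. \<one>\<^bsub>CA \<nu> c\<^esub>)(b := f)))"
  unfolding slot_def by (intro ext O.CA.M.pure_cong[where \<nu> = \<nu>]) simp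
 ultimately show ?thesis by (simp only:)
qed

text \<open>The operators \<open>f\<close> whose matrix unit lies in \<open>B\<close> form a
  subspace that contains one and is closed under left multiplication by braid letters, hence they
  exhaust the image of the braid group algebra.\<close>

lemma eu_slot:
 assumes w: "w \<in> words d n" and b: "b \<in> {1..d}" and f: "f \<in> Cb b (cont w b)"
 shows "eu n w w (slot (cont w) b f) \<in> B"
proof -
 let ?\<nu> = "cont w" and ?m = "cont w b"
 let ?L = "%f. eu n w w (slot ?\<nu> b f)"
 let ?N = "{f \<in> Cb b ?m. ?L f \<in> B}"
 have L: "lin K (CA ?\<nu> b) (En n) ?L" by (rule lin_comp[OF slot_lin[OF b] eu_lin[OF w w HOL.refl]])
 have Lz: "?L \<zero>\<^bsub>CA ?\<nu> b\<^esub> = \<zero>\<^bsub>En n\<^esub>"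
  by (rule lin_zero[OF unital_algebra.axioms(1)[OF O.CA.A[where \<nu> = ?\<nu>, OF b]] E.module_axioms L])
 have C: "subsp K (EV b ?m) (Cb b ?m)" by (rule Cb_subsp[OF b])
 have N: "subsp K (EV b ?m) ?N" using C B_subsp Lz lin_add[OF L] lin_smult[OF L]
  unfolding subsp_def by (simp del: end_alg_simps) blast
 have one: "\<one>\<^bsub>EV b ?m\<^esub> \<in> ?N"
  using Cb_one[OF b, of ?m] eu_diag[OF w] slot_one[OF b, of ?\<nu>] by (simp del: end_alg_simps tensor_alg_simps)
 obtain x where x: "x \<in> carrier (group_alg K (presented_group (braid_gens ?m) (braid_rels ?m)))" "f = \<phi> b ?m x"
  using f unfolding Cb_def braid_group_def by (elim imageE)
 have "\<phi> b ?m x \<in> ?N"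
 proof (rule presented_alg_hom_image_subset[OF K_cring EV[OF b] phi_hom'[OF b] N one _ x(1)])
  fix l :: "fb_gen \<times> bool" and y assume l: "l \<in> braid_gens ?m \<times> UNIV" and y: "y \<in> ?N"
  then obtain r e where re: "l = (Sg r, e)" "1 \<le> r" "r < ?m" by (auto simp: braid_gens_def)
  let ?p = "ph b ?m r e"
  have p: "?p \<in> Cb b ?m" by (rule ph_Cb[OF re(2,3)])
  have yC: "y \<in> Cb b ?m" "?L y \<in> B" using y by simp_all
  have s: "slot ?\<nu> b ?p \<in> carrier (TC ?\<nu>)" "slot ?\<nu> b y \<in> carrier (TC ?\<nu>)"
   using slot_closed[where \<nu> = ?\<nu>, OF b] p yC(1) by blast+
  have "?L ?p \<otimes>\<^bsub>En n\<^esub> ?L y = ?L (?p \<otimes>\<^bsub>EV b ?m\<^esub> y)"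
   unfolding eu_mult[OF w w w HOL.refl HOL.refl HOL.refl s] slot_mult[where \<nu> = ?\<nu>, OF b p yC(1)] ..
  then have "?L (?p \<otimes>\<^bsub>EV b ?m\<^esub> y) \<in> B" using B_mult[OF eu_slot_letter[OF w b re(2,3), of e] yC(2)] by (simp only:)
  then show "\<phi> b ?m (basis_vec K (wcls (braid_gens ?m) (braid_rels ?m) [l])) \<otimes>\<^bsub>EV b ?m\<^esub> y \<in> ?N"
   using Cb_mult[OF b p yC(1)] unfolding re(1) ph_def by blast
 qed
 then show ?thesis unfolding x(2) by blast
qed

text \<open>A pure tensor is the product of its single slots, and diagonal matrix units at the same
  word multiply like their entries; general tensors follow by linearity.\<close>

lemma eu_all:
 assumes w: "w \<in> words d n" and X: "X \<in> carrier (TC (cont w))" shows "eu n w w X \<in> B"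
proof (rule spans_image_closed[where f = "eu n w w" and x = X, OF _ E.module_axioms O.CA.M.spans_pure[where \<nu> = "cont w"] _ B_subsp])
 let ?\<nu> = "cont w"
 show "module K (tensor K {1..d} (CA ?\<nu>))" by (rule O.CA.M.tensor_module)
 show "lin K (tensor K {1..d} (CA ?\<nu>)) (En n) (eu n w w)" using eu_lin[OF w w HOL.refl] by simp
 show "X \<in> carrier (tensor K {1..d} (CA ?\<nu>))" using X by simp
 fix Y assume "Y \<in> pure K {1..d} (CA ?\<nu>) ` (\<Pi>\<^sub>E b\<in>{1..d}. carrier (CA ?\<nu> b))"
 then obtain f where f': "f \<in> (\<Pi>\<^sub>E b\<in>{1..d}. carrier (CA ?\<nu> b))" and Y: "Y = pure K {1..d} (CA ?\<nu>) f" by (elim imageE)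
 have f: "f b \<in> Cb b (?\<nu> b)" if "b \<in> {1..d}" for b using PiE_mem[OF f' that] by simp
 \<comment> \<open>\<open>J\<close> holds the slots already filled with \<open>f\<close>; the others
   still carry one.\<close>
 have "eu n w w (pure K {1..d} (CA ?\<nu>) (%c. if c \<in> J then f c else \<one>\<^bsub>CA ?\<nu> c\<^esub>)) \<in> B" if "finite J" "J <= {1..d}" for J using that
 proof (induction J rule: finite_induct)
  case empty
  then show ?case using eu_diag[OF w] by (simp del: end_alg_simps)
 next
  case (insert b J)
  let ?g = "%c. if c \<in> J then f c else \<one>\<^bsub>CA ?\<nu> c\<^esub>"
  have b: "b \<in> {1..d}" using insert.prems by simp
  have g: "?g c \<in> carrier (CA ?\<nu> c)" if "c \<in> {1..d}" for c using f[OF that] CA_one[OF that] by simp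
  have p: "pure K {1..d} (CA ?\<nu>) ?g \<in> carrier (TC ?\<nu>)" using O.CA.M.pure_closed[where \<nu> = ?\<nu>, OF g] by simp
  have "pure K {1..d} (CA ?\<nu>) (%c. if c \<in> insert b J then f c else \<one>\<^bsub>CA ?\<nu> c\<^esub>) =
    pure K {1..d} (CA ?\<nu>) (%c. (if c = b then f b else \<one>\<^bsub>CA ?\<nu> c\<^esub>) \<otimes>\<^bsub>CA ?\<nu> c\<^esub> ?g c)"
  proof (rule O.CA.M.pure_cong[where \<nu> = ?\<nu>])
   fix c assume c: "c \<in> {1..d}"
   have gc: "?g c \<in> Cb c (?\<nu> c)" using g[OF c] by simp
   show "(if c \<in> insert b J then f c else \<one>\<^bsub>CA ?\<nu> c\<^esub>) = (if c = b then f b else \<one>\<^bsub>CA ?\<nu> c\<^esub>) \<otimes>\<^bsub>CA ?\<nu> c\<^esub> ?g c"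
    using insert.hyps(2) CA_l_r_one(1)[where \<nu> = ?\<nu>, OF c gc] CA_l_r_one(2)[where \<nu> = ?\<nu>, OF b f[OF b]]
    by (cases "c = b") (simp_all del: end_alg_simps)
  qed
  also have "... = slot ?\<nu> b (f b) \<otimes>\<^bsub>TC ?\<nu>\<^esub> pure K {1..d} (CA ?\<nu>) ?g"
   unfolding slot_def by (rule O.CA.pure_mult_pure[where \<nu> = ?\<nu>, symmetric]) (use g f[OF b] CA_one in \<open>simp_all del: end_alg_simps\<close>)
  finally have e: "pure K {1..d} (CA ?\<nu>) (%c. if c \<in> insert b J then f c else \<one>\<^bsub>CA ?\<nu> c\<^esub>) =
   slot ?\<nu> b (f b) \<otimes>\<^bsub>TC ?\<nu>\<^esub> pure K {1..d} (CA ?\<nu>) ?g" .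
  have "eu n w w (pure K {1..d} (CA ?\<nu>) ?g) \<in> B" using insert by blast
  from B_mult[OF eu_slot[OF w b f[OF b]] this] show ?case
   unfolding e eu_mult[OF w w w HOL.refl HOL.refl HOL.refl slot_closed[where \<nu> = ?\<nu>, OF b f[OF b]] p] .
 qed
 from this[OF finite_atLeastAtMost order_refl]
 have "eu n w w (pure K {1..d} (CA ?\<nu>) (%c. if c \<in> {1..d} then f c else \<one>\<^bsub>CA ?\<nu> c\<^esub>)) \<in> B" .
 moreover have "pure K {1..d} (CA ?\<nu>) (%c. if c \<in> {1..d} then f c else \<one>\<^bsub>CA ?\<nu> c\<^esub>) = Y"
  unfolding Y by (rule O.CA.M.pure_cong[where \<nu> = ?\<nu>]) simp
 ultimately show "eu n w w Y \<in> B" by simp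
qed

lemma eu_B:
 assumes w: "w \<in> words d n" "w' \<in> words d n" "cont w' = cont w" and X: "X \<in> carrier (TC (cont w))"
 shows "eu n w' w X \<in> B"
 using B_mult[OF eu_one[OF w] eu_all[OF w(1) X]]
 unfolding eu_mult[OF w(2,1,1,3) HOL.refl HOL.refl O.CA.one_closed X] O.CA.l_one[OF X] .

end

section \<open>The isomorphism with a sum of matrix algebras\<close>

text \<open>Such words are the permutations of the multiset with \<open>\<nu> b\<close> copies of
  each letter \<open>b\<close>.\<close>

lemma card_words_content:
 assumes "\<nu> \<in> compositions d n"
 shows "card {w \<in> words d n. content d w = \<nu>} = multinomial d n \<nu>"
proof -
 have \<nu>: "\<nu> \<in> extensional {1..d}" "(\<Sum>b\<in>{1..d}. \<nu> b) = n" using assms by (auto simp: compositions_def PiE_def)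
 define M where "M = (\<Sum>b\<in>{1..d}. replicate_mset (\<nu> b) b)"
 have cM: "count M c = (if c \<in> {1..d} then \<nu> c else 0)" for c unfolding M_def count_sum by (simp add: sum.delta)
 have sM: "size M = n" 
 proof -
  have "size (\<Sum>b\<in>S. replicate_mset (\<nu> b) b) = (\<Sum>b\<in>S. \<nu> b)" if "finite S" for S
   using that by (induction S rule: finite_induct) auto
  then show ?thesis unfolding M_def \<nu>(2)[symmetric] by simp
 qed
 have "{w \<in> words d n. content d w = \<nu>} = permutations_of_multiset M"
 proof (intro equalityI subsetI)
  fix w assume w: "w \<in> {w \<in> words d n. content d w = \<nu>}"
  have "count (mset w) c = count M c" for c
  proof (cases "c \<in> {1..d}")
   case True
   then have "count_list w c = \<nu> c" using w content_apply[of c d w] by auto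
   then show ?thesis using True by (simp add: cM count_mset)
  next
   case False
   then have "c \<notin> set w" using w by (auto simp: words_def)
   then show ?thesis using False by (simp only: cM count_mset count_list_0_iff if_False simp_thms)
  qed
  then show "w \<in> permutations_of_multiset M" by (simp add: permutations_of_multiset_def multiset_eq_iff)
 next
  fix w assume "w \<in> permutations_of_multiset M"
  then have w: "mset w = M" by (simp add: permutations_of_multiset_def)
  have "c \<in> {1..d}" if "c \<in> set w" for c using that w cM[of c] by (metis count_eq_zero_iff set_mset_mset)
  moreover have "length w = n" using w sM by (metis size_mset)
  moreover have "content d w = \<nu>" using \<nu>(1) cM w by (auto simp: content_def fun_eq_iff extensional_def count_mset[symmetric])
  ultimately show "w \<in> {w \<in> words d n. content d w = \<nu>}" by (auto simp: words_def)
 qed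
 then have "card {w \<in> words d n. content d w = \<nu>} = fact n div (\<Prod>c\<in>set_mset M. fact (count M c))"
  by (simp add: card_permutations_of_multiset(1) sM)
 also have "(\<Prod>c\<in>set_mset M. fact (count M c)) = (\<Prod>c\<in>{1..d}. fact (\<nu> c) :: nat)"
 proof (rule prod.mono_neutral_cong_left)
  show sub: "set_mset M <= {1..d}" using cM by (metis count_eq_zero_iff subsetI)
  show "ALL c:{1..d} - set_mset M. fact (\<nu> c) = (1::nat)" using cM by (metis DiffD1 DiffD2 count_eq_zero_iff fact_0)
  show "fact (count M c) = (fact (\<nu> c) :: nat)" if "c \<in> set_mset M" for c using cM[of c] sub that by auto
 qed simp
 finally show ?thesis by (simp add: multinomial_def)
qed

lemma subsp_finsum:
 assumes M: "module K M" and N: "subsp K M N" and A: "finite A" "!!i. i \<in> A ==> f i \<in> N"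
 shows "(\<Oplus>\<^bsub>M\<^esub>i\<in>A. f i) \<in> N"
 using A
proof (induction A rule: finite_induct)
 interpret M: module K M by fact
 { case empty then show ?case using N by (simp add: subsp_def) }
 { case (insert i A)
  have "f \<in> insert i A \<rightarrow> carrier M" using insert.prems N by (auto simp: subsp_def)
  then have "(\<Oplus>\<^bsub>M\<^esub>i\<in>insert i A. f i) = f i \<oplus>\<^bsub>M\<^esub> (\<Oplus>\<^bsub>M\<^esub>i\<in>A. f i)" using insert.hyps by (intro M.finsum_insert) auto
  then show ?case using insert N by (simp add: subsp_def) }
qed

section \<open>Matrix entries of block operators\<close>

context braid_setup
begin

text \<open>\<open>ent f w' w X\<close>: the \<open>(w', w)\<close> entry of \<open>f\<close> is the operator of \<open>X\<close>.\<close>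

definition ent :: "_ => nat list => nat list => _ => bool"
 where "ent f w' w X \<longleftrightarrow> X \<in> carrier (TC (cont w)) \<and> (ALL y:carrier (U (cont w)). prj w' (f (iota w y)) = psi (cont w) X y)"

definition coord where "coord f w' w = (THE X. ent f w' w X)"

text \<open>Injectivity of \<open>psi\<close> makes an entry a well-defined element of the abstract
  tensor product, not only an operator.\<close>

lemma ent_unique:
 assumes "ent f w' w X" "ent f w' w Y" shows "X = Y"
proof (rule inj_onD[OF O.psi_inj[of "cont w"]])
 show XY: "X \<in> carrier (TC (cont w))" "Y \<in> carrier (TC (cont w))" using assms unfolding ent_def by blast+
 show "psi (cont w) X = psi (cont w) Y"
  by (rule linear_maps_ext[OF O.psi_closed[OF XY(1)] O.psi_closed[OF XY(2)]]) (use assms in \<open>simp add: ent_def\<close>)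
qed

lemma coord_eq: "ent f w' w X ==> coord f w' w = X" unfolding coord_def by (rule the_equality) (assumption, rule ent_unique)

text \<open>The operators that are block diagonal with respect to content and whose entries come
  from the abstract tensor products. This is the concrete description of the image, see
  \<open>B_eq\<close>.\<close>

definition good :: "nat => _ set"
 where "good n = {f \<in> linmapsW n. ALL w:words d n. ALL w':words d n.
  (cont w' = cont w --> (\<exists>X. ent f w' w X)) \<and>
  (cont w' ~= cont w --> (ALL y:carrier (U (cont w)). prj w' (f (iota w y)) = \<zero>\<^bsub>U (cont w')\<^esub>))}"

lemma good_lin: "f \<in> good n ==> linW n f" unfolding good_def using linear_maps_lin by blast

lemma good_ent: "f \<in> good n ==> w \<in> words d n ==> w' \<in> words d n ==> cont w' = cont w ==> ent f w' w (coord f w' w)"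
 unfolding good_def
 by (elim CollectE conjE) (drule (1) bspec, drule (1) bspec, auto simp: coord_eq)

lemma good_zero: "f \<in> good n ==> w \<in> words d n ==> w' \<in> words d n ==> cont w' ~= cont w ==>
  y \<in> carrier (U (cont w)) ==> prj w' (f (iota w y)) = \<zero>\<^bsub>U (cont w')\<^esub>"
 unfolding good_def by blast

lemma coord_closed: "f \<in> good n ==> w \<in> words d n ==> w' \<in> words d n ==> cont w' = cont w ==> coord f w' w \<in> carrier (TC (cont w))"
 and coord_psi: "f \<in> good n ==> w \<in> words d n ==> w' \<in> words d n ==> cont w' = cont w ==>
  y \<in> carrier (U (cont w)) ==> prj w' (f (iota w y)) = psi (cont w) (coord f w' w) y"
 using good_ent unfolding ent_def by blast+

lemma entry_lin:
 assumes "w \<in> words d n" "w' \<in> words d n" "y \<in> carrier (U (cont w))"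
 shows "lin K (En n) (U (cont w')) (%f. prj w' (f (iota w y)))"
 by (rule lin_comp[OF end_eval_lin[OF TW.tensor_module iota_closed[OF assms(1,3)]] prj_lin[OF assms(2)]])

lemma psi_eval_lin: "y \<in> carrier (U \<nu>) ==> lin K (TC \<nu>) (U \<nu>) (%X. psi \<nu> X y)"
 by (rule lin_comp[OF O.psi_lin end_eval_lin[OF U_module]])

lemma En_module: "module K (En n)" by (rule unital_algebra.axioms(1)[OF En])

lemma TC_module: "module K (TC \<nu>)" by (rule O.CA.tensor_alg_module)

context
 fixes n w w'
 assumes w: "w \<in> words d n" "w' \<in> words d n" "cont w' = cont w"
begin

lemma ent_zero: "ent \<zero>\<^bsub>En n\<^esub> w' w \<zero>\<^bsub>TC (cont w)\<^esub>" unfolding ent_def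
proof (intro conjI ballI)
 show "\<zero>\<^bsub>TC (cont w)\<^esub> \<in> carrier (TC (cont w))" by (rule abelian_monoid.zero_closed[OF abelian_group.axioms(1)[OF module.axioms(2)[OF TC_module]]])
 fix y assume y: "y \<in> carrier (U (cont w))"
 show "prj w' (\<zero>\<^bsub>En n\<^esub> (iota w y)) = psi (cont w) \<zero>\<^bsub>TC (cont w)\<^esub> y"
  unfolding lin_zero[OF En_module U_module entry_lin[OF w(1,2) y]] lin_zero[OF TC_module U_module psi_eval_lin[OF y]] w(3) ..
qed

lemma ent_add:
 assumes "f \<in> carrier (En n)" "g \<in> carrier (En n)" "ent f w' w X" "ent g w' w Y"
 shows "ent (f \<oplus>\<^bsub>En n\<^esub> g) w' w (X \<oplus>\<^bsub>TC (cont w)\<^esub> Y)"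
proof -
 have XY: "X \<in> carrier (TC (cont w))" "Y \<in> carrier (TC (cont w))" using assms unfolding ent_def by blast+
 show ?thesis unfolding ent_def
 proof (intro conjI ballI)
  show "X \<oplus>\<^bsub>TC (cont w)\<^esub> Y \<in> carrier (TC (cont w))"
   by (rule abelian_monoid.a_closed[OF abelian_group.axioms(1)[OF module.axioms(2)[OF TC_module]] XY])
  fix y assume y: "y \<in> carrier (U (cont w))"
  show "prj w' ((f \<oplus>\<^bsub>En n\<^esub> g) (iota w y)) = psi (cont w) (X \<oplus>\<^bsub>TC (cont w)\<^esub> Y) y"
   unfolding lin_add[OF entry_lin[OF w(1,2) y] assms(1,2)] lin_add[OF psi_eval_lin[OF y] XY] w(3)
   using assms(3,4) y unfolding ent_def by simp
 qed
qed

lemma ent_smult: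
 assumes "c \<in> carrier K" "f \<in> carrier (En n)" "ent f w' w X"
 shows "ent (c \<odot>\<^bsub>En n\<^esub> f) w' w (c \<odot>\<^bsub>TC (cont w)\<^esub> X)"
proof -
 have X: "X \<in> carrier (TC (cont w))" using assms unfolding ent_def by blast
 show ?thesis unfolding ent_def
 proof (intro conjI ballI)
  show "c \<odot>\<^bsub>TC (cont w)\<^esub> X \<in> carrier (TC (cont w))" by (rule module.smult_closed[OF TC_module assms(1) X])
  fix y assume y: "y \<in> carrier (U (cont w))"
  show "prj w' ((c \<odot>\<^bsub>En n\<^esub> f) (iota w y)) = psi (cont w) (c \<odot>\<^bsub>TC (cont w)\<^esub> X) y"
   unfolding lin_smult[OF entry_lin[OF w(1,2) y] assms(1,2)] lin_smult[OF psi_eval_lin[OF y] assms(1) X] w(3)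
   using assms(3) y unfolding ent_def by simp
 qed
qed

lemma ent_one: "ent \<one>\<^bsub>En n\<^esub> w' w (if w' = w then \<one>\<^bsub>TC (cont w)\<^esub> else \<zero>\<^bsub>TC (cont w)\<^esub>)" unfolding ent_def
proof (intro conjI ballI)
 have "\<zero>\<^bsub>TC (cont w)\<^esub> \<in> carrier (TC (cont w))" using ent_zero unfolding ent_def by blast
 then show "(if w' = w then \<one>\<^bsub>TC (cont w)\<^esub> else \<zero>\<^bsub>TC (cont w)\<^esub>) \<in> carrier (TC (cont w))"
  using O.CA.one_closed[of "cont w"] by (cases "w' = w") (simp_all only: if_True if_False simp_thms)
 fix y assume y: "y \<in> carrier (U (cont w))"
 have "prj w' (\<one>\<^bsub>En n\<^esub> (iota w y)) = prj w' (iota w y)" using iota_closed[OF w(1) y] by simp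
 then show "prj w' (\<one>\<^bsub>En n\<^esub> (iota w y)) = psi (cont w) (if w' = w then \<one>\<^bsub>TC (cont w)\<^esub> else \<zero>\<^bsub>TC (cont w)\<^esub>) y"
  using psi_one'[OF y] lin_zero[OF TC_module U_module psi_eval_lin[OF y]]
  by (simp only: prj_iota[OF w(2,1) y] w(3) split: if_split) simp
qed

end

lemma good_subsp: "subsp K (En n) (good n)"
proof -
 interpret E: module K "En n" by (rule En_module)
 have cl: "good n <= carrier (En n)" unfolding good_def by auto
 have goodI: "f \<in> good n" if "f \<in> carrier (En n)"
  "!!w w'. w \<in> words d n ==> w' \<in> words d n ==> cont w' = cont w ==> \<exists>X. ent f w' w X"
  "!!w w' y. w \<in> words d n ==> w' \<in> words d n ==> cont w' ~= cont w ==> y \<in> carrier (U (cont w)) ==>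
   prj w' (f (iota w y)) = \<zero>\<^bsub>U (cont w')\<^esub>" for f
  using that unfolding good_def by simp
 have U0: "\<zero>\<^bsub>U \<nu>\<^esub> \<oplus>\<^bsub>U \<nu>\<^esub> \<zero>\<^bsub>U \<nu>\<^esub> = \<zero>\<^bsub>U \<nu>\<^esub>" "c \<in> carrier K ==> c \<odot>\<^bsub>U \<nu>\<^esub> \<zero>\<^bsub>U \<nu>\<^esub> = \<zero>\<^bsub>U \<nu>\<^esub>" for \<nu> c
 proof -
  interpret U: module K "U \<nu>" by (rule U_module)
  show "\<zero>\<^bsub>U \<nu>\<^esub> \<oplus>\<^bsub>U \<nu>\<^esub> \<zero>\<^bsub>U \<nu>\<^esub> = \<zero>\<^bsub>U \<nu>\<^esub>" "c \<in> carrier K ==> c \<odot>\<^bsub>U \<nu>\<^esub> \<zero>\<^bsub>U \<nu>\<^esub> = \<zero>\<^bsub>U \<nu>\<^esub>" by simp_all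
 qed
 show ?thesis unfolding subsp_def
 proof (intro conjI ballI cl)
  show "\<zero>\<^bsub>En n\<^esub> \<in> good n"
  proof (rule goodI[OF E.zero_closed])
   fix w w' assume w: "w \<in> words d n" "w' \<in> words d n"
   show "\<exists>X. ent \<zero>\<^bsub>En n\<^esub> w' w X" if "cont w' = cont w" using ent_zero[OF w that] by blast
   show "prj w' (\<zero>\<^bsub>En n\<^esub> (iota w y)) = \<zero>\<^bsub>U (cont w')\<^esub>" if "y \<in> carrier (U (cont w))" for y
    by (rule lin_zero[OF En_module U_module entry_lin[OF w that]])
  qed
  fix f g assume f: "f \<in> good n" and g: "g \<in> good n"
  have fE: "f \<in> carrier (En n)" "g \<in> carrier (En n)" using f g cl by blast+
  show "f \<oplus>\<^bsub>En n\<^esub> g \<in> good n"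
  proof (rule goodI[OF E.a_closed[OF fE]])
   fix w w' assume w: "w \<in> words d n" "w' \<in> words d n"
   show "\<exists>X. ent (f \<oplus>\<^bsub>En n\<^esub> g) w' w X" if "cont w' = cont w"
    using ent_add[OF w that fE good_ent[OF f w that] good_ent[OF g w that]] by blast
   show "prj w' ((f \<oplus>\<^bsub>En n\<^esub> g) (iota w y)) = \<zero>\<^bsub>U (cont w')\<^esub>" if "cont w' ~= cont w" "y \<in> carrier (U (cont w))" for y
    unfolding lin_add[OF entry_lin[OF w that(2)] fE] good_zero[OF f w that] good_zero[OF g w that] by (rule U0)
  qed
 next
  fix c f assume c: "c \<in> carrier K" and f: "f \<in> good n"
  have fE: "f \<in> carrier (En n)" using f cl by blast
  show "c \<odot>\<^bsub>En n\<^esub> f \<in> good n"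
  proof (rule goodI[OF E.smult_closed[OF c fE]])
   fix w w' assume w: "w \<in> words d n" "w' \<in> words d n"
   show "\<exists>X. ent (c \<odot>\<^bsub>En n\<^esub> f) w' w X" if "cont w' = cont w" using ent_smult[OF w that c fE good_ent[OF f w that]] by blast
   show "prj w' ((c \<odot>\<^bsub>En n\<^esub> f) (iota w y)) = \<zero>\<^bsub>U (cont w')\<^esub>" if "cont w' ~= cont w" "y \<in> carrier (U (cont w))" for y
    unfolding lin_smult[OF entry_lin[OF w that(2)] c fE] good_zero[OF f w that] by (rule U0(2)[OF c])
  qed
 qed
qed

text \<open>Column \<open>w\<close> of a monomial operator has one entry, \<open>c w\<close> times
  \<open>X w\<close> in row \<open>s w\<close>; that row has the same content.\<close>

lemma mon_good:
 assumes comp: "compatible n s c X" shows "mon n s c X \<in> good n"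
 unfolding good_def
proof (intro CollectI conjI ballI impI)
 show "mon n s c X \<in> linmapsW n" by (rule mon_closed[OF comp])
 fix w w' assume w: "w \<in> words d n" "w' \<in> words d n"
 have s: "s w \<in> words d n" "cont (s w) = cont w" "c w \<in> carrier K" "X w \<in> carrier (TC (cont w))"
  using comp w(1) unfolding compatible_def by auto
 have e: "prj w' (mon n s c X (iota w y)) = c w \<odot>\<^bsub>U (cont w')\<^esub> (if w' = s w then psi (cont w) (X w) y else \<zero>\<^bsub>U (cont w')\<^esub>)"
  if y: "y \<in> carrier (U (cont w))" for y
 proof -
  have q: "psi (cont w) (X w) y \<in> carrier (U (cont (s w)))" unfolding s(2) by (rule psi_closed'[OF s(4) y])
  show ?thesis
   unfolding mon_iota[OF comp w(1) y] lin_smult[OF prj_lin[OF w(2)] s(3) iota_closed[OF s(1) q]] prj_iota[OF w(2) s(1) q] ..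
 qed
 have z: "c w \<odot>\<^bsub>U \<nu>\<^esub> \<zero>\<^bsub>U \<nu>\<^esub> = \<zero>\<^bsub>U \<nu>\<^esub>" for \<nu>
 proof -
  interpret U: module K "U \<nu>" by (rule U_module)
  show ?thesis using s(3) by simp
 qed
 show "prj w' (mon n s c X (iota w y)) = \<zero>\<^bsub>U (cont w')\<^esub>" if "cont w' ~= cont w" "y \<in> carrier (U (cont w))" for y
  using e[OF that(2)] that(1) s(2) z by auto
 assume eq: "cont w' = cont w"
 have "ent (mon n s c X) w' w (if w' = s w then c w \<odot>\<^bsub>TC (cont w)\<^esub> X w else \<zero>\<^bsub>TC (cont w)\<^esub>)" unfolding ent_def
 proof (intro conjI ballI)
  have "\<zero>\<^bsub>TC (cont w)\<^esub> \<in> carrier (TC (cont w))" using ent_zero[OF w eq] unfolding ent_def by blast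
  then show "(if w' = s w then c w \<odot>\<^bsub>TC (cont w)\<^esub> X w else \<zero>\<^bsub>TC (cont w)\<^esub>) \<in> carrier (TC (cont w))"
   using module.smult_closed[OF TC_module s(3,4)] by (cases "w' = s w") (simp_all only: if_True if_False simp_thms)
  fix y assume y: "y \<in> carrier (U (cont w))"
  show "prj w' (mon n s c X (iota w y)) = psi (cont w) (if w' = s w then c w \<odot>\<^bsub>TC (cont w)\<^esub> X w else \<zero>\<^bsub>TC (cont w)\<^esub>) y"
   unfolding e[OF y] eq
   using lin_smult[OF psi_eval_lin[OF y] s(3,4)] lin_zero[OF TC_module U_module psi_eval_lin[OF y]] z
   by (cases "w' = s w") (simp_all only: if_True if_False simp_thms)
 qed
 then show "\<exists>X'. ent (mon n s c X) w' w X'" by blast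
qed

text \<open>The resolution of the identity by the homogeneous components; it recovers an operator
  from its entries and yields matrix multiplication.\<close>

lemma resolution:
 assumes x: "x \<in> carW n" shows "(\<Oplus>\<^bsub>tpow K W n\<^esub>w\<in>words d n. iota w (prj w x)) = x"
proof (rule iota_lin_eq[OF TW.tensor_module _ lin_id _ x])
 show "linW n (%x. \<Oplus>\<^bsub>tpow K W n\<^esub>w\<in>words d n. iota w (prj w x))"
  by (rule lin_finsum_map[OF TW.tensor_module finite_words]) (rule lin_comp[OF prj_lin iota_lin])
 fix u y assume u: "u \<in> words d n" and y: "y \<in> carrier (U (cont u))"
 have "(\<Oplus>\<^bsub>tpow K W n\<^esub>w\<in>words d n. iota w (prj w (iota u y))) = iota u (prj u (iota u y))"
  by (rule finsum_single[OF TW.tensor_module finite_words u])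
   (use u y iota_closed iota_zero in \<open>simp_all add: prj_iota[OF _ u y]\<close>)
 then show "(\<Oplus>\<^bsub>tpow K W n\<^esub>w\<in>words d n. iota w (prj w (iota u y))) = iota u y" by (simp add: prj_iota[OF u u y])
qed

lemma good_eqI:
 assumes f: "f \<in> good n" and g: "g \<in> good n"
  and eq: "!!w w'. w \<in> words d n ==> w' \<in> words d n ==> cont w' = cont w ==> coord f w' w = coord g w' w"
 shows "f = g"
proof (rule linear_maps_iota_eq[OF _ _ TW.tensor_module])
 show "f \<in> linmapsW n" "g \<in> linmapsW n"
  using f g unfolding good_def by blast+
 fix w y assume w: "w \<in> words d n" and y: "y \<in> carrier (U (cont w))"
 have e: "prj w' (f (iota w y)) = prj w' (g (iota w y))" if w': "w' \<in> words d n" for w'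
  using coord_psi[OF f w w' _ y] coord_psi[OF g w w' _ y] eq[OF w w'] good_zero[OF f w w' _ y] good_zero[OF g w w' _ y]
  by (cases "cont w' = cont w") simp_all
 have c: "f (iota w y) \<in> carW n" "g (iota w y) \<in> carW n"
  using lin_closed[OF good_lin[OF f] iota_closed[OF w y]] lin_closed[OF good_lin[OF g] iota_closed[OF w y]] .
 interpret T: module K "tpow K W n" by (rule TW.tensor_module)
 have "(\<Oplus>\<^bsub>tpow K W n\<^esub>w'\<in>words d n. iota w' (prj w' (f (iota w y)))) =
   (\<Oplus>\<^bsub>tpow K W n\<^esub>w'\<in>words d n. iota w' (prj w' (g (iota w y))))"
  by (rule abelian_monoid.finsum_cong'[OF abelian_group.axioms(1)[OF module.axioms(2)[OF TW.tensor_module]]])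
   (use e iota_closed prj_closed[OF _ c(2)] in auto)
 then show "f (iota w y) = g (iota w y)" unfolding resolution[OF c(1)] resolution[OF c(2)] .
qed

text \<open>Insert the resolution of the identity between \<open>f\<close> and \<open>g\<close>.
  Words of a different content drop out because \<open>g\<close> is block diagonal, and what remains
  is a matrix product.\<close>

lemma ent_mult:
 assumes f: "f \<in> good n" and g: "g \<in> good n" and w: "w \<in> words d n" "w' \<in> words d n" "cont w' = \<nu>" "cont w = \<nu>"
 shows "ent (f \<otimes>\<^bsub>En n\<^esub> g) w' w (\<Oplus>\<^bsub>TC \<nu>\<^esub>u\<in>{u \<in> words d n. cont u = \<nu>}. coord f w' u \<otimes>\<^bsub>TC \<nu>\<^esub> coord g u w)"
 unfolding ent_def w(4)
proof (intro conjI ballI)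
 let ?W = "{u \<in> words d n. cont u = \<nu>}"
 interpret TCm: module K "TC \<nu>" by (rule TC_module)
 have fW: "finite ?W" using finite_words[of n] by simp
 have cl: "coord f w' u \<in> carrier (TC \<nu>)" "coord g u w \<in> carrier (TC \<nu>)" if "u \<in> ?W" for u
  using coord_closed[OF f _ w(2), of u] coord_closed[OF g w(1), of u] that w by auto
 have cm: "coord f w' u \<otimes>\<^bsub>TC \<nu>\<^esub> coord g u w \<in> carrier (TC \<nu>)" if "u \<in> ?W" for u by (rule O.CA.mult_closed[OF cl[OF that]])
 show "(\<Oplus>\<^bsub>TC \<nu>\<^esub>u\<in>?W. coord f w' u \<otimes>\<^bsub>TC \<nu>\<^esub> coord g u w) \<in> carrier (TC \<nu>)" by (rule TCm.finsum_closed) (use cm in blast)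
 fix y assume y: "y \<in> carrier (U \<nu>)"
 then have y': "y \<in> carrier (U (cont w))" by (simp only: w(4))
 have iw: "iota w y \<in> carW n" by (rule iota_closed[OF w(1) y'])
 have gi: "g (iota w y) \<in> carW n" by (rule lin_closed[OF good_lin[OF g] iw])
 let ?t = "%u. iota u (prj u (g (iota w y)))"
 have t: "?t \<in> words d n \<rightarrow> carW n" using iota_closed prj_closed[OF _ gi] by blast
 have L: "lin K (tpow K W n) (U (cont w')) (%x. prj w' (f x))" by (rule lin_comp[OF good_lin[OF f] prj_lin[OF w(2)]])
 have "prj w' ((f \<otimes>\<^bsub>En n\<^esub> g) (iota w y)) = prj w' (f (\<Oplus>\<^bsub>tpow K W n\<^esub>u\<in>words d n. ?t u))"
  unfolding En_mult[OF iw] resolution[OF gi] ..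
 also have "... = (\<Oplus>\<^bsub>U (cont w')\<^esub>u\<in>words d n. prj w' (f (?t u)))"
  by (rule lin_finsum[OF TW.tensor_module U_module L finite_words t])
 also have "... = (\<Oplus>\<^bsub>U (cont w')\<^esub>u\<in>?W. psi \<nu> (coord f w' u \<otimes>\<^bsub>TC \<nu>\<^esub> coord g u w) y)"
 proof -
  have psi_c: "psi \<nu> (coord f w' u \<otimes>\<^bsub>TC \<nu>\<^esub> coord g u w) y \<in> carrier (U (cont w'))" if "u \<in> ?W" for u
   unfolding w(3) by (rule psi_closed'[OF cm[OF that] y])
  show ?thesis
  proof (rule NT.outer.T.add.finprod_mono_neutral_cong_right[OF finite_words])
   show "?W <= words d n" by blast
   show "(%u. prj w' (f (?t u))) \<in> words d n \<rightarrow> carrier (U (cont w'))" using lin_closed[OF L] t by auto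
   show "prj w' (f (?t u)) = \<zero>\<^bsub>U (cont w')\<^esub>" if u: "u \<in> words d n - ?W" for u
   proof -
    have "prj u (g (iota w y)) = \<zero>\<^bsub>U (cont u)\<^esub>" by (rule good_zero[OF g w(1) _ _ y']) (use u w in auto)
    then have "?t u = \<zero>\<^bsub>tpow K W n\<^esub>" using iota_zero[of u n "cont u"] u by simp
    then show ?thesis using lin_zero[OF TW.tensor_module U_module L] by (simp only:)
   qed
   fix u assume u: "u \<in> ?W"
   have uw: "u \<in> words d n" "cont u = \<nu>" using u by auto
   have q: "prj u (g (iota w y)) = psi \<nu> (coord g u w) y" using coord_psi[OF g w(1) uw(1) _ y'] uw(2) by (simp only: w(4))
   have p: "psi \<nu> (coord g u w) y \<in> carrier (U (cont u))" unfolding uw(2) by (rule psi_closed'[OF cl(2)[OF u] y])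
   show "prj w' (f (?t u)) = psi \<nu> (coord f w' u \<otimes>\<^bsub>TC \<nu>\<^esub> coord g u w) y" unfolding q psi_mult'[OF cl[OF u] y]
    using coord_psi[OF f uw(1) w(2) _ p] by (simp only: uw(2) w(3))
  qed
 qed
 also have "... = psi \<nu> (\<Oplus>\<^bsub>TC \<nu>\<^esub>u\<in>?W. coord f w' u \<otimes>\<^bsub>TC \<nu>\<^esub> coord g u w) y"
  unfolding w(3) by (rule lin_finsum[OF TC_module U_module psi_eval_lin[OF y] fW, symmetric]) (use cm in blast)
 finally show "prj w' ((f \<otimes>\<^bsub>En n\<^esub> g) (iota w y)) = psi \<nu> (\<Oplus>\<^bsub>TC \<nu>\<^esub>u\<in>?W. coord f w' u \<otimes>\<^bsub>TC \<nu>\<^esub> coord g u w) y" .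
qed

end

lemma mat_alg_simps:
 "carrier (mat_alg m A) = ({..<m} \<times> {..<m}) \<rightarrow>\<^sub>E carrier A"
 "X \<otimes>\<^bsub>mat_alg m A\<^esub> Y = (\<lambda>p\<in>{..<m} \<times> {..<m}. \<Oplus>\<^bsub>A\<^esub>l\<in>{..<m}. X (fst p, l) \<otimes>\<^bsub>A\<^esub> Y (l, snd p))"
 "\<one>\<^bsub>mat_alg m A\<^esub> = (\<lambda>p\<in>{..<m} \<times> {..<m}. if fst p = snd p then \<one>\<^bsub>A\<^esub> else \<zero>\<^bsub>A\<^esub>)"
 "X \<oplus>\<^bsub>mat_alg m A\<^esub> Y = (\<lambda>p\<in>{..<m} \<times> {..<m}. X p \<oplus>\<^bsub>A\<^esub> Y p)"
 "c \<odot>\<^bsub>mat_alg m A\<^esub> X = (\<lambda>p\<in>{..<m} \<times> {..<m}. c \<odot>\<^bsub>A\<^esub> X p)"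
 by (simp_all add: mat_alg_def Let_def case_prod_beta')

lemma dsum_mult_one:
 "x \<otimes>\<^bsub>dsum I M\<^esub> y = (\<lambda>i\<in>I. x i \<otimes>\<^bsub>M i\<^esub> y i)" "\<one>\<^bsub>dsum I M\<^esub> = (\<lambda>i\<in>I. \<one>\<^bsub>M i\<^esub>)"
 by (simp_all add: dsum_def)

lemma content_compositions:
 assumes "w \<in> words d n" shows "content d w \<in> compositions d n"
 using assms sum_count_set[of w "{1..d}"] by (simp add: compositions_def words_def content_def)

section \<open>Additivity and homogeneity of the coordinates\<close>

context braid_setup
begin

lemma coord_add:
 assumes "f \<in> good n" "g \<in> good n" "w \<in> words d n" "w' \<in> words d n" "cont w' = \<nu>" "cont w = \<nu>"
 shows "coord (f \<oplus>\<^bsub>En n\<^esub> g) w' w = coord f w' w \<oplus>\<^bsub>TC \<nu>\<^esub> coord g w' w"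
proof -
 have eq: "cont w' = cont w" using assms by simp
 have "f \<in> carrier (En n)" "g \<in> carrier (En n)" using assms(1,2) good_subsp[of n] unfolding subsp_def by blast+
 from coord_eq[OF ent_add[OF assms(3,4) eq this good_ent[OF assms(1,3,4) eq] good_ent[OF assms(2,3,4) eq]]]
 show ?thesis unfolding assms(6) .
qed

lemma coord_smult:
 assumes "c \<in> carrier K" "f \<in> good n" "w \<in> words d n" "w' \<in> words d n" "cont w' = \<nu>" "cont w = \<nu>"
 shows "coord (c \<odot>\<^bsub>En n\<^esub> f) w' w = c \<odot>\<^bsub>TC \<nu>\<^esub> coord f w' w"
proof -
 have eq: "cont w' = cont w" using assms by simp
 have "f \<in> carrier (En n)" using assms(2) good_subsp[of n] unfolding subsp_def by blast
 from coord_eq[OF ent_smult[OF assms(3,4) eq assms(1) this good_ent[OF assms(2,3,4) eq]]]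
 show ?thesis unfolding assms(6) .
qed

end

section \<open>The image as the algebra of all block matrices\<close>

context gen_setup
begin

lemma B_good: "B <= good n" by (rule B_least[OF good_subsp mon_good])

text \<open>A sum of matrix units realises any prescribed entries inside \<open>B\<close>. Both the
  description of \<open>B\<close> as \<open>good n\<close> and the surjectivity of the isomorphism
  rest on it.\<close>

lemma mat_elem:
 assumes Z: "!!w w'. w \<in> words d n ==> w' \<in> words d n ==> cont w' = cont w ==> Z w' w \<in> carrier (TC (cont w))"
 shows "EX f:B. ALL w:words d n. ALL w':words d n. cont w' = cont w --> coord f w' w = Z w' w"
proof -
 define S where "S = {p \<in> words d n \<times> words d n. cont (fst p) = cont (snd p)}"
 have fS: "finite S" unfolding S_def using finite_words[of n] by simp
 let ?g = "%p. eu n (fst p) (snd p) (Z (fst p) (snd p))"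
 define f where "f = (\<Oplus>\<^bsub>En n\<^esub>p\<in>S. ?g p)"
 have Sp: "fst p \<in> words d n" "snd p \<in> words d n" "cont (fst p) = cont (snd p)" if "p \<in> S" for p
  using that unfolding S_def by auto
 have gB: "?g p \<in> B" if "p \<in> S" for p by (rule eu_B[OF Sp(2,1,3)[OF that] Z[OF Sp(2,1,3)[OF that]]])
 have f: "f \<in> B" unfolding f_def by (rule subsp_finsum[OF En_module B_subsp fS gB])
 have "ent f w' w (Z w' w)" if w: "w \<in> words d n" "w' \<in> words d n" "cont w' = cont w" for w w' unfolding ent_def
 proof (intro conjI ballI)
  show Zc: "Z w' w \<in> carrier (TC (cont w))" by (rule Z[OF w])
  fix y assume y: "y \<in> carrier (U (cont w))"
  have p0: "(w', w) \<in> S" using w unfolding S_def by simp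
  have q: "psi (cont w) (Z w' w) y \<in> carrier (U (cont w'))" unfolding w(3) by (rule psi_closed'[OF Zc y])
  have e: "prj w' (?g p (iota w y)) = (if p = (w', w) then psi (cont w) (Z w' w) y else \<zero>\<^bsub>U (cont w')\<^esub>)" if p: "p \<in> S" for p
  proof (cases "snd p = w")
   case True
   have q': "psi (cont (snd p)) (Z (fst p) (snd p)) y \<in> carrier (U (cont (fst p)))"
    unfolding Sp(3)[OF p] by (rule psi_closed'[OF Z[OF Sp(2,1,3)[OF p]]]) (use y True in simp)
   have "?g p (iota w y) = iota (fst p) (psi (cont (snd p)) (Z (fst p) (snd p)) y)"
    unfolding eu_iota[OF Sp(2,1,3)[OF p] Z[OF Sp(2,1,3)[OF p]] w(1) y] using True by simp
   then have "prj w' (?g p (iota w y)) = (if w' = fst p then psi (cont (snd p)) (Z (fst p) (snd p)) y else \<zero>\<^bsub>U (cont w')\<^esub>)"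
    by (simp only: prj_iota[OF w(2) Sp(1)[OF p] q'])
   then show ?thesis using True by (cases "w' = fst p") (simp_all add: prod_eq_iff)
  next
   case False
   have "?g p (iota w y) = \<zero>\<^bsub>tpow K W n\<^esub>"
    unfolding eu_iota[OF Sp(2,1,3)[OF p] Z[OF Sp(2,1,3)[OF p]] w(1) y] using False by simp
   then show ?thesis using False lin_zero[OF TW.tensor_module U_module prj_lin[OF w(2)]] by auto
  qed
  have "prj w' (f (iota w y)) = (\<Oplus>\<^bsub>U (cont w')\<^esub>p\<in>S. prj w' (?g p (iota w y)))"
   unfolding f_def by (rule lin_finsum[OF En_module U_module entry_lin[OF w(1,2) y] fS]) (use gB B_En in blast)
  also have "... = prj w' (?g (w', w) (iota w y))"
  proof (rule finsum_single[OF U_module fS p0])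
   show "prj w' (?g p (iota w y)) = \<zero>\<^bsub>U (cont w')\<^esub>" if "p \<in> S" "p ~= (w', w)" for p using e[OF that(1)] that(2) by simp
   show "prj w' (?g (w', w) (iota w y)) \<in> carrier (U (cont w'))" using e[OF p0] q by simp
  qed
  also have "... = psi (cont w) (Z w' w) y" using e[OF p0] by simp
  finally show "prj w' (f (iota w y)) = psi (cont w) (Z w' w) y" .
 qed
 then show ?thesis using f coord_eq by blast
qed

lemma B_eq: "B = good n"
proof (intro equalityI B_good subsetI)
 fix f assume f: "f \<in> good n"
 obtain g where g: "g \<in> B" "ALL w:words d n. ALL w':words d n. cont w' = cont w --> coord g w' w = coord f w' w"
  using mat_elem[of "coord f"] coord_closed[OF f] by blast
 have "g = f" by (rule good_eqI[OF subsetD[OF B_good g(1)] f]) (use g(2) in blast)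
 then show "f \<in> B" using g(1) by simp
qed

text \<open>Entries are naturally indexed by pairs of words of equal content, whereas
  \<open>mat_alg\<close> is indexed by numbers. An enumeration of the words of each content
  translates between the two, and the map is then taking coordinates.\<close>

lemma B_iso:
 "alg_isomorphic K ((En n)\<lparr>carrier := B\<rparr>) (dsum (compositions d n) (\<lambda>\<nu>. mat_alg (multinomial d n \<nu>) (TC \<nu>)))"
proof -
 let ?C = "compositions d n" and ?m = "multinomial d n" and ?W = "\<lambda>\<nu>. {w \<in> words d n. cont w = \<nu>}"
 let ?I = "\<lambda>\<nu>. {..<?m \<nu>} \<times> {..<?m \<nu>}"
 let ?D = "dsum ?C (\<lambda>\<nu>. mat_alg (?m \<nu>) (TC \<nu>))"
 have "\<forall>\<nu>\<in>?C. \<exists>h. bij_betw h {..<?m \<nu>} (?W \<nu>)"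
 proof
  fix \<nu> assume \<nu>: "\<nu> \<in> ?C"
  have "finite (?W \<nu>)" using finite_words[of n] by simp
  from ex_bij_betw_nat_finite[OF this] show "\<exists>h. bij_betw h {..<?m \<nu>} (?W \<nu>)"
   unfolding card_words_content[OF \<nu>] atLeast0LessThan .
 qed
 \<comment> \<open>For each composition, \<open>e \<nu>\<close> enumerates the words of content
   \<open>\<nu>\<close>; their number is the multinomial coefficient.\<close>
 from bchoice[OF this] obtain e where e: "!!\<nu>. \<nu> \<in> ?C ==> bij_betw (e \<nu>) {..<?m \<nu>} (?W \<nu>)" by blast
 have ew: "e \<nu> i \<in> words d n" "cont (e \<nu> i) = \<nu>" if "\<nu> \<in> ?C" "i < ?m \<nu>" for \<nu> i
  using bij_betwE[OF e[OF that(1)]] that(2) by blast+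
 have inj: "e \<nu> i = e \<nu> j \<longleftrightarrow> i = j" if "\<nu> \<in> ?C" "i < ?m \<nu>" "j < ?m \<nu>" for \<nu> i j
  using bij_betw_imp_inj_on[OF e[OF that(1)]] that(2,3) by (auto dest: inj_onD)
 have surj: "\<exists>i<?m (cont w). e (cont w) i = w" if "w \<in> words d n" for w
 proof -
  have "w \<in> e (cont w) ` {..<?m (cont w)}" using bij_betw_imp_surj_on[OF e[OF content_compositions[OF that]]] that by blast
  then obtain i where "i \<in> {..<?m (cont w)}" "w = e (cont w) i" by (rule imageE)
  then show ?thesis by (intro exI[of _ i]) simp
 qed
 \<comment> \<open>Row and column numbers are turned into words, and the coordinate at that pair of
   words is recorded.\<close>
 define h where "h f = (\<lambda>\<nu>\<in>?C. \<lambda>p\<in>?I \<nu>. coord f (e \<nu> (fst p)) (e \<nu> (snd p)))" for f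
 have h_entry: "h f \<nu> p = coord f (e \<nu> (fst p)) (e \<nu> (snd p))" if "\<nu> \<in> ?C" "p \<in> ?I \<nu>" for f \<nu> p using that by (simp add: h_def)
 have cc: "coord f (e \<nu> i) (e \<nu> j) \<in> carrier (TC \<nu>)" if "f \<in> good n" "\<nu> \<in> ?C" "i < ?m \<nu>" "j < ?m \<nu>" for f \<nu> i j
  using coord_closed[OF that(1) ew(1)[OF that(2,4)] ew(1)[OF that(2,3)]] by (simp only: ew[OF that(2,3)] ew[OF that(2,4)] simp_thms)
 have hI: "h f = (\<lambda>\<nu>\<in>?C. \<lambda>p\<in>?I \<nu>. G \<nu> p)"
  if "!!\<nu> i j. \<nu> \<in> ?C ==> i < ?m \<nu> ==> j < ?m \<nu> ==> coord f (e \<nu> i) (e \<nu> j) = G \<nu> (i, j)" for f G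
  unfolding h_def by (intro restrict_ext) (use that in auto)
 have hD: "h f \<in> carrier ?D" if f: "f \<in> good n" for f unfolding h_def dsum_simps mat_alg_simps
  by (intro restrict_PiE_iff[THEN iffD2] ballI) (use cc[OF f] in \<open>auto simp del: tensor_alg_simps\<close>)
 have add: "h (f \<oplus>\<^bsub>En n\<^esub> g) = h f \<oplus>\<^bsub>?D\<^esub> h g" if "f \<in> good n" "g \<in> good n" for f g
 proof -
  have "h (f \<oplus>\<^bsub>En n\<^esub> g) = (\<lambda>\<nu>\<in>?C. \<lambda>p\<in>?I \<nu>. h f \<nu> p \<oplus>\<^bsub>TC \<nu>\<^esub> h g \<nu> p)"
   by (rule hI) (simp add: h_entry coord_add[OF that ew(1) ew(1) ew(2) ew(2)] del: tensor_alg_simps end_alg_simps)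
  then show ?thesis by (simp only: dsum_simps mat_alg_simps)
 qed
 have smult: "h (c \<odot>\<^bsub>En n\<^esub> f) = c \<odot>\<^bsub>?D\<^esub> h f" if "c \<in> carrier K" "f \<in> good n" for c f
 proof -
  have "h (c \<odot>\<^bsub>En n\<^esub> f) = (\<lambda>\<nu>\<in>?C. \<lambda>p\<in>?I \<nu>. c \<odot>\<^bsub>TC \<nu>\<^esub> h f \<nu> p)"
   by (rule hI) (simp add: h_entry coord_smult[OF that ew(1) ew(1) ew(2) ew(2)] del: tensor_alg_simps end_alg_simps)
  then show ?thesis by (simp only: dsum_simps mat_alg_simps)
 qed
 have mult: "h (f \<otimes>\<^bsub>En n\<^esub> g) = h f \<otimes>\<^bsub>?D\<^esub> h g" if f: "f \<in> good n" and g: "g \<in> good n" for f g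
 proof -
  have "h (f \<otimes>\<^bsub>En n\<^esub> g) = (\<lambda>\<nu>\<in>?C. \<lambda>p\<in>?I \<nu>. \<Oplus>\<^bsub>TC \<nu>\<^esub>l\<in>{..<?m \<nu>}. h f \<nu> (fst p, l) \<otimes>\<^bsub>TC \<nu>\<^esub> h g \<nu> (l, snd p))"
  proof (rule hI)
   fix \<nu> i j assume \<nu>: "\<nu> \<in> ?C" and i: "i < ?m \<nu>" and j: "j < ?m \<nu>"
   let ?t = "%u. coord f (e \<nu> i) u \<otimes>\<^bsub>TC \<nu>\<^esub> coord g u (e \<nu> j)"
   have am: "abelian_monoid (TC \<nu>)" by (rule abelian_group.axioms(1)[OF module.axioms(2)[OF TC_module]])
   have tc: "?t (e \<nu> l) \<in> carrier (TC \<nu>)" if "l < ?m \<nu>" for l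
    by (rule O.CA.mult_closed[OF cc[OF f \<nu> i that] cc[OF g \<nu> that j]])
   have im: "?W \<nu> = e \<nu> ` {..<?m \<nu>}" using bij_betw_imp_surj_on[OF e[OF \<nu>]] by simp
   have "coord (f \<otimes>\<^bsub>En n\<^esub> g) (e \<nu> i) (e \<nu> j) = (\<Oplus>\<^bsub>TC \<nu>\<^esub>u\<in>?W \<nu>. ?t u)"
    by (rule coord_eq[OF ent_mult[OF f g ew(1)[OF \<nu> j] ew(1)[OF \<nu> i] ew(2)[OF \<nu> i] ew(2)[OF \<nu> j]]])
   also have "... = (\<Oplus>\<^bsub>TC \<nu>\<^esub>l\<in>{..<?m \<nu>}. ?t (e \<nu> l))"
    unfolding im by (rule abelian_monoid.finsum_reindex[OF am]) (use tc bij_betw_imp_inj_on[OF e[OF \<nu>]] in blast)+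
   also have "... = (\<Oplus>\<^bsub>TC \<nu>\<^esub>l\<in>{..<?m \<nu>}. h f \<nu> (fst (i, j), l) \<otimes>\<^bsub>TC \<nu>\<^esub> h g \<nu> (l, snd (i, j)))"
   proof (rule abelian_monoid.finsum_cong'[OF am HOL.refl])
    have he: "h f \<nu> (i, l) = coord f (e \<nu> i) (e \<nu> l)" "h g \<nu> (l, j) = coord g (e \<nu> l) (e \<nu> j)" if "l < ?m \<nu>" for l
     using h_entry[OF \<nu>, of "(i, l)" f] h_entry[OF \<nu>, of "(l, j)" g] i j that by simp_all
    show "(%l. h f \<nu> (fst (i, j), l) \<otimes>\<^bsub>TC \<nu>\<^esub> h g \<nu> (l, snd (i, j))) \<in> {..<?m \<nu>} \<rightarrow> carrier (TC \<nu>)"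
     using tc he by (auto simp del: tensor_alg_simps)
    show "?t (e \<nu> l) = h f \<nu> (fst (i, j), l) \<otimes>\<^bsub>TC \<nu>\<^esub> h g \<nu> (l, snd (i, j))" if "l \<in> {..<?m \<nu>}" for l
     using that he by (simp del: tensor_alg_simps)
   qed
   finally show "coord (f \<otimes>\<^bsub>En n\<^esub> g) (e \<nu> i) (e \<nu> j) =
     (\<Oplus>\<^bsub>TC \<nu>\<^esub>l\<in>{..<?m \<nu>}. h f \<nu> (fst (i, j), l) \<otimes>\<^bsub>TC \<nu>\<^esub> h g \<nu> (l, snd (i, j)))" .
  qed
  then show ?thesis by (simp only: dsum_mult_one mat_alg_simps)
 qed
 have one: "h \<one>\<^bsub>En n\<^esub> = \<one>\<^bsub>?D\<^esub>"
 proof -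
  have "h \<one>\<^bsub>En n\<^esub> = (\<lambda>\<nu>\<in>?C. \<lambda>p\<in>?I \<nu>. if fst p = snd p then \<one>\<^bsub>TC \<nu>\<^esub> else \<zero>\<^bsub>TC \<nu>\<^esub>)"
  proof (rule hI)
   fix \<nu> i j assume a: "\<nu> \<in> ?C" "i < ?m \<nu>" "j < ?m \<nu>"
   have "cont (e \<nu> i) = cont (e \<nu> j)" using ew(2)[OF a(1,2)] ew(2)[OF a(1,3)] by simp
   from coord_eq[OF ent_one[OF ew(1)[OF a(1,3)] ew(1)[OF a(1,2)] this]]
   show "coord \<one>\<^bsub>En n\<^esub> (e \<nu> i) (e \<nu> j) = (if fst (i, j) = snd (i, j) then \<one>\<^bsub>TC \<nu>\<^esub> else \<zero>\<^bsub>TC \<nu>\<^esub>)"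
    by (simp only: ew(2)[OF a(1,3)] inj[OF a] fst_conv snd_conv)
  qed
  then show ?thesis by (simp only: dsum_mult_one mat_alg_simps)
 qed
 let ?B = "(En n)\<lparr>carrier := B\<rparr>"
 have hom: "h \<in> alg_hom K ?B ?D" unfolding alg_hom_iff
 proof (intro conjI ballI linI)
  show "h x \<in> carrier ?D" if "x \<in> carrier ?B" for x by (rule hD) (use that B_eq in simp)
  show "h (x \<oplus>\<^bsub>?B\<^esub> y) = h x \<oplus>\<^bsub>?D\<^esub> h y" if "x \<in> carrier ?B" "y \<in> carrier ?B" for x y
   using add[of x y] that B_eq by (simp del: end_alg_simps)
  show "h (c \<odot>\<^bsub>?B\<^esub> x) = c \<odot>\<^bsub>?D\<^esub> h x" if "c \<in> carrier K" "x \<in> carrier ?B" for c x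
   using smult[of c x] that B_eq by (simp del: end_alg_simps)
  show "h (x \<otimes>\<^bsub>?B\<^esub> y) = h x \<otimes>\<^bsub>?D\<^esub> h y" if "x \<in> carrier ?B" "y \<in> carrier ?B" for x y
   using mult[of x y] that B_eq by (simp del: end_alg_simps)
  show "h \<one>\<^bsub>?B\<^esub> = \<one>\<^bsub>?D\<^esub>" using one by (simp del: end_alg_simps)
 qed
 have "inj_on h B"
 proof (rule inj_onI)
  fix f g assume f: "f \<in> B" and g: "g \<in> B" and eq: "h f = h g"
  show "f = g"
  proof (rule good_eqI[OF subsetD[OF B_good f] subsetD[OF B_good g]])
   fix w w' assume w: "w \<in> words d n" "w' \<in> words d n" "cont w' = cont w"
   obtain i j where i: "i < ?m (cont w)" "e (cont w) i = w'" and j: "j < ?m (cont w)" "e (cont w) j = w"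
    using surj[OF w(2)] surj[OF w(1)] unfolding w(3) by blast
   show "coord f w' w = coord g w' w"
    using h_entry[OF content_compositions[OF w(1)], of "(i, j)" f] h_entry[OF content_compositions[OF w(1)], of "(i, j)" g]
     i j eq by simp
  qed
 qed
 moreover have "h ` B = carrier ?D"
 proof (intro equalityI subsetI)
  show "x \<in> carrier ?D" if "x \<in> h ` B" for x using that hD B_good by blast
  fix Z assume Z: "Z \<in> carrier ?D"
  then have Zc: "Z \<nu> p \<in> carrier (TC \<nu>)" if "\<nu> \<in> ?C" "p \<in> ?I \<nu>" for \<nu> p
   using that unfolding dsum_simps mat_alg_simps by (blast dest: PiE_mem)
  \<comment> \<open>The number of a word in the enumeration for its content; it carries a given
    family of matrices back to entries indexed by words.\<close>
  define idx where "idx w = (SOME i. i < ?m (cont w) \<and> e (cont w) i = w)" for w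
  have idx: "idx w < ?m (cont w)" "e (cont w) (idx w) = w" if "w \<in> words d n" for w
   using someI_ex[OF surj[OF that]] unfolding idx_def by blast+
  obtain f where f: "f \<in> B" and fZ: "ALL w:words d n. ALL w':words d n. cont w' = cont w --> coord f w' w = Z (cont w) (idx w', idx w)"
  proof -
   have "Z (cont w) (idx w', idx w) \<in> carrier (TC (cont w))" if "w \<in> words d n" "w' \<in> words d n" "cont w' = cont w" for w w'
    by (rule Zc[OF content_compositions[OF that(1)]]) (use idx(1)[OF that(1)] idx(1)[OF that(2)] that(3) in simp)
   from mat_elem[of "%w' w. Z (cont w) (idx w', idx w)", OF this] show ?thesis using that by blast
  qed
  have "h f = (\<lambda>\<nu>\<in>?C. \<lambda>p\<in>?I \<nu>. Z \<nu> p)"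
  proof (rule hI)
   fix \<nu> i j assume a: "\<nu> \<in> ?C" "i < ?m \<nu>" "j < ?m \<nu>"
   have ix: "idx (e \<nu> k) = k" if k: "k < ?m \<nu>" for k
    using idx[OF ew(1)[OF a(1) k]] inj[OF a(1) _ k] by (simp add: ew(2)[OF a(1) k])
   show "coord f (e \<nu> i) (e \<nu> j) = Z \<nu> (i, j)"
    using fZ[rule_format, OF ew(1)[OF a(1,3)] ew(1)[OF a(1,2)]] ew(2)[OF a(1,2)] ew(2)[OF a(1,3)]
    by (simp add: ix[OF a(2)] ix[OF a(3)])
  qed
  also have "... = Z"
  proof (rule extensionalityI[of _ ?C])
   show "Z \<in> extensional ?C" using Z unfolding dsum_simps PiE_def by blast
   fix \<nu> assume \<nu>: "\<nu> \<in> ?C"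
   then have "Z \<nu> \<in> carrier (mat_alg (?m \<nu>) (TC \<nu>))" using Z unfolding dsum_simps by (rule PiE_mem[rotated])
   then have "Z \<nu> \<in> extensional (?I \<nu>)" unfolding mat_alg_simps PiE_def by blast
   then show "(\<lambda>\<nu>\<in>?C. \<lambda>p\<in>?I \<nu>. Z \<nu> p) \<nu> = Z \<nu>" using \<nu> by (simp add: extensional_restrict)
  qed simp
  finally show "Z \<in> h ` B" using f by blast
 qed
 ultimately have "bij_betw h (carrier ?B) (carrier ?D)" by (simp add: bij_betw_def)
 then show ?thesis unfolding alg_isomorphic_def using hom by blast
qed

end

text \<open>\<open>end_over\<close> shares all operations with \<open>end_alg\<close> and differs in
  the carrier, so equivariance is a condition on values that can be added or dropped.\<close>

lemma alg_hom_end_over: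
 "h \<in> alg_hom K A (end_over K B M \<rho>) \<longleftrightarrow> h \<in> alg_hom K A (end_alg K M) \<and> (ALL x:carrier A. h x \<in> carrier (end_over K B M \<rho>))"
 by (auto simp: alg_hom_iff lin_def end_over_def simp del: end_alg_simps(2-)) 

context full_setup
begin

text \<open>Each word maps to one monomial operator, so the image lies in any subspace containing
  these. It is applied to the equivariant operators, for the target of \<Phi>, and to
  \<open>good\<close>, for the upper bound on the image.\<close>

lemma image_mon:
 assumes h: "h \<in> alg_hom K (group_alg K (framed_braid_group d n)) (En n)"
  and hl: "!!l. l \<in> framed_gens n \<times> UNIV ==> h (basis_vec K (wcls (framed_gens n) (framed_rels d n) [l])) = gop n l"
  and N: "subsp K (En n) N" and mN: "!!s c X. compatible n s c X ==> mon n s c X \<in> N"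
  and x: "x \<in> carrier (group_alg K (framed_braid_group d n))"
 shows "h x \<in> N"
proof (rule spans_image_closed[where f = h and x = x,
   OF free_mod_module[OF K_cring] En_module spans_basis_vec[OF K_cring] _ N])
 let ?S = "framed_gens n" and ?R = "framed_rels d n"
 note h' = h[unfolded framed_braid_group_def]
 show "lin K (free_mod K (carrier (framed_braid_group d n))) (En n) h" using alg_hom_lin[OF h] by (simp only: lin_group_alg)
 show "x \<in> carrier (free_mod K (carrier (framed_braid_group d n)))" using x by (simp only: group_alg_simps)
 have mon: "\<exists>s c X. compatible n s c X \<and> h (basis_vec K (wcls ?S ?R w)) = mon n s c X" if "w \<in> lists (?S \<times> UNIV)" for w
  using that
 proof (induction w)
  case Nil
  show ?case unfolding presented_alg_hom_Nil[OF K_cring En h'] mon_one[symmetric] using compatible_one by blast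
 next
  case (Cons l w)
  then obtain s c X where m: "compatible n s c X" "h (basis_vec K (wcls ?S ?R w)) = mon n s c X" by blast
  have l: "l \<in> ?S \<times> UNIV" using Cons.hyps by blast
  have "\<exists>s c X. compatible n s c X \<and> gop n l = mon n s c X"
  proof (cases "fst l")
   case (Sg i)
   then have i: "1 \<le> i" "i < n" and le: "l = (Sg i, snd l)" using l framed_gens_iff(1) by (cases l; auto)+
   have "gop n l = sig n (snd l) i" by (subst le) (simp only: gop_simps)
   then show ?thesis using sig_compatible[OF i] unfolding sig_def by blast
  next
   case (Tg i)
   then have le: "l = (Tg i, snd l)" by (cases l) auto
   have "gop n l = ta n (snd l) i" by (subst le) (simp only: gop_simps)
   then show ?thesis using ta_compatible unfolding ta_def by blast
  qed
  then obtain s' c' X' where m': "compatible n s' c' X'" "gop n l = mon n s' c' X'" by blast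
  show ?case unfolding presented_alg_hom_Cons[OF K_cring En h' l Cons.hyps(2)] hl[OF l] m(2) m'(2) mon_mult[OF m'(1) m(1)]
   using compatible_comp[OF m'(1) m(1)] by blast
 qed
 fix y assume "y \<in> basis_vec K ` carrier (framed_braid_group d n)"
 then obtain w where w: "w \<in> lists (?S \<times> UNIV)" and y: "y = basis_vec K (wcls ?S ?R w)"
  unfolding framed_braid_group_def presented_group_carrier by (elim imageE) blast
 from mon[OF w] show "h y \<in> N" unfolding y using mN by metis
qed

text \<open>For each algebra element and each vector, commutation is an equality of two linear
  functions of the operator; the carrier is the intersection of these conditions.\<close>

lemma equivariant_subsp: "subsp K (En n) (carrier (end_over K Bx (tpow K W n) (WR.Rep n)))"
proof -
 let ?N = "%a x. {f \<in> carrier (En n). f (WR.Rep n a x) = WR.Rep n a (f x)}"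
 have N: "subsp K (En n) (?N a x)" if a: "a \<in> carrier Bx" and x: "x \<in> carW n" for a x
 proof -
  have r: "linW n (WR.Rep n a)" by (rule linear_maps_lin[OF WR.Rep_closed[OF a]])
  show ?thesis by (rule subsp_eq[OF En_module TW.tensor_module end_eval_lin[OF TW.tensor_module lin_closed[OF r x]]
      lin_comp[OF end_eval_lin[OF TW.tensor_module x] r]])
 qed
 have "carrier (end_over K Bx (tpow K W n) (WR.Rep n)) =
   {f \<in> carrier (En n). ALL a:carrier Bx. ALL x:carW n. f (WR.Rep n a x) = WR.Rep n a (f x)}"
  by (simp add: end_over_def)
 moreover have "subsp K (En n) (carrier (En n))" using En_module submodule_iff_subsp module.carrier_is_submodule by blast
 ultimately show ?thesis using N unfolding subsp_def by (simp del: end_alg_simps tensor_alg_simps)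
qed

lemma mon_end_over:
 assumes "compatible n s c X" shows "mon n s c X \<in> carrier (end_over K Bx (tpow K W n) (WR.Rep n))"
 using mon_closed[OF assms] mon_equivariant[OF assms] by (simp add: end_over_def)

end

theorem theorem3p3:
  fixes K :: "'k ring" and d n :: nat and \<zeta> :: 'k
    and A :: "nat \<Rightarrow> ('k, 'a) module"
    and \<Delta> :: "nat \<Rightarrow> 'a \<Rightarrow> ((nat \<Rightarrow> 'a) \<Rightarrow> 'k) set"
    and \<epsilon> :: "nat \<Rightarrow> 'a \<Rightarrow> 'k"
    and V :: "nat \<Rightarrow> ('k, 'v) module"
    and \<rho> :: "nat \<Rightarrow> 'a \<Rightarrow> 'v \<Rightarrow> 'v"
    and R :: "nat \<Rightarrow> ((nat \<Rightarrow> 'v) \<Rightarrow> 'k) set \<Rightarrow> ((nat \<Rightarrow> 'v) \<Rightarrow> 'k) set"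
    and \<phi> :: "nat \<Rightarrow> nat \<Rightarrow> (fb_gen word set \<Rightarrow> 'k)
                \<Rightarrow> ((nat \<Rightarrow> 'v) \<Rightarrow> 'k) set \<Rightarrow> ((nat \<Rightarrow> 'v) \<Rightarrow> 'k) set"
  assumes "field K" and "d \<ge> 1" and "[d] \<cdot>\<^bsub>K\<^esub> \<one>\<^bsub>K\<^esub> \<in> Units K"
    and "\<zeta> \<in> carrier K" and "\<zeta> [^]\<^bsub>K\<^esub> d = \<one>\<^bsub>K\<^esub>"
    and "\<And>m. 1 \<le> m \<Longrightarrow> m < d \<Longrightarrow> \<zeta> [^]\<^bsub>K\<^esub> m \<noteq> \<one>\<^bsub>K\<^esub>"
    and "\<And>b. b \<in> {1..d} \<Longrightarrow> bialgebra K (A b) (\<Delta> b) (\<epsilon> b)"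
    and "\<And>b. b \<in> {1..d} \<Longrightarrow> module K (V b)"
    and "\<And>b. b \<in> {1..d} \<Longrightarrow> \<rho> b \<in> alg_hom K (A b) (end_alg K (V b))"
    and "\<And>b. b \<in> {1..d} \<Longrightarrow> R b \<in> carrier (end_alg K (tpow K (V b) 2))"
    and "\<And>b m. b \<in> {1..d} \<Longrightarrow>
          \<phi> b m \<in> alg_hom K (group_alg K (braid_group m))
                     (end_tpow K (A b) (\<Delta> b) (\<epsilon> b) (V b) (\<rho> b) m)"
    and "\<And>b m i. b \<in> {1..d} \<Longrightarrow> 1 \<le> i \<Longrightarrow> i < m \<Longrightarrow>
          \<phi> b m (braid_elt K m (Sg i)) = on_factors K (V b) m i (R b)"
    and "n \<ge> 1"
  shows "let W = box_mod d V;
             kFB = group_alg K (framed_braid_group d n);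
             E = end_tpow K (box_alg K d A) (box_comult K d A \<Delta>) (box_counit K d A \<epsilon>)
                   W (box_rep K d A \<epsilon> V \<rho>) n;
             assigns = (\<lambda>\<Phi>.
               (\<forall>i\<in>{1..n}. \<Phi> (framed_braid_elt K d n (Tg i)) = on_factor K W n i (tau_op K d \<zeta> V)) \<and>
               (\<forall>i\<in>{1..<n}. \<Phi> (framed_braid_elt K d n (Sg i)) = on_factors K W n i (sigma_op K d V R)))
         in \<exists>\<Phi>\<in>alg_hom K kFB E. assigns \<Phi> \<and>
              (\<forall>\<Psi>\<in>alg_hom K kFB E. assigns \<Psi> \<longrightarrow> (\<forall>x\<in>carrier kFB. \<Psi> x = \<Phi> x)) \<and>
              alg_isomorphic K (image_alg \<Phi> kFB E)
                (dsum (compositions d n) (\<lambda>\<nu>.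
                   mat_alg (multinomial d n \<nu>)
                     (tensor_alg K {1..d} (\<lambda>b.
                        image_alg (\<phi> b (\<nu> b)) (group_alg K (braid_group (\<nu> b)))
                          (end_tpow K (A b) (\<Delta> b) (\<epsilon> b) (V b) (\<rho> b) (\<nu> b))))))"
proof -
 have field: "field K" and d: "1 \<le> d" and zeta: "\<zeta> \<in> carrier K" "\<zeta> [^]\<^bsub>K\<^esub> d = \<one>\<^bsub>K\<^esub>"
  and prim: "!!m. 1 \<le> m ==> m < d ==> \<zeta> [^]\<^bsub>K\<^esub> m ~= \<one>\<^bsub>K\<^esub>" using assms(1,2,4,5,6) by blast+
 note bial = assms(7) and V = assms(8) and rho = assms(9) and R = assms(10) and phi = assms(11) and phiR = assms(12)
 \<comment> \<open>The target is widened from the equivariant operators to all operators;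
   equivariance is recovered in \<open>phi_eq\<close>.\<close>
 have phi': "\<phi> b m \<in> alg_hom K (group_alg K (braid_group m)) (end_alg K (tpow K (V b) m))" if "b \<in> {1..d}" for b m
  using phi[OF that, of m] unfolding alg_hom_end_over by blast
 have wt: "word_tensor K d V" by (intro word_tensor.intro field V)
 have bs: "braid_setup K d V \<phi> \<zeta>" by (intro braid_setup.intro wt braid_setup_axioms.intro phi' zeta d)
 have bo: "braid_ops K d V \<phi> \<zeta> R" by (intro braid_ops.intro bs braid_ops_axioms.intro) (use R phiR in simp_all)
 have bx: "box_setup K d V A \<Delta> \<epsilon> \<rho>" by (intro box_setup.intro wt box_setup_axioms.intro bial rho)
 have phi_eq: "f (tpow_rep K (A b) (\<Delta> b) (\<epsilon> b) (V b) (\<rho> b) m a x) = tpow_rep K (A b) (\<Delta> b) (\<epsilon> b) (V b) (\<rho> b) m a (f x)"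
  if b: "b \<in> {1..d}" and f: "f \<in> braid_setup.Cb K \<phi> b m" and a: "a \<in> carrier (A b)" and x: "x \<in> carrier (tpow K (V b) m)"
  for b m f a x
 proof -
  obtain y where y: "f = \<phi> b m y" "y \<in> carrier (group_alg K (braid_group m))"
   using f unfolding braid_setup.Cb_def[OF bs] by (rule imageE)
  then have "f \<in> carrier (end_tpow K (A b) (\<Delta> b) (\<epsilon> b) (V b) (\<rho> b) m)" using phi[OF b, of m] unfolding alg_hom_end_over by blast
  then show ?thesis using a x by (simp add: end_over_def)
 qed
 interpret full_setup K d V \<phi> \<zeta> R A \<Delta> \<epsilon> \<rho> by (intro full_setup.intro bo bx full_setup_axioms.intro phi_eq)
 let ?kFB = "group_alg K (framed_braid_group d n)" and ?E = "end_over K Bx (tpow K W n) (WR.Rep n)"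
 let ?gen = "%l. basis_vec K (wcls (framed_gens n) (framed_rels d n) [l])"
 have elt: "framed_braid_elt K d n x = ?gen (x, True)" for x by (simp only: framed_braid_elt_def pgen_wcls)
 obtain \<Phi> where \<Phi>: "\<Phi> \<in> alg_hom K ?kFB (En n)" and gen: "ALL l:framed_gens n \<times> UNIV. \<Phi> (?gen l) = gop n l"
  using Phi_ex[of n] by (elim bexE)
 note gen' = gen[rule_format]
 have \<Phi>E: "\<Phi> \<in> alg_hom K ?kFB ?E" unfolding alg_hom_end_over using \<Phi> image_mon[OF \<Phi> gen' equivariant_subsp mon_end_over] by blast
 have T: "\<Phi> (framed_braid_elt K d n (Tg i)) = on_factor K W n i (tau_op K d \<zeta> V)" if i: "i \<in> {1..n}" for i
 proof -
  have "(Tg i, True) \<in> framed_gens n \<times> UNIV" using i framed_gens_iff(2) by blast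
  from gen'[OF this] show ?thesis unfolding elt gop_simps ta_on_factor[OF i] .
 qed
 have S: "\<Phi> (framed_braid_elt K d n (Sg i)) = on_factors K W n i (sigma_op K d V R)" if i: "i \<in> {1..<n}" for i
 proof -
  have i': "1 \<le> i" "i < n" using i by simp_all
  then have "(Sg i, True) \<in> framed_gens n \<times> UNIV" using framed_gens_iff(1) by blast
  from gen'[OF this] show ?thesis unfolding elt gop_simps sig_on_factors[OF i'] .
 qed
 have unique: "\<Psi> x = \<Phi> x" if \<Psi>: "\<Psi> \<in> alg_hom K ?kFB ?E"
   and T': "ALL i:{1..n}. \<Psi> (framed_braid_elt K d n (Tg i)) = on_factor K W n i (tau_op K d \<zeta> V)"
   and S': "ALL i:{1..<n}. \<Psi> (framed_braid_elt K d n (Sg i)) = on_factors K W n i (sigma_op K d V R)"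
   and x: "x \<in> carrier ?kFB" for \<Psi> x
 proof (rule presented_alg_hom_unique[OF K_cring En])
  show "\<Psi> \<in> alg_hom K (group_alg K (presented_group (framed_gens n) (framed_rels d n))) (En n)"
   using \<Psi> unfolding alg_hom_end_over framed_braid_group_def by blast
  show "\<Phi> \<in> alg_hom K (group_alg K (presented_group (framed_gens n) (framed_rels d n))) (En n)"
   using \<Phi> unfolding framed_braid_group_def .
  show "x \<in> carrier (group_alg K (presented_group (framed_gens n) (framed_rels d n)))"
   using x unfolding framed_braid_group_def .
  fix y assume y: "y \<in> framed_gens n"
  show "\<Psi> (?gen (y, True)) = \<Phi> (?gen (y, True))" unfolding elt[symmetric]
  proof (cases y)
   case (Sg i)
   then have i: "i \<in> {1..<n}" using y framed_gens_iff(1) by simp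
   show "\<Psi> (framed_braid_elt K d n y) = \<Phi> (framed_braid_elt K d n y)" unfolding Sg S[OF i] by (rule S'[rule_format, OF i])
  next
   case (Tg i)
   then have i: "i \<in> {1..n}" using y framed_gens_iff(2) by simp
   show "\<Psi> (framed_braid_elt K d n y) = \<Phi> (framed_braid_elt K d n y)" unfolding Tg T[OF i] by (rule T'[rule_format, OF i])
  qed
 qed
 let ?B = "\<Phi> ` carrier ?kFB"
 have G: "group (framed_braid_group d n)" unfolding framed_braid_group_def by (rule presented_group_group)
 note im = group_alg_hom_image[OF K_cring G En \<Phi>]
 have letter: "gop n l \<in> ?B" if l: "l \<in> framed_gens n \<times> UNIV" for l
 proof -
  have "[l] \<in> lists (framed_gens n \<times> UNIV)" using l by simp
  then have "?gen l \<in> carrier ?kFB" unfolding group_alg_simps framed_braid_group_def presented_group_carrier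
   by (intro basis_vec_closed[OF K_cring] imageI)
  then show ?thesis unfolding gen'[OF l, symmetric] by (rule imageI)
 qed
 \<comment> \<open>The abstract \<open>B\<close> is now the image of \<Phi>: its subalgebra
   properties hold for images of homomorphisms, and its bound from above is
   \<open>image_mon\<close>.\<close>
 interpret gen_setup K d V \<phi> \<zeta> n ?B
 proof (intro gen_setup.intro bs gen_setup_axioms.intro prim im)
  show "sig n e i \<in> ?B" if "1 \<le> i" "i < n" for e i
   using letter[of "(Sg i, e)"] that framed_gens_iff(1) unfolding gop_simps by blast
  show "ta n True i \<in> ?B" if "i \<in> {1..n}" for i
   using letter[of "(Tg i, True)"] that framed_gens_iff(2) unfolding gop_simps by blast
  show "?B <= N" if "subsp K (En n) N" "!!s c X. compatible n s c X ==> mon n s c X \<in> N" for N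
   by (rule image_subsetI) (rule image_mon[OF \<Phi> gen' that])
 qed
 \<comment> \<open>Passing to the image replaces the carrier, so it makes no difference whether the
   image is taken inside the equivariant or inside all operators.\<close>
 have CA: "image_alg (\<phi> b (\<nu> b)) (group_alg K (braid_group (\<nu> b)))
   (end_tpow K (A b) (\<Delta> b) (\<epsilon> b) (V b) (\<rho> b) (\<nu> b)) = CA \<nu> b" for \<nu> b
  by (simp add: image_alg_def end_over_def Cb_def)
 have B: "image_alg \<Phi> ?kFB ?E = (En n)\<lparr>carrier := ?B\<rparr>" by (simp add: image_alg_def end_over_def)
 show ?thesis unfolding Let_def CA
 proof (intro bexI[of _ \<Phi>] conjI ballI impI)
  show "alg_isomorphic K (image_alg \<Phi> ?kFB ?E) (dsum (compositions d n) (\<lambda>\<nu>. mat_alg (multinomial d n \<nu>) (TC \<nu>)))"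
   unfolding B by (rule B_iso)
 qed (use T S unique \<Phi>E in blast)+
qed

end
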